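(* Let $n\ge 1$ be an integer and $\beta>0$. Let $\alpha_0,\ldots,\alpha_{n-1}$ be independent random variables with $\alpha_k\sim\Theta_{\beta(n-k-1)+1}$ for $0\le k\le n-1$, and let $\rho_k=\sqrt{1-|\alpha_k|^2}$. Define $$\Xi_k=\begin{bmatrix}\bar\alpha_k&\rho_k\\ \rho_k&-\alpha_k\end{bmatrix}\qquad(0\le k\le n-2),$$ and let $\Xi_{-1}=[1]$ and $\Xi_{n-1}=[\bar\alpha_{n-1}]$ be $1\times1$ matrices. Form the $n\times n$ block-diagonal matrices $$L=\operatorname{diag}(\Xi_0,\Xi_2,\Xi_4,\ldots),\qquad M=\operatorname{diag}(\Xi_{-1},\Xi_1,\Xi_3,\ldots),$$ where the indices run over the even, respectively odd, integers in $\{-1,0,\ldots,n-1\}$. Then the eigenvalues of $LM$, and likewise those of $ML$, are distributed as the Coulomb gas on the unit circle at inverse temperature $\beta$: if $\lambda_1,\ldots,\lambda_n$ denote the eigenvalues (counted with multiplicity) of $LM$ (or of $ML$), then for every symmetric (bounded measurable) function $f$, $$\mathbb{E}\,f(\lambda_1,\ldots,\lambda_n)=\frac{1}{(2\pi)^nZ_{n,\beta}}\int_0^{2\pi}\!\!\cdots\!\int_0^{2\pi} f(e^{i\theta_1},\ldots,e^{i\theta_n})\,\bigl|\Delta(e^{i\theta_1},\ldots,e^{i\theta_n})\bigr|^\beta\,d\theta_1\cdots d\theta_n .$$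
   Context: $\Delta(z_1,\ldots,z_n)=\prod_{1\le j<k\le n}(z_k-z_j)$ is the Vandermonde determinant, and $Z_{n,\beta}$ is the normalization constant making the right-hand side a probability expectation (i.e. equal to $1$ for $f\equiv1$). For $\nu>1$, a complex random variable $X$ with values in the unit disk $\mathbb{D}=\{z\in\mathbb{C}:|z|<1\}$ is $\Theta_\nu$-distributed, written $X\sim\Theta_\nu$, if $\mathbb{E}\{f(X)\}=\frac{\nu-1}{2\pi}\iint_{\mathbb{D}}f(z)(1-|z|^2)^{(\nu-3)/2}\,d^2z$, where $d^2z$ is Lebesgue measure. $X\sim\Theta_1$ means that $X$ is uniformly distributed on the unit circle in $\mathbb{C}$. *)

theory Defs
  imports "HOL-Probability.Probability" "Jordan_Normal_Form.Char_Poly"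
begin

(* Only nu >= 1 is meaningful; for nu > 1 the base of powr is positive on the open disk. *)
definition Theta :: "real \<Rightarrow> complex measure" where
  "Theta \<nu> =
     (if \<nu> = 1 then distr (uniform_measure lborel {0..2 * pi}) borel cis
      else density lborel (\<lambda>z. ennreal
        ((\<nu> - 1) / (2 * pi) * (1 - (cmod z)\<^sup>2) powr ((\<nu> - 3) / 2) * indicator (ball 0 1) z)))"

definition cmv_rho :: "complex \<Rightarrow> complex" where
  "cmv_rho a = complex_of_real (sqrt (1 - (cmod a)\<^sup>2))"

definition cmv_Xi :: "nat \<Rightarrow> (nat \<Rightarrow> complex) \<Rightarrow> int \<Rightarrow> complex mat" where
  "cmv_Xi n a k =
     (if k = -1 then mat_of_rows_list 1 [[1]]
      else if k = int n - 1 then mat_of_rows_list 1 [[cnj (a (nat k))]]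
      else mat_of_rows_list 2
        [[cnj (a (nat k)), cmv_rho (a (nat k))],
         [cmv_rho (a (nat k)), - a (nat k)]])"

definition cmv_L :: "nat \<Rightarrow> (nat \<Rightarrow> complex) \<Rightarrow> complex mat" where
  "cmv_L n a = diag_block_mat (map (cmv_Xi n a) (filter even [-1..int n - 1]))"

definition cmv_M :: "nat \<Rightarrow> (nat \<Rightarrow> complex) \<Rightarrow> complex mat" where
  "cmv_M n a = diag_block_mat (map (cmv_Xi n a) (filter odd [-1..int n - 1]))"

(* v lists the eigenvalues with algebraic multiplicity, in an arbitrary order.
   Points of C^m are the elements of the product space over {..<m}, hence the
   restriction to extensional functions. *)
definition eigenvalue_vector :: "complex mat \<Rightarrow> (nat \<Rightarrow> complex) \<Rightarrow> bool" where
  "eigenvalue_vector A v \<longleftrightarrow>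
     v \<in> {..<dim_row A} \<rightarrow>\<^sub>E UNIV \<and> char_poly A = (\<Prod>i<dim_row A. [:- v i, 1:])"

definition vandermonde :: "nat \<Rightarrow> (nat \<Rightarrow> complex) \<Rightarrow> complex" where
  "vandermonde n z = (\<Prod>k<n. \<Prod>j<k. z k - z j)"

definition circle_point :: "nat \<Rightarrow> (nat \<Rightarrow> real) \<Rightarrow> nat \<Rightarrow> complex" where
  "circle_point n \<theta> = (\<lambda>i\<in>{..<n}. cis (\<theta> i))"

definition coulomb_Z :: "nat \<Rightarrow> real \<Rightarrow> real" where
  "coulomb_Z n \<beta> = 1 / (2 * pi) ^ n *
     (LINT \<theta>:({..<n} \<rightarrow>\<^sub>E {0..2 * pi})|(\<Pi>\<^sub>M i\<in>{..<n}. lborel).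
        cmod (vandermonde n (circle_point n \<theta>)) powr \<beta>)"

definition symmetric_fun :: "nat \<Rightarrow> ((nat \<Rightarrow> complex) \<Rightarrow> complex) \<Rightarrow> bool" where
  "symmetric_fun n f \<longleftrightarrow>
     (\<forall>\<pi> z. \<pi> permutes {..<n} \<longrightarrow> z \<in> {..<n} \<rightarrow>\<^sub>E UNIV \<longrightarrow> f (z \<circ> \<pi>) = f z)"

end

theory Submission imports Defs begin

text \<open>
  The proof follows the idea of Killip and Nenciu. Write \<open>n = m + 1\<close>.

  The characteristic polynomial of \<open>LM\<close>, and of \<open>ML\<close>, is obtained from the parameters
  by the Szego recursion, in reversed order and rotated by the phase of the last parameter
  (\<open>char_poly_cmv\<close>). It has the form \<open>z * p z + u * p\<^sup>* z\<close>, where \<open>p\<close> is a monic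
  polynomial of degree \<open>m\<close> with all roots in the disk, \<open>p\<^sup>*\<close> is its reversal and
  \<open>u\<close> is unimodular. For fixed \<open>u\<close> the coefficients of \<open>p\<close> have a density with respect to
  Lebesgue measure, because one Szego step is real linear in the coefficients with an explicit
  determinant (\<open>nn_integral_lin\<close>, \<open>nn_integral_scoef\<close>). The laws \<open>\<Theta>\<close> are adjusted so that this
  density is the power \<open>\<beta> / 2 - 1\<close> of the resultant of \<open>p\<close> and \<open>p\<^sup>*\<close>
  (\<open>Wt_stable_aux\<close>).

  On the other hand \<open>p\<close> divided by the characteristic polynomial has the eigenvalues as simple
  poles on the circle and positive residues: the coefficients of \<open>p\<close> are parametrised
  bijectively by increasing angles \<open>\<theta>\<close> with prescribed sum and by positive weights \<open>\<nu>\<close> of total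
  mass one (\<open>completion_lag\<close>, \<open>sv_surjective\<close>, \<open>sv_inj_on\<close>). In these coordinates the resultant
  is \<open>\<Prod>\<nu> * \<bar>\<Delta>\<bar>\<^sup>2\<close> (\<open>lag_resultant\<close>) and the Jacobian is a constant times
  \<open>\<bar>\<Delta>\<bar>\<^sup>2\<close> (\<open>det_jacobian\<close>, \<open>sv_change_of_variables\<close>). The density of angles and weights is
  therefore a constant times \<open>\<bar>\<Delta>\<bar> powr \<beta> * \<Prod>\<nu> powr (\<beta> / 2 - 1)\<close>. Angles and weights
  separate; the weights integrate to a constant, and integrating over the phase \<open>u\<close>, that is
  over the sum of the angles, frees the last angle
  (\<open>nn_integral_coefficients_to_angles\<close>).

  Symmetrising over the cube (\<open>nn_integral_gas_sorted\<close>) and determining the constant with the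
  test function \<open>1\<close> gives the theorem. Eigenvalues come without a measurable ordering, so
  symmetric functions of them are shown to be measurable through the coefficients of the
  characteristic polynomial (\<open>measurable_symmetric_of_roots\<close>).
\<close>

section \<open>The Szego recursion in coefficient coordinates\<close>

text \<open>The monic polynomial of degree \<open>m\<close> with coefficient vector \<open>s\<close>, leading terms first. With this order a Szego step acts as \<open>lin\<close> followed by appending the parameter as the new constant term.\<close>

definition mev :: "nat \<Rightarrow> (nat \<Rightarrow> complex) \<Rightarrow> complex \<Rightarrow> complex" where
  "mev m s z = z ^ m + (\<Sum>j<m. s j * z ^ (m - 1 - j))"

text \<open>The reversed polynomial \<open>z ^ m * cnj (mev m s (1 / cnj z))\<close>.\<close>

definition rmev :: "nat \<Rightarrow> (nat \<Rightarrow> complex) \<Rightarrow> complex \<Rightarrow> complex" where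
  "rmev m s z = 1 + (\<Sum>j<m. cnj (s j) * z ^ Suc j)"

text \<open>The action of a Szego step with parameter \<open>g\<close> on coefficients. It is real linear and couples only the indices \<open>j\<close> and \<open>m - 1 - j\<close>, so its Jacobian is computed one pair at a time.\<close>

definition lin :: "nat \<Rightarrow> complex \<Rightarrow> (nat \<Rightarrow> complex) \<Rightarrow> nat \<Rightarrow> complex" where
  "lin m g s = (\<lambda>j\<in>{..<m}. s j + g * cnj (s (m - 1 - j)))"

definition lin_inv :: "nat \<Rightarrow> complex \<Rightarrow> (nat \<Rightarrow> complex) \<Rightarrow> nat \<Rightarrow> complex" where
  "lin_inv m g s = (\<lambda>j\<in>{..<m}. (s j - g * cnj (s (m - 1 - j))) / of_real (1 - (cmod g)\<^sup>2))"

lemma mev_0 [simp]: "mev 0 s z = 1" by (simp add: mev_def)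
lemma rmev_0 [simp]: "rmev 0 s z = 1" by (simp add: rmev_def)

lemma mev_cong: "(\<And>j. j < m \<Longrightarrow> s j = t j) \<Longrightarrow> mev m s z = mev m t z"
  by (simp add: mev_def)

lemma rmev_cong: "(\<And>j. j < m \<Longrightarrow> s j = t j) \<Longrightarrow> rmev m s z = rmev m t z"
  by (simp add: rmev_def)

lemma mev_reflect_sum: "(\<Sum>j<m. cnj (s (m - 1 - j)) * z ^ (m - j)) = (\<Sum>j<m. cnj (s j) * z ^ Suc j)" for z :: complex
proof -
  have "(\<Sum>j<m. cnj (s (m - 1 - j)) * z ^ (m - j)) = (\<Sum>j<m. (\<lambda>i. cnj (s i) * z ^ Suc i) (m - Suc j))"
    by (rule sum.cong) (auto simp: Suc_diff_Suc)
  also have "\<dots> = (\<Sum>j<m. cnj (s j) * z ^ Suc j)" by (rule sum.nat_diff_reindex)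
  finally show ?thesis .
qed

lemma mev_shift_sum: "(\<Sum>j<m. s j * z ^ (m - j)) = z * (\<Sum>j<m. s j * z ^ (m - 1 - j))" for z :: complex
proof -
  have "(\<Sum>j<m. s j * z ^ (m - j)) = (\<Sum>j<m. z * (s j * z ^ (m - 1 - j)))"
  proof (rule sum.cong)
    fix j assume "j \<in> {..<m}"
    then have "m - j = Suc (m - 1 - j)" by auto
    then show "s j * z ^ (m - j) = z * (s j * z ^ (m - 1 - j))" by (simp only: power_Suc) simp
  qed simp
  then show ?thesis by (simp add: sum_distrib_left)
qed

lemma rmev_reflect_sum: "(\<Sum>j<m. s (m - 1 - j) * z ^ Suc j) = z * (\<Sum>j<m. s j * z ^ (m - 1 - j))" for z :: complex
proof -
  have "(\<Sum>j<m. s (m - 1 - j) * z ^ Suc j) = (\<Sum>j<m. (\<lambda>i. s i * z ^ (m - i)) (m - Suc j))"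
    by (rule sum.cong) (auto simp: Suc_diff_Suc)
  also have "\<dots> = (\<Sum>j<m. s j * z ^ (m - j))" by (rule sum.nat_diff_reindex)
  also have "\<dots> = z * (\<Sum>j<m. s j * z ^ (m - 1 - j))" by (rule mev_shift_sum)
  finally show ?thesis .
qed

text \<open>The Szego recursion.\<close>

lemma mev_step: "mev (Suc m) ((lin m g s)(m := g)) z = z * mev m s z + g * rmev m s z"
proof -
  have "mev (Suc m) ((lin m g s)(m := g)) z
      = z ^ Suc m + (\<Sum>j<m. (s j + g * cnj (s (m - 1 - j))) * z ^ (m - j)) + g"
    by (simp add: mev_def lin_def)
  also have "(\<Sum>j<m. (s j + g * cnj (s (m - 1 - j))) * z ^ (m - j))
      = (\<Sum>j<m. s j * z ^ (m - j)) + g * (\<Sum>j<m. cnj (s (m - 1 - j)) * z ^ (m - j))"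
    by (simp add: ring_distribs sum.distrib sum_distrib_left mult.assoc)
  finally show ?thesis
    unfolding mev_reflect_sum mev_shift_sum by (simp add: mev_def rmev_def algebra_simps)
qed

lemma rmev_step: "rmev (Suc m) ((lin m g s)(m := g)) z = rmev m s z + cnj g * z * mev m s z"
proof -
  have "rmev (Suc m) ((lin m g s)(m := g)) z
      = 1 + (\<Sum>j<m. (cnj (s j) + cnj g * s (m - 1 - j)) * z ^ Suc j) + cnj g * z ^ Suc m"
    by (simp add: rmev_def lin_def del: power_Suc)
  also have "(\<Sum>j<m. (cnj (s j) + cnj g * s (m - 1 - j)) * z ^ Suc j)
      = (\<Sum>j<m. cnj (s j) * z ^ Suc j) + cnj g * (\<Sum>j<m. s (m - 1 - j) * z ^ Suc j)"
    by (simp add: ring_distribs sum.distrib sum_distrib_left mult.assoc del: power_Suc)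
  finally show ?thesis
    unfolding rmev_reflect_sum by (simp add: mev_def rmev_def algebra_simps)
qed

lemma one_minus_cmod_sq: "cmod g < 1 \<Longrightarrow> 1 - (cmod g)\<^sup>2 > 0"
  by (simp add: power_less_one_iff abs_square_less_1)

lemma cnj_mult_self: "g * cnj g = of_real ((cmod g)\<^sup>2)"
  using complex_norm_square[of g] by simp

lemma lin_inv_lin:
  assumes "cmod g < 1" "s \<in> {..<m} \<rightarrow>\<^sub>E UNIV"
  shows "lin_inv m g (lin m g s) = s"
proof
  fix j
  have nz: "complex_of_real (1 - (cmod g)\<^sup>2) \<noteq> 0"
    using one_minus_cmod_sq[OF assms(1)] by (simp only: of_real_eq_0_iff)
  show "lin_inv m g (lin m g s) j = s j"
  proof (cases "j < m")
    case True
    then have "m - Suc j < m" "m - Suc (m - Suc j) = j" by auto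
    then have "lin_inv m g (lin m g s) j = (s j + g * cnj (s (m - Suc j)) - g * (cnj (s (m - Suc j)) + cnj g * s j)) / of_real (1 - (cmod g)\<^sup>2)"
      using True by (simp add: lin_inv_def lin_def)
    also have "s j + g * cnj (s (m - Suc j)) - g * (cnj (s (m - Suc j)) + cnj g * s j) = (1 - g * cnj g) * s j"
      by (simp add: algebra_simps)
    also have "1 - g * cnj g = complex_of_real (1 - (cmod g)\<^sup>2)"
      unfolding cnj_mult_self by simp
    finally show ?thesis using nz by simp
  next
    case False
    then show ?thesis using assms(2) by (auto simp: lin_inv_def PiE_def extensional_def)
  qed
qed

lemma lin_lin_inv:
  assumes "cmod g < 1" "s \<in> {..<m} \<rightarrow>\<^sub>E UNIV"
  shows "lin m g (lin_inv m g s) = s"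
proof
  fix j
  have nz: "complex_of_real (1 - (cmod g)\<^sup>2) \<noteq> 0"
    using one_minus_cmod_sq[OF assms(1)] by (simp only: of_real_eq_0_iff)
  show "lin m g (lin_inv m g s) j = s j"
  proof (cases "j < m")
    case True
    then have "m - Suc j < m" "m - Suc (m - Suc j) = j" by auto
    then have "lin m g (lin_inv m g s) j = (s j - g * cnj (s (m - Suc j)) + g * (cnj (s (m - Suc j)) - cnj g * s j)) / of_real (1 - (cmod g)\<^sup>2)"
      using True by (simp add: lin_inv_def lin_def add_divide_distrib)
    also have "s j - g * cnj (s (m - Suc j)) + g * (cnj (s (m - Suc j)) - cnj g * s j) = (1 - g * cnj g) * s j"
      by (simp add: algebra_simps)
    also have "1 - g * cnj g = complex_of_real (1 - (cmod g)\<^sup>2)"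
      unfolding cnj_mult_self by simp
    finally show ?thesis using nz by simp
  next
    case False
    then show ?thesis using assms(2) by (auto simp: lin_def PiE_def extensional_def)
  qed
qed

lemma lin_PiE [simp]: "lin m g s \<in> {..<m} \<rightarrow>\<^sub>E UNIV" by (simp add: lin_def)
lemma lin_inv_PiE [simp]: "lin_inv m g s \<in> {..<m} \<rightarrow>\<^sub>E UNIV" by (simp add: lin_inv_def)

lemma lin_inv_cong: "(\<And>j. j < m \<Longrightarrow> s j = t j) \<Longrightarrow> lin_inv m g s = lin_inv m g t"
  by (auto simp: lin_inv_def restrict_def fun_eq_iff)

definition monic_of :: "nat \<Rightarrow> (nat \<Rightarrow> complex) \<Rightarrow> complex poly" where
  "monic_of m s = Polynomial.monom 1 m + (\<Sum>j<m. Polynomial.monom (s j) (m - 1 - j))"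

lemma poly_monic_of [simp]: "poly (monic_of m s) z = mev m s z"
  by (simp add: monic_of_def mev_def poly_monom poly_sum)

lemma coeff_monic_of: "Polynomial.coeff (monic_of m s) i = (if i = m then 1 else if i < m then s (m - 1 - i) else 0)"
proof -
  have "Polynomial.coeff (monic_of m s) i = (if i = m then 1 else 0) + (\<Sum>j<m. if j = m - 1 - i \<and> i < m then s j else 0)"
    unfolding monic_of_def
    by (cases "i = m") (auto simp: coeff_sum intro!: sum.cong sum.neutral sum.neutral[symmetric])
  also have "(\<Sum>j<m. if j = m - 1 - i \<and> i < m then s j else 0) = (if i < m then s (m - 1 - i) else 0)"
    by (cases "i < m") (auto simp: sum.delta)
  finally show ?thesis by (cases "i = m") auto
qed

lemma degree_monic_of [simp]: "Polynomial.degree (monic_of m s) = m"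
  by (rule antisym, rule degree_le, simp add: coeff_monic_of, rule le_degree, simp add: coeff_monic_of)

lemma monic_factorization:
  fixes p :: "complex poly"
  assumes "Polynomial.coeff p (Polynomial.degree p) = 1"
  obtains w where "p = (\<Prod>i<Polynomial.degree p. [:- w i, 1:])"
proof -
  from fundamental_theorem_algebra_factorized[of p] obtain as where
    as: "(\<Prod>a\<leftarrow>as. [:- a, 1:]) = p" "length as = Polynomial.degree p"
    using assms by auto
  have "(\<Prod>a\<leftarrow>as. [:- a, 1:]) = (\<Prod>i<length as. [:- (as ! i), 1:])"
    unfolding prod.list_conv_set_nth by (simp add: atLeast0LessThan)
  then have "p = (\<Prod>i<Polynomial.degree p. [:- (as ! i), 1:])" unfolding as .
  then show ?thesis by (rule that)
qed

lemma mev_factorization: "\<exists>w. \<forall>z. mev m s z = (\<Prod>i<m. z - w i)"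
proof -
  obtain w where w: "monic_of m s = (\<Prod>i<m. [:- w i, 1:])"
    using monic_factorization[of "monic_of m s"] by (auto simp: coeff_monic_of)
  have "mev m s z = (\<Prod>i<m. z - w i)" for z
    unfolding poly_monic_of[symmetric] w by (simp add: poly_prod)
  then show ?thesis by blast
qed

lemma rmev_eq_reflect:
  assumes "z \<noteq> 0"
  shows "rmev m s z = z ^ m * cnj (mev m s (1 / cnj z))"
proof -
  have "z ^ m * cnj (mev m s (1 / cnj z)) = z ^ m * (1 / z) ^ m + (\<Sum>j<m. cnj (s j) * (z ^ m * (1 / z) ^ (m - 1 - j)))"
    by (simp add: mev_def ring_distribs sum_distrib_left mult_ac)
  also have "(\<Sum>j<m. cnj (s j) * (z ^ m * (1 / z) ^ (m - 1 - j))) = (\<Sum>j<m. cnj (s j) * z ^ Suc j)"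
  proof (rule sum.cong)
    fix j assume "j \<in> {..<m}"
    then have *: "m = Suc j + (m - 1 - j)" by auto
    have "z ^ m * (1 / z) ^ (m - 1 - j) = z ^ Suc j * (z ^ (m - 1 - j) * (1 / z) ^ (m - 1 - j))"
      by (subst *) (simp only: power_add mult.assoc)
    then show "cnj (s j) * (z ^ m * (1 / z) ^ (m - 1 - j)) = cnj (s j) * z ^ Suc j"
      using assms by (simp add: power_mult_distrib[symmetric])
  qed simp
  finally show ?thesis using assms by (simp add: rmev_def power_mult_distrib[symmetric])
qed

text \<open>Reversal reflects every root in the unit circle.\<close>

lemma rmev_factor:
  assumes "\<And>z. mev m s z = (\<Prod>i<m. z - w i)"
  shows "rmev m s z = (\<Prod>i<m. 1 - cnj (w i) * z)"
proof (cases "z = 0")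
  case False
  have "rmev m s z = (\<Prod>i<m. z * cnj (1 / cnj z - w i))"
    unfolding rmev_eq_reflect[OF False] assms by (simp add: prod.distrib)
  also have "\<dots> = (\<Prod>i<m. 1 - cnj (w i) * z)"
    using False by (intro prod.cong) (auto simp: field_simps)
  finally show ?thesis .
qed (simp add: rmev_def)

definition schur_stable :: "nat \<Rightarrow> (nat \<Rightarrow> complex) \<Rightarrow> bool" where
  "schur_stable m s \<longleftrightarrow> (\<forall>z. 1 \<le> cmod z \<longrightarrow> mev m s z \<noteq> 0)"

lemma stable_root_less:
  assumes "schur_stable m s" "\<And>z. mev m s z = (\<Prod>i<m. z - w i)" "i < m"
  shows "cmod (w i) < 1"
proof (rule ccontr)
  assume "\<not> cmod (w i) < 1"
  then have "mev m s (w i) \<noteq> 0" using assms(1) by (auto simp: schur_stable_def)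
  moreover have "mev m s (w i) = 0" unfolding assms(2) using assms(3) by (subst prod_zero_iff) auto
  ultimately show False by blast
qed

text \<open>The sign of the right-hand side decides which factor of a Blaschke product is larger, inside and outside the disk.\<close>

lemma cmod_diff_sq: "(cmod (z - w))\<^sup>2 - (cmod (1 - cnj w * z))\<^sup>2 = ((cmod z)\<^sup>2 - 1) * (1 - (cmod w)\<^sup>2)"
  unfolding cmod_power2 by (simp add: algebra_simps power2_eq_square)

text \<open>For \<open>\<bar>w\<bar> < 1 \<le> \<bar>z\<bar>\<close> the factor \<open>\<bar>1 - cnj w * z\<bar>\<close> is at most \<open>\<bar>z - w\<bar>\<close>, and this is multiplied over the roots.\<close>

lemma stable_le:
  assumes "schur_stable m s" "1 \<le> cmod z"
  shows "cmod (rmev m s z) \<le> cmod (mev m s z)"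
proof -
  obtain w where w: "\<And>z. mev m s z = (\<Prod>i<m. z - w i)" using mev_factorization by blast
  show ?thesis
    unfolding w rmev_factor[OF w] prod_norm[symmetric]
  proof (rule prod_mono, safe)
    fix i assume "i < m"
    then have "cmod (w i) < 1" using stable_root_less[OF assms(1) w] by blast
    then have "((cmod z)\<^sup>2 - 1) * (1 - (cmod (w i))\<^sup>2) \<ge> 0"
      using assms(2) one_minus_cmod_sq[of "w i"] by (intro mult_nonneg_nonneg) auto
    then have "(cmod (1 - cnj (w i) * z))\<^sup>2 \<le> (cmod (z - w i))\<^sup>2"
      using cmod_diff_sq[of z "w i"] by linarith
    then show "cmod (1 - cnj (w i) * z) \<le> cmod (z - w i)"
      by (rule power2_le_imp_le) simp
  qed simp
qed

lemma stable_step: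
  assumes "schur_stable m s" "cmod g < 1"
  shows "schur_stable (Suc m) ((lin m g s)(m := g))"
  unfolding schur_stable_def mev_step
proof (intro allI impI)
  fix z :: complex assume z: "1 \<le> cmod z"
  have ne: "cmod (mev m s z) > 0" using assms(1) z by (auto simp: schur_stable_def)
  have "cmod (g * rmev m s z) \<le> cmod g * cmod (mev m s z)"
    using stable_le[OF assms(1) z] by (simp add: norm_mult mult_left_mono)
  also have "\<dots> < 1 * cmod (mev m s z)" using assms(2) ne by (rule mult_strict_right_mono)
  also have "\<dots> \<le> cmod (z * mev m s z)" using mult_right_mono[OF z, of "cmod (mev m s z)"] by (simp add: norm_mult)
  finally show "z * mev m s z + g * rmev m s z \<noteq> 0"
    by (metis add_eq_0_iff norm_minus_cancel order_less_irrefl)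
qed

text \<open>The constant term is, up to sign, the product of the roots. If undoing the step created an exterior root, then at that point the polynomial would be \<open>t m\<close> times its reversal, against \<open>stable_le\<close>.\<close>

lemma stable_Suc:
  assumes "schur_stable (Suc m) t"
  shows "cmod (t m) < 1" "schur_stable m (lin_inv m (t m) t)"
proof -
  obtain w where w: "\<And>z. mev (Suc m) t z = (\<Prod>i<Suc m. z - w i)" using mev_factorization by blast
  have "(\<Sum>j<m. t j * 0 ^ (m - j)) = 0" by (rule sum.neutral) auto
  then have "mev (Suc m) t 0 = t m" by (simp add: mev_def)
  then have e: "(\<Prod>i<Suc m. 0 - w i) = t m" unfolding w .
  have "cmod (t m) = (\<Prod>i<Suc m. cmod (w i))"
    unfolding e[symmetric] prod_norm[symmetric] by simp
  also have "\<dots> < 1"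
  proof -
    have "(\<Prod>i<m. cmod (w i)) \<le> 1"
      using stable_root_less[OF assms w] by (intro prod_le_1) (auto simp: less_imp_le)
    then have "(\<Prod>i<m. cmod (w i)) * cmod (w m) \<le> 1 * cmod (w m)" by (rule mult_right_mono) simp
    then have "(\<Prod>i<Suc m. cmod (w i)) \<le> cmod (w m)" by simp
    also have "\<dots> < 1" using stable_root_less[OF assms w, of m] by simp
    finally show ?thesis .
  qed
  finally show g: "cmod (t m) < 1" .
  define s where "s = lin_inv m (t m) t"
  have lin: "lin m (t m) s = restrict t {..<m}"
    unfolding s_def using lin_lin_inv[OF g, of "restrict t {..<m}" m]
    by (simp add: lin_inv_cong[of m "restrict t {..<m}" t])
  have eqn: "mev (Suc m) t z = z * mev m s z + t m * rmev m s z"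
            "rmev (Suc m) t z = rmev m s z + cnj (t m) * z * mev m s z" for z
    unfolding mev_step[symmetric] rmev_step[symmetric] lin
    by (auto intro!: mev_cong rmev_cong)
  show "schur_stable m (lin_inv m (t m) t)"
    unfolding schur_stable_def s_def[symmetric]
  proof (intro allI impI notI)
    fix z :: complex assume z: "1 \<le> cmod z" and 0: "mev m s z = 0"
    then have "mev (Suc m) t z = t m * rmev (Suc m) t z" by (simp add: eqn)
    moreover have "mev (Suc m) t z \<noteq> 0" using assms z by (auto simp: schur_stable_def)
    ultimately have "cmod (mev (Suc m) t z) < 1 * cmod (rmev (Suc m) t z)"
      using mult_strict_right_mono[OF g, of "cmod (rmev (Suc m) t z)"]
      by (auto simp: norm_mult)
    then show False using stable_le[OF assms z] by simp
  qed
qed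

text \<open>The density, with respect to Lebesgue measure, of the coefficient vector produced by independent Szego parameters. The exponent collects the density of the parameter and the inverse Jacobian of the step.\<close>

fun Wt :: "real \<Rightarrow> nat \<Rightarrow> (nat \<Rightarrow> complex) \<Rightarrow> real" where
  "Wt c 0 s = 1"
| "Wt c (Suc m) s = (if cmod (s m) < 1 then ((1 - (cmod (s m))\<^sup>2) powr (real (Suc m) * c)) * Wt c m (lin_inv m (s m) s) else 0)"

lemma mev_split:
  assumes "cmod (t m) < 1" defines "s \<equiv> lin_inv m (t m) t"
  shows "mev (Suc m) t z = z * mev m s z + t m * rmev m s z"
        "rmev (Suc m) t z = rmev m s z + cnj (t m) * z * mev m s z"
proof -
  have lin: "lin m (t m) s = restrict t {..<m}"
    unfolding s_def using lin_lin_inv[OF assms(1), of "restrict t {..<m}" m]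
    by (simp add: lin_inv_cong[of m "restrict t {..<m}" t])
  show "mev (Suc m) t z = z * mev m s z + t m * rmev m s z"
            "rmev (Suc m) t z = rmev m s z + cnj (t m) * z * mev m s z"
    unfolding mev_step[symmetric] rmev_step[symmetric] lin
    by (auto intro!: mev_cong rmev_cong)
qed

lemma stable_Suc_iff: "schur_stable (Suc m) t \<longleftrightarrow> cmod (t m) < 1 \<and> schur_stable m (lin_inv m (t m) t)"
proof (safe intro!: stable_Suc)
  assume g: "cmod (t m) < 1" and st: "schur_stable m (lin_inv m (t m) t)"
  from stable_step[OF st g] have "schur_stable (Suc m) ((lin m (t m) (lin_inv m (t m) t))(m := t m))" .
  then show "schur_stable (Suc m) t"
    unfolding schur_stable_def mev_split(1)[of t m, OF g] mev_step .
qed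

lemma Wt_unstable: "\<not> schur_stable m s \<Longrightarrow> Wt c m s = 0"
  by (induction m arbitrary: s) (auto simp: stable_Suc_iff schur_stable_def[of 0])

lemma resultant_swap:
  "(\<Prod>i<p. \<Prod>j<q. cmod (1 - cnj (v j) * w i)) = (\<Prod>j<q. \<Prod>i<p. cmod (1 - cnj (w i) * v j))"
proof -
  have "cmod (1 - cnj (v j) * w i) = cmod (1 - cnj (w i) * v j)" for i j
  proof -
    have "cnj (1 - cnj (v j) * w i) = 1 - cnj (w i) * v j" by (simp add: mult.commute)
    then show ?thesis by (metis complex_mod_cnj)
  qed
  then show ?thesis by (subst prod.swap) simp
qed

text \<open>The recursive density is a power of the resultant of the polynomial and its reversal. At the roots of the new polynomial the Szego recursion expresses the reversed polynomial through the old one, and exchanging the roles of the two root sets in the double product reduces the resultant to that of the previous step times a power of \<open>1 - \<bar>g\<bar>\<^sup>2\<close>.\<close>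

lemma Wt_stable_aux:
  assumes "schur_stable m s" "\<And>z. mev m s z = (\<Prod>i<m. z - w i)"
  shows "Wt c m s = (\<Prod>i<m. cmod (rmev m s (w i))) powr c \<and> (\<Prod>i<m. cmod (rmev m s (w i))) > 0"
  using assms
proof (induction m arbitrary: s w)
  case (Suc m t w)
  define g where "g = t m"
  define s where "s = lin_inv m g t"
  have g: "cmod g < 1" and st: "schur_stable m s"
    using stable_Suc[OF Suc.prems(1)] by (auto simp: g_def s_def)
  have eqn: "mev (Suc m) t z = z * mev m s z + g * rmev m s z" "rmev (Suc m) t z = rmev m s z + cnj g * z * mev m s z" for z
    unfolding g_def s_def using mev_split[of t m z] g by (simp_all add: g_def)
  obtain v where v: "\<And>z. mev m s z = (\<Prod>i<m. z - v i)" using mev_factorization by blast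
  note IH = Suc.IH[OF st v]
  let ?r = "1 - (cmod g)\<^sup>2"
  have r: "?r > 0" using one_minus_cmod_sq[OF g] .
  have rr: "of_real ?r = 1 - cnj g * g" using cnj_mult_self[of g] by (simp add: mult.commute)
  have "rmev (Suc m) t (w i) = of_real ?r * rmev m s (w i)" if "i < Suc m" for i
  proof -
    have "mev (Suc m) t (w i) = 0" unfolding Suc.prems(2) using that by (subst prod_zero_iff) auto
    then have "w i * mev m s (w i) = - g * rmev m s (w i)" using eqn(1)[of "w i"]
      by (simp add: eq_neg_iff_add_eq_0)
    then have "rmev (Suc m) t (w i) = rmev m s (w i) + cnj g * (- g * rmev m s (w i))"
      using eqn(2)[of "w i"] by (simp add: mult.assoc)
    then show ?thesis unfolding rr by (simp add: algebra_simps)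
  qed
  then have "(\<Prod>i<Suc m. cmod (rmev (Suc m) t (w i))) = (\<Prod>i<Suc m. ?r * cmod (rmev m s (w i)))"
    using r by (intro prod.cong) (auto simp: norm_mult simp del: of_real_diff of_real_power)
  also have "\<dots> = ?r ^ Suc m * (\<Prod>i<Suc m. cmod (rmev m s (w i)))"
    by (simp only: prod.distrib prod_constant card_lessThan)
  also have "(\<Prod>i<Suc m. cmod (rmev m s (w i))) = (\<Prod>j<m. cmod (rmev (Suc m) t (v j)))"
    unfolding rmev_factor[OF v] rmev_factor[OF Suc.prems(2)] prod_norm[symmetric]
    by (rule resultant_swap)
  also have "\<dots> = (\<Prod>j<m. cmod (rmev m s (v j)))"
  proof (intro prod.cong refl)
    fix x assume "x \<in> {..<m}"
    then have "mev m s (v x) = 0" unfolding v by (subst prod_zero_iff) auto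
    then show "cmod (rmev (Suc m) t (v x)) = cmod (rmev m s (v x))" by (simp add: eqn)
  qed
  finally have *: "(\<Prod>i<Suc m. cmod (rmev (Suc m) t (w i))) = ?r ^ Suc m * (\<Prod>j<m. cmod (rmev m s (v j)))" .
  have "Wt c (Suc m) t = ?r powr (real (Suc m) * c) * (\<Prod>j<m. cmod (rmev m s (v j))) powr c"
    using g IH by (simp add: g_def[symmetric] s_def[symmetric])
  also have "?r powr (real (Suc m) * c) = (?r ^ Suc m) powr c"
    using r by (simp only: powr_powr[symmetric] powr_realpow)
  finally show ?case unfolding * using IH r by (simp add: powr_mult)
qed simp

fun scoef :: "(nat \<Rightarrow> complex) \<Rightarrow> nat \<Rightarrow> nat \<Rightarrow> complex" where
  "scoef b 0 = (\<lambda>_. undefined)"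
| "scoef b (Suc j) = (lin j (b j) (scoef b j))(j := b j)"

section \<open>The characteristic polynomial of a CMV product\<close>

text \<open>The continuant recursion, by expansion along the first row and then the first column.\<close>

lemma det_three_term:
  fixes A :: "'b :: comm_ring_1 mat"
  assumes A: "A \<in> carrier_mat (Suc (Suc n)) (Suc (Suc n))"
    and r0: "\<And>c. 2 \<le> c \<Longrightarrow> c < Suc (Suc n) \<Longrightarrow> A $$ (0, c) = 0"
    and c0: "\<And>r. 2 \<le> r \<Longrightarrow> r < Suc (Suc n) \<Longrightarrow> A $$ (r, 0) = 0"
  shows "Determinant.det A = A $$ (0,0) * Determinant.det (mat_delete A 0 0)
     - A $$ (0,1) * A $$ (1,0) * Determinant.det (mat_delete (mat_delete A 0 1) 0 0)"
proof -
  let ?N = "Suc (Suc n)"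
  have "Determinant.det A = (\<Sum>j<?N. A $$ (0,j) * cofactor A 0 j)"
    by (rule laplace_expansion_row[OF A]) simp
  also have "\<dots> = (\<Sum>j\<in>{0,1}. A $$ (0,j) * cofactor A 0 j)"
  proof (rule sum.mono_neutral_right)
    show "\<forall>i\<in>{..<?N} - {0, 1}. A $$ (0, i) * cofactor A 0 i = 0"
    proof
      fix i assume "i \<in> {..<?N} - {0, 1}"
      then have "2 \<le> i" "i < ?N" by auto
      then show "A $$ (0, i) * cofactor A 0 i = 0" by (simp add: r0)
    qed
  qed auto
  also have "\<dots> = A $$ (0,0) * Determinant.det (mat_delete A 0 0) - A $$ (0,1) * Determinant.det (mat_delete A 0 1)"
    by (simp add: cofactor_def)
  also have "Determinant.det (mat_delete A 0 1) = A $$ (1,0) * Determinant.det (mat_delete (mat_delete A 0 1) 0 0)"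
  proof -
    have B: "mat_delete A 0 1 \<in> carrier_mat (Suc n) (Suc n)"
      using A by (simp add: mat_delete_def)
    have e: "mat_delete A 0 1 $$ (i, 0) = A $$ (Suc i, 0)" if "i < Suc n" for i
      using A that by (simp add: mat_delete_def)
    have "Determinant.det (mat_delete A 0 1) = (\<Sum>i<Suc n. mat_delete A 0 1 $$ (i,0) * cofactor (mat_delete A 0 1) i 0)"
      by (rule laplace_expansion_column[OF B]) simp
    also have "\<dots> = (\<Sum>i\<in>{0}. mat_delete A 0 1 $$ (i,0) * cofactor (mat_delete A 0 1) i 0)"
    proof (rule sum.mono_neutral_right)
      show "\<forall>i\<in>{..<Suc n} - {0}. mat_delete A 0 1 $$ (i,0) * cofactor (mat_delete A 0 1) i 0 = 0"
      proof
        fix i assume "i \<in> {..<Suc n} - {0}"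
        then show "mat_delete A 0 1 $$ (i,0) * cofactor (mat_delete A 0 1) i 0 = 0"
          using e[of i] c0[of "Suc i"] by simp
      qed
    qed auto
    finally show ?thesis using e[of 0] by (simp add: cofactor_def)
  qed
  finally show ?thesis by (simp add: mult.assoc)
qed

definition band_det :: "(nat \<Rightarrow> nat \<Rightarrow> complex) \<Rightarrow> nat \<Rightarrow> nat \<Rightarrow> complex" where
  "band_det K k j = Determinant.det (mat j j (\<lambda>(r, c). K (k + r) (k + c)))"

lemma band_det_0 [simp]: "band_det K k 0 = 1"
  by (simp add: band_det_def)

lemma band_det_1: "band_det K k (Suc 0) = K k k"
  by (simp add: band_det_def det_single)

lemma band_det_rec:
  assumes "\<And>r c. r + 2 \<le> c \<Longrightarrow> K r c = 0" "\<And>r c. c + 2 \<le> r \<Longrightarrow> K r c = 0"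
  shows "band_det K k (Suc (Suc j)) = K k k * band_det K (Suc k) (Suc j)
     - K k (Suc k) * K (Suc k) k * band_det K (Suc (Suc k)) j"
proof -
  let ?A = "mat (Suc (Suc j)) (Suc (Suc j)) (\<lambda>(r, c). K (k + r) (k + c))"
  have 1: "mat_delete ?A 0 0 = mat (Suc j) (Suc j) (\<lambda>(r, c). K (Suc k + r) (Suc k + c))"
    by (rule eq_matI) (auto simp: mat_delete_def)
  have 2: "mat_delete (mat_delete ?A 0 1) 0 0 = mat j j (\<lambda>(r, c). K (Suc (Suc k) + r) (Suc (Suc k) + c))"
    by (rule eq_matI) (auto simp: mat_delete_def)
  have "Determinant.det ?A = ?A $$ (0,0) * Determinant.det (mat_delete ?A 0 0)
     - ?A $$ (0,1) * ?A $$ (1,0) * Determinant.det (mat_delete (mat_delete ?A 0 1) 0 0)"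
    by (rule det_three_term) (auto simp: assms)
  then show ?thesis unfolding 1 2 by (simp add: band_det_def)
qed

text \<open>The entries of a block diagonal product of \<open>2 \<times> 2\<close> reflections; the parity \<open>p\<close> of the index selects where the blocks begin.\<close>

definition band :: "(nat \<Rightarrow> complex) \<Rightarrow> nat \<Rightarrow> nat \<Rightarrow> nat \<Rightarrow> complex" where
  "band a p i j = (if i = j then (if even (i + p) then cnj (a i) else - a (i - 1))
     else if j = Suc i \<and> even (i + p) then cmv_rho (a i)
     else if i = Suc j \<and> even (j + p) then cmv_rho (a j) else 0)"

definition cmv_tail :: "nat \<Rightarrow> (nat \<Rightarrow> complex) \<Rightarrow> nat \<Rightarrow> complex mat" where
  "cmv_tail n a k = diag_block_mat (map (cmv_Xi n a) (filter (\<lambda>j. even (j - int k)) [int k..int n - 1]))"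

lemma cmv_tail_last: "cmv_tail (Suc k) a k = mat 1 1 (\<lambda>_. cnj (a k))"
  unfolding cmv_tail_def by (simp add: cmv_Xi_def) (rule eq_matI, auto simp: mat_of_rows_list_def)

lemma cmv_tail_nil: "n \<le> k \<Longrightarrow> cmv_tail n a k = 0\<^sub>m 0 0"
  unfolding cmv_tail_def by simp

lemma cmv_tail_rec:
  assumes "Suc k < n"
  shows "cmv_tail n a k = four_block_mat
     (mat 2 2 (\<lambda>(r, c). band a k (k + r) (k + c)))
     (0\<^sub>m 2 (dim_col (cmv_tail n a (k + 2)))) (0\<^sub>m (dim_row (cmv_tail n a (k + 2))) 2) (cmv_tail n a (k + 2))"
proof -
  have "[int k..int n - 1] = int k # int (k + 1) # [int (k + 2)..int n - 1]"
    using assms by (subst upto_rec1, simp, subst upto_rec1, auto simp: add.commute add.left_commute)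
  then have 1: "filter (\<lambda>j. even (j - int k)) [int k..int n - 1] = int k # filter (\<lambda>j. even (j - int (k + 2))) [int (k + 2)..int n - 1]"
    by (auto intro!: filter_cong)
  have 2: "cmv_Xi n a (int k) = mat 2 2 (\<lambda>(r, c). band a k (k + r) (k + c))"
    using assms
    by (intro eq_matI) (auto simp: cmv_Xi_def mat_of_rows_list_def band_def less_2_cases_iff nth_Cons')
  show ?thesis
    unfolding cmv_tail_def 1 by (simp add: Let_def 2)
qed

lemma band_off_block:
  assumes "i < 2" "2 \<le> j"
  shows "band a k (k + i) (k + j) = 0" "band a k (k + j) (k + i) = 0"
  using assms by (auto simp: band_def less_2_cases_iff)

lemma cmv_tail_eq:
  assumes "k \<le> n"
  shows "cmv_tail n a k = mat (n - k) (n - k) (\<lambda>(r, c). band a k (k + r) (k + c))"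
  using assms
proof (induction "n - k" arbitrary: k rule: less_induct)
  case less
  consider "k = n" | "n = Suc k" | "Suc k < n" using less.prems by linarith
  then show ?case
  proof cases
    case 3
    have IH: "cmv_tail n a (k + 2) = mat (n - (k + 2)) (n - (k + 2)) (\<lambda>(r, c). band a (k + 2) (k + 2 + r) (k + 2 + c))"
      using 3 by (intro less.hyps) auto
    have *: "band a (k + 2) (k + 2 + (r - 2)) (k + 2 + (c - 2)) = band a k (k + r) (k + c)"
      if "\<not> r < 2" "\<not> c < 2" for r c
      using that by (auto simp: band_def)
    show ?thesis
      unfolding cmv_tail_rec[OF 3] IH
    proof (rule eq_matI, goal_cases)
      case (1 i j)
      then have ij: "i < n - k" "j < n - k" by auto
      consider "i < 2" "j < 2" | "i < 2" "\<not> j < 2" | "\<not> i < 2" "j < 2" | "\<not> i < 2" "\<not> j < 2" by blast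
      then show ?case
      proof cases
        case 1 then show ?thesis using ij 3 by simp
      next
        case 2 then show ?thesis using ij 3 band_off_block(1)[of i j a k] by simp
      next
        case 3 then show ?thesis using ij \<open>Suc k < n\<close> band_off_block(2)[of j i a k] by simp
      next
        case 4
        then have "i - 2 < n - (k + 2)" "j - 2 < n - (k + 2)" using ij by auto
        then show ?thesis using 4 ij 3 *[OF 4] by simp
      qed
    qed (use 3 in auto)
  next
    case 1
    show ?thesis unfolding 1 cmv_tail_nil[OF order.refl] by (rule eq_matI) auto
  next
    case 2
    have "band a k k k = cnj (a k)" by (simp add: band_def)
    then show ?thesis unfolding 2 cmv_tail_last by (intro eq_matI) auto
  qed
qed

lemma cmv_L_eq: "n \<ge> 1 \<Longrightarrow> cmv_L n a = mat n n (\<lambda>(i, j). band a 0 i j)"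
proof -
  assume n: "n \<ge> 1"
  have "[-1..int n - 1] = -1 # [0..int n - 1]" using n by (subst upto_rec1) auto
  then have "cmv_L n a = cmv_tail n a 0" by (simp add: cmv_L_def cmv_tail_def)
  then show ?thesis using cmv_tail_eq[of 0 n a] by simp
qed

definition mband :: "(nat \<Rightarrow> complex) \<Rightarrow> nat \<Rightarrow> nat \<Rightarrow> complex" where
  "mband a i j = (if i = 0 \<and> j = 0 then 1 else band a 1 i j)"

lemma cmv_M_eq: "n \<ge> 1 \<Longrightarrow> cmv_M n a = mat n n (\<lambda>(i, j). mband a i j)"
proof -
  assume n: "n \<ge> 1"
  have "[-1..int n - 1] = -1 # 0 # [1..int n - 1]" using n by (subst upto_rec1, simp, subst upto_rec1) auto
  then have "filter odd [-1..int n - 1] = -1 # filter (\<lambda>j. even (j - int 1)) [int 1..int n - 1]"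
    by (auto intro!: filter_cong)
  moreover have "cmv_Xi n a (-1) = mat 1 1 (\<lambda>_. 1)" by (rule eq_matI) (auto simp: cmv_Xi_def mat_of_rows_list_def)
  ultimately have "cmv_M n a = four_block_mat (mat 1 1 (\<lambda>_. 1)) (0\<^sub>m 1 (dim_col (cmv_tail n a 1))) (0\<^sub>m (dim_row (cmv_tail n a 1)) 1) (cmv_tail n a 1)"
    unfolding cmv_M_def cmv_tail_def by (simp add: Let_def)
  also have "\<dots> = mat n n (\<lambda>(i, j). mband a i j)"
    unfolding cmv_tail_eq[OF n]
  proof (rule eq_matI, goal_cases)
    case (1 i j)
    have "band a 1 0 j = 0 \<and> band a 1 j 0 = 0" if "j > 0" for j using that by (auto simp: band_def)
    then show ?case using 1 n by (cases "i = 0"; cases "j = 0") (auto simp: mband_def)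
  qed (use n in auto)
  finally show ?thesis .
qed

lemma cmv_rho_sq: "cmod g \<le> 1 \<Longrightarrow> cmv_rho g * cmv_rho g = 1 - g * cnj g"
proof -
  assume "cmod g \<le> 1"
  then have "0 \<le> 1 - (cmod g)\<^sup>2" by (simp add: power_le_one)
  then have "cmv_rho g * cmv_rho g = of_real (1 - (cmod g)\<^sup>2)"
    unfolding cmv_rho_def of_real_mult[symmetric] by simp
  then show ?thesis unfolding cnj_mult_self by simp
qed

lemma cnj_cmv_rho [simp]: "cnj (cmv_rho g) = cmv_rho g"
  by (simp add: cmv_rho_def)

text \<open>Each block is unitary as soon as its parameter lies in the closed disk, and the last one because its parameter is unimodular.\<close>

lemma cmv_tail_unitary:
  assumes "\<And>k. k < n \<Longrightarrow> cmod (a k) \<le> 1" "n \<ge> 1" "cmod (a (n - 1)) = 1" "k \<le> n"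
  shows "cmv_tail n a k * map_mat cnj (cmv_tail n a k) = 1\<^sub>m (n - k)"
  using assms(4)
proof (induction "n - k" arbitrary: k rule: less_induct)
  case less
  consider "k = n" | "n = Suc k" | "Suc k < n" using less.prems by linarith
  then show ?case
  proof cases
    case 2
    then have "cnj (a k) * a k = 1" using assms(3) by (simp add: complex_norm_square[symmetric] mult.commute)
    then show ?thesis unfolding 2 cmv_tail_last by (intro eq_matI) (auto simp: scalar_prod_def)
  next
    case 3
    define T where "T = cmv_tail n a (k + 2)"
    define X where "X = mat 2 2 (\<lambda>(r, c). band a k (k + r) (k + c))"
    have T: "T \<in> carrier_mat (n - (k + 2)) (n - (k + 2))" unfolding T_def using 3 by (simp add: cmv_tail_eq)
    have X: "X \<in> carrier_mat 2 2" by (simp add: X_def)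
    have IH: "T * map_mat cnj T = 1\<^sub>m (n - (k + 2))" unfolding T_def
      using 3 by (intro less.hyps) auto
    have XX: "X * map_mat cnj X = 1\<^sub>m 2"
    proof (rule eq_matI)
      fix i j assume "i < dim_row (1\<^sub>m 2 :: complex mat)" "j < dim_col (1\<^sub>m 2 :: complex mat)"
      then have ij: "i < 2" "j < 2" by auto
      have h: "a k * cnj (a k) + cmv_rho (a k) * cmv_rho (a k) = 1"
        using cmv_rho_sq assms(1)[of k] 3 by simp
      have b: "band a k k k = cnj (a k)" "band a k k (Suc k) = cmv_rho (a k)"
        "band a k (Suc k) k = cmv_rho (a k)" "band a k (Suc k) (Suc k) = - a k"
        by (auto simp: band_def)
      have "(X * map_mat cnj X) $$ (i, j) = (\<Sum>l\<in>{0..<2}. X $$ (i,l) * cnj (X $$ (l,j)))"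
        using ij X by (simp add: scalar_prod_def)
      also have "{0..<2} = {0, Suc 0}" by auto
      finally have p: "(X * map_mat cnj X) $$ (i, j) = X $$ (i,0) * cnj (X $$ (0,j)) + X $$ (i,1) * cnj (X $$ (1,j))"
        by simp
      have x: "X $$ (0,0) = cnj (a k)" "X $$ (0,1) = cmv_rho (a k)" "X $$ (1,0) = cmv_rho (a k)" "X $$ (1,1) = - a k"
        by (auto simp: X_def b)
      consider "i = 0" "j = 0" | "i = 0" "j = 1" | "i = 1" "j = 0" | "i = 1" "j = 1" using ij by linarith
      then show "(X * map_mat cnj X) $$ (i, j) = 1\<^sub>m 2 $$ (i, j)"
      proof cases
        case 1 then show ?thesis using p h unfolding 1 x by (simp add: mult.commute add.commute)
      next
        case 2 then show ?thesis using p h unfolding 2 x by (simp add: mult.commute add.commute)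
      next
        case 3 then show ?thesis using p h unfolding 3 x by (simp add: mult.commute add.commute)
      next
        case 4 then show ?thesis using p h unfolding 4 x by (simp add: mult.commute add.commute)
      qed
    qed (auto simp: X_def)
    let ?l = "n - (k + 2)"
    have e: "cmv_tail n a k = four_block_mat X (0\<^sub>m 2 ?l) (0\<^sub>m ?l 2) T"
      using cmv_tail_rec[OF 3, of a] T unfolding T_def[symmetric] X_def by auto
    have e': "map_mat cnj (cmv_tail n a k) = four_block_mat (map_mat cnj X) (0\<^sub>m 2 ?l) (0\<^sub>m ?l 2) (map_mat cnj T)"
      unfolding e by (rule eq_matI) (use X T in auto)
    have "cmv_tail n a k * map_mat cnj (cmv_tail n a k) =
       four_block_mat (X * map_mat cnj X + 0\<^sub>m 2 ?l * 0\<^sub>m ?l 2) (X * 0\<^sub>m 2 ?l + 0\<^sub>m 2 ?l * map_mat cnj T)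
         (0\<^sub>m ?l 2 * map_mat cnj X + T * 0\<^sub>m ?l 2) (0\<^sub>m ?l 2 * 0\<^sub>m 2 ?l + T * map_mat cnj T)"
      unfolding e' unfolding e
      by (rule mult_four_block_mat) (use X T in auto)
    also have "\<dots> = four_block_mat (1\<^sub>m 2) (0\<^sub>m 2 ?l) (0\<^sub>m ?l 2) (1\<^sub>m ?l)"
    proof -
      have z: "X * 0\<^sub>m 2 ?l = 0\<^sub>m 2 ?l" "0\<^sub>m 2 ?l * map_mat cnj T = 0\<^sub>m 2 ?l"
        "0\<^sub>m ?l 2 * map_mat cnj X = 0\<^sub>m ?l 2" "T * 0\<^sub>m ?l 2 = 0\<^sub>m ?l 2"
        "0\<^sub>m 2 ?l * 0\<^sub>m ?l 2 = (0\<^sub>m 2 2 :: complex mat)" "0\<^sub>m ?l 2 * 0\<^sub>m 2 ?l = (0\<^sub>m ?l ?l :: complex mat)"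
        using X T by (auto intro!: right_mult_zero_mat left_mult_zero_mat)
      show ?thesis unfolding z IH XX by simp
    qed
    also have "\<dots> = 1\<^sub>m (2 + ?l)"
      by (rule eq_matI) (auto simp: index_mat_four_block)
    also have "2 + ?l = n - k" using 3 by simp
    finally show ?thesis .
  next
    case 1
    show ?thesis unfolding 1 cmv_tail_nil[OF order.refl] by (rule eq_matI) auto
  qed
qed


text \<open>Since the first factor is unitary, the characteristic polynomial is, up to a constant, the determinant of the tridiagonal matrix \<open>z * L\<^sup>* - M\<close>, whose entries are these.\<close>

definition cmv_pencil :: "(nat \<Rightarrow> complex) \<Rightarrow> complex \<Rightarrow> nat \<Rightarrow> nat \<Rightarrow> complex" where
  "cmv_pencil a z i j = z * cnj (band a 0 i j) - mband a i j"

lemma cmv_pencil_far: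
  "r + 2 \<le> c \<Longrightarrow> cmv_pencil a z r c = 0" "c + 2 \<le> r \<Longrightarrow> cmv_pencil a z r c = 0"
  by (auto simp: cmv_pencil_def band_def mband_def)

lemma cmv_pencil_diag:
  "cmv_pencil a z 0 0 = z * a 0 - 1"
  "0 < k \<Longrightarrow> even k \<Longrightarrow> cmv_pencil a z k k = z * a k + a (k - 1)"
  "odd k \<Longrightarrow> cmv_pencil a z k k = - cnj (a k) - z * cnj (a (k - 1))"
  by (auto simp: cmv_pencil_def band_def mband_def)

lemma cmv_pencil_off:
  "cmv_pencil a z k (Suc k) * cmv_pencil a z (Suc k) k = (if even k then z\<^sup>2 else 1) * (cmv_rho (a k) * cmv_rho (a k))"
  by (auto simp: cmv_pencil_def band_def mband_def power2_eq_square)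

text \<open>Expanding the tridiagonal determinant from the last index backwards produces, in alternation, multiples of the Szego polynomials and of their reversals. This is why the parameters enter in reversed order, rotated by \<open>u\<close>.\<close>

lemma cmv_pencil_det:
  assumes a: "\<And>k. k \<le> m \<Longrightarrow> cmod (a k) \<le> 1" "cmod (a m) = 1"
  defines "u \<equiv> - cnj (a m)"
  defines "b \<equiv> \<lambda>j. - u * a (m - 1 - j)"
  shows "\<exists>c. \<forall>z. band_det (cmv_pencil a z) 0 (Suc m) = c * (z * mev m (scoef b m) z + u * rmev m (scoef b m) z)"
proof -
  define P where "P z j = mev j (scoef b j) z" for z j
  define R where "R z j = rmev j (scoef b j) z" for z j
  define T where "T z i = band_det (cmv_pencil a z) i (Suc m - i)" for z i
  define D where "D z k = (if even k then z * a k else - cnj (a k))" for z k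
  define q where "q z k = (if even k then z\<^sup>2 else 1) * (1 - a k * cnj (a k))" for z k
  define X where "X z k = D z k * T z (Suc k) - (if k = m then 0 else q z k * T z (Suc (Suc k)))" for z k
  have uu: "u * cnj u = 1" using a(2) unfolding u_def by (simp add: complex_norm_square[symmetric] mult.commute)
  have Trec: "T z k = cmv_pencil a z k k * T z (Suc k) - (if k = m then 0 else q z k * T z (Suc (Suc k)))" if "k \<le> m" for z k
  proof (cases "k = m")
    case True
    then show ?thesis by (simp add: T_def band_det_1)
  next
    case False
    define j where "j = m - Suc k"
    have j: "Suc m - k = Suc (Suc j)" using False that unfolding j_def by arith
    then have "Suc m - Suc k = Suc j" "Suc m - Suc (Suc k) = j" by auto
    moreover have "cmv_rho (a k) * cmv_rho (a k) = 1 - a k * cnj (a k)" using cmv_rho_sq a(1)[OF that] by blast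
    ultimately show ?thesis
      using False unfolding T_def j by (simp add: band_det_rec[OF cmv_pencil_far] cmv_pencil_off q_def)
  qed
  have T0: "T z 0 = X z 0 - T z (Suc 0)" for z
    by (simp add: Trec X_def D_def cmv_pencil_diag algebra_simps)
  have Tk: "T z k = X z k + (if even k then a (k - 1) else - z * cnj (a (k - 1))) * T z (Suc k)" if "0 < k" "k \<le> m" for z k
    using that by (simp add: Trec X_def D_def cmv_pencil_diag algebra_simps)
  have PS: "P z (Suc j) = z * P z j + b j * R z j" and RS: "R z (Suc j) = R z j + cnj (b j) * z * P z j" for z j
    unfolding P_def R_def scoef.simps mev_step rmev_step by auto
  have inv: "\<exists>c. \<forall>z. if even (m - j) then X z (m - j) = - z * cnj u * c * P z j \<and> T z (Suc (m - j)) = c * R z j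
     else X z (m - j) = - c * R z j \<and> T z (Suc (m - j)) = - c * cnj u * P z j" if "j \<le> m" for j
    using that
  proof (induction j)
    case 0
    have cu: "cnj u = - a m" by (simp add: u_def)
    have T1: "T z (Suc m) = 1" for z by (simp add: T_def)
    have X0: "X z m = D z m" for z by (simp add: X_def T1)
    show ?case
    proof (cases "even m")
      case True
      then show ?thesis by (intro exI[of _ 1]) (simp add: T1 X0 D_def P_def R_def cu)
    next
      case False
      then show ?thesis using uu by (intro exI[of _ "- u"]) (simp add: T1 X0 D_def P_def R_def u_def)
    qed
  next
    case (Suc j)
    define k where "k = m - j"
    have k: "0 < k" "k \<le> m" "m - Suc j = k - 1" "Suc (k - 1) = k" using Suc.prems by (auto simp: k_def)
    from Suc obtain c where c: "\<And>z. if even k then X z k = - z * cnj u * c * P z j \<and> T z (Suc k) = c * R z j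
     else X z k = - c * R z j \<and> T z (Suc k) = - c * cnj u * P z j" unfolding k_def by auto
    define \<alpha> where "\<alpha> = a (k - 1)"
    have bj: "b j = - u * \<alpha>" "cnj (b j) = - cnj u * cnj \<alpha>" unfolding b_def \<alpha>_def k_def by (auto simp: diff_commute)
    have PS': "P z (Suc j) = z * P z j - u * \<alpha> * R z j" for z using PS[of z j] by (simp add: bj(1))
    have RS': "R z (Suc j) = R z j - cnj u * cnj \<alpha> * z * P z j" for z using RS[of z j] by (simp only: bj(2)) simp
    have Xk: "X z (k - 1) = D z (k - 1) * T z k - q z (k - 1) * T z (Suc k)" for z
      using k by (simp add: X_def)
    show ?case
    proof (cases "even k")
      case True
      then have o: "odd (k - 1)" using k by auto
      have "X z (k - 1) = - c * R z (Suc j) \<and> T z k = - c * cnj u * P z (Suc j)" for z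
      proof -
        have h: "X z k = - z * cnj u * c * P z j" "T z (Suc k) = c * R z j" using c[of z] True by auto
        have t: "T z k = X z k + \<alpha> * T z (Suc k)" using Tk[OF k(1,2), of z] True by (simp add: \<alpha>_def)
        have x: "X z (k - 1) = - cnj \<alpha> * T z k - (1 - \<alpha> * cnj \<alpha>) * T z (Suc k)"
          unfolding Xk using o by (simp add: D_def q_def \<alpha>_def)
        show ?thesis unfolding x t h PS' RS'
        proof (intro conjI, goal_cases)
          case 1 show ?case by (simp add: algebra_simps)
        next
          case 2
          have "- c * cnj u * (z * P z j - u * \<alpha> * R z j) = - z * cnj u * c * P z j + (u * cnj u) * (\<alpha> * (c * R z j))"
            by (simp add: algebra_simps)
          then show ?case unfolding uu by simp
        qed
      qed
      then show ?thesis unfolding k(3,4) using o by (intro exI[of _ c]) auto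
    next
      case False
      then have o: "even (k - 1)" using k by auto
      have "X z (k - 1) = - z * cnj u * (- c) * P z (Suc j) \<and> T z k = - c * R z (Suc j)" for z
      proof -
        have h: "X z k = - c * R z j" "T z (Suc k) = - c * cnj u * P z j" using c[of z] False by auto
        have t: "T z k = X z k - z * cnj \<alpha> * T z (Suc k)" using Tk[OF k(1,2), of z] False by (simp add: \<alpha>_def)
        have x: "X z (k - 1) = z * \<alpha> * T z k - z\<^sup>2 * (1 - \<alpha> * cnj \<alpha>) * T z (Suc k)"
          unfolding Xk using o by (simp add: D_def q_def \<alpha>_def)
        show ?thesis unfolding x t h PS' RS'
        proof (intro conjI, goal_cases)
          case 1
          have "- z * cnj u * (- c) * (z * P z j - u * \<alpha> * R z j) = z\<^sup>2 * c * cnj u * P z j - (u * cnj u) * (z * c * \<alpha> * R z j)"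
            by (simp add: algebra_simps power2_eq_square)
          then have "- z * cnj u * (- c) * (z * P z j - u * \<alpha> * R z j) = z\<^sup>2 * c * cnj u * P z j - z * c * \<alpha> * R z j"
            unfolding uu by simp
          then show ?case by (simp add: algebra_simps power2_eq_square)
        next
          case 2 show ?case by (simp add: algebra_simps)
        qed
      qed
      then show ?thesis unfolding k(3,4) using o by (intro exI[of _ "- c"]) auto
    qed
  qed
  from inv[of m] obtain c where c: "\<And>z. X z 0 = - z * cnj u * c * P z m \<and> T z (Suc 0) = c * R z m" by auto
  have "T z 0 = - c * cnj u * (z * P z m + u * R z m)" for z
  proof -
    have "- c * cnj u * (z * P z m + u * R z m) = - z * cnj u * c * P z m - (u * cnj u) * (c * R z m)"
      by (simp add: algebra_simps)
    then show ?thesis unfolding T0 uu using c[of z] by simp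
  qed
  then show ?thesis unfolding T_def P_def R_def by (intro exI[of _ "- c * cnj u"]) simp
qed

text \<open>Both sides are monic of the same degree, which fixes the constant left open by the pencil determinant. The product in the other order is similar, with the same characteristic polynomial.\<close>

lemma char_poly_cmv:
  assumes a: "\<And>k. k \<le> m \<Longrightarrow> cmod (a k) \<le> 1" "cmod (a m) = 1"
  defines "u \<equiv> - cnj (a m)"
  defines "b \<equiv> \<lambda>j. - u * a (m - 1 - j)"
  defines "p \<equiv> monic_of (Suc m) ((lin m u (scoef b m))(m := u))"
  shows "char_poly (cmv_L (Suc m) a * cmv_M (Suc m) a) = p"
        "char_poly (cmv_M (Suc m) a * cmv_L (Suc m) a) = p"
proof -
  let ?n = "Suc m"
  define A where "A = cmv_L ?n a"
  define B where "B = cmv_M ?n a"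
  define C where "C = map_mat cnj A"
  have carr: "A \<in> carrier_mat ?n ?n" "B \<in> carrier_mat ?n ?n" "C \<in> carrier_mat ?n ?n"
    by (auto simp: A_def B_def C_def cmv_L_eq cmv_M_eq)
  have "A = cmv_tail ?n a 0" using cmv_tail_eq[of 0 ?n a] by (simp add: A_def cmv_L_eq)
  then have AC: "A * C = 1\<^sub>m ?n"
    using cmv_tail_unitary[of ?n a 0] a by (simp add: C_def)
  have CA: "C * A = 1\<^sub>m ?n" by (rule mat_mult_left_right_inverse[OF carr(1) carr(3) AC])
  obtain c where c: "\<And>z. band_det (cmv_pencil a z) 0 ?n = c * (z * mev m (scoef b m) z + u * rmev m (scoef b m) z)"
    using cmv_pencil_det[of m a, OF a] unfolding u_def b_def by auto
  have "poly (char_poly (A * B)) z = poly (Polynomial.smult (Determinant.det A * c) p) z" for z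
  proof -
    have m: "z \<cdot>\<^sub>m C - B = mat ?n ?n (\<lambda>(r, c). cmv_pencil a z (0 + r) (0 + c))"
      by (rule eq_matI) (auto simp: A_def B_def C_def cmv_L_eq cmv_M_eq cmv_pencil_def)
    have "A * (z \<cdot>\<^sub>m C - B) = z \<cdot>\<^sub>m 1\<^sub>m ?n - A * B"
      using mult_minus_distrib_mat[OF carr(1) smult_carrier_mat[OF carr(3)] carr(2)] mult_smult_distrib[OF carr(1,3)]
      by (simp add: AC)
    also have "\<dots> = - char_matrix (A * B) z"
      using carr unfolding char_matrix_def by (intro eq_matI) auto
    finally have "poly (char_poly (A * B)) z = Determinant.det (A * (z \<cdot>\<^sub>m C - B))"
      using char_poly_matrix[of "A * B" ?n z] carr by simp
    also have "\<dots> = Determinant.det A * Determinant.det (z \<cdot>\<^sub>m C - B)"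
      using carr by (intro det_mult) auto
    also have "Determinant.det (z \<cdot>\<^sub>m C - B) = c * (z * mev m (scoef b m) z + u * rmev m (scoef b m) z)"
      unfolding m c[symmetric] band_det_def ..
    finally show ?thesis unfolding p_def by (simp add: mev_step)
  qed
  then have eq: "char_poly (A * B) = Polynomial.smult (Determinant.det A * c) p"
    unfolding poly_eq_poly_eq_iff[symmetric] by (rule ext)
  have AB: "A * B \<in> carrier_mat ?n ?n" using carr by auto
  have "Polynomial.degree p = ?n" "Polynomial.coeff p ?n = 1" by (simp_all add: p_def coeff_monic_of)
  moreover have "Polynomial.degree (char_poly (A * B)) = ?n" "Polynomial.coeff (char_poly (A * B)) ?n = 1"
    using degree_monic_char_poly[OF AB] by auto
  ultimately have "Determinant.det A * c = 1" unfolding eq by simp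
  then show 1: "char_poly (cmv_L (Suc m) a * cmv_M (Suc m) a) = p" using eq by (simp add: A_def B_def)
  have "similar_mat (B * A) (A * B)"
  proof (rule similar_matI[of _ _ C A ?n])
    show "B * A = C * (A * B) * A"
      using carr CA by (simp add: assoc_mult_mat[of C ?n ?n A ?n, symmetric])
  qed (use carr AC CA in auto)
  then show "char_poly (cmv_M (Suc m) a * cmv_L (Suc m) a) = p"
    using char_poly_similar 1 unfolding A_def B_def by metis
qed

section \<open>Stable polynomials as positive combinations of partial fractions\<close>

text \<open>The polynomial \<open>\<Sum>j. \<nu> j / (w - z j)\<close> cleared of denominators, for nodes \<open>z\<close> and weights \<open>\<nu>\<close>.\<close>

definition lag :: "nat \<Rightarrow> (nat \<Rightarrow> complex) \<Rightarrow> (nat \<Rightarrow> real) \<Rightarrow> complex \<Rightarrow> complex" where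
  "lag m z \<nu> w = (\<Sum>j\<le>m. of_real (\<nu> j) * (\<Prod>i\<in>{..m}-{j}. w - z i))"

lemma lag_at:
  assumes "k \<le> m"
  shows "lag m z \<nu> (z k) = of_real (\<nu> k) * (\<Prod>i\<in>{..m}-{k}. z k - z i)"
proof -
  have "lag m z \<nu> (z k) = (\<Sum>j\<in>{k}. of_real (\<nu> j) * (\<Prod>i\<in>{..m}-{j}. z k - z i))"
    unfolding lag_def using assms
    by (intro sum.mono_neutral_right) auto
  then show ?thesis by simp
qed

lemma unit_mult_cnj: "cmod z = 1 \<Longrightarrow> z * cnj z = 1"
  by (simp add: complex_norm_square[symmetric])

text \<open>Completing a Szego recursion with the unimodular parameter \<open>u = \<Prod>j. - z j\<close> returns the node polynomial: reflection in the circle multiplies each partial product by minus its missing node.\<close>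

lemma lag_completion:
  assumes z: "\<And>j. j \<le> m \<Longrightarrow> cmod (z j) = 1" and \<nu>: "(\<Sum>j\<le>m. \<nu> j) = 1"
    and s: "\<And>w. mev m s w = lag m z \<nu> w"
  shows "w * mev m s w + (\<Prod>j\<le>m. - z j) * rmev m s w = (\<Prod>j\<le>m. w - z j)"
proof (cases "w = 0")
  case True
  then show ?thesis by (simp add: rmev_def)
next
  case False
  have 1: "(\<Prod>j\<le>m. - z j) * (w ^ m * cnj (\<Prod>i\<in>{..m}-{j}. 1 / cnj w - z i)) = - z j * (\<Prod>i\<in>{..m}-{j}. w - z i)"
    if j: "j \<le> m" for j
  proof -
    have a: "w ^ m * cnj (\<Prod>i\<in>{..m}-{j}. 1 / cnj w - z i) = (\<Prod>i\<in>{..m}-{j}. w * cnj (1 / cnj w - z i))"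
      using j by (simp add: prod.distrib)
    have b: "(\<Prod>j\<le>m. - z j) = - z j * (\<Prod>i\<in>{..m}-{j}. - z i)"
      using j by (subst prod.remove[of _ j]) auto
    have "(\<Prod>j\<le>m. - z j) * (w ^ m * cnj (\<Prod>i\<in>{..m}-{j}. 1 / cnj w - z i)) =
        - z j * (\<Prod>i\<in>{..m}-{j}. - z i * (w * cnj (1 / cnj w - z i)))"
      unfolding a b prod.distrib by (simp only: mult.assoc)
    also have "(\<Prod>i\<in>{..m}-{j}. - z i * (w * cnj (1 / cnj w - z i))) = (\<Prod>i\<in>{..m}-{j}. w - z i)"
    proof (intro prod.cong refl)
      fix i assume "i \<in> {..m} - {j}"
      then have "z i * cnj (z i) = 1" using z by (intro unit_mult_cnj) auto
      have "- z i * (w * cnj (1 / cnj w - z i)) = - z i * (1 - w * cnj (z i))"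
        using False by (simp add: field_simps)
      also have "\<dots> = w * (z i * cnj (z i)) - z i" by (simp add: algebra_simps)
      finally show "- z i * (w * cnj (1 / cnj w - z i)) = w - z i"
        using \<open>z i * cnj (z i) = 1\<close> by simp
    qed
    finally show ?thesis .
  qed
  have "(\<Prod>j\<le>m. - z j) * rmev m s w
     = (\<Sum>j\<le>m. of_real (\<nu> j) * ((\<Prod>j\<le>m. - z j) * (w ^ m * cnj (\<Prod>i\<in>{..m}-{j}. 1 / cnj w - z i))))"
    unfolding rmev_eq_reflect[OF False] s lag_def
    by (simp add: sum_distrib_left mult_ac)
  also have "\<dots> = (\<Sum>j\<le>m. of_real (\<nu> j) * (- z j * (\<Prod>i\<in>{..m}-{j}. w - z i)))"
    using 1 by (intro sum.cong) auto
  finally have "w * mev m s w + (\<Prod>j\<le>m. - z j) * rmev m s w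
    = (\<Sum>j\<le>m. of_real (\<nu> j) * ((w - z j) * (\<Prod>i\<in>{..m}-{j}. w - z i)))"
    unfolding s lag_def by (simp add: sum_distrib_left sum.distrib[symmetric] algebra_simps)
  also have "\<dots> = (\<Sum>j\<le>m. of_real (\<nu> j) * (\<Prod>i\<le>m. w - z i))"
    by (intro sum.cong refl, subst (2) prod.remove) auto
  also have "\<dots> = of_real (\<Sum>j\<le>m. \<nu> j) * (\<Prod>i\<le>m. w - z i)"
    by (simp add: sum_distrib_right)
  finally show ?thesis using \<nu> by simp
qed

text \<open>Away from the nodes, \<open>w / (w - z)\<close> has positive real part when \<open>\<bar>w\<bar> \<ge> 1\<close> and \<open>\<bar>z\<bar> = 1\<close>, so a positive combination cannot vanish; at a node only one term survives.\<close>

lemma lag_schur_stable: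
  assumes z: "\<And>j. j \<le> m \<Longrightarrow> cmod (z j) = 1" and inj: "inj_on z {..m}" and \<nu>: "\<And>j. j \<le> m \<Longrightarrow> \<nu> j > 0"
    and s: "\<And>w. mev m s w = lag m z \<nu> w"
  shows "schur_stable m s"
  unfolding schur_stable_def s
proof (intro allI impI)
  fix w :: complex assume w: "1 \<le> cmod w"
  show "lag m z \<nu> w \<noteq> 0"
  proof (cases "w \<in> z ` {..m}")
    case True
    then obtain k where k: "k \<le> m" "w = z k" by auto
    have "z k - z i \<noteq> 0" if "i \<in> {..m} - {k}" for i
      using inj that k(1) by (auto simp: inj_on_def)
    then show ?thesis unfolding k(2) lag_at[OF k(1)] using \<nu>[OF k(1)] by auto
  next
    case False
    then have ne: "w \<noteq> z j" if "j \<le> m" for j using that by auto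
    have pos: "Re (w / (w - z j)) > 0" if "j \<le> m" for j
    proof -
      have "(cmod (w - z j))\<^sup>2 > 0" using ne[OF that] by simp
      moreover have "(cmod (w - z j))\<^sup>2 = (cmod w)\<^sup>2 + (cmod (z j))\<^sup>2 - 2 * Re (w * cnj (z j))"
        unfolding cmod_power2 by (simp add: power2_eq_square algebra_simps)
      moreover have "Re (w * cnj (w - z j)) = (cmod w)\<^sup>2 - Re (w * cnj (z j))"
        unfolding cmod_power2 by (simp add: power2_eq_square algebra_simps)
      moreover have "(cmod (z j))\<^sup>2 \<le> (cmod w)\<^sup>2" using w z[OF that] by simp
      ultimately have "Re (w * cnj (w - z j)) > 0" by linarith
      then show ?thesis
        using \<open>(cmod (w - z j))\<^sup>2 > 0\<close> unfolding complex_div_cnj[of w] by (simp add: Re_divide_of_real del: complex_cnj_diff)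
    qed
    have "w * lag m z \<nu> w = (\<Sum>j\<le>m. of_real (\<nu> j) * (w / (w - z j))) * (\<Prod>i\<le>m. w - z i)"
      unfolding lag_def sum_distrib_left sum_distrib_right
    proof (intro sum.cong refl)
      fix j assume "j \<in> {..m}"
      then show "w * (of_real (\<nu> j) * (\<Prod>i\<in>{..m} - {j}. w - z i)) =
         of_real (\<nu> j) * (w / (w - z j)) * (\<Prod>i\<le>m. w - z i)"
        using ne[of j] by (subst (2) prod.remove[of _ j]) auto
    qed
    moreover
    have "Re (\<Sum>j\<le>m. of_real (\<nu> j) * (w / (w - z j))) > 0"
      unfolding Re_sum
    proof (rule sum_pos)
      fix i assume "i \<in> {..m}"
      have "Re (of_real (\<nu> i) * (w / (w - z i))) = \<nu> i * Re (w / (w - z i))" by (simp only: times_complex.sel Re_complex_of_real Im_complex_of_real mult_zero_left diff_zero)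
      then show "0 < Re (of_real (\<nu> i) * (w / (w - z i)))"
        using pos[of i] \<nu>[of i] \<open>i \<in> {..m}\<close> by simp
    qed auto
    then have "(\<Sum>j\<le>m. of_real (\<nu> j) * (w / (w - z j))) \<noteq> 0" by (metis zero_complex.sel(1) less_irrefl)
    ultimately show ?thesis using ne by auto
  qed
qed

lemma vandermonde_sq:
  "(\<Prod>j<n. \<Prod>i\<in>{..<n}-{j}. cmod (z j - z i)) = (cmod (vandermonde n z))\<^sup>2"
proof (induction n)
  case (Suc n)
  have 1: "(\<Prod>i\<in>{..<Suc n}-{j}. cmod (z j - z i)) = cmod (z n - z j) * (\<Prod>i\<in>{..<n}-{j}. cmod (z j - z i))" if "j < n" for j
  proof -
    have "{..<Suc n}-{j} = insert n ({..<n}-{j})" using that by auto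
    then show ?thesis by (simp add: norm_minus_commute)
  qed
  have 2: "{..<Suc n} - {n} = {..<n}" by auto
  have "(\<Prod>j<Suc n. \<Prod>i\<in>{..<Suc n}-{j}. cmod (z j - z i))
     = (\<Prod>j<n. cmod (z n - z j) * (\<Prod>i\<in>{..<n}-{j}. cmod (z j - z i))) * (\<Prod>i<n. cmod (z n - z i))"
    unfolding prod.lessThan_Suc 2 by (simp add: 1)
  also have "\<dots> = ((\<Prod>i<n. cmod (z n - z i)))\<^sup>2 * (cmod (vandermonde n z))\<^sup>2"
    unfolding prod.distrib Suc by (simp add: power2_eq_square)
  finally show ?case by (simp add: vandermonde_def norm_mult power_mult_distrib prod_norm mult.commute)
qed (simp add: vandermonde_def)

text \<open>At a root of the polynomial, the completion identity turns the reversed polynomial into the node polynomial. Exchanging the product, one evaluates the polynomial at the nodes, where a single Lagrange term remains.\<close>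

lemma lag_resultant:
  assumes z: "\<And>j. j \<le> m \<Longrightarrow> cmod (z j) = 1" and \<nu>1: "(\<Sum>j\<le>m. \<nu> j) = 1" and \<nu>: "\<And>j. j \<le> m \<Longrightarrow> \<nu> j > 0"
    and s: "\<And>w. mev m s w = lag m z \<nu> w" and v: "\<And>w. mev m s w = (\<Prod>i<m. w - v i)"
  shows "(\<Prod>i<m. cmod (rmev m s (v i))) = (\<Prod>j\<le>m. \<nu> j) * (cmod (vandermonde (Suc m) z))\<^sup>2"
proof -
  have u: "cmod (\<Prod>j\<le>m. - z j) = 1" using z by (simp add: prod_norm[symmetric])
  have "(\<Prod>i<m. cmod (rmev m s (v i))) = (\<Prod>i<m. \<Prod>j\<le>m. cmod (v i - z j))"
  proof (intro prod.cong refl)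
    fix i assume "i \<in> {..<m}"
    then have "mev m s (v i) = 0" unfolding v by (subst prod_zero_iff) auto
    then have "(\<Prod>j\<le>m. - z j) * rmev m s (v i) = (\<Prod>j\<le>m. v i - z j)"
      using lag_completion[OF z \<nu>1 s, of "v i"] by simp
    then have "cmod ((\<Prod>j\<le>m. - z j) * rmev m s (v i)) = cmod (\<Prod>j\<le>m. v i - z j)" by simp
    then show "cmod (rmev m s (v i)) = (\<Prod>j\<le>m. cmod (v i - z j))"
      using u by (simp only: norm_mult prod_norm)
  qed
  also have "\<dots> = (\<Prod>j\<le>m. \<Prod>i<m. cmod (z j - v i))"
    by (subst prod.swap) (simp add: norm_minus_commute)
  also have "\<dots> = (\<Prod>j\<le>m. cmod (lag m z \<nu> (z j)))"
    unfolding s[symmetric] v by (simp add: prod_norm)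
  also have "\<dots> = (\<Prod>j\<le>m. \<nu> j * (\<Prod>i\<in>{..m}-{j}. cmod (z j - z i)))"
  proof (intro prod.cong refl)
    fix j assume "j \<in> {..m}"
    then show "cmod (lag m z \<nu> (z j)) = \<nu> j * (\<Prod>i\<in>{..m}-{j}. cmod (z j - z i))"
      using \<nu>[of j] by (simp add: lag_at norm_mult prod_norm)
  qed
  also have "\<dots> = (\<Prod>j\<le>m. \<nu> j) * (\<Prod>j<Suc m. \<Prod>i\<in>{..<Suc m}-{j}. cmod (z j - z i))"
    by (simp only: prod.distrib lessThan_Suc_atMost)
  finally show ?thesis unfolding vandermonde_sq .
qed

lemma schur_stable_inside:
  assumes "schur_stable m s" "cmod w < 1"
  shows "cmod (w * mev m s w) < cmod (rmev m s w)"
proof (cases "w = 0")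
  case False
  define y where "y = 1 / cnj w"
  have y: "1 \<le> cmod y" "y \<noteq> 0" "w = 1 / cnj y" using assms(2) False by (auto simp: y_def norm_divide divide_simps)
  have ne: "cmod (mev m s y) > 0" using assms(1) y(1) by (auto simp: schur_stable_def)
  have r: "cmod (rmev m s w) = cmod w ^ m * cmod (mev m s y)"
    unfolding rmev_eq_reflect[OF False] y_def by (simp add: norm_mult norm_power)
  have "cmod (rmev m s y) = cmod y ^ m * cmod (mev m s w)"
    unfolding rmev_eq_reflect[OF y(2)] y(3) by (simp add: norm_mult norm_power)
  then have "cmod w ^ m * cmod (rmev m s y) = cmod (mev m s w)"
    using False by (simp add: y_def norm_divide power_divide)
  moreover have "cmod w ^ m * cmod (rmev m s y) \<le> cmod w ^ m * cmod (mev m s y)"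
    using stable_le[OF assms(1) y(1)] by (rule mult_left_mono) simp
  ultimately have le: "cmod (mev m s w) \<le> cmod (rmev m s w)" using r by simp
  have pos: "cmod (rmev m s w) > 0" unfolding r using ne False by simp
  have "cmod (w * mev m s w) \<le> cmod w * cmod (rmev m s w)" using le by (simp add: norm_mult mult_left_mono)
  also have "\<dots> < 1 * cmod (rmev m s w)" using assms(2) pos by (rule mult_strict_right_mono)
  finally show ?thesis by simp
qed (simp add: rmev_def)

text \<open>Inside the disk the reversed polynomial strictly dominates and outside the polynomial does, so the two terms can only cancel on the circle.\<close>

lemma completion_roots_unit:
  assumes st: "schur_stable m s" and u: "cmod u = 1"
    and z: "\<And>w. w * mev m s w + u * rmev m s w = (\<Prod>j\<le>m. w - z j)" and j: "j \<le> m"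
  shows "cmod (z j) = 1"
proof -
  have 0: "z j * mev m s (z j) + u * rmev m s (z j) = 0"
    unfolding z using j by (subst prod_zero_iff) auto
  then have eq: "cmod (z j * mev m s (z j)) = cmod (rmev m s (z j))"
    using u by (metis add_eq_0_iff2 mult_1 norm_minus_cancel norm_mult)
  consider "cmod (z j) < 1" | "cmod (z j) > 1" | "cmod (z j) = 1" by linarith
  then show ?thesis
  proof cases
    case 1 then show ?thesis using schur_stable_inside[OF st 1] eq by simp
  next
    case 2
    then have "cmod (mev m s (z j)) > 0" using st by (auto simp: schur_stable_def)
    then have "1 * cmod (mev m s (z j)) < cmod (z j * mev m s (z j))"
      unfolding norm_mult using 2 by (intro mult_strict_right_mono) auto
    then show ?thesis using eq stable_le[OF st, of "z j"] 2 by simp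
  qed
qed

lemma completion_prod:
  assumes "\<And>w. w * mev m s w + u * rmev m s w = (\<Prod>j\<le>m. w - z j)"
  shows "(\<Prod>j\<le>m. - z j) = u"
  using assms[of 0] by (simp add: rmev_def)

text \<open>The logarithmic derivative of the Blaschke product is positive along the circle, hence the roots of the completion are simple and the residues are positive.\<close>

lemma completion_weight:
  assumes st: "schur_stable m s" and u: "cmod u = 1"
    and z: "\<And>w. w * mev m s w + u * rmev m s w = (\<Prod>j\<le>m. w - z j)" and j: "j \<le> m"
  shows "\<exists>c\<ge>1::real. (\<Prod>i\<in>{..m}-{j}. z j - z i) = of_real c * mev m s (z j)"
proof -
  obtain v where v: "\<And>w. mev m s w = (\<Prod>i<m. w - v i)" using mev_factorization by blast
  define x where "x = z j"
  have x1: "cmod x = 1" unfolding x_def by (rule completion_roots_unit[OF st u z j])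
  then have xx: "x * cnj x = 1" by (rule unit_mult_cnj)
  have v1: "cmod (v i) < 1" if "i < m" for i using stable_root_less[OF st v that] .
  have ne1: "x - v i \<noteq> 0" if "i < m" for i using v1[OF that] x1 by auto
  have ne2: "1 - cnj (v i) * x \<noteq> 0" if "i < m" for i
  proof
    assume "1 - cnj (v i) * x = 0"
    then have "cmod (cnj (v i) * x) = 1" by simp
    then show False using v1[OF that] x1 by (simp add: norm_mult)
  qed
  have root: "x * mev m s x + u * rmev m s x = 0"
    unfolding z x_def using j by (subst prod_zero_iff) auto
  have d1: "((\<lambda>w. mev m s w) has_field_derivative mev m s x * (\<Sum>i<m. 1 / (x - v i))) (at x)"
    unfolding v by (rule has_field_derivative_prod'[of "{..<m}" "\<lambda>i w. w - v i" x "\<lambda>i. 1"])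
      (use ne1 in \<open>auto intro!: derivative_eq_intros\<close>)
  have d2: "((\<lambda>w. rmev m s w) has_field_derivative rmev m s x * (\<Sum>i<m. - cnj (v i) / (1 - cnj (v i) * x))) (at x)"
    unfolding rmev_factor[OF v] by (rule has_field_derivative_prod'[of "{..<m}" "\<lambda>i w. 1 - cnj (v i) * w" x "\<lambda>i. - cnj (v i)"])
      (use ne2 in \<open>auto intro!: derivative_eq_intros\<close>)
  let ?A = "\<Sum>i<m. 1 / (x - v i)" and ?B = "\<Sum>i<m. - cnj (v i) / (1 - cnj (v i) * x)"
  have D1: "((\<lambda>w. w * mev m s w + u * rmev m s w) has_field_derivative
      (mev m s x + x * (mev m s x * ?A) + u * (rmev m s x * ?B))) (at x)"
    using d1 d2 by (auto intro!: derivative_eq_intros)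
  have "((\<lambda>w. (w - x) * (\<Prod>i\<in>{..m}-{j}. w - z i)) has_field_derivative
      (\<Prod>i\<in>{..m}-{j}. x - z i) + (x - x) * (\<Sum>i\<in>{..m}-{j}. 1 * (\<Prod>y\<in>{..m}-{j}-{i}. x - z y))) (at x)"
    by (auto intro!: derivative_eq_intros has_field_derivative_prod)
  also have "(\<lambda>w. (w - x) * (\<Prod>i\<in>{..m}-{j}. w - z i)) = (\<lambda>w. w * mev m s w + u * rmev m s w)"
    unfolding z x_def using j by (subst prod.remove[of "{..m}" j]) auto
  finally have D2: "((\<lambda>w. w * mev m s w + u * rmev m s w) has_field_derivative (\<Prod>i\<in>{..m}-{j}. x - z i)) (at x)"
    by simp
  have ur: "u * rmev m s x = - (x * mev m s x)" using root by (simp add: eq_neg_iff_add_eq_0 add.commute)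
  have "(\<Prod>i\<in>{..m}-{j}. x - z i) = mev m s x + x * (mev m s x * ?A) + (u * rmev m s x) * ?B"
    using DERIV_unique[OF D2 D1] by (simp add: mult.assoc)
  also have "\<dots> = mev m s x * (1 + (\<Sum>i<m. x * (1 / (x - v i)) - x * (- cnj (v i) / (1 - cnj (v i) * x))))"
    unfolding ur sum_subtractf sum_distrib_left[symmetric] by (simp add: algebra_simps)
  also have "(\<Sum>i<m. x * (1 / (x - v i)) - x * (- cnj (v i) / (1 - cnj (v i) * x)))
      = (\<Sum>i<m. of_real ((1 - (cmod (v i))\<^sup>2) / (cmod (x - v i))\<^sup>2))"
  proof (intro sum.cong refl)
    fix i assume "i \<in> {..<m}"
    then have i: "i < m" by simp
    have e: "1 - cnj (v i) * x = x * cnj (x - v i)" using xx by (simp add: algebra_simps)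
    have c: "cnj (x - v i) \<noteq> 0" using ne1[OF i] by (metis complex_cnj_zero_iff)
    have "x \<noteq> 0" using x1 by auto
    have "x * (1 / (x - v i)) - x * (- cnj (v i) / (1 - cnj (v i) * x)) = x / (x - v i) + cnj (v i) / cnj (x - v i)"
      unfolding e using \<open>x \<noteq> 0\<close> by simp
    also have "\<dots> = (x * cnj (x - v i) + cnj (v i) * (x - v i)) / ((x - v i) * cnj (x - v i))"
      using add_frac_eq[OF ne1[OF i] c, of x "cnj (v i)"] by simp
    also have "x * cnj (x - v i) + cnj (v i) * (x - v i) = 1 - v i * cnj (v i)"
      using xx by (simp add: algebra_simps)
    finally show "x * (1 / (x - v i)) - x * (- cnj (v i) / (1 - cnj (v i) * x)) = of_real ((1 - (cmod (v i))\<^sup>2) / (cmod (x - v i))\<^sup>2)"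
      unfolding cnj_mult_self by simp
  qed
  also have "1 + (\<Sum>i<m. complex_of_real ((1 - (cmod (v i))\<^sup>2) / (cmod (x - v i))\<^sup>2))
     = of_real (1 + (\<Sum>i<m. (1 - (cmod (v i))\<^sup>2) / (cmod (x - v i))\<^sup>2))" by simp
  finally have "(\<Prod>i\<in>{..m}-{j}. x - z i) = of_real (1 + (\<Sum>i<m. (1 - (cmod (v i))\<^sup>2) / (cmod (x - v i))\<^sup>2)) * mev m s x"
    by (simp add: mult.commute)
  moreover have "(\<Sum>i<m. (1 - (cmod (v i))\<^sup>2) / (cmod (x - v i))\<^sup>2) \<ge> 0"
    using one_minus_cmod_sq[OF v1] by (intro sum_nonneg divide_nonneg_nonneg) (auto simp: less_imp_le)
  ultimately show ?thesis unfolding x_def by (intro exI[of _ "1 + (\<Sum>i<m. (1 - (cmod (v i))\<^sup>2) / (cmod (z j - v i))\<^sup>2)"]) auto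
qed

lemma lag_poly:
  obtains p where "\<And>w. poly p w = lag m z \<nu> w" "Polynomial.degree p \<le> m" "Polynomial.coeff p m = of_real (\<Sum>j\<le>m. \<nu> j)"
proof -
  define q where "q j = (\<Prod>i\<in>{..m}-{j}. [:- z i, 1:])" for j
  define p where "p = (\<Sum>j\<le>m. Polynomial.smult (of_real (\<nu> j)) (q j))"
  have deg: "Polynomial.degree (q j) = m" if "j \<le> m" for j
    unfolding q_def using that by (subst degree_prod_eq_sum_degree) auto
  have lc: "Polynomial.coeff (q j) m = 1" if "j \<le> m" for j
    using deg[OF that] monic_prod[of "{..m}-{j}" "\<lambda>i. [:- z i, 1:]"] by (auto simp: q_def)
  have "poly p w = lag m z \<nu> w" for w
    by (simp add: p_def q_def lag_def poly_sum poly_prod)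
  moreover have "Polynomial.degree p \<le> m"
    unfolding p_def using deg by (intro degree_sum_le) (auto intro: order.trans[OF degree_smult_le])
  moreover have "Polynomial.coeff p m = of_real (\<Sum>j\<le>m. \<nu> j)"
    unfolding p_def using lc by (simp add: coeff_sum)
  ultimately show ?thesis by (rule that)
qed

text \<open>The weights are the reciprocals of the constants in the previous lemma. Lagrange interpolation at the simple roots recovers the polynomial, and its leading coefficient gives total mass one.\<close>

lemma completion_lag:
  assumes st: "schur_stable m s" and u: "cmod u = 1"
    and z: "\<And>w. w * mev m s w + u * rmev m s w = (\<Prod>j\<le>m. w - z j)"
  shows "inj_on z {..m} \<and> (\<exists>\<nu>. (\<forall>j\<le>m. \<nu> j > 0) \<and> (\<Sum>j\<le>m. \<nu> j) = 1 \<and> (\<forall>w. mev m s w = lag m z \<nu> w))"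
proof -
  obtain c where c: "\<And>j. j \<le> m \<Longrightarrow> c j \<ge> (1::real)"
    "\<And>j. j \<le> m \<Longrightarrow> (\<Prod>i\<in>{..m}-{j}. z j - z i) = of_real (c j) * mev m s (z j)"
    using completion_weight[OF st u z] by metis
  have z1: "\<And>j. j \<le> m \<Longrightarrow> cmod (z j) = 1" by (rule completion_roots_unit[OF st u z])
  have ne: "mev m s (z j) \<noteq> 0" if "j \<le> m" for j
    using st z1[OF that] by (auto simp: schur_stable_def)
  have inj: "inj_on z {..m}"
  proof (rule inj_onI, rule ccontr)
    fix i j assume ij: "i \<in> {..m}" "j \<in> {..m}" "z i = z j" "i \<noteq> j"
    then have "(\<Prod>i\<in>{..m}-{j}. z j - z i) = 0" by (intro prod_zero) (auto intro!: bexI[of _ i])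
    then have "of_real (c j) * mev m s (z j) = 0" using c(2)[of j] ij by (metis atMost_iff)
    moreover have "c j \<ge> 1" "mev m s (z j) \<noteq> 0" using c(1)[of j] ne[of j] ij by auto
    ultimately show False by (auto simp: mult_eq_0_iff)
  qed
  define \<nu> where "\<nu> j = 1 / c j" for j
  have pos: "\<nu> j > 0" if "j \<le> m" for j using c(1)[OF that] by (simp add: \<nu>_def)
  obtain p where p: "\<And>w. poly p w = lag m z \<nu> w" "Polynomial.degree p \<le> m" "Polynomial.coeff p m = of_real (\<Sum>j\<le>m. \<nu> j)"
    using lag_poly[of m z \<nu>] by blast
  have "p = monic_of m s"
  proof (rule poly_eqI_degree[of "z ` {..m}"])
    show "card (z ` {..m}) > Polynomial.degree p" "card (z ` {..m}) > Polynomial.degree (monic_of m s)"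
      using p(2) card_image[OF inj] by auto
    fix x assume "x \<in> z ` {..m}"
    then obtain j where j: "j \<le> m" "x = z j" by auto
    show "poly p x = poly (monic_of m s) x"
      unfolding p j lag_at[OF j(1)] c(2)[OF j(1)] using c(1)[OF j(1)] by (simp add: \<nu>_def)
  qed
  then have "mev m s w = lag m z \<nu> w" for w using p(1)[of w] by simp
  moreover have "(\<Sum>j\<le>m. \<nu> j) = 1"
    using p(3) \<open>p = monic_of m s\<close> by (simp only: coeff_monic_of) (metis of_real_eq_1_iff)
  ultimately show ?thesis using inj pos by blast
qed

lemma lag_weights_unique:
  assumes "inj_on z {..m}" "\<And>w. lag m z \<nu> w = lag m z \<nu>' w" "j \<le> m"
  shows "\<nu> j = \<nu>' j"
proof -
  have "z j - z i \<noteq> 0" if "i \<in> {..m} - {j}" for i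
    using assms that by (auto simp: inj_on_def)
  then have "(\<Prod>i\<in>{..m}-{j}. z j - z i) \<noteq> 0" by (subst prod_zero_iff) auto
  then show ?thesis using assms(2)[of "z j"] unfolding lag_at[OF assms(3)] by simp
qed

section \<open>Measurability of symmetric functions of roots\<close>

lemma root_vectors_permuted:
  fixes x y :: "nat \<Rightarrow> complex"
  assumes "(\<Prod>i<n. [:- x i, 1:]) = (\<Prod>i<n. [:- y i, 1:])"
  obtains \<tau> where "\<tau> permutes {..<n}" "\<And>i. i < n \<Longrightarrow> x i = y (\<tau> i)"
proof -
  have *: "proots (\<Prod>i<n. [:- z i, 1:]) = image_mset z (mset_set {..<n})" for z :: "nat \<Rightarrow> complex"
    by (subst proots_prod) (auto simp: sum_unfold_sum_mset multiset.map_comp comp_def)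
  have "image_mset x (mset_set {..<n}) = image_mset y (mset_set {..<n})"
    unfolding *[symmetric] assms ..
  then obtain p where "p permutes {..<n}" "\<forall>i\<in>{..<n}. x i = y (p i)"
    by (rule image_mset_eq_implies_permutes[rotated]) auto
  then show ?thesis by (intro that[of p]) auto
qed

text \<open>Roots ranging over a compact box give a compact, hence closed, set of coefficient vectors. This replaces the continuity of the roots.\<close>

lemma compact_coeff_box:
  fixes K :: "nat \<Rightarrow> complex set"
  assumes "\<And>i. i < n \<Longrightarrow> compact (K i)"
  shows "compact {Polynomial.coeff (\<Prod>i<n. [:- x i, 1:]) | x. \<forall>i<n. x i \<in> K i}"
  using assms
proof (induction n)
  case (Suc n)
  let ?C = "{Polynomial.coeff (\<Prod>i<n. [:- x i, 1:]) | x. \<forall>i<n. x i \<in> K i}"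
  let ?h = "\<lambda>(c, t::complex) k. (if k = 0 then 0 else c (k - 1)) - t * (c k :: complex)"
  have cont: "continuous_on S (\<lambda>y. fst y k)" for S :: "((nat \<Rightarrow> complex) \<times> complex) set" and k
    by (intro continuous_on_compose2[OF continuous_on_product_coordinates continuous_on_fst[OF continuous_on_id]]) auto
  have "compact (?h ` (?C \<times> K n))"
  proof (rule compact_continuous_image)
    show "continuous_on (?C \<times> K n) ?h"
    proof (rule continuous_on_coordinatewise_then_product)
      fix k :: nat
      show "continuous_on (?C \<times> K n) (\<lambda>y. ?h y k)"
        by (cases k) (auto simp: case_prod_unfold intro!: continuous_intros cont)
    qed
    show "compact (?C \<times> K n)" using Suc by (intro compact_Times) auto
  qed
  also have "?h ` (?C \<times> K n) = {Polynomial.coeff (\<Prod>i<Suc n. [:- x i, 1:]) | x. \<forall>i<Suc n. x i \<in> K i}"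
  proof -
    have h: "?h (Polynomial.coeff p, t) = Polynomial.coeff (p * [:- t, 1:])" for p t
    proof
      fix k show "?h (Polynomial.coeff p, t) k = Polynomial.coeff (p * [:- t, 1:]) k"
        by (cases k) (auto simp: coeff_pCons)
    qed
    show ?thesis
    proof (intro equalityI subsetI)
      fix f assume "f \<in> ?h ` (?C \<times> K n)"
      then obtain x t where x: "\<forall>i<n. x i \<in> K i" "t \<in> K n" "f = ?h (Polynomial.coeff (\<Prod>i<n. [:- x i, 1:]), t)"
        by auto
      have "f = Polynomial.coeff (\<Prod>i<Suc n. [:- (x(n := t)) i, 1:])"
        unfolding x(3) h by simp
      moreover have "\<forall>i<Suc n. (x(n := t)) i \<in> K i" using x by (auto simp: less_Suc_eq)
      ultimately show "f \<in> {Polynomial.coeff (\<Prod>i<Suc n. [:- x i, 1:]) | x. \<forall>i<Suc n. x i \<in> K i}" by blast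
    next
      fix f assume "f \<in> {Polynomial.coeff (\<Prod>i<Suc n. [:- x i, 1:]) | x. \<forall>i<Suc n. x i \<in> K i}"
      then obtain x where x: "\<forall>i<Suc n. x i \<in> K i" "f = Polynomial.coeff (\<Prod>i<Suc n. [:- x i, 1:])" by auto
      have "f = ?h (Polynomial.coeff (\<Prod>i<n. [:- x i, 1:]), x n)"
        unfolding x(2) h by simp
      moreover have "(Polynomial.coeff (\<Prod>i<n. [:- x i, 1:]), x n) \<in> ?C \<times> K n" using x(1) by auto
      ultimately show "f \<in> ?h ` (?C \<times> K n)" by (rule image_eqI)
    qed
  qed
  finally show ?case .
qed simp

context
  fixes M :: "'w measure" and n :: nat and p :: "'w \<Rightarrow> complex poly"
  assumes p: "\<And>k. (\<lambda>\<omega>. Polynomial.coeff (p \<omega>) k) \<in> borel_measurable M"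
begin

lemma sets_root_in_box:
  assumes "\<And>i. i < n \<Longrightarrow> closed (K i)"
  shows "{\<omega> \<in> space M. \<exists>x. (\<forall>i<n. x i \<in> K i) \<and> p \<omega> = (\<Prod>i<n. [:- x i, 1:])} \<in> sets M"
proof -
  let ?C = "\<lambda>l::nat. {Polynomial.coeff (\<Prod>i<n. [:- x i, 1:]) | x. \<forall>i<n. x i \<in> K i \<inter> cball 0 (real l)}"
  have [measurable]: "(\<lambda>\<omega>. Polynomial.coeff (p \<omega>)) \<in> borel_measurable M"
    by (rule measurable_coordinatewise_then_product) (rule p)
  have "closed (?C l)" for l
    by (rule compact_imp_closed, rule compact_coeff_box, rule closed_Int_compact) (use assms in auto)
  then have [measurable]: "?C l \<in> sets borel" for l by (rule borel_closed)
  have "{\<omega> \<in> space M. \<exists>x. (\<forall>i<n. x i \<in> K i) \<and> p \<omega> = (\<Prod>i<n. [:- x i, 1:])}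
      = (\<Union>l. {\<omega> \<in> space M. Polynomial.coeff (p \<omega>) \<in> ?C l})"
  proof (intro equalityI subsetI)
    fix \<omega> assume "\<omega> \<in> {\<omega> \<in> space M. \<exists>x. (\<forall>i<n. x i \<in> K i) \<and> p \<omega> = (\<Prod>i<n. [:- x i, 1:])}"
    then obtain x where x: "\<omega> \<in> space M" "\<forall>i<n. x i \<in> K i" "p \<omega> = (\<Prod>i<n. [:- x i, 1:])" by auto
    obtain l where l: "(\<Sum>i<n. cmod (x i)) \<le> real l" using real_arch_simple by blast
    have "cmod (x i) \<le> real l" if "i < n" for i
      using that by (intro order.trans[OF _ l] member_le_sum) auto
    then show "\<omega> \<in> (\<Union>l. {\<omega> \<in> space M. Polynomial.coeff (p \<omega>) \<in> ?C l})" using x by auto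
  next
    fix \<omega> assume "\<omega> \<in> (\<Union>l. {\<omega> \<in> space M. Polynomial.coeff (p \<omega>) \<in> ?C l})"
    then obtain l x where "\<omega> \<in> space M" "\<forall>i<n. x i \<in> K i" "Polynomial.coeff (p \<omega>) = Polynomial.coeff (\<Prod>i<n. [:- x i, 1:])"
      by auto
    then show "\<omega> \<in> {\<omega> \<in> space M. \<exists>x. (\<forall>i<n. x i \<in> K i) \<and> p \<omega> = (\<Prod>i<n. [:- x i, 1:])}"
      by (auto simp: coeff_inject)
  qed
  also have "\<dots> \<in> sets M" by measurable
  finally show ?thesis .
qed

context
  fixes r :: "'w \<Rightarrow> nat \<Rightarrow> complex"
  assumes r: "\<And>\<omega>. \<omega> \<in> space M \<Longrightarrow> p \<omega> = (\<Prod>i<n. [:- r \<omega> i, 1:])"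
    and ext: "\<And>\<omega>. \<omega> \<in> space M \<Longrightarrow> r \<omega> \<in> {..<n} \<rightarrow>\<^sub>E UNIV"
begin

text \<open>The number of reorderings of the root vector that land in \<open>A\<close>. Unlike the root vector itself it is determined by the polynomial, and it is additive in \<open>A\<close>, so it is accessible to a generator argument.\<close>

definition perm_count :: "(nat \<Rightarrow> complex) set \<Rightarrow> 'w \<Rightarrow> nat" where
  "perm_count A \<omega> = card {\<sigma>. \<sigma> permutes {..<n} \<and> r \<omega> \<circ> \<sigma> \<in> A}"

lemma finite_perms: "finite {\<sigma>. \<sigma> permutes {..<n} \<and> Q \<sigma>}"
  by (rule finite_subset[OF _ finite_permutations[of "{..<n}"]]) auto

lemma comp_perm_PiE:
  assumes "\<omega> \<in> space M" "\<sigma> permutes {..<n}" shows "r \<omega> \<circ> \<sigma> \<in> {..<n} \<rightarrow>\<^sub>E UNIV"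
  using ext[OF assms(1)] assms(2) by (auto simp: PiE_def extensional_def permutes_def)

text \<open>At least \<open>k\<close> reorderings lie in a box exactly when, for some \<open>k\<close> permutations, all the correspondingly permuted boxes contain the root vector, and this is a statement about one smaller box.\<close>

lemma sets_perm_count_box:
  assumes K: "\<And>i. i < n \<Longrightarrow> closed (K i)"
  shows "{\<omega> \<in> space M. k \<le> perm_count (PiE {..<n} K) \<omega>} \<in> sets M"
proof -
  let ?S = "{T. T \<subseteq> {\<sigma>. \<sigma> permutes {..<n}} \<and> card T = k}"
  let ?K = "\<lambda>T i. (\<Inter>\<sigma>\<in>T. K (inv_into UNIV \<sigma> i))"
  let ?E = "\<lambda>T. {\<omega> \<in> space M. \<exists>x. (\<forall>i<n. x i \<in> ?K T i) \<and> p \<omega> = (\<Prod>i<n. [:- x i, 1:])}"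
  have fin: "finite ?S" by (rule finite_subset[of _ "Pow {\<sigma>. \<sigma> permutes {..<n}}"]) (auto simp: finite_permutations)
  have perm_lt: "\<sigma> i < n \<longleftrightarrow> i < n" if "\<sigma> permutes {..<n}" for \<sigma> and i
    using permutes_in_image[OF that] by simp
  have mem: "r \<omega> \<circ> \<sigma> \<in> PiE {..<n} K \<longleftrightarrow> (\<forall>j<n. r \<omega> (\<sigma> j) \<in> K j)" if "\<omega> \<in> space M" "\<sigma> permutes {..<n}" for \<omega> \<sigma>
    using comp_perm_PiE[OF that] by (auto simp: PiE_iff)
  have Kiff: "(\<forall>i<n. x i \<in> ?K T i) \<longleftrightarrow> (\<forall>\<sigma>\<in>T. \<forall>j<n. x (\<sigma> j) \<in> K j)" if "T \<in> ?S" for x :: "nat \<Rightarrow> complex" and T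
  proof -
    have "(\<forall>i<n. x i \<in> K (inv_into UNIV \<sigma> i)) \<longleftrightarrow> (\<forall>j<n. x (\<sigma> j) \<in> K j)" if "\<sigma> permutes {..<n}" for \<sigma>
    proof
      assume l: "\<forall>i<n. x i \<in> K (inv_into UNIV \<sigma> i)"
      show "\<forall>j<n. x (\<sigma> j) \<in> K j"
      proof (intro allI impI)
        fix j assume "j < n"
        then have "x (\<sigma> j) \<in> K (inv_into UNIV \<sigma> (\<sigma> j))" using l perm_lt[OF that] by blast
        then show "x (\<sigma> j) \<in> K j" by (simp add: permutes_inverses(2)[OF that])
      qed
    next
      assume l: "\<forall>j<n. x (\<sigma> j) \<in> K j"
      show "\<forall>i<n. x i \<in> K (inv_into UNIV \<sigma> i)"
      proof (intro allI impI)
        fix i assume "i < n"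
        then have "inv_into UNIV \<sigma> i < n" using perm_lt[OF permutes_inv[OF that]] by blast
        then have "x (\<sigma> (inv_into UNIV \<sigma> i)) \<in> K (inv_into UNIV \<sigma> i)" using l by blast
        then show "x i \<in> K (inv_into UNIV \<sigma> i)" by (simp add: permutes_inverses(1)[OF that])
      qed
    qed
    then show ?thesis using that by blast
  qed
  have "{\<omega> \<in> space M. k \<le> perm_count (PiE {..<n} K) \<omega>} = (\<Union>T\<in>?S. ?E T)"
  proof (intro equalityI subsetI)
    fix \<omega> assume "\<omega> \<in> {\<omega> \<in> space M. k \<le> perm_count (PiE {..<n} K) \<omega>}"
    then have w: "\<omega> \<in> space M" "k \<le> card {\<sigma>. \<sigma> permutes {..<n} \<and> r \<omega> \<circ> \<sigma> \<in> PiE {..<n} K}"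
      by (auto simp: perm_count_def)
    obtain T where T: "T \<subseteq> {\<sigma>. \<sigma> permutes {..<n} \<and> r \<omega> \<circ> \<sigma> \<in> PiE {..<n} K}" "card T = k"
      using obtain_subset_with_card_n[OF w(2)] by metis
    then have TS: "T \<in> ?S" by auto
    have "\<forall>\<sigma>\<in>T. \<forall>j<n. r \<omega> (\<sigma> j) \<in> K j" using T(1) mem[OF w(1)] by blast
    then have "\<forall>i<n. r \<omega> i \<in> ?K T i" by (rule iffD2[OF Kiff[OF TS]])
    then have "\<omega> \<in> ?E T" using w(1) r[OF w(1)] by (intro CollectI conjI exI[of _ "r \<omega>"])
    then show "\<omega> \<in> (\<Union>T\<in>?S. ?E T)" using TS by blast
  next
    fix \<omega> assume "\<omega> \<in> (\<Union>T\<in>?S. ?E T)"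
    then obtain T where TS: "T \<in> ?S" and E: "\<omega> \<in> ?E T" by (rule UN_E)
    from E obtain x where Tx: "\<omega> \<in> space M" "\<forall>i<n. x i \<in> ?K T i" "p \<omega> = (\<Prod>i<n. [:- x i, 1:])"
      by (elim CollectE conjE exE) (rule that)
    note T = TS Tx
    have "\<forall>\<sigma>\<in>T. \<forall>j<n. x (\<sigma> j) \<in> K j" by (rule iffD1[OF Kiff[OF T(1)] T(3)])
    obtain \<tau> where \<tau>: "\<tau> permutes {..<n}" "\<And>i. i < n \<Longrightarrow> x i = r \<omega> (\<tau> i)"
      using root_vectors_permuted[where n = n and x = x and y = "r \<omega>"] r[OF T(2)] T(4) by metis
    have inj: "inj_on ((\<circ>) \<tau>) T"
    proof (rule inj_onI)
      fix \<sigma> \<sigma>' assume "\<tau> \<circ> \<sigma> = \<tau> \<circ> \<sigma>'"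
      then have "inv_into UNIV \<tau> \<circ> (\<tau> \<circ> \<sigma>) = inv_into UNIV \<tau> \<circ> (\<tau> \<circ> \<sigma>')" by simp
      then show "\<sigma> = \<sigma>'" unfolding comp_assoc[symmetric] permutes_inv_o[OF \<tau>(1)] by simp
    qed
    have sub: "(\<circ>) \<tau> ` T \<subseteq> {\<sigma>. \<sigma> permutes {..<n} \<and> r \<omega> \<circ> \<sigma> \<in> PiE {..<n} K}"
    proof
      fix \<rho> assume "\<rho> \<in> (\<circ>) \<tau> ` T"
      then obtain \<sigma> where s: "\<sigma> \<in> T" "\<rho> = \<tau> \<circ> \<sigma>" by blast
      then have sp: "\<sigma> permutes {..<n}" using T(1) by auto
      have *: "\<rho> permutes {..<n}" unfolding s(2) using sp \<tau>(1) by (rule permutes_compose)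
      have "\<forall>j<n. x (\<sigma> j) \<in> K j" using \<open>\<forall>\<sigma>\<in>T. \<forall>j<n. x (\<sigma> j) \<in> K j\<close> s(1) by blast
      then have "\<forall>j<n. r \<omega> (\<rho> j) \<in> K j" using \<tau>(2) perm_lt[OF sp] by (simp add: s(2))
      then show "\<rho> \<in> {\<sigma>. \<sigma> permutes {..<n} \<and> r \<omega> \<circ> \<sigma> \<in> PiE {..<n} K}"
        using mem[OF T(2) *] * by blast
    qed
    have "card ((\<circ>) \<tau> ` T) \<le> perm_count (PiE {..<n} K) \<omega>"
      unfolding perm_count_def by (rule card_mono[OF finite_perms sub])
    then have "k \<le> perm_count (PiE {..<n} K) \<omega>"
      using card_image[OF inj] T(1) by simp
    then show "\<omega> \<in> {\<omega> \<in> space M. k \<le> perm_count (PiE {..<n} K) \<omega>}" using T(2) by auto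
  qed
  also have "\<dots> \<in> sets M"
  proof (rule sets.finite_UN[OF fin])
    fix T assume T: "T \<in> ?S"
    have "closed (?K T i)" if "i < n" for i
    proof (rule closed_INT, rule ballI)
      fix \<sigma> assume "\<sigma> \<in> T"
      then have "\<sigma> permutes {..<n}" using T by auto
      then have "inv_into UNIV \<sigma> i < n" using perm_lt[OF permutes_inv] that by blast
      then show "closed (K (inv_into UNIV \<sigma> i))" by (rule K)
    qed
    then show "?E T \<in> sets M" by (rule sets_root_in_box)
  qed
  finally show ?thesis .
qed

definition closed_boxes :: "(nat \<Rightarrow> complex) set set" where
  "closed_boxes = {PiE {..<n} K | K. \<forall>i<n. closed (K i)}"

lemma sets_PiM_closed_boxes:
  "sets (PiM {..<n} (\<lambda>_. borel :: complex measure)) = sigma_sets ({..<n} \<rightarrow>\<^sub>E UNIV) closed_boxes"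
proof
  have sub: "closed_boxes \<subseteq> Pow ({..<n} \<rightarrow>\<^sub>E UNIV)" by (auto simp: closed_boxes_def)
  let ?N = "sigma ({..<n} \<rightarrow>\<^sub>E UNIV) closed_boxes"
  have sN: "space ?N = ({..<n} \<rightarrow>\<^sub>E UNIV)" using sub by (rule space_measure_of)
  have meas: "(\<lambda>x. x i) \<in> measurable ?N (sigma UNIV (Collect closed))" if "i < n" for i
  proof (rule measurable_measure_of)
    fix C :: "complex set" assume "C \<in> Collect closed"
    then have C: "closed C" by simp
    have "(\<lambda>x. x i) -` C \<inter> space ?N = PiE {..<n} (\<lambda>j. if j = i then C else UNIV)"
      unfolding sN
    proof (intro equalityI subsetI)
      fix x :: "nat \<Rightarrow> complex" assume "x \<in> (\<lambda>x. x i) -` C \<inter> ({..<n} \<rightarrow>\<^sub>E UNIV)"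
      then have "x i \<in> C" "x \<in> extensional {..<n}" by (simp_all add: PiE_iff)
      then show "x \<in> PiE {..<n} (\<lambda>j. if j = i then C else UNIV)" unfolding PiE_iff by simp
    next
      fix x :: "nat \<Rightarrow> complex" assume "x \<in> PiE {..<n} (\<lambda>j. if j = i then C else UNIV)"
      then have x: "\<forall>j\<in>{..<n}. x j \<in> (if j = i then C else UNIV)" "x \<in> extensional {..<n}" unfolding PiE_iff by blast+
      have "x i \<in> C" using bspec[OF x(1), of i] that by simp
      then show "x \<in> (\<lambda>x. x i) -` C \<inter> ({..<n} \<rightarrow>\<^sub>E UNIV)" using x(2) by (simp add: PiE_iff)
    qed
    moreover have "PiE {..<n} (\<lambda>j. if j = i then C else UNIV) \<in> closed_boxes"
      unfolding closed_boxes_def by (intro CollectI exI[of _ "\<lambda>j. if j = i then C else UNIV"] conjI refl) (simp add: C)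
    ultimately show "(\<lambda>x. x i) -` C \<inter> space ?N \<in> sets ?N"
      using sub by (simp add: sigma_sets.Basic)
  qed auto
  have "sets (PiM {..<n} (\<lambda>_. borel :: complex measure)) \<subseteq> sets ?N"
  proof (rule sets_PiM_in_sets)
    fix i and A :: "complex set" assume "i \<in> {..<n}" "A \<in> sets borel"
    then have "A \<in> sets (sigma UNIV (Collect closed))" by (simp add: borel_eq_closed[symmetric])
    then have "(\<lambda>x. x i) -` A \<inter> space ?N \<in> sets ?N" using measurable_sets[OF meas] \<open>i \<in> {..<n}\<close> by auto
    then show "{x \<in> space ?N. x i \<in> A} \<in> sets ?N" by (simp add: vimage_def Int_def conj_commute)
  qed (simp add: sN)
  then show "sets (PiM {..<n} (\<lambda>_. borel :: complex measure)) \<subseteq> sigma_sets ({..<n} \<rightarrow>\<^sub>E UNIV) closed_boxes"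
    using sub by simp
  have cb: "closed_boxes \<subseteq> sets (PiM {..<n} (\<lambda>_. borel :: complex measure))"
  proof
    fix A assume "A \<in> closed_boxes"
    then obtain K where "A = PiE {..<n} K" "\<forall>i<n. closed (K i)" unfolding closed_boxes_def by blast
    then show "A \<in> sets (PiM {..<n} (\<lambda>_. borel :: complex measure))"
      by (simp add: sets_PiM_I_finite borel_closed)
  qed
  have sp: "space (PiM {..<n} (\<lambda>_. borel :: complex measure)) = {..<n} \<rightarrow>\<^sub>E UNIV" by (simp add: space_PiM)
  show "sigma_sets ({..<n} \<rightarrow>\<^sub>E UNIV) closed_boxes \<subseteq> sets (PiM {..<n} (\<lambda>_. borel :: complex measure))"
    using sets.sigma_sets_subset[OF cb] unfolding sp .
qed

lemma measurable_perm_count: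
  assumes "A \<in> sets (PiM {..<n} (\<lambda>_. borel :: complex measure))"
  shows "(\<lambda>\<omega>. real (perm_count A \<omega>)) \<in> borel_measurable M"
proof -
  have Int: "Int_stable closed_boxes"
  proof (rule Int_stableI)
    fix a b assume "a \<in> closed_boxes" "b \<in> closed_boxes"
    then obtain K L where KL: "a = PiE {..<n} K" "b = PiE {..<n} L" "\<forall>i<n. closed (K i)" "\<forall>i<n. closed (L i)"
      by (auto simp: closed_boxes_def)
    then have "a \<inter> b = PiE {..<n} (\<lambda>i. K i \<inter> L i)" by (simp add: PiE_Int)
    then show "a \<inter> b \<in> closed_boxes" unfolding closed_boxes_def using KL by (auto intro!: exI[of _ "\<lambda>i. K i \<inter> L i"])
  qed
  have Pow: "closed_boxes \<subseteq> Pow ({..<n} \<rightarrow>\<^sub>E UNIV)" by (auto simp: closed_boxes_def)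
  show ?thesis
  using assms unfolding sets_PiM_closed_boxes
proof (induction rule: sigma_sets_induct_disjoint[OF Int Pow, consumes 1, case_names basic empty compl union])
  case (basic A)
  then obtain K where K: "A = PiE {..<n} K" "\<And>i. i < n \<Longrightarrow> closed (K i)" by (auto simp: closed_boxes_def)
  show ?case unfolding borel_measurable_iff_ge
  proof
    fix a :: real
    have "{\<omega> \<in> space M. a \<le> real (perm_count A \<omega>)} = {\<omega> \<in> space M. nat \<lceil>a\<rceil> \<le> perm_count A \<omega>}"
      by (auto simp: nat_le_iff ceiling_le_iff)
    also have "\<dots> \<in> sets M" unfolding K(1) by (rule sets_perm_count_box[OF K(2)])
    finally show "{\<omega> \<in> space M. a \<le> real (perm_count A \<omega>)} \<in> sets M" .
  qed
next
  case empty
  show ?case by (simp add: perm_count_def)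
next
  case (compl A)
  have eq: "real (perm_count (({..<n} \<rightarrow>\<^sub>E UNIV) - A) \<omega>) = fact n - real (perm_count A \<omega>)" if "\<omega> \<in> space M" for \<omega>
  proof -
    have "{\<sigma>. \<sigma> permutes {..<n} \<and> r \<omega> \<circ> \<sigma> \<in> ({..<n} \<rightarrow>\<^sub>E UNIV) - A} = {\<sigma>. \<sigma> permutes {..<n}} - {\<sigma>. \<sigma> permutes {..<n} \<and> r \<omega> \<circ> \<sigma> \<in> A}"
      using comp_perm_PiE[OF that] by auto
    then have "perm_count (({..<n} \<rightarrow>\<^sub>E UNIV) - A) \<omega> = card {\<sigma>. \<sigma> permutes {..<n}} - perm_count A \<omega>"
      unfolding perm_count_def by (simp only:) (rule card_Diff_subset[OF finite_perms], auto)
    moreover have "perm_count A \<omega> \<le> card {\<sigma>. \<sigma> permutes {..<n}}"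
      unfolding perm_count_def by (rule card_mono) (auto simp: finite_permutations)
    moreover have "card {\<sigma>. \<sigma> permutes {..<n}} = fact n"
      by (rule card_permutations) auto
    ultimately show ?thesis by (simp add: of_nat_diff)
  qed
  show ?case
    by (rule iffD2[OF measurable_cong[OF eq]]) (assumption, rule borel_measurable_diff[OF borel_measurable_const compl(2)])
next
  case (union F)
  have eq: "real (perm_count (\<Union>i. F i) \<omega>) = (\<Sum>i. real (perm_count (F i) \<omega>))" for \<omega>
  proof -
    let ?P = "{\<sigma>. \<sigma> permutes {..<n}}"
    have c: "real (perm_count B \<omega>) = (\<Sum>\<sigma>\<in>?P. indicator B (r \<omega> \<circ> \<sigma>))" for B
    proof -
      have fin: "finite ?P" by (rule finite_permutations) simp
      have "real (perm_count B \<omega>) = (\<Sum>\<sigma>\<in>{\<sigma> \<in> ?P. r \<omega> \<circ> \<sigma> \<in> B}. 1)"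
        unfolding perm_count_def real_of_card by (simp only: mem_Collect_eq)
      also have "\<dots> = (\<Sum>\<sigma>\<in>?P. if r \<omega> \<circ> \<sigma> \<in> B then 1 else 0)"
        by (rule sum.inter_filter[OF fin])
      finally show ?thesis unfolding indicator_def of_bool_def .
    qed
    have "(\<lambda>i. \<Sum>\<sigma>\<in>?P. indicator (F i) (r \<omega> \<circ> \<sigma>) :: real) sums (\<Sum>\<sigma>\<in>?P. indicator (\<Union>i. F i) (r \<omega> \<circ> \<sigma>))"
    proof (rule sums_sum)
      fix \<sigma>
      show "(\<lambda>i. indicator (F i) (r \<omega> \<circ> \<sigma>) :: real) sums indicator (\<Union>i. F i) (r \<omega> \<circ> \<sigma>)"
        by (rule indicator_sums) (use union(1) in \<open>blast dest: disjoint_family_onD\<close>)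
    qed
    then show ?thesis unfolding c by (rule sums_unique)
  qed
  have "(\<lambda>\<omega>. \<Sum>i. real (perm_count (F i) \<omega>)) \<in> borel_measurable M"
    by (rule borel_measurable_suminf) (rule union(3))
  then show ?case unfolding eq .
qed
qed

text \<open>For symmetric \<open>f\<close> either all reorderings or none lie in a preimage, so \<open>perm_count\<close> detects membership although the chosen ordering of the roots need not be measurable.\<close>

lemma measurable_symmetric_of_roots:
  assumes f: "f \<in> measurable (PiM {..<n} (\<lambda>_. borel :: complex measure)) N"
    and sym: "\<And>\<sigma> z. \<sigma> permutes {..<n} \<Longrightarrow> z \<in> {..<n} \<rightarrow>\<^sub>E UNIV \<Longrightarrow> f (z \<circ> \<sigma>) = f z"
  shows "(\<lambda>\<omega>. f (r \<omega>)) \<in> measurable M N"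
proof (rule measurableI)
  fix \<omega> assume "\<omega> \<in> space M"
  then show "f (r \<omega>) \<in> space N" using measurable_space[OF f, of "r \<omega>"] ext by (simp add: space_PiM)
next
  fix B assume B: "B \<in> sets N"
  define A where "A = f -` B \<inter> ({..<n} \<rightarrow>\<^sub>E UNIV)"
  have A: "A \<in> sets (PiM {..<n} (\<lambda>_. borel :: complex measure))"
    using measurable_sets[OF f B] by (simp add: A_def space_PiM)
  have pc: "perm_count A \<omega> = (if f (r \<omega>) \<in> B then fact n else 0)" if w: "\<omega> \<in> space M" for \<omega>
  proof -
    have iff: "r \<omega> \<circ> \<sigma> \<in> A \<longleftrightarrow> f (r \<omega>) \<in> B" if "\<sigma> permutes {..<n}" for \<sigma>
    proof -
      have "r \<omega> \<circ> \<sigma> \<in> A \<longleftrightarrow> f (r \<omega> \<circ> \<sigma>) \<in> B" unfolding A_def using comp_perm_PiE[OF w that] by blast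
      then show ?thesis unfolding sym[OF that ext[OF w]] .
    qed
    have c: "card {\<sigma>. \<sigma> permutes {..<n}} = fact n" by (rule card_permutations) auto
    show ?thesis
    proof (cases "f (r \<omega>) \<in> B")
      case True
      then have "{\<sigma>. \<sigma> permutes {..<n} \<and> r \<omega> \<circ> \<sigma> \<in> A} = {\<sigma>. \<sigma> permutes {..<n}}"
        using iff by (intro Collect_cong) blast
      then show ?thesis unfolding perm_count_def using True by (simp only: c if_True)
    next
      case False
      then have "\<not> (\<sigma> permutes {..<n} \<and> r \<omega> \<circ> \<sigma> \<in> A)" for \<sigma> using iff[of \<sigma>] by argo
      then have e: "{\<sigma>. \<sigma> permutes {..<n} \<and> r \<omega> \<circ> \<sigma> \<in> A} = {}" by (intro Collect_empty_eq[THEN iffD2] allI)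
      show ?thesis unfolding perm_count_def e using False by (simp only: card.empty if_False)
    qed
  qed
  have "(\<lambda>\<omega>. f (r \<omega>)) -` B \<inter> space M = {\<omega> \<in> space M. 0 < real (perm_count A \<omega>)}"
  proof (intro equalityI subsetI)
    fix \<omega> assume "\<omega> \<in> (\<lambda>\<omega>. f (r \<omega>)) -` B \<inter> space M"
    then show "\<omega> \<in> {\<omega> \<in> space M. 0 < real (perm_count A \<omega>)}" using pc[of \<omega>] by simp
  next
    fix \<omega> assume "\<omega> \<in> {\<omega> \<in> space M. 0 < real (perm_count A \<omega>)}"
    then show "\<omega> \<in> (\<lambda>\<omega>. f (r \<omega>)) -` B \<inter> space M" using pc[of \<omega>] by (cases "f (r \<omega>) \<in> B") simp_all
  qed
  also have "\<dots> \<in> sets M"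
    using measurable_perm_count[OF A] unfolding borel_measurable_iff_greater by blast
  finally show "(\<lambda>\<omega>. f (r \<omega>)) -` B \<inter> space M \<in> sets M" .
qed

end

end

section \<open>Lebesgue measure under one Szego step\<close>

lemma lborel_complex_eq: "(lborel :: complex measure) = distr (lborel \<Otimes>\<^sub>M lborel) borel (\<lambda>(x, y). Complex x y)"
proof (rule lborel_eqI)
  have [measurable]: "(\<lambda>(x, y). Complex x y) \<in> borel_measurable (lborel \<Otimes>\<^sub>M lborel)"
    unfolding Complex_eq by measurable
  fix l u :: complex assume le: "\<And>b. b \<in> Basis \<Longrightarrow> l \<bullet> b \<le> u \<bullet> b"
  have le: "Re l \<le> Re u" "Im l \<le> Im u"
    using le[of 1] le[of \<i>] by (auto simp: Basis_complex_def)
  have "(\<lambda>(x, y). Complex x y) -` box l u \<inter> space (lborel \<Otimes>\<^sub>M lborel) = box (Re l) (Re u) \<times> box (Im l) (Im u)"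
    by (auto simp: in_box_complex_iff space_pair_measure)
  then have "emeasure (distr (lborel \<Otimes>\<^sub>M lborel) borel (\<lambda>(x, y). Complex x y)) (box l u)
      = emeasure (lborel \<Otimes>\<^sub>M lborel) (box (Re l) (Re u) \<times> box (Im l) (Im u))"
    by (subst emeasure_distr) auto
  also have "\<dots> = emeasure lborel (box (Re l) (Re u)) * emeasure lborel (box (Im l) (Im u))"
    by (rule lborel.emeasure_pair_measure_Times) auto
  also have "\<dots> = ennreal (\<Prod>b\<in>Basis. (u - l) \<bullet> b)"
    using le by (simp add: Basis_complex_def ennreal_mult' )
  finally show "emeasure (distr (lborel \<Otimes>\<^sub>M lborel) borel (\<lambda>(x, y). Complex x y)) (box l u) = (\<Prod>b\<in>Basis. (u - l) \<bullet> b)" .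
qed simp

lemma measurable_Complex [measurable (raw)]:
  assumes "f \<in> borel_measurable M" "g \<in> borel_measurable M"
  shows "(\<lambda>x. Complex (f x) (g x)) \<in> borel_measurable M"
  using assms unfolding Complex_eq by measurable

lemma measurable_cnj [measurable]: "cnj \<in> borel_measurable borel"
  by (intro borel_measurable_continuous_onI continuous_intros)

lemma nn_integral_complex:
  assumes [measurable]: "H \<in> borel_measurable borel"
  shows "(\<integral>\<^sup>+ z. H z \<partial>(lborel :: complex measure)) = (\<integral>\<^sup>+ x. \<integral>\<^sup>+ y. H (Complex x y) \<partial>lborel \<partial>lborel)"
proof -
  have "(\<integral>\<^sup>+ z. H z \<partial>(lborel :: complex measure)) = (\<integral>\<^sup>+ p. H (case p of (x, y) \<Rightarrow> Complex x y) \<partial>(lborel \<Otimes>\<^sub>M lborel))"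
    by (subst lborel_complex_eq, subst nn_integral_distr) (auto simp: case_prod_unfold)
  also have "\<dots> = (\<integral>\<^sup>+ x. \<integral>\<^sup>+ y. H (Complex x y) \<partial>lborel \<partial>lborel)"
    by (subst lborel.nn_integral_fst[symmetric]) auto
  finally show ?thesis .
qed

lemma nn_integral_linear_plane:
  fixes a b c d :: real
  assumes [measurable]: "(\<lambda>(x, y). H x y) \<in> borel_measurable (borel \<Otimes>\<^sub>M borel)" and det: "a * d - b * c \<noteq> 0"
  shows "ennreal \<bar>a * d - b * c\<bar> * (\<integral>\<^sup>+ x. \<integral>\<^sup>+ y. H (a * x + b * y) (c * x + d * y) \<partial>lborel \<partial>lborel)
       = (\<integral>\<^sup>+ x. \<integral>\<^sup>+ y. H x y \<partial>lborel \<partial>lborel)"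
proof (cases "a = 0")
  case False
  define e where "e = (a * d - b * c) / a"
  have e: "e \<noteq> 0" using det False by (simp add: e_def)
  have "(\<integral>\<^sup>+ x. \<integral>\<^sup>+ y. H x y \<partial>lborel \<partial>lborel) = (\<integral>\<^sup>+ x. ennreal \<bar>e\<bar> * (\<integral>\<^sup>+ y. H x (c * x / a + e * y) \<partial>lborel) \<partial>lborel)"
    using e by (intro nn_integral_cong nn_integral_real_affine) auto
  also have "\<dots> = ennreal \<bar>e\<bar> * (\<integral>\<^sup>+ x. \<integral>\<^sup>+ y. H x (c * x / a + e * y) \<partial>lborel \<partial>lborel)"
    by (rule nn_integral_cmult) measurable
  also have "(\<integral>\<^sup>+ x. \<integral>\<^sup>+ y. H x (c * x / a + e * y) \<partial>lborel \<partial>lborel) = (\<integral>\<^sup>+ y. \<integral>\<^sup>+ x. H x (c * x / a + e * y) \<partial>lborel \<partial>lborel)"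
    by (rule lborel_pair.Fubini') measurable
  also have "\<dots> = (\<integral>\<^sup>+ y. ennreal \<bar>a\<bar> * (\<integral>\<^sup>+ x. H (b * y + a * x) (c * (b * y + a * x) / a + e * y) \<partial>lborel) \<partial>lborel)"
    using False by (intro nn_integral_cong nn_integral_real_affine) auto
  also have "\<dots> = (\<integral>\<^sup>+ y. ennreal \<bar>a\<bar> * (\<integral>\<^sup>+ x. H (a * x + b * y) (c * x + d * y) \<partial>lborel) \<partial>lborel)"
  proof -
    have "c * (b * y + a * x) / a + e * y = c * x + d * y" for x y
      using False by (simp add: e_def field_simps)
    then show ?thesis by (simp add: add.commute)
  qed
  also have "\<dots> = ennreal \<bar>a\<bar> * (\<integral>\<^sup>+ y. \<integral>\<^sup>+ x. H (a * x + b * y) (c * x + d * y) \<partial>lborel \<partial>lborel)"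
    by (rule nn_integral_cmult) measurable
  also have "(\<integral>\<^sup>+ y. \<integral>\<^sup>+ x. H (a * x + b * y) (c * x + d * y) \<partial>lborel \<partial>lborel) = (\<integral>\<^sup>+ x. \<integral>\<^sup>+ y. H (a * x + b * y) (c * x + d * y) \<partial>lborel \<partial>lborel)"
    by (rule lborel_pair.Fubini') measurable
  moreover have "ennreal \<bar>e\<bar> * ennreal \<bar>a\<bar> = ennreal \<bar>a * d - b * c\<bar>"
  proof -
    have "e * a = a * d - b * c" using False by (simp add: e_def)
    then show ?thesis by (metis abs_mult abs_ge_zero ennreal_mult)
  qed
  ultimately show ?thesis by (simp only: mult.assoc[symmetric])
next
  case True
  then have bc: "b \<noteq> 0" "c \<noteq> 0" using det by auto
  have "(\<integral>\<^sup>+ x. \<integral>\<^sup>+ y. H x y \<partial>lborel \<partial>lborel) = ennreal \<bar>b\<bar> * (\<integral>\<^sup>+ x. \<integral>\<^sup>+ y. H (b * x) y \<partial>lborel \<partial>lborel)"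
    using bc(1) by (subst nn_integral_real_affine[where c = b and t = 0]) auto
  also have "(\<integral>\<^sup>+ x. \<integral>\<^sup>+ y. H (b * x) y \<partial>lborel \<partial>lborel) = (\<integral>\<^sup>+ x. ennreal \<bar>c\<bar> * (\<integral>\<^sup>+ y. H (b * x) (d * x + c * y) \<partial>lborel) \<partial>lborel)"
    using bc(2) by (intro nn_integral_cong nn_integral_real_affine) auto
  also have "\<dots> = ennreal \<bar>c\<bar> * (\<integral>\<^sup>+ x. \<integral>\<^sup>+ y. H (b * x) (d * x + c * y) \<partial>lborel \<partial>lborel)"
    by (rule nn_integral_cmult) measurable
  also have "(\<integral>\<^sup>+ x. \<integral>\<^sup>+ y. H (b * x) (d * x + c * y) \<partial>lborel \<partial>lborel) = (\<integral>\<^sup>+ y. \<integral>\<^sup>+ x. H (b * x) (d * x + c * y) \<partial>lborel \<partial>lborel)"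
    by (rule lborel_pair.Fubini') measurable
  finally show ?thesis
    using True by (simp add: mult.assoc[symmetric] ennreal_mult[symmetric] abs_mult[symmetric] add.commute)
qed

lemma nn_integral_complex_linear:
  assumes [measurable]: "H \<in> borel_measurable borel" and det: "(cmod p)\<^sup>2 \<noteq> (cmod q)\<^sup>2"
  shows "ennreal \<bar>(cmod p)\<^sup>2 - (cmod q)\<^sup>2\<bar> * (\<integral>\<^sup>+ z. H (p * z + q * cnj z) \<partial>lborel) = (\<integral>\<^sup>+ z. H z \<partial>lborel)"
proof -
  let ?a = "Re p + Re q" and ?b = "Im q - Im p" and ?c = "Im p + Im q" and ?d = "Re p - Re q"
  have e: "?a * ?d - ?b * ?c = (cmod p)\<^sup>2 - (cmod q)\<^sup>2"
    unfolding cmod_power2 by (simp add: power2_eq_square algebra_simps)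
  have z: "p * Complex x y + q * cnj (Complex x y) = Complex (?a * x + ?b * y) (?c * x + ?d * y)" for x y
    by (simp add: complex_eq_iff algebra_simps)
  have "ennreal \<bar>?a * ?d - ?b * ?c\<bar> * (\<integral>\<^sup>+ x. \<integral>\<^sup>+ y. H (Complex (?a * x + ?b * y) (?c * x + ?d * y)) \<partial>lborel \<partial>lborel)
       = (\<integral>\<^sup>+ x. \<integral>\<^sup>+ y. H (Complex x y) \<partial>lborel \<partial>lborel)"
    by (rule nn_integral_linear_plane) (use det e in \<open>simp_all\<close>)
  then show ?thesis
    unfolding e by (simp add: nn_integral_complex z)
qed

lemma nn_integral_complex_translate:
  assumes [measurable]: "H \<in> borel_measurable borel"
  shows "(\<integral>\<^sup>+ z. H (z + t) \<partial>lborel) = (\<integral>\<^sup>+ z. H z \<partial>(lborel :: complex measure))"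
proof -
  have "(\<integral>\<^sup>+ z. H z \<partial>(lborel :: complex measure)) = (\<integral>\<^sup>+ z. H z \<partial>(distr lborel borel ((+) t)))"
    by (simp add: lborel_distr_plus)
  then show ?thesis by (simp add: nn_integral_distr add.commute)
qed

lemma nn_integral_reflect_single:
  assumes [measurable]: "H \<in> borel_measurable borel" and g: "cmod g < 1"
  shows "ennreal (1 - (cmod g)\<^sup>2) * (\<integral>\<^sup>+ z. H (z + g * cnj z) \<partial>lborel) = (\<integral>\<^sup>+ z. H z \<partial>lborel)"
  using nn_integral_complex_linear[of H 1 g] one_minus_cmod_sq[OF g] by simp

text \<open>Translating \<open>x\<close> by \<open>g * cnj y\<close> leaves \<open>y\<close> multiplied by \<open>1 - \<bar>g\<bar>\<^sup>2\<close>, up to a translation. Scaling a complex coordinate contributes the square of the factor.\<close>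

lemma nn_integral_reflect_pair:
  assumes [measurable]: "(\<lambda>(x, y). H x y) \<in> borel_measurable (borel \<Otimes>\<^sub>M borel)" and g: "cmod g < 1"
  shows "ennreal ((1 - (cmod g)\<^sup>2)\<^sup>2) * (\<integral>\<^sup>+ x. \<integral>\<^sup>+ y. H (x + g * cnj y) (y + g * cnj x) \<partial>lborel \<partial>lborel)
    = (\<integral>\<^sup>+ x. \<integral>\<^sup>+ y. H x y \<partial>lborel \<partial>lborel)"
proof -
  let ?r = "1 - (cmod g)\<^sup>2"
  have r: "?r > 0" by (rule one_minus_cmod_sq[OF g])
  have cr: "complex_of_real ?r = 1 - g * cnj g" using cnj_mult_self[of g] by simp
  have "(\<integral>\<^sup>+ x. \<integral>\<^sup>+ y. H (x + g * cnj y) (y + g * cnj x) \<partial>lborel \<partial>lborel)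
      = (\<integral>\<^sup>+ y. \<integral>\<^sup>+ x. H (x + g * cnj y) (y + g * cnj x) \<partial>lborel \<partial>lborel)"
    by (rule lborel_pair.Fubini') measurable
  also have "\<dots> = (\<integral>\<^sup>+ y. \<integral>\<^sup>+ x. H x (of_real ?r * y + g * cnj x) \<partial>lborel \<partial>lborel)"
  proof (rule nn_integral_cong)
    fix y :: complex
    have "(\<integral>\<^sup>+ x. H (x + g * cnj y) (of_real ?r * y + g * cnj (x + g * cnj y)) \<partial>lborel) = (\<integral>\<^sup>+ x. H x (of_real ?r * y + g * cnj x) \<partial>lborel)"
      by (rule nn_integral_complex_translate[of "\<lambda>x. H x (of_real ?r * y + g * cnj x)"]) measurable
    moreover have "of_real ?r * y + g * cnj (x + g * cnj y) = y + g * cnj x" for x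
      unfolding cr by (simp add: algebra_simps)
    ultimately show "(\<integral>\<^sup>+ x. H (x + g * cnj y) (y + g * cnj x) \<partial>lborel) = (\<integral>\<^sup>+ x. H x (of_real ?r * y + g * cnj x) \<partial>lborel)"
      by simp
  qed
  also have "\<dots> = (\<integral>\<^sup>+ x. \<integral>\<^sup>+ y. H x (of_real ?r * y + g * cnj x) \<partial>lborel \<partial>lborel)"
    by (rule lborel_pair.Fubini') measurable
  finally have 1: "(\<integral>\<^sup>+ x. \<integral>\<^sup>+ y. H (x + g * cnj y) (y + g * cnj x) \<partial>lborel \<partial>lborel)
     = (\<integral>\<^sup>+ x. \<integral>\<^sup>+ y. H x (of_real ?r * y + g * cnj x) \<partial>lborel \<partial>lborel)" .
  have 2: "ennreal (?r\<^sup>2) * (\<integral>\<^sup>+ y. H x (of_real ?r * y + g * cnj x) \<partial>lborel) = (\<integral>\<^sup>+ y. H x y \<partial>lborel)" for x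
  proof -
    have "(cmod (of_real ?r))\<^sup>2 = ?r\<^sup>2" by (simp only: norm_of_real power2_abs)
    then have "ennreal (?r\<^sup>2) * (\<integral>\<^sup>+ y. H x (of_real ?r * y + g * cnj x) \<partial>lborel) = (\<integral>\<^sup>+ y. H x (y + g * cnj x) \<partial>lborel)"
      using nn_integral_complex_linear[of "\<lambda>y. H x (y + g * cnj x)" "of_real ?r" 0] r
      by (simp del: of_real_diff of_real_power)
    also have "\<dots> = (\<integral>\<^sup>+ y. H x y \<partial>lborel)"
      by (rule nn_integral_complex_translate) measurable
    finally show ?thesis .
  qed
  show ?thesis unfolding 1 2[symmetric]
    by (rule nn_integral_cmult[symmetric]) measurable
qed

interpretation lborel_prod: product_sigma_finite "\<lambda>_::nat. lborel :: complex measure" ..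

definition reflect :: "(nat \<Rightarrow> nat) \<Rightarrow> complex \<Rightarrow> nat set \<Rightarrow> (nat \<Rightarrow> complex) \<Rightarrow> nat \<Rightarrow> complex" where
  "reflect \<sigma> g I s = (\<lambda>j\<in>I. s j + g * cnj (s (\<sigma> j)))"

lemma measurable_reflect:
  assumes "\<sigma> ` I \<subseteq> I"
  shows "reflect \<sigma> g I \<in> measurable (PiM I (\<lambda>_. lborel)) (PiM I (\<lambda>_. lborel))"
  unfolding reflect_def
proof (rule measurable_restrict)
  fix k assume k: "k \<in> I"
  then have "\<sigma> k \<in> I" using assms by auto
  then show "(\<lambda>s. s k + g * cnj (s (\<sigma> k))) \<in> measurable (PiM I (\<lambda>_. lborel)) lborel"
    using k by measurable
qed

lemma nn_integral_PiM_pair: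
  fixes f :: "complex \<Rightarrow> complex \<Rightarrow> ennreal" and i j :: nat
  assumes f: "(\<lambda>(x, y). f x y) \<in> borel_measurable (borel \<Otimes>\<^sub>M borel)" and "i \<noteq> j"
  shows "(\<integral>\<^sup>+ s. f (s i) (s j) \<partial>PiM {i, j} (\<lambda>_. lborel)) = (\<integral>\<^sup>+ x. \<integral>\<^sup>+ y. f x y \<partial>lborel \<partial>lborel)"
proof -
  have f': "(\<lambda>(x, y). f x y) \<in> borel_measurable (lborel \<Otimes>\<^sub>M lborel)"
    using f by (simp cong: measurable_cong_sets)
  have "(\<integral>\<^sup>+ s. f (s i) (s j) \<partial>PiM {i, j} (\<lambda>_. lborel)) = (\<integral>\<^sup>+ z. f (fst z) (snd z) \<partial>(lborel \<Otimes>\<^sub>M lborel))"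
    by (rule lborel_prod.product_nn_integral_pair) (use f' assms(2) in auto)
  also have "\<dots> = (\<integral>\<^sup>+ x. \<integral>\<^sup>+ y. f x y \<partial>lborel \<partial>lborel)"
    using lborel.nn_integral_fst[OF f'] by (simp add: case_prod_unfold)
  finally show ?thesis .
qed

lemma nn_integral_reflect_orbit:
  assumes "\<sigma> i = j" "\<sigma> j = i" and g: "cmod g < 1"
    and H [measurable]: "H \<in> borel_measurable (PiM {i, j} (\<lambda>_. lborel))"
  shows "ennreal ((1 - (cmod g)\<^sup>2) ^ card {i, j}) * (\<integral>\<^sup>+ s. H (reflect \<sigma> g {i, j} s) \<partial>PiM {i, j} (\<lambda>_. lborel))
    = (\<integral>\<^sup>+ s. H s \<partial>PiM {i, j} (\<lambda>_. lborel))"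
proof (cases "i = j")
  case True
  define f where "f y = H (\<lambda>k\<in>{i}. y)" for y
  have [measurable]: "H \<in> borel_measurable (PiM {i} (\<lambda>_. lborel))" using H True by simp
  have [measurable]: "f \<in> borel_measurable borel" unfolding f_def by measurable
  have 1: "(\<integral>\<^sup>+ s. H s \<partial>PiM {i} (\<lambda>_. lborel)) = (\<integral>\<^sup>+ s. f (s i) \<partial>PiM {i} (\<lambda>_. lborel))"
    by (intro nn_integral_cong arg_cong[where f = H]) (auto simp: f_def space_PiM PiE_iff extensional_def fun_eq_iff intro!: arg_cong[where f = H])
  have 2: "(\<integral>\<^sup>+ s. H (reflect \<sigma> g {i} s) \<partial>PiM {i} (\<lambda>_. lborel)) = (\<integral>\<^sup>+ s. f (s i + g * cnj (s i)) \<partial>PiM {i} (\<lambda>_. lborel))"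
    using assms True by (intro nn_integral_cong) (auto simp: f_def reflect_def fun_eq_iff intro!: arg_cong[where f = H])
  have e: "{i, j} = {i}" using True by simp
  show ?thesis
    unfolding e 1 2
    using nn_integral_reflect_single[of f g] g
      lborel_prod.product_nn_integral_singleton[of f i] lborel_prod.product_nn_integral_singleton[of "\<lambda>x. f (x + g * cnj x)" i]
    by simp
next
  case False
  define f where "f x y = H (\<lambda>k\<in>{i, j}. if k = i then x else y)" for x y
  have [measurable]: "(\<lambda>(x, y). f x y) \<in> borel_measurable (borel \<Otimes>\<^sub>M borel)"
    unfolding f_def case_prod_unfold
    by (rule measurable_compose[OF measurable_restrict H]) (auto split: if_splits)
  have 1: "(\<integral>\<^sup>+ s. H s \<partial>PiM {i, j} (\<lambda>_. lborel)) = (\<integral>\<^sup>+ s. f (s i) (s j) \<partial>PiM {i, j} (\<lambda>_. lborel))"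
    using False by (intro nn_integral_cong) (auto simp: f_def space_PiM PiE_iff extensional_def fun_eq_iff intro!: arg_cong[where f = H])
  have 2: "(\<integral>\<^sup>+ s. H (reflect \<sigma> g {i, j} s) \<partial>PiM {i, j} (\<lambda>_. lborel)) = (\<integral>\<^sup>+ s. f (s i + g * cnj (s j)) (s j + g * cnj (s i)) \<partial>PiM {i, j} (\<lambda>_. lborel))"
    using assms False by (intro nn_integral_cong) (auto simp: f_def reflect_def fun_eq_iff intro!: arg_cong[where f = H])
  have c: "card {i, j} = 2" using False by simp
  have m: "(\<lambda>(x, y). f (x + g * cnj y) (y + g * cnj x)) \<in> borel_measurable (borel \<Otimes>\<^sub>M borel)"
    by measurable
  show ?thesis
    unfolding c 1 2 nn_integral_PiM_pair[OF m False] nn_integral_PiM_pair[OF \<open>(\<lambda>(x, y). f x y) \<in> _\<close> False]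
    by (rule nn_integral_reflect_pair[OF \<open>(\<lambda>(x, y). f x y) \<in> _\<close> g])
qed

text \<open>Induction over the orbits of the involution.\<close>

lemma nn_integral_reflect:
  assumes "finite I" "\<sigma> ` I \<subseteq> I" "\<And>j. j \<in> I \<Longrightarrow> \<sigma> (\<sigma> j) = j" and g: "cmod g < 1"
    and "H \<in> borel_measurable (PiM I (\<lambda>_. lborel))"
  shows "ennreal ((1 - (cmod g)\<^sup>2) ^ card I) * (\<integral>\<^sup>+ s. H (reflect \<sigma> g I s) \<partial>PiM I (\<lambda>_. lborel))
    = (\<integral>\<^sup>+ s. H s \<partial>PiM I (\<lambda>_. lborel))"
  using assms(1-3,5)
proof (induction "card I" arbitrary: I H rule: less_induct)
  case less
  let ?r = "1 - (cmod g)\<^sup>2"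
  let ?L = "\<lambda>_::nat. lborel :: complex measure"
  have r: "?r > 0" by (rule one_minus_cmod_sq[OF g])
  note [measurable] = less.prems(4)
  show ?case
  proof (cases "I = {}")
    case True
    have "reflect \<sigma> g I s = s" if "s \<in> space (PiM I ?L)" for s
      using that True by (auto simp: reflect_def space_PiM)
    then have "(\<integral>\<^sup>+ s. H (reflect \<sigma> g I s) \<partial>PiM I ?L) = (\<integral>\<^sup>+ s. H s \<partial>PiM I ?L)"
      by (intro nn_integral_cong) simp
    then show ?thesis using True by simp
  next
    case False
    then obtain i where i: "i \<in> I" by auto
    define j where "j = \<sigma> i"
    define B where "B = {i, j}"
    define J where "J = I - B"
    have j: "j \<in> I" "\<sigma> j = i" using less.prems i by (auto simp: j_def)
    have J: "finite J" "J \<inter> B = {}" "I = J \<union> B" "finite B" using less.prems(1) i j by (auto simp: J_def B_def)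
    have \<sigma>J: "\<sigma> ` J \<subseteq> J"
    proof
      fix x assume "x \<in> \<sigma> ` J"
      then obtain k where k: "k \<in> I" "k \<noteq> i" "k \<noteq> j" "x = \<sigma> k" by (auto simp: J_def B_def)
      have "x \<in> I" using k less.prems(2) by auto
      moreover have "\<sigma> x = k" using less.prems(3) k by simp
      then have "x \<noteq> i" "x \<noteq> j" using k j by (auto simp: j_def)
      ultimately show "x \<in> J" by (simp add: J_def B_def)
    qed
    have \<sigma>B: "\<sigma> ` B \<subseteq> B" using j by (auto simp: B_def j_def)
    note [measurable] = measurable_reflect[OF \<sigma>J, of g] measurable_reflect[OF \<sigma>B, of g] measurable_reflect[OF less.prems(2), of g]
    have H [measurable]: "H \<in> borel_measurable (PiM (J \<union> B) ?L)" unfolding J(3)[symmetric] by (rule less.prems(4))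
    interpret B: sigma_finite_measure "PiM B ?L" by (rule lborel_prod.sigma_finite[OF J(4)])
    define H' where "H' x = (\<integral>\<^sup>+ y. H (merge J B (x, y)) \<partial>PiM B ?L)" for x
    have H' [measurable]: "H' \<in> borel_measurable (PiM J ?L)" unfolding H'_def by measurable
    have m: "reflect \<sigma> g I (merge J B (x, y)) = merge J B (reflect \<sigma> g J x, reflect \<sigma> g B y)" for x y
    proof
      fix k
      consider "k \<in> J" "\<sigma> k \<in> J" "k \<notin> B" | "k \<in> B" "\<sigma> k \<in> B" "k \<notin> J" "\<sigma> k \<notin> J" | "k \<notin> J" "k \<notin> B"
        using \<sigma>J \<sigma>B J(2) by blast
      then show "reflect \<sigma> g I (merge J B (x, y)) k = merge J B (reflect \<sigma> g J x, reflect \<sigma> g B y) k"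
      proof cases
        case 1 then have "k \<in> I" using J(3) by blast
        then show ?thesis using 1 by (simp add: reflect_def merge_def)
      next
        case 2 then have "k \<in> I" using J(3) by blast
        then show ?thesis using 2 by (simp add: reflect_def merge_def)
      next
        case 3 then have "k \<notin> I" using J(3) by blast
        then show ?thesis using 3 by (simp add: reflect_def merge_def)
      qed
    qed
    have "(\<integral>\<^sup>+ s. H (reflect \<sigma> g I s) \<partial>PiM I ?L)
        = (\<integral>\<^sup>+ x. \<integral>\<^sup>+ y. H (reflect \<sigma> g I (merge J B (x, y))) \<partial>PiM B ?L \<partial>PiM J ?L)"
    proof -
      have "(\<lambda>s. H (reflect \<sigma> g I s)) \<in> borel_measurable (PiM (J \<union> B) ?L)"
        unfolding J(3)[symmetric] by (rule measurable_compose[OF measurable_reflect[OF less.prems(2)] less.prems(4)])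
      from lborel_prod.product_nn_integral_fold[OF J(2,1,4) this] show ?thesis unfolding J(3)[symmetric] .
    qed
    then have e: "(\<integral>\<^sup>+ s. H (reflect \<sigma> g I s) \<partial>PiM I ?L)
        = (\<integral>\<^sup>+ x. \<integral>\<^sup>+ y. H (merge J B (reflect \<sigma> g J x, reflect \<sigma> g B y)) \<partial>PiM B ?L \<partial>PiM J ?L)"
      unfolding m .
    have inner: "ennreal (?r ^ card B) * (\<integral>\<^sup>+ y. H (merge J B (x, reflect \<sigma> g B y)) \<partial>PiM B ?L) = H' x" if "x \<in> space (PiM J ?L)" for x
      unfolding H'_def B_def
      by (rule nn_integral_reflect_orbit[OF j_def[symmetric] j(2) g]) (use that in \<open>simp add: B_def[symmetric]\<close>)
    have cI: "card I = card J + card B" using J by (simp add: card_Un_disjoint)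
    have "card B > 0" by (simp add: B_def card_gt_0_iff)
    have "ennreal (?r ^ card I) * (\<integral>\<^sup>+ s. H (reflect \<sigma> g I s) \<partial>PiM I ?L)
       = ennreal (?r ^ card J) * (ennreal (?r ^ card B) * (\<integral>\<^sup>+ x. \<integral>\<^sup>+ y. H (merge J B (reflect \<sigma> g J x, reflect \<sigma> g B y)) \<partial>PiM B ?L \<partial>PiM J ?L))"
      unfolding e cI power_add using r by (simp add: ennreal_mult mult.assoc)
    also have "ennreal (?r ^ card B) * (\<integral>\<^sup>+ x. \<integral>\<^sup>+ y. H (merge J B (reflect \<sigma> g J x, reflect \<sigma> g B y)) \<partial>PiM B ?L \<partial>PiM J ?L)
       = (\<integral>\<^sup>+ x. ennreal (?r ^ card B) * (\<integral>\<^sup>+ y. H (merge J B (reflect \<sigma> g J x, reflect \<sigma> g B y)) \<partial>PiM B ?L) \<partial>PiM J ?L)"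
      by (rule nn_integral_cmult[symmetric]) measurable
    also have "\<dots> = (\<integral>\<^sup>+ x. H' (reflect \<sigma> g J x) \<partial>PiM J ?L)"
      using measurable_space[OF measurable_reflect[OF \<sigma>J, of g]] by (intro nn_integral_cong inner) auto
    also have "ennreal (?r ^ card J) * \<dots> = (\<integral>\<^sup>+ x. H' x \<partial>PiM J ?L)"
      by (rule less.hyps) (use cI J H' \<sigma>J less.prems(3) \<open>card B > 0\<close> in auto)
    also have "\<dots> = (\<integral>\<^sup>+ s. H s \<partial>PiM I ?L)"
      unfolding H'_def lborel_prod.product_nn_integral_fold[OF J(2,1,4) H, symmetric] J(3)[symmetric] ..
    finally show ?thesis .
  qed
qed

text \<open>The step is the reflection \<open>j \<mapsto> m - 1 - j\<close> on indices; each orbit contributes \<open>1 - \<bar>g\<bar>\<^sup>2\<close> per coordinate.\<close>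

lemma nn_integral_lin:
  assumes g: "cmod g < 1" and H: "H \<in> borel_measurable (PiM {..<m} (\<lambda>_. lborel))"
  shows "ennreal ((1 - (cmod g)\<^sup>2) ^ m) * (\<integral>\<^sup>+ s. H (lin m g s) \<partial>PiM {..<m} (\<lambda>_. lborel))
    = (\<integral>\<^sup>+ s. H s \<partial>PiM {..<m} (\<lambda>_. lborel))"
proof -
  have "reflect (\<lambda>j. m - 1 - j) g {..<m} = lin m g"
    by (simp add: fun_eq_iff reflect_def lin_def)
  then show ?thesis
    using nn_integral_reflect[of "{..<m}" "\<lambda>j. m - 1 - j" g H] g H by (auto simp: image_subset_iff)
qed

section \<open>The law of the polynomial coefficients\<close>

lemma sets_Theta [simp, measurable_cong]: "sets (Theta \<nu>) = sets borel"
  by (simp add: Theta_def)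

lemma space_Theta [simp]: "space (Theta \<nu>) = UNIV"
  using sets_eq_imp_space_eq[OF sets_Theta] by simp

lemma measurable_complex_of_real [measurable]: "complex_of_real \<in> borel_measurable borel"
  by (intro borel_measurable_continuous_onI continuous_intros)

definition Theta_density :: "real \<Rightarrow> complex \<Rightarrow> ennreal" where
  "Theta_density \<nu> z = ennreal ((\<nu> - 1) / (2 * pi) * (1 - (cmod z)\<^sup>2) powr ((\<nu> - 3) / 2) * indicator (ball 0 1) z)"

lemma measurable_Theta_density [measurable]: "Theta_density \<nu> \<in> borel_measurable borel"
proof -
  have [measurable]: "ball (0::complex) 1 \<in> sets borel" by simp
  have "(\<lambda>z. ennreal ((\<nu> - 1) / (2 * pi) * (1 - (cmod z)\<^sup>2) powr ((\<nu> - 3) / 2) * indicator (ball (0::complex) 1) z)) \<in> borel_measurable borel"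
    by measurable
  then show ?thesis by (simp add: Theta_density_def[abs_def])
qed

lemma Theta_eq_density: "\<nu> \<noteq> 1 \<Longrightarrow> Theta \<nu> = density lborel (Theta_density \<nu>)"
  by (simp add: Theta_def Theta_density_def[abs_def])

lemma sigma_finite_Theta:
  assumes "\<nu> \<noteq> 1"
  shows "sigma_finite_measure (Theta \<nu>)"
proof -
  have "AE x in lborel. Theta_density \<nu> x \<noteq> \<infinity>" by (simp add: Theta_density_def)
  then show ?thesis unfolding Theta_eq_density[OF assms]
    by (subst sigma_finite_measure.sigma_finite_iff_density_finite[OF lborel.sigma_finite_measure_axioms]) simp_all
qed

lemma product_sigma_finite_Theta:
  assumes "\<beta> > 0"
  shows "product_sigma_finite (\<lambda>j::nat. Theta (\<beta> * (real j + 1) + 1))"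
  unfolding product_sigma_finite_def
proof
  fix j :: nat
  have "\<beta> * (real j + 1) > 0" using assms by (intro mult_pos_pos) auto
  then show "sigma_finite_measure (Theta (\<beta> * (real j + 1) + 1))" by (intro sigma_finite_Theta) linarith
qed

lemma measurable_lin_inv_comp:
  assumes "g \<in> borel_measurable N" "\<And>j. j < m \<Longrightarrow> (\<lambda>w. F w j) \<in> borel_measurable N" "j < m"
  shows "(\<lambda>w. lin_inv m (g w) (F w) j) \<in> borel_measurable N"
proof -
  have "m - 1 - j < m" using assms(3) by auto
  then have [measurable]: "g \<in> borel_measurable N" "(\<lambda>w. F w j) \<in> borel_measurable N" "(\<lambda>w. F w (m - 1 - j)) \<in> borel_measurable N"
    using assms by auto
  have [measurable]: "(\<lambda>w. complex_of_real (1 - (cmod (g w))\<^sup>2)) \<in> borel_measurable N"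
    by measurable
  have "(\<lambda>w. (F w j - g w * cnj (F w (m - 1 - j))) / complex_of_real (1 - (cmod (g w))\<^sup>2)) \<in> borel_measurable N"
    by measurable
  then show ?thesis unfolding lin_inv_def using assms(3) by (simp del: of_real_diff of_real_power)
qed

lemma measurable_Wt:
  assumes "\<And>j. j < m \<Longrightarrow> (\<lambda>w. F w j) \<in> borel_measurable N"
  shows "(\<lambda>w. Wt c m (F w)) \<in> borel_measurable N"
  using assms
proof (induction m arbitrary: F)
  case (Suc m)
  have [measurable]: "(\<lambda>w. F w m) \<in> borel_measurable N" using Suc.prems by simp
  have [measurable]: "(\<lambda>w. Wt c m (lin_inv m (F w m) (F w))) \<in> borel_measurable N"
    by (rule Suc.IH) (use Suc.prems in \<open>auto intro!: measurable_lin_inv_comp\<close>)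
  show ?case by simp
qed simp

lemma Wt_nonneg: "Wt c m s \<ge> 0"
  by (induction m arbitrary: s) auto

lemma scoef_cong: "(\<And>j. j < m \<Longrightarrow> a j = b j) \<Longrightarrow> scoef a m = scoef b m"
  by (induction m) auto

lemma measurable_lin:
  assumes [measurable]: "g \<in> borel_measurable N" "F \<in> measurable N (PiM {..<m} (\<lambda>_. borel))"
  shows "(\<lambda>w. lin m (g w) (F w)) \<in> measurable N (PiM {..<m} (\<lambda>_. borel))"
  unfolding lin_def
proof (rule measurable_restrict)
  fix j assume j: "j \<in> {..<m}"
  then have "m - 1 - j \<in> {..<m}" by auto
  then have [measurable]: "(\<lambda>w. F w j) \<in> borel_measurable N" "(\<lambda>w. F w (m - 1 - j)) \<in> borel_measurable N"
    using measurable_compose[OF assms(2) measurable_component_singleton] j by blast+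
  show "(\<lambda>w. F w j + g w * cnj (F w (m - 1 - j))) \<in> borel_measurable N" by measurable
qed

lemma measurable_upd:
  assumes "F \<in> measurable N (PiM {..<m} (\<lambda>_. borel))" "g \<in> borel_measurable N"
  shows "(\<lambda>w. (F w)(m := g w)) \<in> measurable N (PiM {..<Suc m} (\<lambda>_. borel))"
  by (rule measurable_fun_upd[where J = "{..<m}"]) (use assms in auto)

lemma measurable_scoef:
  assumes "\<And>j. j < m \<Longrightarrow> (\<lambda>w. F w j) \<in> borel_measurable N"
  shows "(\<lambda>w. scoef (F w) m) \<in> measurable N (PiM {..<m} (\<lambda>_. borel))"
  using assms
proof (induction m)
  case 0
  show ?case by (simp add: measurable_def space_PiM sets_PiM_empty)
next
  case (Suc m)
  have [measurable]: "(\<lambda>w. F w m) \<in> borel_measurable N" using Suc.prems by simp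
  show ?case unfolding scoef.simps by (intro measurable_upd measurable_lin Suc.IH) (use Suc.prems in auto)
qed

text \<open>By induction: for a fixed newest parameter the previous coefficients are distributed by the induction hypothesis, and the density of the new parameter combines with the Jacobian of the step to the next factor of \<open>Wt\<close>.\<close>

lemma nn_integral_scoef:
  fixes \<beta> :: real
  assumes \<beta>: "\<beta> > 0"
  defines "c \<equiv> \<beta> / 2 - 1"
  defines "M \<equiv> \<lambda>j::nat. Theta (\<beta> * (real j + 1) + 1)"
  shows "\<exists>K. \<forall>H\<in>borel_measurable (PiM {..<m} (\<lambda>_. borel)).
     (\<integral>\<^sup>+ b. H (scoef b m) \<partial>PiM {..<m} M) = K * (\<integral>\<^sup>+ s. H s * ennreal (Wt c m s) \<partial>PiM {..<m} (\<lambda>_. lborel))"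
proof (induction m)
  case 0
  interpret M: product_sigma_finite M unfolding M_def by (rule product_sigma_finite_Theta[OF \<beta>])
  show ?case
  proof (intro exI[of _ 1] ballI)
    fix H :: "(nat \<Rightarrow> complex) \<Rightarrow> ennreal"
    show "(\<integral>\<^sup>+ b. H (scoef b 0) \<partial>PiM {..<0} M) = 1 * (\<integral>\<^sup>+ s. H s * ennreal (Wt c 0 s) \<partial>PiM {..<0} (\<lambda>_. lborel))"
      using M.nn_integral_empty[of "\<lambda>b. H (scoef b 0)"] lborel_prod.nn_integral_empty[of "\<lambda>s. H s * ennreal (Wt c 0 s)"]
      by simp
  qed
next
  case (Suc m)
  interpret M: product_sigma_finite M unfolding M_def by (rule product_sigma_finite_Theta[OF \<beta>])
  interpret Lm: sigma_finite_measure "PiM {..<m} (\<lambda>_::nat. lborel :: complex measure)" by (rule lborel_prod.sigma_finite) simp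
  let ?B = "\<lambda>_::nat. borel :: complex measure" and ?L = "\<lambda>_::nat. lborel :: complex measure"
  have sM [measurable_cong]: "sets (PiM I M) = sets (PiM I ?B)" for I by (rule sets_PiM_cong) (auto simp: M_def)
  have sL [measurable_cong]: "sets (PiM I ?L) = sets (PiM I ?B)" for I by (rule sets_PiM_cong) auto
  from Suc obtain K where K: "\<And>H. H \<in> borel_measurable (PiM {..<m} ?B) \<Longrightarrow>
     (\<integral>\<^sup>+ b. H (scoef b m) \<partial>PiM {..<m} M) = K * (\<integral>\<^sup>+ s. H s * ennreal (Wt c m s) \<partial>PiM {..<m} ?L)" by blast
  define \<kappa> where "\<kappa> = ennreal (\<beta> * (real m + 1) / (2 * pi))"
  have ins: "{..<Suc m} = insert m {..<m}" by auto
  show ?case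
  proof (intro exI[of _ "\<kappa> * K"] ballI)
    fix H :: "(nat \<Rightarrow> complex) \<Rightarrow> ennreal" assume H [measurable]: "H \<in> borel_measurable (PiM {..<Suc m} ?B)"
    have scoef_meas: "(\<lambda>b. H (scoef b (Suc m))) \<in> borel_measurable (PiM {..<Suc m} ?B)"
      by (rule measurable_compose[OF measurable_scoef H]) auto
    define A where "A x = (\<integral>\<^sup>+ s. H ((lin m x s)(m := x)) * ennreal (Wt c m s) \<partial>PiM {..<m} ?L)" for x
    have Wm [measurable]: "Wt c m \<in> borel_measurable (PiM {..<m} ?B)"
      by (rule measurable_Wt) simp
    have pm: "(\<lambda>p. H ((lin m (fst p) (snd p))(m := fst p)) * ennreal (Wt c m (snd p))) \<in> borel_measurable (borel \<Otimes>\<^sub>M PiM {..<m} ?B)"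
    proof (intro borel_measurable_times_ennreal)
      show "(\<lambda>p. H ((lin m (fst p) (snd p))(m := fst p))) \<in> borel_measurable (borel \<Otimes>\<^sub>M PiM {..<m} ?B)"
        by (rule measurable_compose[OF _ H], rule measurable_upd, rule measurable_lin) auto
    qed measurable
    have Am [measurable]: "A \<in> borel_measurable borel"
      unfolding A_def by (rule Lm.borel_measurable_nn_integral) (use pm in \<open>simp add: case_prod_unfold cong: measurable_cong_sets\<close>)
    have "(\<integral>\<^sup>+ b. H (scoef b (Suc m)) \<partial>PiM {..<Suc m} M)
       = (\<integral>\<^sup>+ x. \<integral>\<^sup>+ b. H (scoef (b(m := x)) (Suc m)) \<partial>PiM {..<m} M \<partial>M m)"
      unfolding ins by (rule M.product_nn_integral_insert_rev) (use scoef_meas ins in \<open>auto cong: measurable_cong_sets\<close>)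
    also have "\<dots> = (\<integral>\<^sup>+ x. K * A x \<partial>M m)"
    proof (rule nn_integral_cong)
      fix x assume "x \<in> space (M m)"
      have "scoef (b(m := x)) (Suc m) = (lin m x (scoef b m))(m := x)" for b
        using scoef_cong[of m "b(m := x)" b] by simp
      moreover have "(\<lambda>s. H ((lin m x s)(m := x))) \<in> borel_measurable (PiM {..<m} ?B)"
        by (rule measurable_compose[OF _ H], rule measurable_upd, rule measurable_lin) auto
      ultimately show "(\<integral>\<^sup>+ b. H (scoef (b(m := x)) (Suc m)) \<partial>PiM {..<m} M) = K * A x"
        unfolding A_def using K by simp
    qed
    also have "M m = density lborel (Theta_density (\<beta> * (real m + 1) + 1))"
    proof -
      have "\<beta> * (real m + 1) > 0" using \<beta> by (intro mult_pos_pos) auto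
      then show ?thesis unfolding M_def by (intro Theta_eq_density) linarith
    qed
    also have "(\<integral>\<^sup>+ x. K * A x \<partial>\<dots>) = (\<integral>\<^sup>+ z. Theta_density (\<beta> * (real m + 1) + 1) z * (K * A z) \<partial>lborel)"
      by (rule nn_integral_density) measurable
    also have "\<dots> = (\<integral>\<^sup>+ x. \<kappa> * K * (\<integral>\<^sup>+ t. H (t(m := x)) * ennreal (Wt c (Suc m) (t(m := x))) \<partial>PiM {..<m} ?L) \<partial>lborel)"
    proof (rule nn_integral_cong)
      fix x :: complex
      show "Theta_density (\<beta> * (real m + 1) + 1) x * (K * A x)
         = \<kappa> * K * (\<integral>\<^sup>+ t. H (t(m := x)) * ennreal (Wt c (Suc m) (t(m := x))) \<partial>PiM {..<m} ?L)"
      proof (cases "cmod x < 1")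
        case True
        define r where "r = 1 - (cmod x)\<^sup>2"
        have r: "r > 0" unfolding r_def by (rule one_minus_cmod_sq[OF True])
        have ex: "(\<beta> * (real m + 1) + 1 - 3) / 2 = real (Suc m) * c + real m"
          by (simp add: c_def field_simps)
        have rp: "r powr ((\<beta> * (real m + 1) + 1 - 3) / 2) = r powr (real (Suc m) * c) * r ^ m"
          unfolding ex powr_add using r by (simp add: powr_realpow)
        have lm: "(\<lambda>t. H (t(m := x)) * ennreal (Wt c m (lin_inv m x t))) \<in> borel_measurable (PiM {..<m} ?B)"
        proof (intro borel_measurable_times_ennreal)
          show "(\<lambda>t. H (t(m := x))) \<in> borel_measurable (PiM {..<m} ?B)"
            by (rule measurable_compose[OF _ H], rule measurable_upd) auto
          have "(\<lambda>t. Wt c m (lin_inv m x t)) \<in> borel_measurable (PiM {..<m} ?B)"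
            by (intro measurable_Wt measurable_lin_inv_comp) auto
          then show "(\<lambda>t. ennreal (Wt c m (lin_inv m x t))) \<in> borel_measurable (PiM {..<m} ?B)" by measurable
        qed
        have "A x = (\<integral>\<^sup>+ s. H ((lin m x s)(m := x)) * ennreal (Wt c m (lin_inv m x (lin m x s))) \<partial>PiM {..<m} ?L)"
          unfolding A_def by (intro nn_integral_cong) (simp add: lin_inv_lin[OF True] space_PiM)
        then have "ennreal (r ^ m) * A x = (\<integral>\<^sup>+ t. H (t(m := x)) * ennreal (Wt c m (lin_inv m x t)) \<partial>PiM {..<m} ?L)"
          using nn_integral_lin[OF True, of "\<lambda>t. H (t(m := x)) * ennreal (Wt c m (lin_inv m x t))" m] lm
          unfolding r_def by (simp cong: measurable_cong_sets)
        then have "ennreal (r powr (real (Suc m) * c)) * (ennreal (r ^ m) * A x) =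
           (\<integral>\<^sup>+ t. ennreal (r powr (real (Suc m) * c)) * (H (t(m := x)) * ennreal (Wt c m (lin_inv m x t))) \<partial>PiM {..<m} ?L)"
          using lm by (simp add: nn_integral_cmult cong: measurable_cong_sets)
        also have "\<dots> = (\<integral>\<^sup>+ t. H (t(m := x)) * ennreal (Wt c (Suc m) (t(m := x))) \<partial>PiM {..<m} ?L)"
        proof (rule nn_integral_cong)
          fix t
          have "Wt c (Suc m) (t(m := x)) = r powr (real (Suc m) * c) * Wt c m (lin_inv m x t)"
            using True lin_inv_cong[of m "t(m := x)" t x] by (simp add: r_def)
          then show "ennreal (r powr (real (Suc m) * c)) * (H (t(m := x)) * ennreal (Wt c m (lin_inv m x t))) =
             H (t(m := x)) * ennreal (Wt c (Suc m) (t(m := x)))"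
            using Wt_nonneg[of c m "lin_inv m x t"] by (simp add: ennreal_mult mult_ac)
        qed
        finally have e: "ennreal (r powr (real (Suc m) * c)) * (ennreal (r ^ m) * A x) = (\<integral>\<^sup>+ t. H (t(m := x)) * ennreal (Wt c (Suc m) (t(m := x))) \<partial>PiM {..<m} ?L)" .
        have i: "indicator (ball 0 1) x = (1::real)" using True by simp
        have "Theta_density (\<beta> * (real m + 1) + 1) x = ennreal ((\<beta> * (real m + 1) / (2 * pi)) * (r powr (real (Suc m) * c) * r ^ m))"
          unfolding Theta_density_def r_def[symmetric] rp i by simp
        also have "\<dots> = \<kappa> * (ennreal (r powr (real (Suc m) * c)) * ennreal (r ^ m))"
          unfolding \<kappa>_def using \<beta> r by (subst ennreal_mult, simp, simp, subst ennreal_mult) simp_all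
        finally show ?thesis
          unfolding e[symmetric] by (simp only: mult_ac)
      next
        case False
        then have "Wt c (Suc m) (t(m := x)) = 0" for t by simp
        then show ?thesis using False by (simp add: Theta_density_def)
      qed
    qed
    also have "\<dots> = \<kappa> * K * (\<integral>\<^sup>+ x. \<integral>\<^sup>+ t. H (t(m := x)) * ennreal (Wt c (Suc m) (t(m := x))) \<partial>PiM {..<m} ?L \<partial>lborel)"
    proof (rule nn_integral_cmult)
      have "(\<lambda>p. H ((snd p)(m := fst p)) * ennreal (Wt c (Suc m) ((snd p)(m := fst p)))) \<in> borel_measurable (borel \<Otimes>\<^sub>M PiM {..<m} ?B)"
      proof (intro borel_measurable_times_ennreal)
        show "(\<lambda>p. H ((snd p)(m := fst p))) \<in> borel_measurable (borel \<Otimes>\<^sub>M PiM {..<m} ?B)"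
          by (rule measurable_compose[OF _ H], rule measurable_upd) auto
        have "(\<lambda>p. Wt c (Suc m) ((snd p)(m := fst p))) \<in> borel_measurable (borel \<Otimes>\<^sub>M PiM {..<m} ?B)"
          by (rule measurable_Wt) (auto simp: less_Suc_eq)
        then show "(\<lambda>p. ennreal (Wt c (Suc m) ((snd p)(m := fst p)))) \<in> borel_measurable (borel \<Otimes>\<^sub>M PiM {..<m} ?B)" by measurable
      qed
      then show "(\<lambda>x. \<integral>\<^sup>+ t. H (t(m := x)) * ennreal (Wt c (Suc m) (t(m := x))) \<partial>PiM {..<m} ?L) \<in> borel_measurable lborel"
        by (intro Lm.borel_measurable_nn_integral) (simp add: case_prod_unfold cong: measurable_cong_sets)
    qed
    also have "(\<integral>\<^sup>+ x. \<integral>\<^sup>+ t. H (t(m := x)) * ennreal (Wt c (Suc m) (t(m := x))) \<partial>PiM {..<m} ?L \<partial>lborel)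
       = (\<integral>\<^sup>+ s. H s * ennreal (Wt c (Suc m) s) \<partial>PiM {..<Suc m} ?L)"
    proof -
      have "(\<lambda>s. Wt c (Suc m) s) \<in> borel_measurable (PiM {..<Suc m} ?B)" by (rule measurable_Wt) simp
      then have "(\<lambda>s. H s * ennreal (Wt c (Suc m) s)) \<in> borel_measurable (PiM {..<Suc m} ?B)" by measurable
      then show ?thesis
        unfolding ins by (intro lborel_prod.product_nn_integral_insert_rev[symmetric]) (auto cong: measurable_cong_sets)
    qed
    finally show "(\<integral>\<^sup>+ b. H (scoef b (Suc m)) \<partial>PiM {..<Suc m} M) = \<kappa> * K * (\<integral>\<^sup>+ s. H s * ennreal (Wt c (Suc m) s) \<partial>PiM {..<Suc m} ?L)" .
  qed
qed

lemma Theta_rotate: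
  assumes "\<nu> \<noteq> 1" "cmod u = 1"
  shows "distr (Theta \<nu>) borel (\<lambda>z. u * z) = Theta \<nu>"
proof (rule measure_eqI)
  fix A :: "complex set" assume "A \<in> sets (distr (Theta \<nu>) borel (\<lambda>z. u * z))"
  then have A [measurable]: "A \<in> sets borel" by simp
  define d where "d = Theta_density \<nu>"
  have [measurable]: "d \<in> borel_measurable borel" unfolding d_def by measurable
  have du: "d (u * z) = d z" for z
    using assms(2) by (simp add: d_def Theta_density_def norm_mult indicator_def)
  have T: "Theta \<nu> = density lborel d" unfolding d_def by (rule Theta_eq_density[OF assms(1)])
  have "(\<lambda>z. u * z) \<in> borel_measurable borel" by measurable
  from measurable_sets_borel[OF this A] have uA [measurable]: "(\<lambda>z. u * z) -` A \<in> sets borel" by simp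
  have "emeasure (distr (Theta \<nu>) borel (\<lambda>z. u * z)) A = emeasure (Theta \<nu>) ((\<lambda>z. u * z) -` A)"
    by (subst emeasure_distr) auto
  also have "\<dots> = (\<integral>\<^sup>+ z. d z * indicator ((\<lambda>z. u * z) -` A) z \<partial>lborel)"
    unfolding T by (subst emeasure_density) auto
  also have "\<dots> = (\<integral>\<^sup>+ z. (\<lambda>w. d w * indicator A w) (u * z + 0 * cnj z) \<partial>lborel)"
    by (intro nn_integral_cong) (auto simp: du indicator_def)
  also have "\<dots> = (\<integral>\<^sup>+ z. d z * indicator A z \<partial>lborel)"
    using nn_integral_complex_linear[of "\<lambda>w. d w * indicator A w" u 0] assms(2) by simp
  also have "\<dots> = emeasure (Theta \<nu>) A"
    unfolding T by (subst emeasure_density) auto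
  finally show "emeasure (distr (Theta \<nu>) borel (\<lambda>z. u * z)) A = emeasure (Theta \<nu>) A" .
qed simp

section \<open>Change of variables for nonnegative integrands\<close>

text \<open>The measure of the image of a bounded piece is the integral of the Jacobian. The comparison on bounded sets is enough to identify two measures, and hence all nonnegative integrals.\<close>

lemma nn_integral_change_of_variables:
  fixes g :: "real ^ 'n::{finite,wellorder} \<Rightarrow> real ^ 'n::_"
  assumes S: "S \<in> sets borel" and img: "g ` S \<in> sets borel"
    and der: "\<And>x. x \<in> S \<Longrightarrow> (g has_derivative g' x) (at x within S)"
    and inj: "inj_on g S"
    and g [measurable]: "g \<in> borel_measurable borel" and D [measurable]: "D \<in> borel_measurable borel"
    and det: "\<And>x. x \<in> S \<Longrightarrow> \<bar>Determinants.det (matrix (g' x))\<bar> = D x"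
    and h [measurable]: "h \<in> borel_measurable borel"
  shows "(\<integral>\<^sup>+ y. h y * indicator (g ` S) y \<partial>lborel) = (\<integral>\<^sup>+ x. h (g x) * ennreal (D x) * indicator S x \<partial>lborel)"
proof -
  note [measurable] = S img
  define M1 where "M1 = density lborel (indicator (g ` S))"
  define M2 where "M2 = distr (density lborel (\<lambda>x. ennreal (D x) * indicator S x)) borel g"
  have sets: "sets M1 = sets borel" "sets M2 = sets borel" by (auto simp: M1_def M2_def)
  have bdd: "emeasure M1 A = emeasure M2 A" if A [measurable]: "A \<in> sets borel" and "bounded A" for A
  proof -
    define S' where "S' = S \<inter> g -` A"
    have S' [measurable]: "S' \<in> sets borel" unfolding S'_def using measurable_sets_borel[OF g A] S by simp
    have im: "g ` S' = g ` S \<inter> A" by (auto simp: S'_def)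
    then have im_b [measurable]: "g ` S' \<in> sets borel" unfolding im using img A by simp
    have sub: "S' \<subseteq> S" by (auto simp: S'_def)
    have der': "(g has_derivative g' x) (at x within S')" if "x \<in> S'" for x
      using der[of x] that sub by (blast intro: has_derivative_subset)
    have inj': "inj_on g S'" using inj sub by (rule inj_on_subset)
    have "bounded (g ` S')" unfolding im using \<open>bounded A\<close> by (rule bounded_subset) auto
    then have lm: "g ` S' \<in> lmeasurable"
        using im_b by (intro bounded_set_imp_lmeasurable) auto
    have Sl: "S' \<in> sets lebesgue" using S' by auto
    have int: "(\<lambda>x. \<bar>Determinants.det (matrix (g' x))\<bar>) integrable_on S'"
      using measurable_differentiable_image_eq[OF Sl der' inj'] lm by blast
    have int': "D integrable_on S'"
      by (rule integrable_eq[OF int]) (use det sub in auto)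
    have pos: "0 \<le> D x" if "x \<in> S'" for x using det[of x] that sub by (metis abs_ge_zero subsetD)
    have "measure lebesgue (g ` S') = integral S' (\<lambda>x. \<bar>Determinants.det (matrix (g' x))\<bar>)"
      by (rule measure_differentiable_image_eq[OF Sl der' inj' int])
    also have "\<dots> = integral S' D" by (rule integral_cong) (use det sub in auto)
    finally have m: "measure lebesgue (g ` S') = integral S' D" .
    have "emeasure M1 A = (\<integral>\<^sup>+ y. indicator (g ` S) y * indicator A y \<partial>lborel)"
      unfolding M1_def by (rule emeasure_density) auto
    also have "\<dots> = (\<integral>\<^sup>+ y. indicator (g ` S') y \<partial>lborel)"
      unfolding im by (intro nn_integral_cong) (auto simp: indicator_def)
    also have "\<dots> = emeasure lborel (g ` S')" by (rule nn_integral_indicator) simp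
    finally have e1: "emeasure M1 A = emeasure lborel (g ` S')" .
    have "emeasure lborel (g ` S') = emeasure lebesgue (g ` S')" using im_b by (simp add: emeasure_completion main_part_sets)
    also have "\<dots> = ennreal (integral S' D)"
      using emeasure_eq_measure2[OF lm] m by simp
    also have "\<dots> = (\<integral>\<^sup>+ x. ennreal (D x) * indicator S' x \<partial>lborel)"
      by (rule nn_integral_has_integral_lebesgue'[OF pos integrable_integral[OF int'], symmetric])
    also have "\<dots> = (\<integral>\<^sup>+ x. (ennreal (D x) * indicator S x) * indicator (g -` A) x \<partial>lborel)"
      by (intro nn_integral_cong) (auto simp: S'_def indicator_def)
    also have "\<dots> = emeasure M2 A"
    proof -
      have "g -` A \<in> sets borel" using measurable_sets_borel[OF g A] by simp
      then show ?thesis unfolding M2_def by (subst emeasure_distr) (simp_all add: emeasure_density)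
    qed
    finally show ?thesis unfolding e1 .
  qed
  have "M1 = M2"
  proof (rule measure_eqI)
    fix A assume "A \<in> sets M1"
    then have A [measurable]: "A \<in> sets borel" using sets by simp
    let ?A = "\<lambda>n::nat. A \<inter> cball 0 (real n)"
    have U: "(\<Union>n. ?A n) = A" using real_arch_simple by auto
    have inc: "incseq ?A" by (auto simp: incseq_def intro: order.trans)
    have "emeasure M1 A = (SUP n. emeasure M1 (?A n))"
      using SUP_emeasure_incseq[of ?A M1] inc U sets by (simp add: image_subset_iff)
    also have "\<dots> = (SUP n. emeasure M2 (?A n))"
      by (intro SUP_cong refl bdd) (auto intro: bounded_subset[OF bounded_cball])
    also have "\<dots> = emeasure M2 A"
      using SUP_emeasure_incseq[of ?A M2] inc U sets by (simp add: image_subset_iff)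
    finally show "emeasure M1 A = emeasure M2 A" .
  qed (simp add: sets)
  then have "(\<integral>\<^sup>+ y. h y \<partial>M1) = (\<integral>\<^sup>+ y. h y \<partial>M2)" by simp
  then show ?thesis
    unfolding M1_def M2_def by (simp add: nn_integral_density nn_integral_distr mult_ac)
qed

lemma lborel_vec_eq: "(lborel :: (real ^ 'n::finite) measure) = distr (PiM (UNIV :: 'n set) (\<lambda>_. lborel)) borel (\<lambda>w. \<chi> i. w i)"
proof (rule lborel_eqI)
  interpret product_sigma_finite "\<lambda>_::'n. lborel :: real measure" ..
  have m [measurable]: "(\<lambda>w. \<chi> i. w i) \<in> borel_measurable (PiM (UNIV :: 'n set) (\<lambda>_. lborel :: real measure))"
    unfolding borel_measurable_euclidean_space[of "\<lambda>w. \<chi> i. w i"]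
    by (auto simp: Basis_vec_def inner_axis)
  fix l u :: "real ^ 'n" assume le: "\<And>b. b \<in> Basis \<Longrightarrow> l \<bullet> b \<le> u \<bullet> b"
  have le': "vec_nth l i \<le> vec_nth u i" for i using le[of "axis i 1"] by (simp add: inner_axis axis_in_Basis_iff)
  have "(\<lambda>w. \<chi> i. w i) -` box l u \<inter> space (PiM (UNIV :: 'n set) (\<lambda>_. lborel :: real measure)) = PiE UNIV (\<lambda>i. box (vec_nth l i) (vec_nth u i))"
    by (auto simp: mem_box_cart space_PiM PiE_iff)
  then have "emeasure (distr (PiM (UNIV :: 'n set) (\<lambda>_. lborel)) borel (\<lambda>w. \<chi> i. w i)) (box l u)
     = emeasure (PiM (UNIV :: 'n set) (\<lambda>_. lborel)) (PiE UNIV (\<lambda>i. box (vec_nth l i) (vec_nth u i)))"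
    by (subst emeasure_distr) auto
  also have "\<dots> = (\<Prod>i\<in>UNIV. ennreal (vec_nth u i - vec_nth l i))"
    using le' by (subst emeasure_PiM) auto
  also have "\<dots> = ennreal (\<Prod>i\<in>UNIV. vec_nth u i - vec_nth l i)"
    using le' by (simp add: prod_ennreal)
  also have "(\<Prod>i\<in>UNIV. vec_nth u i - vec_nth l i) = (\<Prod>b\<in>Basis. (u - l) \<bullet> b)"
    unfolding Basis_vec_def by (simp add: prod.UNION_disjoint axis_eq_axis inner_axis prod.reindex inj_on_def)
  finally show "emeasure (distr (PiM (UNIV :: 'n set) (\<lambda>_. lborel)) borel (\<lambda>w. \<chi> i. w i)) (box l u) = (\<Prod>b\<in>Basis. (u - l) \<bullet> b)" .
qed simp

section \<open>Angles and weights as coordinates, and their derivative\<close>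

text \<open>Coordinates \<open>x k = \<nu> k + \<i> * \<theta> k\<close> with \<open>k < m\<close> encode the weights and angles; the last weight is fixed by total mass one and the last angle by the prescribed sum \<open>S\<close>.\<close>

definition nuv :: "nat \<Rightarrow> (nat \<Rightarrow> complex) \<Rightarrow> nat \<Rightarrow> real" where
  "nuv m x k = (if k < m then Re (x k) else 1 - (\<Sum>j<m. Re (x j)))"

definition thv :: "nat \<Rightarrow> real \<Rightarrow> (nat \<Rightarrow> complex) \<Rightarrow> nat \<Rightarrow> real" where
  "thv m S x k = (if k < m then Im (x k) else S - (\<Sum>j<m. Im (x j)))"

definition lagpoly :: "nat \<Rightarrow> (nat \<Rightarrow> complex) \<Rightarrow> (nat \<Rightarrow> real) \<Rightarrow> complex poly" where
  "lagpoly m z \<nu> = (\<Sum>j\<le>m. Polynomial.smult (of_real (\<nu> j)) (\<Prod>i\<in>{..m}-{j}. [:- z i, 1:]))"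

text \<open>The coefficient vector of the Lagrange combination with the given angles and weights.\<close>

definition sv :: "nat \<Rightarrow> real \<Rightarrow> (nat \<Rightarrow> complex) \<Rightarrow> nat \<Rightarrow> complex" where
  "sv m S x = (\<lambda>j\<in>{..<m}. Polynomial.coeff (lagpoly m (\<lambda>k. cis (thv m S x k)) (nuv m x)) (m - 1 - j))"

definition increasing_angles :: "nat \<Rightarrow> (nat \<Rightarrow> real) \<Rightarrow> bool" where
  "increasing_angles m \<theta> \<longleftrightarrow> 0 \<le> \<theta> 0 \<and> (\<forall>k<m. \<theta> k < \<theta> (Suc k)) \<and> \<theta> m < 2 * pi"

definition Reg :: "nat \<Rightarrow> real \<Rightarrow> (nat \<Rightarrow> complex) set" where
  "Reg m S = {x \<in> {..<m} \<rightarrow>\<^sub>E UNIV. increasing_angles m (thv m S x) \<and> (\<forall>k\<le>m. nuv m x k > 0)}"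

lemma sum_nuv: "(\<Sum>k\<le>m. nuv m x k) = 1"
  by (simp add: nuv_def lessThan_Suc_atMost[symmetric])

lemma sum_thv: "(\<Sum>k\<le>m. thv m S x k) = S"
  by (simp add: thv_def lessThan_Suc_atMost[symmetric])

lemma poly_lagpoly: "poly (lagpoly m z \<nu>) w = lag m z \<nu> w"
  by (simp add: lagpoly_def lag_def poly_sum poly_prod)

lemma degree_lagpoly: "Polynomial.degree (lagpoly m z \<nu>) \<le> m"
  and coeff_lagpoly_top: "Polynomial.coeff (lagpoly m z \<nu>) m = of_real (\<Sum>j\<le>m. \<nu> j)"
proof -
  define q where "q j = (\<Prod>i\<in>{..m}-{j}. [:- z i, 1:])" for j
  have deg: "Polynomial.degree (q j) = m" if "j \<le> m" for j
    unfolding q_def using that by (subst degree_prod_eq_sum_degree) auto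
  have lc: "Polynomial.coeff (q j) m = 1" if "j \<le> m" for j
    using deg[OF that] monic_prod[of "{..m}-{j}" "\<lambda>i. [:- z i, 1:]"] by (auto simp: q_def)
  show "Polynomial.degree (lagpoly m z \<nu>) \<le> m"
    unfolding lagpoly_def q_def[symmetric] using deg by (intro degree_sum_le) (auto intro: order.trans[OF degree_smult_le])
  show "Polynomial.coeff (lagpoly m z \<nu>) m = of_real (\<Sum>j\<le>m. \<nu> j)"
    unfolding lagpoly_def q_def[symmetric] using lc by (simp add: coeff_sum)
qed

lemma monic_of_lagpoly:
  assumes "(\<Sum>j\<le>m. \<nu> j) = 1" "\<And>j. j < m \<Longrightarrow> s j = Polynomial.coeff (lagpoly m z \<nu>) (m - 1 - j)"
  shows "monic_of m s = lagpoly m z \<nu>"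
proof (rule poly_eqI)
  fix i
  consider "i = m" | "i < m" | "i > m" by linarith
  then show "Polynomial.coeff (monic_of m s) i = Polynomial.coeff (lagpoly m z \<nu>) i"
  proof cases
    case 1 then show ?thesis using assms(1) by (simp add: coeff_monic_of coeff_lagpoly_top)
  next
    case 2
    then have "m - 1 - i < m" "m - 1 - (m - 1 - i) = i" by auto
    then show ?thesis using 2 assms(2)[of "m - 1 - i"] by (simp add: coeff_monic_of)
  next
    case 3 then show ?thesis
      using coeff_eq_0[of "lagpoly m z \<nu>" i] degree_lagpoly[of m z \<nu>] by (simp add: coeff_monic_of)
  qed
qed

lemma mev_sv: "mev m (sv m S x) w = lag m (\<lambda>k. cis (thv m S x k)) (nuv m x) w"
proof -
  have "monic_of m (sv m S x) = lagpoly m (\<lambda>k. cis (thv m S x k)) (nuv m x)"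
    by (rule monic_of_lagpoly) (auto simp: sum_nuv sv_def)
  then show ?thesis by (metis poly_monic_of poly_lagpoly)
qed

lemma increasing_angles_less:
  assumes "increasing_angles m \<theta>" "i < j" "j \<le> m"
  shows "\<theta> i < \<theta> j"
  using assms(2,3)
proof (induction j)
  case (Suc j)
  have "\<theta> j < \<theta> (Suc j)" using assms(1) Suc.prems by (auto simp: increasing_angles_def)
  then show ?case using Suc by (cases "i = j") auto
qed simp

lemma increasing_angles_range:
  assumes "increasing_angles m \<theta>" "j \<le> m"
  shows "0 \<le> \<theta> j" "\<theta> j < 2 * pi"
proof -
  have "\<theta> 0 \<le> \<theta> j" using increasing_angles_less[OF assms(1), of 0 j] assms(2) by (cases "j = 0") auto
  then show "0 \<le> \<theta> j" using assms(1) by (auto simp: increasing_angles_def)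
  have "\<theta> j \<le> \<theta> m" using increasing_angles_less[OF assms(1), of j m] assms(2) by (cases "j = m") auto
  then show "\<theta> j < 2 * pi" using assms(1) by (auto simp: increasing_angles_def)
qed

lemma cis_inj_range:
  assumes "cis a = cis b" "0 \<le> a" "a < 2 * pi" "0 \<le> b" "b < 2 * pi"
  shows "a = b"
proof -
  have "cos a = cos b" "sin a = sin b" using assms(1) by (metis cis.sel(1), metis cis.sel(2))
  then obtain n :: int where n: "a = b + 2 * pi * n" using sin_cos_eq_iff[of a b] by auto
  have "n < 1"
  proof (rule ccontr)
    assume "\<not> n < 1"
    then have "2 * pi * 1 \<le> 2 * pi * real_of_int n" by (intro mult_left_mono) auto
    then show False using n assms by linarith
  qed
  moreover have "n > -1"
  proof (rule ccontr)
    assume "\<not> n > -1"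
    then have "2 * pi * real_of_int n \<le> 2 * pi * -1" by (intro mult_left_mono) auto
    then show False using n assms by linarith
  qed
  ultimately have "n = 0" by linarith
  then show ?thesis using n by simp
qed

lemma increasing_angles_inj:
  assumes "increasing_angles m \<theta>"
  shows "inj_on (\<lambda>k. cis (\<theta> k)) {..m}"
proof (rule inj_onI)
  fix i j assume ij: "i \<in> {..m}" "j \<in> {..m}" "cis (\<theta> i) = cis (\<theta> j)"
  then have "\<theta> i = \<theta> j" using increasing_angles_range[OF assms] by (intro cis_inj_range) auto
  then show "i = j" using increasing_angles_less[OF assms, of i j] increasing_angles_less[OF assms, of j i] ij
    by (cases i j rule: linorder_cases) auto
qed

text \<open>An increasing enumeration of a finite set of angles in one period is determined by the set.\<close>

lemma increasing_angles_unique: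
  assumes a: "increasing_angles m \<theta>" and b: "increasing_angles m \<phi>"
    and eq: "(\<lambda>k. cis (\<theta> k)) ` {..m} = (\<lambda>k. cis (\<phi> k)) ` {..m}" and j: "j \<le> m"
  shows "\<theta> j = \<phi> j"
proof -
  have set_eq: "\<theta> ` {..m} = \<phi> ` {..m}"
  proof -
    have "\<theta>' ` {..m} \<subseteq> \<phi>' ` {..m}" if "increasing_angles m \<theta>'" "increasing_angles m \<phi>'"
      "(\<lambda>k. cis (\<theta>' k)) ` {..m} = (\<lambda>k. cis (\<phi>' k)) ` {..m}" for \<theta>' \<phi>' :: "nat \<Rightarrow> real"
    proof
      fix t assume "t \<in> \<theta>' ` {..m}"
      then obtain k where k: "k \<le> m" "t = \<theta>' k" by auto
      then have "cis (\<theta>' k) \<in> (\<lambda>k. cis (\<phi>' k)) ` {..m}" using that(3) by blast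
      then obtain l where l: "l \<le> m" "cis (\<theta>' k) = cis (\<phi>' l)" by auto
      have "\<theta>' k = \<phi>' l" by (rule cis_inj_range[OF l(2)])
        (use increasing_angles_range[OF that(1) k(1)] increasing_angles_range[OF that(2) l(1)] in auto)
      then show "t \<in> \<phi>' ` {..m}" using k l by auto
    qed
    from this[OF a b eq] this[OF b a eq[symmetric]] show ?thesis by blast
  qed
  have srt: "map \<theta>' [0..<Suc m] = sorted_list_of_set (\<theta>' ` {..m})" if "increasing_angles m \<theta>'" for \<theta>' :: "nat \<Rightarrow> real"
  proof -
    have "sorted_wrt (<) (map \<theta>' [0..<Suc m])"
      by (subst sorted_wrt_map, rule sorted_wrt_mono_rel[OF _ sorted_wrt_upt]) (use increasing_angles_less[OF that] in auto)
    moreover have "set (map \<theta>' [0..<Suc m]) = \<theta>' ` {..m}" by (auto simp: atLeast0LessThan lessThan_Suc_atMost simp del: upt_Suc)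
    ultimately show ?thesis by (metis strict_sorted_equal strict_sorted_list_of_set sorted_list_of_set(1) finite_set)
  qed
  have "map \<theta> [0..<Suc m] = map \<phi> [0..<Suc m]" unfolding srt[OF a] srt[OF b] set_eq ..
  then show ?thesis using j unfolding map_eq_conv by (auto simp del: upt_Suc)
qed

lemma prod_neg_cis: "(\<Prod>j\<le>m. - cis (\<theta> j)) = (-1) ^ Suc m * cis (\<Sum>j\<le>m. \<theta> j)"
proof -
  have "(\<Prod>j\<le>m. cis (\<theta> j)) = cis (\<Sum>j\<le>m. \<theta> j)" by (induction m) (auto simp: cis_mult)
  moreover have "(\<Prod>j\<le>m. - cis (\<theta> j)) = (\<Prod>j\<le>m. -1) * (\<Prod>j\<le>m. cis (\<theta> j))"
    unfolding prod.distrib[symmetric] by simp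
  ultimately show ?thesis by simp
qed

lemma sv_completion:
  "w * mev m (sv m S x) w + (-1) ^ Suc m * cis S * rmev m (sv m S x) w = (\<Prod>j\<le>m. w - cis (thv m S x j))"
  using lag_completion[of m "\<lambda>k. cis (thv m S x k)" "nuv m x" "sv m S x" w]
  unfolding prod_neg_cis sum_thv by (simp add: mev_sv sum_nuv)

text \<open>The completion recovers the nodes from the coefficients, the sum \<open>S\<close> being known; the weights are then the Lagrange coefficients.\<close>

lemma sv_inj_on: "inj_on (sv m S) (Reg m S)"
proof (rule inj_onI)
  fix x y assume x: "x \<in> Reg m S" and y: "y \<in> Reg m S" and eq: "sv m S x = sv m S y"
  have ax: "increasing_angles m (thv m S x)" and ay: "increasing_angles m (thv m S y)" using x y by (auto simp: Reg_def)
  have prod_eq: "(\<Prod>j\<le>m. w - cis (thv m S x j)) = (\<Prod>j\<le>m. w - cis (thv m S y j))" for w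
    unfolding sv_completion[symmetric] eq ..
  have roots: "w \<in> (\<lambda>k. cis (\<theta> k)) ` {..m} \<longleftrightarrow> (\<Prod>j\<le>m. w - cis (\<theta> j)) = 0" for w and \<theta> :: "nat \<Rightarrow> real"
    by auto
  have th: "thv m S x j = thv m S y j" if "j \<le> m" for j
    by (rule increasing_angles_unique[OF ax ay _ that]) (subst set_eq_iff, simp only: roots prod_eq, simp)
  have "(\<lambda>k. cis (thv m S x k)) j = (\<lambda>k. cis (thv m S y k)) j" if "j \<le> m" for j using th[OF that] by simp
  then have "lag m (\<lambda>k. cis (thv m S x k)) (nuv m y) w = lag m (\<lambda>k. cis (thv m S y k)) (nuv m y) w" for w
    unfolding lag_def by (intro sum.cong arg_cong2[where f = "(*)"] prod.cong refl) auto
  then have lag_eq: "lag m (\<lambda>k. cis (thv m S x k)) (nuv m x) w = lag m (\<lambda>k. cis (thv m S x k)) (nuv m y) w" for w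
    unfolding mev_sv[symmetric] eq by (simp add: mev_sv)
  have nu: "nuv m x j = nuv m y j" if "j \<le> m" for j
    by (rule lag_weights_unique[OF increasing_angles_inj[OF ax] lag_eq that])
  show "x = y"
  proof
    fix k show "x k = y k"
    proof (cases "k < m")
      case True
      then have "Re (x k) = Re (y k)" "Im (x k) = Im (y k)" using nu[of k] th[of k] by (auto simp: nuv_def thv_def)
      then show ?thesis by (rule complex_eqI)
    next
      case False
      then show ?thesis using x y by (auto simp: Reg_def PiE_def extensional_def)
    qed
  qed
qed

text \<open>The differential of \<open>lag\<close> in the directions \<open>d\<theta>\<close> and \<open>d\<nu>\<close>.\<close>

definition dlag :: "nat \<Rightarrow> (nat \<Rightarrow> complex) \<Rightarrow> (nat \<Rightarrow> real) \<Rightarrow> (nat \<Rightarrow> real) \<Rightarrow> (nat \<Rightarrow> real) \<Rightarrow> complex \<Rightarrow> complex" where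
  "dlag m z \<nu> d\<theta> d\<nu> w = (\<Sum>j\<le>m. of_real (d\<nu> j) * (\<Prod>i\<in>{..m}-{j}. w - z i)
     + of_real (\<nu> j) * (\<Sum>i\<in>{..m}-{j}. - (\<i> * z i * of_real (d\<theta> i)) * (\<Prod>l\<in>{..m}-{j}-{i}. w - z l)))"

text \<open>The differential at the node \<open>z k\<close> in the Lagrange normalisation, that is, divided by the product of the differences to the other nodes.\<close>

definition dcoord :: "nat \<Rightarrow> (nat \<Rightarrow> complex) \<Rightarrow> (nat \<Rightarrow> real) \<Rightarrow> (nat \<Rightarrow> real) \<Rightarrow> (nat \<Rightarrow> real) \<Rightarrow> nat \<Rightarrow> complex" where
  "dcoord m z \<nu> d\<theta> d\<nu> k = of_real (d\<nu> k) - (\<Sum>i\<in>{..m}-{k}.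
     of_real (\<nu> k * d\<theta> i) * (\<i> * (z i / (z k - z i))) + of_real (\<nu> i * d\<theta> k) * (\<i> * (z k / (z k - z i))))"

text \<open>At a node almost all terms vanish, and the surviving ones share the factor \<open>\<Prod>i. z k - z i\<close>.\<close>

lemma dlag_at:
  assumes inj: "inj_on z {..m}" and k: "k \<le> m"
  shows "dlag m z \<nu> d\<theta> d\<nu> (z k) = (\<Prod>i\<in>{..m}-{k}. z k - z i) * dcoord m z \<nu> d\<theta> d\<nu> k"
proof -
  define P where "P = (\<Prod>i\<in>{..m}-{k}. z k - z i)"
  define R where "R i = (\<Prod>l\<in>{..m}-{k}-{i}. z k - z l)" for i
  define a where "a j i = of_real (\<nu> j) * (- (\<i> * z i * of_real (d\<theta> i)) * (\<Prod>l\<in>{..m}-{j}-{i}. z k - z l))" for j i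
  have ne: "z k - z i \<noteq> 0" if "i \<in> {..m}-{k}" for i using inj that k by (auto simp: inj_on_def)
  have R: "R i = P / (z k - z i)" if "i \<in> {..m}-{k}" for i
    unfolding P_def R_def using ne[OF that] that by (subst prod.remove[of "{..m}-{k}" i]) auto
  have "dlag m z \<nu> d\<theta> d\<nu> (z k) = lag m z d\<nu> (z k) + (\<Sum>j\<le>m. \<Sum>i\<in>{..m}-{j}. a j i)"
    unfolding dlag_def lag_def a_def by (simp only: sum.distrib sum_distrib_left)
  also have "lag m z d\<nu> (z k) = of_real (d\<nu> k) * P" unfolding P_def by (rule lag_at[OF k])
  also have "(\<Sum>j\<le>m. \<Sum>i\<in>{..m}-{j}. a j i) = (\<Sum>i\<in>{..m}-{k}. a k i) + (\<Sum>j\<in>{..m}-{k}. \<Sum>i\<in>{..m}-{j}. a j i)"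
    using k by (subst sum.remove[of "{..m}" k]) auto
  also have "(\<Sum>j\<in>{..m}-{k}. \<Sum>i\<in>{..m}-{j}. a j i) = (\<Sum>j\<in>{..m}-{k}. a j k)"
  proof (rule sum.cong[OF refl])
    fix j assume j: "j \<in> {..m}-{k}"
    have "a j i = 0" if "i \<in> {..m}-{j}-{k}" for i
    proof -
      have "(\<Prod>l\<in>{..m}-{j}-{i}. z k - z l) = 0" using j k that by (intro prod_zero) (auto intro!: bexI[of _ k])
      then show ?thesis by (simp add: a_def)
    qed
    then have "(\<Sum>i\<in>{..m}-{j}. a j i) = (\<Sum>i\<in>{k}. a j i)" using j k by (intro sum.mono_neutral_right) auto
    then show "(\<Sum>i\<in>{..m}-{j}. a j i) = a j k" by simp
  qed
  also have "(\<Sum>i\<in>{..m}-{k}. a k i) + (\<Sum>j\<in>{..m}-{k}. a j k) = (\<Sum>i\<in>{..m}-{k}. a k i + a i k)"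
    by (simp add: sum.distrib)
  also have "\<dots> = (\<Sum>i\<in>{..m}-{k}. P * - (of_real (\<nu> k * d\<theta> i) * (\<i> * (z i / (z k - z i))) + of_real (\<nu> i * d\<theta> k) * (\<i> * (z k / (z k - z i)))))"
  proof (rule sum.cong[OF refl])
    fix i assume i: "i \<in> {..m}-{k}"
    have "{..m}-{i}-{k} = {..m}-{k}-{i}" by auto
    then have "a k i + a i k = (of_real (\<nu> k) * - (\<i> * z i * of_real (d\<theta> i)) + of_real (\<nu> i) * - (\<i> * z k * of_real (d\<theta> k))) * R i"
      unfolding a_def R_def by (simp only:) (simp add: algebra_simps)
    then show "a k i + a i k = P * - (of_real (\<nu> k * d\<theta> i) * (\<i> * (z i / (z k - z i))) + of_real (\<nu> i * d\<theta> k) * (\<i> * (z k / (z k - z i))))"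
      unfolding R[OF i] using ne[OF i] by (simp add: divide_simps) (simp add: algebra_simps)
  qed
  also have "\<dots> = P * - (\<Sum>i\<in>{..m}-{k}. of_real (\<nu> k * d\<theta> i) * (\<i> * (z i / (z k - z i))) + of_real (\<nu> i * d\<theta> k) * (\<i> * (z k / (z k - z i))))"
    by (simp only: sum_distrib_left[symmetric] sum_negf)
  finally show ?thesis unfolding dcoord_def P_def[symmetric] by (simp add: algebra_simps)
qed

lemma Re_circle_quotient:
  assumes "cmod a = 1" "cmod b = 1" "a \<noteq> b"
  shows "Re (b / (a - b)) = - 1 / 2" "Re (a / (a - b)) = 1 / 2"
proof -
  have pos: "(cmod (a - b))\<^sup>2 > 0" using assms(3) by simp
  have ab: "(Re a)\<^sup>2 + (Im a)\<^sup>2 = 1" "(Re b)\<^sup>2 + (Im b)\<^sup>2 = 1" using assms(1,2) by (auto simp: cmod_power2[symmetric])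
  have "(cmod (a - b))\<^sup>2 = - 2 * Re (b * cnj (a - b))"
    unfolding cmod_power2 using ab by (simp add: power2_eq_square algebra_simps)
  then have X: "(cmod (a - b))\<^sup>2 = - 2 * Re (b * cnj (a - b))" .
  have "Re (b / (a - b)) = Re (b * cnj (a - b)) / (cmod (a - b))\<^sup>2"
    by (subst complex_div_cnj) (simp only: Re_divide_of_real of_real_power[symmetric])
  also have "\<dots> = - 1 / 2" unfolding X using pos X by (simp del: complex_cnj_diff times_complex.sel)
  finally show 1: "Re (b / (a - b)) = - 1 / 2" .
  have "a / (a - b) = 1 + b / (a - b)" using assms(3) by (simp add: field_simps)
  then show "Re (a / (a - b)) = 1 / 2" using 1 by simp
qed

text \<open>On the circle \<open>z i / (z k - z i)\<close> has real part \<open>- 1 / 2\<close>, so the imaginary part is a fixed linear combination of the \<open>d\<theta>\<close>. With total mass one and total angle variation zero it collapses to a single term.\<close>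

lemma Im_dcoord:
  assumes z: "\<And>j. j \<le> m \<Longrightarrow> cmod (z j) = 1" and inj: "inj_on z {..m}" and k: "k \<le> m"
    and \<nu>: "(\<Sum>j\<le>m. \<nu> j) = 1" and d\<theta>: "(\<Sum>j\<le>m. d\<theta> j) = 0"
  shows "Im (dcoord m z \<nu> d\<theta> d\<nu> k) = - d\<theta> k / 2"
proof -
  have Im_mult: "Im (of_real r * (\<i> * q)) = r * Re q" for r q by simp
  have "Im (dcoord m z \<nu> d\<theta> d\<nu> k) = - (\<Sum>i\<in>{..m}-{k}. \<nu> k * d\<theta> i * Re (z i / (z k - z i)) + \<nu> i * d\<theta> k * Re (z k / (z k - z i)))"
    unfolding dcoord_def minus_complex.sel Im_sum plus_complex.sel Im_mult by simp
  also have "(\<Sum>i\<in>{..m}-{k}. \<nu> k * d\<theta> i * Re (z i / (z k - z i)) + \<nu> i * d\<theta> k * Re (z k / (z k - z i)))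
     = (\<Sum>i\<in>{..m}-{k}. - (\<nu> k / 2) * d\<theta> i + d\<theta> k / 2 * \<nu> i)"
  proof (rule sum.cong[OF refl])
    fix i assume i: "i \<in> {..m}-{k}"
    then have "z k \<noteq> z i" using inj k by (auto simp: inj_on_def)
    then show "\<nu> k * d\<theta> i * Re (z i / (z k - z i)) + \<nu> i * d\<theta> k * Re (z k / (z k - z i)) = - (\<nu> k / 2) * d\<theta> i + d\<theta> k / 2 * \<nu> i"
      using Re_circle_quotient[of "z k" "z i"] z i k by (simp add: field_simps)
  qed
  also have "\<dots> = - (\<nu> k / 2) * (\<Sum>i\<in>{..m}-{k}. d\<theta> i) + d\<theta> k / 2 * (\<Sum>i\<in>{..m}-{k}. \<nu> i)"
    by (simp only: sum.distrib sum_distrib_left)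
  also have "(\<Sum>i\<in>{..m}-{k}. d\<theta> i) = - d\<theta> k" using d\<theta> k by (subst (asm) sum.remove[of _ k]) auto
  also have "(\<Sum>i\<in>{..m}-{k}. \<nu> i) = 1 - \<nu> k" using \<nu> k by (subst (asm) sum.remove[of _ k]) auto
  finally show ?thesis by (simp add: field_simps)
qed

lemma dcoord_weights:
  assumes "\<And>j. j \<le> m \<Longrightarrow> d\<theta> j = 0" "k \<le> m"
  shows "dcoord m z \<nu> d\<theta> d\<nu> k = of_real (d\<nu> k)"
  using assms by (simp add: dcoord_def)

lemma has_derivative_cis_comp:
  assumes "(\<theta> has_derivative d\<theta>) (at y)"
  shows "((\<lambda>y. cis (\<theta> y)) has_derivative (\<lambda>h. \<i> * cis (\<theta> y) * of_real (d\<theta> h))) (at y)"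
proof -
  have "((\<lambda>y. \<i> * complex_of_real (\<theta> y)) has_derivative (\<lambda>h. \<i> * of_real (d\<theta> h))) (at y)"
    by (intro has_derivative_mult_right has_derivative_of_real assms)
  from has_derivative_compose[OF this has_field_derivative_imp_has_derivative[OF DERIV_exp]] show ?thesis
    by (simp add: cis_conv_exp mult_ac)
qed

lemma has_derivative_lag:
  assumes \<theta>: "\<And>j. (\<theta> j has_derivative d\<theta> j) (at y)" and \<nu>: "\<And>j. (\<nu> j has_derivative d\<nu> j) (at y)"
  shows "((\<lambda>y. lag m (\<lambda>j. cis (\<theta> j y)) (\<lambda>j. \<nu> j y) w) has_derivative
     (\<lambda>h. dlag m (\<lambda>j. cis (\<theta> j y)) (\<lambda>j. \<nu> j y) (\<lambda>j. d\<theta> j h) (\<lambda>j. d\<nu> j h) w)) (at y)"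
proof -
  have f: "((\<lambda>y. w - cis (\<theta> i y)) has_derivative (\<lambda>h. - (\<i> * cis (\<theta> i y) * of_real (d\<theta> i h)))) (at y)" for i
    using has_derivative_diff[OF has_derivative_const has_derivative_cis_comp[OF \<theta>[of i]], of w] by simp
  have p: "((\<lambda>y. \<Prod>i\<in>{..m}-{j}. w - cis (\<theta> i y)) has_derivative
     (\<lambda>h. \<Sum>i\<in>{..m}-{j}. - (\<i> * cis (\<theta> i y) * of_real (d\<theta> i h)) * (\<Prod>l\<in>{..m}-{j}-{i}. w - cis (\<theta> l y)))) (at y)" for j
    by (rule has_derivative_prod) (rule f)
  show ?thesis
    unfolding lag_def dlag_def
    by (rule has_derivative_eq_rhs[OF has_derivative_sum[OF has_derivative_mult[OF has_derivative_of_real[OF \<nu>] p]]])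
       (auto simp: fun_eq_iff intro!: sum.cong)
qed

lemma differentiable_coeff_prod:
  fixes f :: "nat \<Rightarrow> 'v::real_normed_vector \<Rightarrow> complex"
  assumes "finite A" "\<And>i. i \<in> A \<Longrightarrow> f i differentiable (at y)"
  shows "(\<lambda>y. Polynomial.coeff (\<Prod>i\<in>A. [:- f i y, 1:]) a) differentiable (at y)"
  using assms
proof (induction A arbitrary: a rule: finite_induct)
  case (insert i A)
  have "(\<lambda>y. Polynomial.coeff (\<Prod>i\<in>insert i A. [:- f i y, 1:]) a)
      = (\<lambda>y. - f i y * Polynomial.coeff (\<Prod>i\<in>A. [:- f i y, 1:]) a + (if a = 0 then 0 else Polynomial.coeff (\<Prod>i\<in>A. [:- f i y, 1:]) (a - 1)))"
    using insert(1,2) by (auto simp: fun_eq_iff coeff_pCons split: nat.split)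
  moreover have "(\<lambda>y. - f i y * Polynomial.coeff (\<Prod>i\<in>A. [:- f i y, 1:]) a + (if a = 0 then 0 else Polynomial.coeff (\<Prod>i\<in>A. [:- f i y, 1:]) (a - 1))) differentiable (at y)"
    using insert by (cases "a = 0") (auto intro!: differentiable_add differentiable_mult differentiable_minus)
  ultimately show ?case by simp
qed simp

lemma differentiable_coeff_lagpoly:
  fixes \<theta> \<nu> :: "nat \<Rightarrow> 'v::real_normed_vector \<Rightarrow> real"
  assumes "\<And>j. \<theta> j differentiable (at y)" "\<And>j. \<nu> j differentiable (at y)"
  shows "(\<lambda>y. Polynomial.coeff (lagpoly m (\<lambda>j. cis (\<theta> j y)) (\<lambda>j. \<nu> j y)) a) differentiable (at y)"
proof -
  have c: "(\<lambda>y. cis (\<theta> i y)) differentiable (at y)" for i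
    using assms(1)[of i] has_derivative_cis_comp unfolding differentiable_def by blast
  have n: "(\<lambda>y. complex_of_real (\<nu> i y)) differentiable (at y)" for i
    using assms(2)[of i] has_derivative_of_real unfolding differentiable_def by blast
  show ?thesis
    unfolding lagpoly_def coeff_sum coeff_smult
    by (intro differentiable_sum differentiable_mult n ballI finite_atMost differentiable_coeff_prod c) auto
qed

section \<open>The Jacobian determinant\<close>

text \<open>The change of variables formula in dimension \<open>m\<close>, as a predicate so that dimensions can be singled out.\<close>

definition cov_holds :: "nat \<Rightarrow> bool" where
  "cov_holds m \<longleftrightarrow> (\<forall>S. sv m S ` Reg m S \<in> sets (PiM {..<m} (\<lambda>_. lborel)) \<and>
     (\<forall>h\<in>borel_measurable (PiM {..<m} (\<lambda>_. lborel)).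
        (\<integral>\<^sup>+ s. h s * indicator (sv m S ` Reg m S) s \<partial>PiM {..<m} (\<lambda>_. lborel))
      = (\<integral>\<^sup>+ x. h (sv m S x) * ennreal ((1 / 2) ^ m * (cmod (vandermonde (Suc m) (\<lambda>k. cis (thv m S x k))))\<^sup>2)
             * indicator (Reg m S) x \<partial>PiM {..<m} (\<lambda>_. lborel))))"

text \<open>The calculus of derivatives is available for spaces whose dimension is a type. To obtain the formula for every natural number it suffices to treat one type, whose size is chosen to be a dimension where the formula fails, if there is any.\<close>

definition bad_dim :: nat where
  "bad_dim = (SOME m. 1 \<le> m \<and> \<not> cov_holds m)"

definition idx_half :: nat where
  "idx_half = max 1 bad_dim"

lemma idx_half_pos: "idx_half > 0"
  by (simp add: idx_half_def)

typedef idx = "{i::nat. i < 2 * idx_half}" morphisms idx_rep idx_abs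
  by (rule exI[of _ 0]) (use idx_half_pos in auto)

instance idx :: finite
proof
  have "UNIV = idx_abs ` {i::nat. i < 2 * idx_half}"
  proof -
    have "x \<in> idx_abs ` {i::nat. i < 2 * idx_half}" for x
      by (rule image_eqI[of _ _ "idx_rep x"]) (simp only: idx_rep_inverse, rule idx_rep)
    then show ?thesis by blast
  qed
  moreover have "finite (idx_abs ` {i::nat. i < 2 * idx_half})" by (intro finite_imageI finite_Collect_less_nat)
  ultimately show "finite (UNIV :: idx set)" by (simp only:)
qed

instantiation idx :: wellorder
begin
definition "a \<le> b \<longleftrightarrow> idx_rep a \<le> idx_rep b"
definition "a < b \<longleftrightarrow> idx_rep a < idx_rep b"
instance
proof
  fix P :: "idx \<Rightarrow> bool" and a
  assume H: "\<And>x. (\<And>y. y < x \<Longrightarrow> P y) \<Longrightarrow> P x"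
  show "P a"
  proof (induction "idx_rep a" arbitrary: a rule: less_induct)
    case less
    show ?case by (rule H, rule less) (simp add: less_idx_def)
  qed
qed (auto simp: less_eq_idx_def less_idx_def idx_rep_inject)
end

lemma idx_rep_abs [simp]: "i < 2 * idx_half \<Longrightarrow> idx_rep (idx_abs i) = i"
  by (simp add: idx_abs_inverse)

lemma idx_rep_less [simp]: "idx_rep i < 2 * idx_half"
  using idx_rep[of i] by simp

lemma bij_betw_idx: "bij_betw idx_rep UNIV {..<2 * idx_half}"
  by (rule bij_betwI[of _ _ _ idx_abs]) (auto simp: idx_rep_inverse)

lemma sum_idx: "(\<Sum>i\<in>UNIV. F (idx_rep i)) = (\<Sum>k<2 * idx_half. F k)"
  using sum.reindex_bij_betw[OF bij_betw_idx, of F] by simp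

lemma prod_idx: "(\<Prod>i\<in>UNIV. F (idx_rep i)) = (\<Prod>k<2 * idx_half. F k)"
  using prod.reindex_bij_betw[OF bij_betw_idx, of F] by simp

lemma sum_lessThan_add: "(\<Sum>k<m + n. F k) = (\<Sum>k<m. F k) + (\<Sum>k<n. F (m + k :: nat))" for F :: "nat \<Rightarrow> 'b::comm_monoid_add"
  by (induction n) (auto simp: add.assoc)

lemma prod_lessThan_add: "(\<Prod>k<m + n. F k) = (\<Prod>k<m. F k) * (\<Prod>k<n. F (m + k :: nat))" for F :: "nat \<Rightarrow> 'b::comm_monoid_mult"
  by (induction n) (auto simp: mult.assoc)

definition imat :: "(nat \<Rightarrow> nat \<Rightarrow> 'b) \<Rightarrow> 'b ^ idx ^ idx" where
  "imat f = (\<chi> i j. f (idx_rep i) (idx_rep j))"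

lemma imat_mult: "imat f ** imat g = imat (\<lambda>i j. \<Sum>k<2 * idx_half. f i k * g k j)" for f g :: "nat \<Rightarrow> nat \<Rightarrow> complex"
proof -
  have "(\<Sum>k\<in>UNIV. f (idx_rep i) (idx_rep k) * g (idx_rep k) (idx_rep j)) = (\<Sum>k<2 * idx_half. f (idx_rep i) k * g k (idx_rep j))" for i j
    by (rule sum_idx)
  then show ?thesis by (simp add: imat_def matrix_matrix_mult_def)
qed

lemma imat_cong:
  assumes "\<And>i j. i < 2 * idx_half \<Longrightarrow> j < 2 * idx_half \<Longrightarrow> f i j = g i j"
  shows "imat f = imat g"
  unfolding imat_def
  by (rule arg_cong[where f = vec_lambda], rule ext, rule arg_cong[where f = vec_lambda], rule ext, rule assms) (rule idx_rep_less)+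

lemma det_imat_lower:
  fixes f :: "nat \<Rightarrow> nat \<Rightarrow> complex"
  assumes "\<And>i j. i < j \<Longrightarrow> j < 2 * idx_half \<Longrightarrow> f i j = 0"
  shows "Determinants.det (imat f) = (\<Prod>k<2 * idx_half. f k k)"
proof -
  have "Determinants.det (imat f) = (\<Prod>i\<in>UNIV. vec_nth (vec_nth (imat f) i) i)"
  proof (rule det_lowerdiagonal)
    fix i j :: idx assume "i < j"
    then have "f (idx_rep i) (idx_rep j) = 0" by (intro assms) (simp_all add: less_idx_def)
    then show "vec_nth (vec_nth (imat f) i) j = 0" by (simp add: imat_def)
  qed
  also have "\<dots> = (\<Prod>i\<in>UNIV. f (idx_rep i) (idx_rep i))" by (simp add: imat_def)
  also have "\<dots> = (\<Prod>k<2 * idx_half. f k k)" by (rule prod_idx)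
  finally show ?thesis .
qed

lemma det_imat_upper:
  fixes f :: "nat \<Rightarrow> nat \<Rightarrow> complex"
  assumes "\<And>i j. j < i \<Longrightarrow> i < 2 * idx_half \<Longrightarrow> f i j = 0"
  shows "Determinants.det (imat f) = (\<Prod>k<2 * idx_half. f k k)"
proof -
  have "Determinants.det (imat f) = (\<Prod>i\<in>UNIV. vec_nth (vec_nth (imat f) i) i)"
  proof (rule det_upperdiagonal)
    fix i j :: idx assume "j < i"
    then have "f (idx_rep i) (idx_rep j) = 0" by (intro assms) (simp_all add: less_idx_def)
    then show "vec_nth (vec_nth (imat f) i) j = 0" by (simp add: imat_def)
  qed
  also have "\<dots> = (\<Prod>i\<in>UNIV. f (idx_rep i) (idx_rep i))" by (simp add: imat_def)
  also have "\<dots> = (\<Prod>k<2 * idx_half. f k k)" by (rule prod_idx)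
  finally show ?thesis .
qed

text \<open>The matrix \<open>f\<close> acting on complex coordinates together with their conjugates.\<close>

definition cblock :: "nat \<Rightarrow> (nat \<Rightarrow> nat \<Rightarrow> complex) \<Rightarrow> nat \<Rightarrow> nat \<Rightarrow> complex" where
  "cblock m f i j = (if i < m \<and> j < m then f i j else if m \<le> i \<and> m \<le> j then cnj (f (i - m) (j - m)) else 0)"

text \<open>The passage from real and imaginary parts to a complex number and its conjugate.\<close>

definition cplx :: "nat \<Rightarrow> nat \<Rightarrow> nat \<Rightarrow> complex" where
  "cplx m i j = (if i < m then (if j = i then 1 else if j = m + i then \<i> else 0)
                 else (if j = i - m then 1 else if j = i then - \<i> else 0))"

lemma cblock_low [simp]:
  "k < m \<Longrightarrow> cblock m f i k = (if i < m then f i k else 0)"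
  "k < m \<Longrightarrow> cblock m f k j = (if j < m then f k j else 0)"
  by (simp_all add: cblock_def)

lemma cblock_high [simp]:
  "cblock m f i (m + k) = (if i < m then 0 else cnj (f (i - m) k))"
  "cblock m f (m + k) j = (if j < m then 0 else cnj (f k (j - m)))"
  by (simp_all add: cblock_def)

lemma cblock_mult_sum:
  "(\<Sum>k<2 * m. cblock m f i k * cblock m g k j) = cblock m (\<lambda>i j. \<Sum>k<m. f i k * g k j) i j"
proof -
  have 1: "(\<Sum>k<m. cblock m f i k * cblock m g k j) = (\<Sum>k<m. if i < m \<and> j < m then f i k * g k j else 0)"
    by (rule sum.cong[OF refl]) simp
  have 2: "(\<Sum>k<m. cblock m f i (m + k) * cblock m g (m + k) j) = (\<Sum>k<m. if \<not> i < m \<and> \<not> j < m then cnj (f (i - m) k * g k (j - m)) else 0)"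
    by (rule sum.cong[OF refl]) simp
  show ?thesis
    unfolding mult_2 sum_lessThan_add 1 2 by (cases "i < m"; cases "j < m") (simp_all add: cblock_def)
qed

lemma cplx_mult_sum:
  assumes "i < 2 * m"
  shows "(\<Sum>k<2 * m. cplx m i k * of_real (g k j)) = (if i < m then Complex (g i j) (g (m + i) j) else cnj (Complex (g (i - m) j) (g i j)))"
proof (cases "i < m")
  case True
  have "(\<Sum>k<2 * m. cplx m i k * of_real (g k j)) = (\<Sum>k\<in>{i, m + i}. cplx m i k * of_real (g k j))"
  proof (rule sum.mono_neutral_right)
    show "{i, m + i} \<subseteq> {..<2 * m}" using True by simp
    show "\<forall>k\<in>{..<2 * m} - {i, m + i}. cplx m i k * of_real (g k j) = 0" using True by (simp add: cplx_def)
  qed simp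
  also have "\<dots> = cplx m i i * of_real (g i j) + cplx m i (m + i) * of_real (g (m + i) j)" using True by simp
  also have "\<dots> = Complex (g i j) (g (m + i) j)" using True by (simp add: cplx_def complex_eq_iff)
  finally show ?thesis using True by simp
next
  case False
  have ne: "i - m \<noteq> i" using False assms by linarith
  have "(\<Sum>k<2 * m. cplx m i k * of_real (g k j)) = (\<Sum>k\<in>{i - m, i}. cplx m i k * of_real (g k j))"
  proof (rule sum.mono_neutral_right)
    show "{i - m, i} \<subseteq> {..<2 * m}" using assms by simp
    show "\<forall>k\<in>{..<2 * m} - {i - m, i}. cplx m i k * of_real (g k j) = 0" using False by (simp add: cplx_def)
  qed simp
  also have "\<dots> = cplx m i (i - m) * of_real (g (i - m) j) + cplx m i i * of_real (g i j)" using ne by simp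
  also have "\<dots> = cnj (Complex (g (i - m) j) (g i j))" using False ne by (simp add: cplx_def complex_eq_iff)
  finally show ?thesis using False by simp
qed

lemma det_cplx_nonzero:
  assumes m: "idx_half = m"
  shows "Determinants.det (imat (cplx m)) \<noteq> 0"
proof -
  have inv: "(\<Sum>k<2 * m. cplx m i k * cnj (cplx m j k)) = (if i = j then 2 else 0)" if ij: "i < 2 * m" "j < 2 * m" for i j
  proof -
    define l where "l = (if i < m then i else i - m)"
    have l: "l < m"
    proof (cases "i < m")
      case False
      then show ?thesis using ij unfolding l_def by simp
    qed (simp add: l_def)
    have "(\<Sum>k<2 * m. cplx m i k * cnj (cplx m j k)) = (\<Sum>k\<in>{l, m + l}. cplx m i k * cnj (cplx m j k))"
    proof (rule sum.mono_neutral_right)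
      show "{l, m + l} \<subseteq> {..<2 * m}" using l by simp
      show "\<forall>k\<in>{..<2 * m} - {l, m + l}. cplx m i k * cnj (cplx m j k) = 0"
        using ij by (cases "i < m") (simp_all add: cplx_def l_def)
    qed simp
    also have "\<dots> = cplx m i l * cnj (cplx m j l) + cplx m i (m + l) * cnj (cplx m j (m + l))" using l by simp
    also have "\<dots> = (if i = j then 2 else 0)"
    proof (cases "i < m")
      case True
      then have i: "cplx m i l = 1" "cplx m i (m + l) = \<i>" "l = i" by (simp_all add: cplx_def l_def)
      show ?thesis unfolding i using True ij by (cases "j < m") (auto simp: cplx_def)
    next
      case False
      then have i: "cplx m i l = 1" "cplx m i (m + l) = - \<i>" "l = i - m" "m + l = i" using ij by (simp_all add: cplx_def l_def)
      show ?thesis unfolding i using False ij by (cases "j < m") (auto simp: cplx_def)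
    qed
    finally show ?thesis .
  qed
  have "imat (cplx m) ** imat (\<lambda>k j. cnj (cplx m j k)) = imat (\<lambda>i j. if i = j then 2 else 0)"
    unfolding imat_mult by (rule imat_cong) (use inv m in auto)
  then have "Determinants.det (imat (cplx m)) * Determinants.det (imat (\<lambda>k j. cnj (cplx m j k))) = Determinants.det (imat (\<lambda>i j. if i = j then 2 else 0))"
    by (metis det_mul)
  also have "\<dots> = 2 ^ (2 * m)" using m by (subst det_imat_lower) auto
  finally show ?thesis by auto
qed

text \<open>The Newton basis triangularises evaluation at the nodes.\<close>

definition newton :: "(nat \<Rightarrow> complex) \<Rightarrow> nat \<Rightarrow> complex poly" where
  "newton z a = (\<Prod>i<a. [:- z i, 1:])"

lemma degree_newton: "Polynomial.degree (newton z a) = a"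
  unfolding newton_def by (subst degree_prod_eq_sum_degree) auto

lemma coeff_newton_top: "Polynomial.coeff (newton z a) a = 1"
  using degree_newton[of z a] monic_prod[of "{..<a}" "\<lambda>i. [:- z i, 1:]"] by (auto simp: newton_def)

text \<open>Evaluation at the nodes is a Vandermonde matrix \<open>V\<close>, doubled by conjugation. In the Lagrange normalisation the differential becomes \<open>Y\<close>, which is triangular by \<open>W1\<close> and \<open>W2\<close> with diagonal entries \<open>1\<close> and \<open>- 1 / 2\<close>. So \<open>V C J = D C Y\<close> with \<open>C\<close> the complexification and \<open>D\<close> the diagonal of node differences; the determinants of \<open>D\<close> and \<open>V\<close> leave the square of the Vandermonde product.\<close>

lemma det_jacobian:
  assumes m: "idx_half = m"
    and z: "\<And>j. j \<le> m \<Longrightarrow> cmod (z j) = 1" and inj: "inj_on z {..m}"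
    and J: "\<And>k j. k < m \<Longrightarrow> j < 2 * m \<Longrightarrow>
       (\<Sum>a<m. z k ^ a * Complex (J a j) (J (m + a) j)) = (\<Prod>i\<in>{..m}-{k}. z k - z i) * W k j"
    and W1: "\<And>k j. k < m \<Longrightarrow> j < m \<Longrightarrow> W k j = (if j = k then 1 else 0)"
    and W2: "\<And>k j. k < m \<Longrightarrow> j < m \<Longrightarrow> Im (W k (m + j)) = (if j = k then - 1 / 2 else 0)"
  shows "\<bar>Determinants.det (imat J :: real ^ idx ^ idx)\<bar> = (1 / 2) ^ m * (cmod (vandermonde (Suc m) z))\<^sup>2"
proof -
  let ?P = "\<lambda>k. \<Prod>i\<in>{..m}-{k}. z k - z i"
  let ?V = "imat (cblock m (\<lambda>k a. z k ^ a))"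
  let ?U = "imat (cblock m (\<lambda>b a. Polynomial.coeff (newton z a) b))"
  let ?T = "imat (cblock m (\<lambda>k a. poly (newton z a) (z k)))"
  let ?D = "imat (cblock m (\<lambda>k j. if k = j then ?P k else 0))"
  let ?C = "imat (cplx m)"
  define Y where "Y i j = (if i < m then Re (W i j) else Im (W (i - m) j))" for i j
  let ?Y = "imat (\<lambda>i j. complex_of_real (Y i j))" and ?J = "imat (\<lambda>i j. complex_of_real (J i j))"
  have VU: "?V ** ?U = ?T"
    unfolding imat_mult m
  proof (rule imat_cong, unfold m)
    fix i j assume ij: "i < 2 * m" "j < 2 * m"
    have "(\<Sum>k<m. z i ^ k * Polynomial.coeff (newton z j) k) = poly (newton z j) (z i)" if "j < m" for i j
    proof -
      have "poly (newton z j) (z i) = (\<Sum>k\<le>j. Polynomial.coeff (newton z j) k * z i ^ k)"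
        using poly_altdef[of "newton z j" "z i"] by (simp add: degree_newton)
      also have "\<dots> = (\<Sum>k<m. Polynomial.coeff (newton z j) k * z i ^ k)"
        using that degree_newton[of z j] by (intro sum.mono_neutral_left) (auto simp: coeff_eq_0)
      finally show ?thesis by (simp add: mult.commute)
    qed
    then show "(\<Sum>k<2 * m. cblock m (\<lambda>k a. z k ^ a) i k * cblock m (\<lambda>b a. Polynomial.coeff (newton z a) b) k j) = cblock m (\<lambda>k a. poly (newton z a) (z k)) i j"
      unfolding cblock_mult_sum using ij by (auto simp: cblock_def)
  qed
  have detU: "Determinants.det ?U = 1"
  proof -
    have "Determinants.det ?U = (\<Prod>k<2 * idx_half. cblock m (\<lambda>b a. Polynomial.coeff (newton z a) b) k k)"
      by (rule det_imat_upper) (auto simp: cblock_def coeff_eq_0 degree_newton)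
    also have "\<dots> = 1" by (rule prod.neutral) (auto simp: cblock_def coeff_newton_top)
    finally show ?thesis .
  qed
  have detT: "Determinants.det ?T = (\<Prod>k<m. poly (newton z k) (z k)) * (\<Prod>k<m. cnj (poly (newton z k) (z k)))"
  proof -
    have "Determinants.det ?T = (\<Prod>k<2 * idx_half. cblock m (\<lambda>k a. poly (newton z a) (z k)) k k)"
    proof (rule det_imat_lower)
      fix i j assume ij: "i < j" "j < 2 * idx_half"
      have "poly (newton z b) (z a) = 0" if "a < b" for a b
        unfolding newton_def poly_prod using that by (intro prod_zero) auto
      then show "cblock m (\<lambda>k a. poly (newton z a) (z k)) i j = 0" using ij by (auto simp: cblock_def)
    qed
    then show ?thesis unfolding m mult_2 prod_lessThan_add by (simp add: cblock_def)
  qed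
  have detV: "Determinants.det ?V = Determinants.det ?T"
    using VU detU by (metis det_mul mult.right_neutral)
  have detD: "Determinants.det ?D = (\<Prod>k<m. ?P k) * (\<Prod>k<m. cnj (?P k))"
  proof -
    have "Determinants.det ?D = (\<Prod>k<2 * idx_half. cblock m (\<lambda>k j. if k = j then ?P k else 0) k k)"
      by (rule det_imat_lower) (auto simp: cblock_def)
    then show ?thesis unfolding m mult_2 prod_lessThan_add by (simp add: cblock_def)
  qed
  have detY: "Determinants.det ?Y = (- 1 / 2) ^ m"
  proof -
    have "Determinants.det ?Y = (\<Prod>k<2 * idx_half. complex_of_real (Y k k))"
    proof (rule det_imat_upper, unfold m)
      fix i j assume ij: "j < i" "i < 2 * m"
      show "complex_of_real (Y i j) = 0"
      proof (cases "i < m")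
        case True
        then show ?thesis using ij W1[of i j] by (simp add: Y_def)
      next
        case False
        then show ?thesis
        proof (cases "j < m")
          case True
          then show ?thesis using ij False W1[of "i - m" j] by (simp add: Y_def)
        next
          case False
          then obtain j' where j': "j = m + j'" using le_Suc_ex by fastforce
          then show ?thesis using ij \<open>\<not> i < m\<close> W2[of "i - m" j'] by (simp add: Y_def)
        qed
      qed
    qed
    also have "\<dots> = (\<Prod>k<m. complex_of_real (Y k k)) *(\<Prod>k<m. complex_of_real (Y (m + k) (m + k)))"
      unfolding m mult_2 prod_lessThan_add ..
    also have "\<dots> = (\<Prod>k<m. 1) * (\<Prod>k<m. - 1 / 2)"
      using W1 W2 by (intro arg_cong2[where f = "(*)"] prod.cong) (auto simp: Y_def)
    finally show ?thesis by simp
  qed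
  have CJ: "?C ** ?J = imat (\<lambda>i j. if i < m then Complex (J i j) (J (m + i) j) else cnj (Complex (J (i - m) j) (J i j)))"
    unfolding imat_mult
  proof (rule imat_cong, unfold m)
    fix i j assume "i < 2 * m"
    then show "(\<Sum>k<2 * m. cplx m i k * complex_of_real (J k j)) = (if i < m then Complex (J i j) (J (m + i) j) else cnj (Complex (J (i - m) j) (J i j)))"
      by (rule cplx_mult_sum)
  qed
  have CY: "?C ** ?Y = imat (\<lambda>i j. if i < m then W i j else cnj (W (i - m) j))"
    unfolding imat_mult
  proof (rule imat_cong, unfold m)
    fix i j assume ij: "i < 2 * m" "j < 2 * m"
    have "Y (m + i) j = Im (W i j)" "m + (i - m) = i \<or> i < m" by (auto simp: Y_def)
    then show "(\<Sum>k<2 * m. cplx m i k * of_real (Y k j)) = (if i < m then W i j else cnj (W (i - m) j))"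
      unfolding cplx_mult_sum[OF ij(1)] using ij by (auto simp: Y_def complex_eq_iff)
  qed
  have VCJ: "?V ** (?C ** ?J) = ?D ** (?C ** ?Y)"
    unfolding CJ CY
    unfolding imat_mult
  proof (rule imat_cong, unfold m)
    fix i j assume ij: "i < 2 * m" "j < 2 * m"
    let ?F = "\<lambda>i j. if i < m then Complex (J i j) (J (m + i) j) else cnj (Complex (J (i - m) j) (J i j))"
    let ?G = "\<lambda>i j. if i < m then W i j else cnj (W (i - m) j)"
    have L: "(\<Sum>k<2 * m. cblock m (\<lambda>k a. z k ^ a) i k * ?F k j) =
       (if i < m then (\<Sum>a<m. z i ^ a * Complex (J a j) (J (m + a) j)) else cnj (\<Sum>a<m. z (i - m) ^ a * Complex (J a j) (J (m + a) j)))"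
      unfolding mult_2 sum_lessThan_add by (auto simp: cblock_def cnj_sum)
    have R: "(\<Sum>k<2 * m. cblock m (\<lambda>k j. if k = j then ?P k else 0) i k * ?G k j) =
       (if i < m then ?P i * W i j else cnj (?P (i - m) * W (i - m) j))"
    proof -
      have "(\<Sum>k<2 * m. cblock m (\<lambda>k j. if k = j then ?P k else 0) i k * ?G k j)
        = (\<Sum>k\<in>{i}. cblock m (\<lambda>k j. if k = j then ?P k else 0) i k * ?G k j)"
        using ij by (intro sum.mono_neutral_right) (auto simp: cblock_def)
      then show ?thesis by (auto simp: cblock_def)
    qed
    show "(\<Sum>k<2 * m. cblock m (\<lambda>k a. z k ^ a) i k * ?F k j) = (\<Sum>k<2 * m. cblock m (\<lambda>k j. if k = j then ?P k else 0) i k * ?G k j)"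
      unfolding L R using J[of i j] J[of "i - m" j] ij by auto
  qed
  have "Determinants.det ?V * (Determinants.det ?C * Determinants.det ?J) = Determinants.det ?D * (Determinants.det ?C * Determinants.det ?Y)"
    using arg_cong[OF VCJ, of Determinants.det] by (simp only: det_mul)
  then have main: "Determinants.det ?T * Determinants.det ?J = Determinants.det ?D * Determinants.det ?Y"
    using det_cplx_nonzero[OF m] unfolding detV by (simp add: mult.left_commute)
  have detJ: "Determinants.det ?J = of_real (Determinants.det (imat J :: real ^ idx ^ idx))"
    unfolding Determinants.det_def imat_def by simp
  define n where "n k = cmod (poly (newton z k) (z k))" for k
  have split: "cmod (?P k) = n k * (\<Prod>i\<in>{k<..m}. cmod (z i - z k))" if "k < m" for k
  proof -
    have set: "{..m}-{k} = {..<k} \<union> {k<..m}" using that by auto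
    have "?P k = (\<Prod>i<k. z k - z i) * (\<Prod>i\<in>{k<..m}. z k - z i)"
      unfolding set by (rule prod.union_disjoint) auto
    then have "cmod (?P k) = cmod (\<Prod>i<k. z k - z i) * (\<Prod>i\<in>{k<..m}. cmod (z k - z i))"
      by (simp only: norm_mult prod_norm)
    also have "(\<Prod>i<k. z k - z i) = poly (newton z k) (z k)" by (simp add: newton_def poly_prod)
    also have "(\<Prod>i\<in>{k<..m}. cmod (z k - z i)) = (\<Prod>i\<in>{k<..m}. cmod (z i - z k))"
      by (rule prod.cong[OF refl]) (rule norm_minus_commute)
    finally show ?thesis unfolding n_def .
  qed
  have npos: "n k > 0" if "k < m" for k
  proof -
    have "z k - z i \<noteq> 0" if "i < k" for i using inj_onD[OF inj, of k i] \<open>k < m\<close> that by force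
    then show ?thesis by (simp add: n_def newton_def poly_prod)
  qed
  have vdm: "(\<Prod>k<M. \<Prod>i\<in>{k<..M}. cmod (z i - z k)) = cmod (vandermonde (Suc M) z)" for M
  proof (induction M)
    case 0
    show ?case by (simp add: vandermonde_def)
  next
    case (Suc M)
    have *: "(\<Prod>i\<in>{k<..Suc M}. cmod (z i - z k)) = (\<Prod>i\<in>{k<..M}. cmod (z i - z k)) * cmod (z (Suc M) - z k)"
      if "k < Suc M" for k
    proof -
      have "{k<..Suc M} = insert (Suc M) {k<..M}" using that by auto
      then show ?thesis by (simp add: mult.commute)
    qed
    have "(\<Prod>k<Suc M. \<Prod>i\<in>{k<..Suc M}. cmod (z i - z k))
      = (\<Prod>k<Suc M. (\<Prod>i\<in>{k<..M}. cmod (z i - z k)) * cmod (z (Suc M) - z k))"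
      by (rule prod.cong[OF refl]) (rule *, simp)
    also have "\<dots> = (\<Prod>k<M. \<Prod>i\<in>{k<..M}. cmod (z i - z k)) * (\<Prod>k<Suc M. cmod (z (Suc M) - z k))"
      unfolding prod.distrib by simp
    also have "\<dots> = cmod (vandermonde (Suc M) z) * (\<Prod>k<Suc M. cmod (z (Suc M) - z k))"
      by (rule arg_cong[OF Suc])
    also have "\<dots> = cmod (vandermonde (Suc M) z) * cmod (\<Prod>k<Suc M. z (Suc M) - z k)" by (simp only: prod_norm)
    also have "\<dots> = cmod (vandermonde (Suc (Suc M)) z)"
      by (simp only: vandermonde_def prod.lessThan_Suc[of _ "Suc M"] norm_mult)
    finally show ?case .
  qed
  have "cmod (Determinants.det ?T) = (\<Prod>k<m. n k)\<^sup>2"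
    unfolding detT by (simp only: norm_mult n_def prod_norm[symmetric] power2_eq_square complex_mod_cnj flip: cnj_prod)
  moreover have "cmod (Determinants.det ?D) = (\<Prod>k<m. n k)\<^sup>2 * (cmod (vandermonde (Suc m) z))\<^sup>2"
  proof -
    have "cmod (Determinants.det ?D) = (\<Prod>k<m. cmod (?P k))\<^sup>2"
      unfolding detD by (simp only: norm_mult prod_norm power2_eq_square complex_mod_cnj flip: cnj_prod)
    also have "(\<Prod>k<m. cmod (?P k)) = (\<Prod>k<m. n k * (\<Prod>i\<in>{k<..m}. cmod (z i - z k)))"
      by (rule prod.cong[OF refl], rule split) simp
    also have "\<dots> = (\<Prod>k<m. n k) * cmod (vandermonde (Suc m) z)" unfolding prod.distrib vdm ..
    finally show ?thesis by (simp add: power_mult_distrib)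
  qed
  moreover have "cmod (Determinants.det ?Y) = (1 / 2) ^ m" unfolding detY by (simp add: norm_power norm_divide)
  moreover have "cmod (Determinants.det ?J) = \<bar>Determinants.det (imat J :: real ^ idx ^ idx)\<bar>" unfolding detJ by simp
  moreover have "(\<Prod>k<m. n k) > 0" by (rule prod_pos) (rule npos, simp)
  ultimately show ?thesis
  proof -
    assume T: "cmod (Determinants.det ?T) = (\<Prod>k<m. n k)\<^sup>2"
      and D: "cmod (Determinants.det ?D) = (\<Prod>k<m. n k)\<^sup>2 * (cmod (vandermonde (Suc m) z))\<^sup>2"
      and Y: "cmod (Determinants.det ?Y) = (1 / 2) ^ m"
      and J: "cmod (Determinants.det ?J) = \<bar>Determinants.det (imat J :: real ^ idx ^ idx)\<bar>"
      and pos: "(\<Prod>k<m. n k) > 0"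
    have "cmod (Determinants.det ?T) * cmod (Determinants.det ?J) = cmod (Determinants.det ?D) * cmod (Determinants.det ?Y)"
      unfolding norm_mult[symmetric] main ..
    then have "(\<Prod>k<m. n k)\<^sup>2 * \<bar>Determinants.det (imat J :: real ^ idx ^ idx)\<bar>
        = (\<Prod>k<m. n k)\<^sup>2 * ((1 / 2) ^ m * (cmod (vandermonde (Suc m) z))\<^sup>2)"
      unfolding T D Y J by (simp only: mult_ac)
    moreover have "(\<Prod>k<m. n k)\<^sup>2 \<noteq> 0" by (rule less_imp_neq[symmetric], rule zero_less_power, rule pos)
    ultimately show ?thesis by (simp only: mult_cancel_left simp_thms)
  qed
qed

section \<open>Complex products as Euclidean spaces\<close>

text \<open>Induction on the index set, where each complex coordinate is split into two real ones by Tonelli.\<close>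

lemma nn_integral_PiM_complex_real:
  fixes u v :: "nat \<Rightarrow> 'j" and H :: "(nat \<Rightarrow> complex) \<Rightarrow> ennreal"
  assumes "finite I" "inj_on u I" "inj_on v I" "u ` I \<inter> v ` I = {}"
    and "H \<in> borel_measurable (PiM I (\<lambda>_. lborel))"
  shows "(\<integral>\<^sup>+ x. H x \<partial>PiM I (\<lambda>_. lborel)) =
    (\<integral>\<^sup>+ w. H (\<lambda>k\<in>I. Complex (w (u k)) (w (v k))) \<partial>PiM (u ` I \<union> v ` I) (\<lambda>_. lborel :: real measure))"
  using assms
proof (induction I arbitrary: H rule: finite_induct)
  case empty
  interpret R: product_sigma_finite "\<lambda>_::'j. lborel :: real measure" by standard
  show ?case by (subst lborel_prod.nn_integral_empty, simp) (simp only: image_empty Un_absorb, subst R.nn_integral_empty, simp_all add: restrict_def)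
next
  case (insert i I)
  interpret R: product_sigma_finite "\<lambda>_::'j. lborel :: real measure" by standard
  have inj: "inj_on u I" "inj_on v I" "u ` I \<inter> v ` I = {}" using insert.prems(1-3) by auto
  have uI: "u i \<notin> u ` I" "v i \<notin> v ` I" "u i \<notin> v ` I" "v i \<notin> u ` I" "u i \<noteq> v i" using insert.prems(1-3) insert.hyps(2) by auto
  let ?J = "u ` I \<union> v ` I"
  have fin: "finite ?J" "finite (insert (v i) ?J)" using insert.hyps(1) by auto
  have set: "u ` insert i I \<union> v ` insert i I = insert (u i) (insert (v i) ?J)" by auto
  have nin: "v i \<notin> ?J" "u i \<notin> insert (v i) ?J" using uI by auto
  note [measurable] = insert.prems(4)
  define F where "F w = H (\<lambda>k\<in>insert i I. Complex (w (u k)) (w (v k)))" for w :: "'j \<Rightarrow> real"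
  have F [measurable]: "F \<in> borel_measurable (PiM (insert (u i) (insert (v i) ?J)) (\<lambda>_. lborel))"
  proof -
    have "(\<lambda>w. \<lambda>k\<in>insert i I. Complex (w (u k)) (w (v k))) \<in> measurable (PiM (insert (u i) (insert (v i) ?J)) (\<lambda>_. lborel)) (PiM (insert i I) (\<lambda>_. lborel))"
    proof (rule measurable_restrict)
      fix k assume k: "k \<in> insert i I"
      have "(\<lambda>w. w (u k)) \<in> borel_measurable (PiM (insert (u i) (insert (v i) ?J)) (\<lambda>_. lborel :: real measure))"
        "(\<lambda>w. w (v k)) \<in> borel_measurable (PiM (insert (u i) (insert (v i) ?J)) (\<lambda>_. lborel :: real measure))"
        using k by (auto intro!: measurable_component_singleton[where M = "\<lambda>_. lborel", simplified])
      then show "(\<lambda>w. Complex (w (u k)) (w (v k))) \<in> measurable (PiM (insert (u i) (insert (v i) ?J)) (\<lambda>_. lborel :: real measure)) lborel"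
        unfolding measurable_lborel1 by (rule measurable_Complex)
    qed
    from measurable_compose[OF this insert.prems(4)] show ?thesis unfolding F_def .
  qed
  have upd: "F (w(v i := y, u i := x)) = H ((\<lambda>k\<in>I. Complex (w (u k)) (w (v k)))(i := Complex x y))" for w x y
    unfolding F_def
  proof (rule arg_cong[where f = H], rule ext)
    fix k
    have *: "u k \<noteq> u i" "u k \<noteq> v i" "v k \<noteq> u i" "v k \<noteq> v i" if "k \<in> I" using that uI by (metis imageI)+
    have "k = i \<or> (k \<noteq> i \<and> k \<in> I) \<or> (k \<noteq> i \<and> k \<notin> I)" by blast
    then show "(\<lambda>k\<in>insert i I. Complex ((w(v i := y, u i := x)) (u k)) ((w(v i := y, u i := x)) (v k))) k
      = ((\<lambda>k\<in>I. Complex (w (u k)) (w (v k)))(i := Complex x y)) k"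
    proof (elim disjE conjE)
      assume "k = i"
      then show ?thesis using uI(5) by (simp add: fun_upd_def)
    next
      assume "k \<noteq> i" "k \<in> I"
      then show ?thesis using *[OF \<open>k \<in> I\<close>] by (simp add: fun_upd_def)
    next
      assume "k \<noteq> i" "k \<notin> I"
      then show ?thesis by simp
    qed
  qed
  have "(\<integral>\<^sup>+ x. H x \<partial>PiM (insert i I) (\<lambda>_. lborel)) = (\<integral>\<^sup>+ y. \<integral>\<^sup>+ x. H (x(i := y)) \<partial>PiM I (\<lambda>_. lborel) \<partial>lborel)"
    by (rule lborel_prod.product_nn_integral_insert_rev) (use insert in auto)
  also have "\<dots> = (\<integral>\<^sup>+ y. \<integral>\<^sup>+ w. H ((\<lambda>k\<in>I. Complex (w (u k)) (w (v k)))(i := y)) \<partial>PiM ?J (\<lambda>_. lborel) \<partial>lborel)"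
  proof (rule nn_integral_cong)
    fix y
    have "(\<lambda>x. H (x(i := y))) \<in> borel_measurable (PiM I (\<lambda>_. lborel))"
      by measurable
    from insert.IH[OF inj this]
    show "(\<integral>\<^sup>+ x. H (x(i := y)) \<partial>PiM I (\<lambda>_. lborel)) = (\<integral>\<^sup>+ w. H ((\<lambda>k\<in>I. Complex (w (u k)) (w (v k)))(i := y)) \<partial>PiM ?J (\<lambda>_. lborel))" .
  qed
  also have "\<dots> = (\<integral>\<^sup>+ x. \<integral>\<^sup>+ y. (\<integral>\<^sup>+ w. F (w(v i := y, u i := x)) \<partial>PiM ?J (\<lambda>_. lborel)) \<partial>lborel \<partial>lborel)"
  proof -
    interpret RJ: finite_product_sigma_finite "\<lambda>_::'j. lborel :: real measure" ?J by standard (rule fin(1))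
    have "(\<lambda>p. H ((\<lambda>k\<in>I. Complex (snd p (u k)) (snd p (v k)))(i := fst p))) \<in> borel_measurable (borel \<Otimes>\<^sub>M PiM ?J (\<lambda>_. lborel :: real measure))"
    proof (rule measurable_compose[OF _ insert.prems(4)], rule measurable_fun_upd[where J = I])
      show "insert i I = I \<union> {i}" by simp
      show "fst \<in> measurable (borel \<Otimes>\<^sub>M PiM ?J (\<lambda>_. lborel :: real measure)) lborel" by simp
      show "(\<lambda>p. \<lambda>k\<in>I. Complex (snd p (u k)) (snd p (v k))) \<in> measurable (borel \<Otimes>\<^sub>M PiM ?J (\<lambda>_. lborel :: real measure)) (PiM I (\<lambda>_. lborel :: complex measure))"
      proof (rule measurable_restrict)
        fix k assume k: "k \<in> I"
        have "(\<lambda>w. w (u k)) \<in> borel_measurable (PiM ?J (\<lambda>_. lborel :: real measure))"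
          "(\<lambda>w. w (v k)) \<in> borel_measurable (PiM ?J (\<lambda>_. lborel :: real measure))"
          using k by (auto intro!: measurable_component_singleton[where M = "\<lambda>_. lborel", simplified])
        from this[THEN measurable_compose[OF measurable_snd]] have "(\<lambda>p. snd p (u k)) \<in> borel_measurable (borel \<Otimes>\<^sub>M PiM ?J (\<lambda>_. lborel :: real measure))"
          "(\<lambda>p. snd p (v k)) \<in> borel_measurable (borel \<Otimes>\<^sub>M PiM ?J (\<lambda>_. lborel :: real measure))"
          .
        then show "(\<lambda>p. Complex (snd p (u k)) (snd p (v k))) \<in> measurable (borel \<Otimes>\<^sub>M PiM ?J (\<lambda>_. lborel :: real measure)) lborel"
          unfolding measurable_lborel1 by (rule measurable_Complex)
      qed
    qed
    then have "(\<lambda>y. \<integral>\<^sup>+ w. H ((\<lambda>k\<in>I. Complex (w (u k)) (w (v k)))(i := y)) \<partial>PiM ?J (\<lambda>_. lborel)) \<in> borel_measurable borel"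
      using RJ.borel_measurable_nn_integral_fst[of "\<lambda>p. H ((\<lambda>k\<in>I. Complex (snd p (u k)) (snd p (v k)))(i := fst p))" borel] by simp
    from nn_integral_complex[OF this] show ?thesis unfolding upd .
  qed
  also have "\<dots> = (\<integral>\<^sup>+ x. \<integral>\<^sup>+ w. F (w(u i := x)) \<partial>PiM (insert (v i) ?J) (\<lambda>_. lborel) \<partial>lborel)"
  proof (rule nn_integral_cong)
    fix x :: real
    have "(\<lambda>w. F (w(u i := x))) \<in> borel_measurable (PiM (insert (v i) ?J) (\<lambda>_. lborel))"
      by measurable
    from R.product_nn_integral_insert_rev[OF fin(1) nin(1) this]
    show "(\<integral>\<^sup>+ y. (\<integral>\<^sup>+ w. F (w(v i := y, u i := x)) \<partial>PiM ?J (\<lambda>_. lborel)) \<partial>lborel) = (\<integral>\<^sup>+ w. F (w(u i := x)) \<partial>PiM (insert (v i) ?J) (\<lambda>_. lborel))"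
      by simp
  qed
  also have "\<dots> = (\<integral>\<^sup>+ w. F w \<partial>PiM (insert (u i) (insert (v i) ?J)) (\<lambda>_. lborel))"
    by (rule R.product_nn_integral_insert_rev[OF fin(2) nin(2) F, symmetric])
  finally show ?case unfolding set F_def .
qed


lemma nn_integral_PiM_complex_vec:
  fixes u v :: "nat \<Rightarrow> 'n::finite" and H :: "(nat \<Rightarrow> complex) \<Rightarrow> ennreal"
  assumes "finite I" "inj_on u I" "inj_on v I" "u ` I \<inter> v ` I = {}" "u ` I \<union> v ` I = UNIV"
    and H: "H \<in> borel_measurable (PiM I (\<lambda>_. lborel))"
  shows "(\<lambda>y. \<lambda>k\<in>I. Complex (vec_nth y (u k)) (vec_nth y (v k))) \<in> measurable (borel :: (real ^ 'n) measure) (PiM I (\<lambda>_. lborel))"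
    and "(\<integral>\<^sup>+ x. H x \<partial>PiM I (\<lambda>_. lborel)) =
    (\<integral>\<^sup>+ y. H (\<lambda>k\<in>I. Complex (vec_nth y (u k)) (vec_nth y (v k))) \<partial>(lborel :: (real ^ 'n) measure))"
proof -
  show meas: "(\<lambda>y. \<lambda>k\<in>I. Complex (vec_nth y (u k)) (vec_nth y (v k))) \<in> measurable (borel :: (real ^ 'n) measure) (PiM I (\<lambda>_. lborel))"
  proof (rule measurable_restrict)
    fix k
    have "(\<lambda>y. vec_nth y i) \<in> borel_measurable (borel :: (real ^ 'n) measure)" for i
      by (intro borel_measurable_continuous_onI continuous_intros)
    then show "(\<lambda>y. Complex (vec_nth y (u k)) (vec_nth y (v k))) \<in> measurable (borel :: (real ^ 'n) measure) lborel"
      unfolding measurable_lborel1 by (intro measurable_Complex)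
  qed
  have chi: "(\<lambda>w. \<chi> i. w i) \<in> measurable (PiM UNIV (\<lambda>_. lborel :: real measure)) (borel :: (real ^ 'n) measure)"
  proof (subst borel_measurable_euclidean_space, rule ballI)
    fix b :: "real ^ 'n" assume "b \<in> Basis"
    then obtain i where b: "b = axis i 1" by (auto simp: Basis_vec_def)
    have "(\<lambda>w. w i) \<in> borel_measurable (PiM UNIV (\<lambda>_::'n. lborel :: real measure))"
      using measurable_component_singleton[of i UNIV "\<lambda>_. lborel :: real measure"] by simp
    then show "(\<lambda>w. (\<chi> i. w i) \<bullet> b) \<in> borel_measurable (PiM UNIV (\<lambda>_::'n. lborel :: real measure))"
      unfolding b by (simp add: inner_axis)
  qed
  show "(\<integral>\<^sup>+ x. H x \<partial>PiM I (\<lambda>_. lborel)) =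
    (\<integral>\<^sup>+ y. H (\<lambda>k\<in>I. Complex (vec_nth y (u k)) (vec_nth y (v k))) \<partial>(lborel :: (real ^ 'n) measure))"
    unfolding nn_integral_PiM_complex_real[OF assms(1-4) H] assms(5)
    by (subst lborel_vec_eq, subst nn_integral_distr[OF chi])
       (use measurable_compose[OF meas H] in simp_all)
qed

section \<open>Transport of the coordinates to a Euclidean space\<close>

definition vec_decode :: "real ^ idx \<Rightarrow> nat \<Rightarrow> complex" where
  "vec_decode y = (\<lambda>k\<in>{..<idx_half}. Complex (vec_nth y (idx_abs k)) (vec_nth y (idx_abs (idx_half + k))))"

definition vec_encode :: "(nat \<Rightarrow> complex) \<Rightarrow> real ^ idx" where
  "vec_encode x = (\<chi> i. if idx_rep i < idx_half then Re (x (idx_rep i)) else Im (x (idx_rep i - idx_half)))"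

text \<open>Coefficients in \<open>mev\<close> are listed leading terms first, polynomial coefficients by degree.\<close>

definition reversed :: "nat \<Rightarrow> (nat \<Rightarrow> complex) \<Rightarrow> nat \<Rightarrow> complex" where
  "reversed m x = (\<lambda>j\<in>{..<m}. x (m - 1 - j))"

lemma vec_encode_decode [simp]: "vec_encode (vec_decode y) = y"
proof (rule Finite_Cartesian_Product.vec_eq_iff[THEN iffD2], rule allI)
  fix i
  show "vec_nth (vec_encode (vec_decode y)) i = vec_nth y i"
  proof (cases "idx_rep i < idx_half")
    case True
    then show ?thesis by (simp add: vec_encode_def vec_decode_def idx_rep_inverse)
  next
    case False
    have "idx_rep i - idx_half < idx_half" using idx_rep_less[of i] idx_half_pos by linarith
    moreover have "idx_half + (idx_rep i - idx_half) = idx_rep i" using False by simp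
    ultimately show ?thesis using False by (simp add: vec_encode_def vec_decode_def idx_rep_inverse)
  qed
qed

lemma vec_decode_PiE: "vec_decode y \<in> {..<idx_half} \<rightarrow>\<^sub>E UNIV"
  by (simp add: vec_decode_def)

lemma vec_decode_encode:
  assumes "x \<in> {..<idx_half} \<rightarrow>\<^sub>E UNIV"
  shows "vec_decode (vec_encode x) = x"
proof (rule ext)
  fix k
  show "vec_decode (vec_encode x) k = x k"
  proof (cases "k < idx_half")
    case False
    then show ?thesis using PiE_arb[OF assms, of k] by (simp add: vec_decode_def)
  qed (simp add: vec_decode_def vec_encode_def)
qed

lemma reversed_reversed:
  assumes "x \<in> {..<m} \<rightarrow>\<^sub>E UNIV"
  shows "reversed m (reversed m x) = x"
proof (rule ext)
  fix k
  show "reversed m (reversed m x) k = x k"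
  proof (cases "k < m")
    case True
    then have "m - 1 - k < m" "m - 1 - (m - 1 - k) = k" by linarith+
    then show ?thesis using True by (simp only: reversed_def restrict_apply lessThan_iff if_True)
  next
    case False
    then show ?thesis using PiE_arb[OF assms, of k] by (simp add: reversed_def)
  qed
qed

lemma reversed_PiE: "reversed m x \<in> {..<m} \<rightarrow>\<^sub>E UNIV"
  by (simp add: reversed_def)

lemma measurable_vec_encode [measurable]:
  "vec_encode \<in> borel_measurable (PiM {..<idx_half} (\<lambda>_. lborel))"
proof (subst borel_measurable_euclidean_space, rule ballI)
  fix b :: "real ^ idx" assume "b \<in> Basis"
  then obtain i where b: "b = axis i 1" by (auto simp: Basis_vec_def)
  have lt: "idx_rep i - idx_half < idx_half" using idx_rep_less[of i] idx_half_pos by linarith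
  have c: "(\<lambda>x. x k) \<in> borel_measurable (PiM {..<idx_half} (\<lambda>_. lborel :: complex measure))" if "k < idx_half" for k
    using measurable_component_singleton[of k "{..<idx_half}" "\<lambda>_. lborel :: complex measure"] that by simp
  have "(\<lambda>x. if idx_rep i < idx_half then Re (x (idx_rep i)) else Im (x (idx_rep i - idx_half))) \<in> borel_measurable (PiM {..<idx_half} (\<lambda>_. lborel :: complex measure))"
    using measurable_compose[OF c borel_measurable_Re, of "idx_rep i"] measurable_compose[OF c[OF lt] borel_measurable_Im]
    by (cases "idx_rep i < idx_half") simp_all
  then show "(\<lambda>x. vec_encode x \<bullet> b) \<in> borel_measurable (PiM {..<idx_half} (\<lambda>_. lborel))"
    unfolding b by (simp add: inner_axis vec_encode_def)
qed

lemma measurable_reversed [measurable]: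
  "reversed m \<in> measurable (PiM {..<m} (\<lambda>_. lborel)) (PiM {..<m} (\<lambda>_. lborel))"
  unfolding reversed_def
  by (rule measurable_restrict) (rule measurable_component_singleton, auto)

lemma idx_abs_eq_iff: "a < 2 * idx_half \<Longrightarrow> b < 2 * idx_half \<Longrightarrow> idx_abs a = idx_abs b \<longleftrightarrow> a = b"
  by (metis idx_rep_abs)

lemma nn_integral_vec_decode:
  assumes H: "H \<in> borel_measurable (PiM {..<idx_half} (\<lambda>_. lborel))"
  shows "(\<integral>\<^sup>+ x. H x \<partial>PiM {..<idx_half} (\<lambda>_. lborel)) = (\<integral>\<^sup>+ y. H (vec_decode y) \<partial>lborel)"
    and "(\<integral>\<^sup>+ x. H x \<partial>PiM {..<idx_half} (\<lambda>_. lborel)) = (\<integral>\<^sup>+ y. H (reversed idx_half (vec_decode y)) \<partial>lborel)"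
    and "vec_decode \<in> measurable borel (PiM {..<idx_half} (\<lambda>_. lborel))"
proof -
  let ?m = idx_half
  have surj: "i \<in> idx_abs ` {..<?m} \<union> (\<lambda>k. idx_abs (?m + k)) ` {..<?m}" for i
  proof (cases "idx_rep i < ?m")
    case True
    then show ?thesis by (intro UnI1 image_eqI[of _ _ "idx_rep i"]) (simp_all add: idx_rep_inverse)
  next
    case False
    then show ?thesis using idx_rep_less[of i]
      by (intro UnI2 image_eqI[of _ _ "idx_rep i - ?m"]) (simp_all add: idx_rep_inverse less_diff_conv2 mult_2)
  qed
  have 1: "inj_on idx_abs {..<?m}" "inj_on (\<lambda>k. idx_abs (?m + k)) {..<?m}"
    "idx_abs ` {..<?m} \<inter> (\<lambda>k. idx_abs (?m + k)) ` {..<?m} = {}"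
    by (auto simp: inj_on_def idx_abs_eq_iff)
  have 2: "idx_abs ` {..<?m} \<union> (\<lambda>k. idx_abs (?m + k)) ` {..<?m} = UNIV" using surj by blast
  have dec: "vec_decode = (\<lambda>y. \<lambda>k\<in>{..<?m}. Complex (vec_nth y (idx_abs k)) (vec_nth y (idx_abs (?m + k))))"
    by (simp add: fun_eq_iff vec_decode_def)
  show "(\<integral>\<^sup>+ x. H x \<partial>PiM {..<?m} (\<lambda>_. lborel)) = (\<integral>\<^sup>+ y. H (vec_decode y) \<partial>lborel)"
    unfolding dec by (rule nn_integral_PiM_complex_vec(2)[OF _ 1 2 H]) simp
  show "vec_decode \<in> measurable borel (PiM {..<?m} (\<lambda>_. lborel))"
    unfolding dec by (rule nn_integral_PiM_complex_vec(1)[OF _ 1 2 H]) simp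
  let ?r = "\<lambda>j. ?m - 1 - j"
  have bij: "?r ` {..<?m} = {..<?m}" "inj_on ?r {..<?m}"
  proof -
    have "bij_betw ?r {..<?m} {..<?m}" by (rule bij_betwI[of _ _ _ ?r]) auto
    then show "?r ` {..<?m} = {..<?m}" "inj_on ?r {..<?m}" by (simp_all add: bij_betw_def)
  qed
  have im: "(\<lambda>j. g (?r j)) ` {..<?m} = g ` {..<?m}" for g :: "nat \<Rightarrow> idx"
    using image_image[of g ?r "{..<?m}"] unfolding bij(1) by simp
  have inj: "inj_on (\<lambda>j. g (?r j)) {..<?m}" if "inj_on g {..<?m}" for g :: "nat \<Rightarrow> idx"
    using comp_inj_on[OF bij(2), of g] that unfolding bij(1) comp_def by simp
  have rd: "reversed ?m (vec_decode y) = (\<lambda>k\<in>{..<?m}. Complex (vec_nth y (idx_abs (?r k))) (vec_nth y (idx_abs (?m + ?r k))))" for y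
  proof (rule ext)
    fix k
    have "?m - 1 - k < ?m" using idx_half_pos by linarith
    then show "reversed ?m (vec_decode y) k = (\<lambda>k\<in>{..<?m}. Complex (vec_nth y (idx_abs (?r k))) (vec_nth y (idx_abs (?m + ?r k)))) k"
      by (simp add: reversed_def vec_decode_def)
  qed
  show "(\<integral>\<^sup>+ x. H x \<partial>PiM {..<?m} (\<lambda>_. lborel)) = (\<integral>\<^sup>+ y. H (reversed ?m (vec_decode y)) \<partial>lborel)"
    unfolding rd
    by (rule nn_integral_PiM_complex_vec(2)[OF _ inj[OF 1(1)] inj[OF 1(2)] _ _ H])
       (simp_all only: im[of idx_abs] im[of "\<lambda>k. idx_abs (?m + k)"] 1 2 finite_lessThan)
qed

section \<open>The derivative of the coefficient map\<close>

lemma has_derivative_vec_encode: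
  assumes "\<And>a. a < idx_half \<Longrightarrow> ((\<lambda>y. q y a) has_derivative q' a) (at y)"
  shows "((\<lambda>y. vec_encode (q y)) has_derivative (\<lambda>h. vec_encode (\<lambda>a. q' a h))) (at y)"
proof (subst has_derivative_componentwise_within, rule ballI)
  fix b :: "real ^ idx" assume "b \<in> Basis"
  then obtain i where b: "b = axis i 1" by (auto simp: Basis_vec_def)
  have lt: "idx_rep i - idx_half < idx_half" using idx_rep_less[of i] idx_half_pos by linarith
  have "((\<lambda>y. if idx_rep i < idx_half then Re (q y (idx_rep i)) else Im (q y (idx_rep i - idx_half))) has_derivative
    (\<lambda>h. if idx_rep i < idx_half then Re (q' (idx_rep i) h) else Im (q' (idx_rep i - idx_half) h))) (at y)"
    using bounded_linear.has_derivative[OF bounded_linear_Re assms] bounded_linear.has_derivative[OF bounded_linear_Im assms[OF lt]]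
    by (cases "idx_rep i < idx_half") simp_all
  then show "((\<lambda>y. vec_encode (q y) \<bullet> b) has_derivative (\<lambda>h. vec_encode (\<lambda>a. q' a h) \<bullet> b)) (at y)"
    unfolding b by (simp add: inner_axis vec_encode_def)
qed

definition dnu :: "nat \<Rightarrow> real ^ idx \<Rightarrow> nat \<Rightarrow> real" where
  "dnu m h j = (if j < m then vec_nth h (idx_abs j) else - (\<Sum>k<m. vec_nth h (idx_abs k)))"

definition dth :: "nat \<Rightarrow> real ^ idx \<Rightarrow> nat \<Rightarrow> real" where
  "dth m h j = (if j < m then vec_nth h (idx_abs (m + j)) else - (\<Sum>k<m. vec_nth h (idx_abs (m + k))))"

lemma has_derivative_coordinates:
  assumes m: "idx_half = m"
  shows "((\<lambda>y. nuv m (vec_decode y) j) has_derivative (\<lambda>h. dnu m h j)) (at y)"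
    and "((\<lambda>y. thv m S (vec_decode y) j) has_derivative (\<lambda>h. dth m h j)) (at y)"
proof -
  have c: "((\<lambda>y. vec_nth y i) has_derivative (\<lambda>h. vec_nth h i)) (at y)" for i :: idx and y :: "real ^ idx"
    by (rule bounded_linear_imp_has_derivative[OF bounded_linear_vec_nth])
  have s: "((\<lambda>y. \<Sum>k<m. vec_nth y (g k)) has_derivative (\<lambda>h. \<Sum>k<m. vec_nth h (g k))) (at y)" for g :: "nat \<Rightarrow> idx"
    by (rule has_derivative_sum) (rule c)
  have n: "nuv m (vec_decode y) j = (if j < m then vec_nth y (idx_abs j) else 1 - (\<Sum>k<m. vec_nth y (idx_abs k)))" for y
    by (simp add: nuv_def vec_decode_def m)
  have t: "thv m S (vec_decode y) j = (if j < m then vec_nth y (idx_abs (m + j)) else S - (\<Sum>k<m. vec_nth y (idx_abs (m + k))))" for y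
    by (simp add: thv_def vec_decode_def m)
  show "((\<lambda>y. nuv m (vec_decode y) j) has_derivative (\<lambda>h. dnu m h j)) (at y)"
    unfolding n dnu_def using has_derivative_diff[OF has_derivative_const s, of 1 idx_abs] c by (cases "j < m") simp_all
  show "((\<lambda>y. thv m S (vec_decode y) j) has_derivative (\<lambda>h. dth m h j)) (at y)"
    unfolding t dth_def using has_derivative_diff[OF has_derivative_const s, of S "\<lambda>k. idx_abs (m + k)"] c by (cases "j < m") simp_all
qed

lemma sum_dth: "(\<Sum>j\<le>m. dth m h j) = 0"
  by (simp add: dth_def lessThan_Suc_atMost[symmetric])

definition coef_map :: "nat \<Rightarrow> real \<Rightarrow> real ^ idx \<Rightarrow> nat \<Rightarrow> complex" where
  "coef_map m S y a = Polynomial.coeff (lagpoly m (\<lambda>k. cis (thv m S (vec_decode y) k)) (nuv m (vec_decode y))) a"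

definition region_vec :: "nat \<Rightarrow> real \<Rightarrow> (real ^ idx) set" where
  "region_vec m S = {y. vec_decode y \<in> Reg m S}"

lemma coef_map_has_derivative:
  assumes m: "idx_half = m"
  shows "((\<lambda>y. coef_map m S y a) has_derivative frechet_derivative (\<lambda>y. coef_map m S y a) (at y)) (at y)"
proof -
  have "(\<lambda>y. thv m S (vec_decode y) j) differentiable (at y)" "(\<lambda>y. nuv m (vec_decode y) j) differentiable (at y)" for j
    using has_derivative_coordinates[OF m] unfolding differentiable_def by blast+
  from differentiable_coeff_lagpoly[OF this]
  have "(\<lambda>y. coef_map m S y a) differentiable (at y)" unfolding coef_map_def .
  then show ?thesis unfolding frechet_derivative_works .
qed

text \<open>Evaluating the derivative of the polynomial at the nodes gives the hypotheses of \<open>det_jacobian\<close>.\<close>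

lemma abs_det_coef_map:
  assumes m: "idx_half = m" and y: "y \<in> region_vec m S"
  shows "\<bar>Determinants.det (matrix (\<lambda>h. vec_encode (\<lambda>a. frechet_derivative (\<lambda>y. coef_map m S y a) (at y) h)))\<bar>
    = (1 / 2) ^ m * (cmod (vandermonde (Suc m) (\<lambda>k. cis (thv m S (vec_decode y) k))))\<^sup>2"
proof -
  define z where "z = (\<lambda>k. cis (thv m S (vec_decode y) k))"
  define \<nu> where "\<nu> = nuv m (vec_decode y)"
  define q where "q a = frechet_derivative (\<lambda>y. coef_map m S y a) (at y)" for a
  define e where "e j = (axis (idx_abs j) 1 :: real ^ idx)" for j
  define J where "J a j = (if a < m then Re (q a (e j)) else Im (q (a - m) (e j)))" for a j
  define W where "W k j = dcoord m z \<nu> (dth m (e j)) (dnu m (e j)) k" for k j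
  have inc: "increasing_angles m (thv m S (vec_decode y))" using y by (simp add: region_vec_def Reg_def)
  have inj: "inj_on z {..m}" unfolding z_def by (rule increasing_angles_inj[OF inc])
  have unit: "cmod (z j) = 1" for j by (simp add: z_def)
  have mat: "matrix (\<lambda>h. vec_encode (\<lambda>a. q a h)) = imat J"
    unfolding matrix_def imat_def vec_encode_def J_def e_def m idx_rep_inverse by simp
  have key: "(\<Sum>a<m. w ^ a * q a h) = dlag m z \<nu> (dth m h) (dnu m h) w" for w h
  proof -
    have ev: "lag m (\<lambda>k. cis (thv m S (vec_decode y) k)) (nuv m (vec_decode y)) w = w ^ m + (\<Sum>a<m. w ^ a * coef_map m S y a)" for y
    proof -
      let ?p = "lagpoly m (\<lambda>k. cis (thv m S (vec_decode y) k)) (nuv m (vec_decode y))"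
      have "poly ?p w = (\<Sum>a\<le>Polynomial.degree ?p. Polynomial.coeff ?p a * w ^ a)" by (rule poly_altdef)
      also have "\<dots> = (\<Sum>a\<le>m. Polynomial.coeff ?p a * w ^ a)"
        using degree_lagpoly[of m] by (intro sum.mono_neutral_left) (auto simp: coeff_eq_0)
      also have "\<dots> = (\<Sum>a<m. Polynomial.coeff ?p a * w ^ a) + w ^ m"
        unfolding lessThan_Suc_atMost[symmetric] by (simp add: coeff_lagpoly_top sum_nuv)
      finally show ?thesis unfolding poly_lagpoly coef_map_def by (simp add: mult.commute add.commute)
    qed
    have "((\<lambda>y. w ^ m + (\<Sum>a<m. w ^ a * coef_map m S y a)) has_derivative (\<lambda>h. 0 + (\<Sum>a<m. w ^ a * q a h))) (at y)"
      unfolding q_def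
      by (intro has_derivative_add has_derivative_const has_derivative_sum has_derivative_mult_right coef_map_has_derivative m)
    moreover have "((\<lambda>y. w ^ m + (\<Sum>a<m. w ^ a * coef_map m S y a)) has_derivative (\<lambda>h. dlag m z \<nu> (dth m h) (dnu m h) w)) (at y)"
    proof -
      have "((\<lambda>y. lag m (\<lambda>j. cis (thv m S (vec_decode y) j)) (\<lambda>j. nuv m (vec_decode y) j) w) has_derivative
        (\<lambda>h. dlag m (\<lambda>j. cis (thv m S (vec_decode y) j)) (\<lambda>j. nuv m (vec_decode y) j) (\<lambda>j. dth m h j) (\<lambda>j. dnu m h j) w)) (at y)"
        by (rule has_derivative_lag) (rule has_derivative_coordinates[OF m])+
      then show ?thesis unfolding ev z_def \<nu>_def .
    qed
    ultimately have "(\<lambda>h. 0 + (\<Sum>a<m. w ^ a * q a h)) = (\<lambda>h. dlag m z \<nu> (dth m h) (dnu m h) w)"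
      by (rule has_derivative_unique)
    from fun_cong[OF this, of h] show ?thesis by simp
  qed
  have e: "vec_nth (e j) (idx_abs i) = (if i = j then 1 else 0)" if "i < 2 * m" "j < 2 * m" for i j
    using that by (simp add: e_def axis_def idx_abs_eq_iff m)
  have "\<bar>Determinants.det (imat J :: real ^ idx ^ idx)\<bar> = (1 / 2) ^ m * (cmod (vandermonde (Suc m) z))\<^sup>2"
  proof (rule det_jacobian[OF m unit inj, where W = W])
    fix k j assume k: "k < m" and j: "j < 2 * m"
    have "(\<Sum>a<m. z k ^ a * Complex (J a j) (J (m + a) j)) = (\<Sum>a<m. z k ^ a * q a (e j))"
      by (rule sum.cong[OF refl]) (simp add: J_def)
    also have "\<dots> = (\<Prod>i\<in>{..m}-{k}. z k - z i) * W k j"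
      unfolding key W_def using k by (intro dlag_at inj) simp
    finally show "(\<Sum>a<m. z k ^ a * Complex (J a j) (J (m + a) j)) = (\<Prod>i\<in>{..m}-{k}. z k - z i) * W k j" .
  next
    fix k j assume k: "k < m" and j: "j < m"
    have "dth m (e j) i = 0" for i
      unfolding dth_def using j by (simp add: e)
    then have "W k j = of_real (dnu m (e j) k)" unfolding W_def using k by (intro dcoord_weights) simp_all
    then show "W k j = (if j = k then 1 else 0)" using k j by (simp add: dnu_def e)
  next
    fix k j assume k: "k < m" and j: "j < m"
    have "Im (W k (m + j)) = - dth m (e (m + j)) k / 2"
      unfolding W_def by (rule Im_dcoord[OF unit inj _ _ sum_dth]) (use k in \<open>simp_all add: \<nu>_def sum_nuv\<close>)
    then show "Im (W k (m + j)) = (if j = k then - 1 / 2 else 0)" using k j by (simp add: dth_def e)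
  qed
  then show ?thesis unfolding q_def[symmetric] mat z_def[symmetric] .
qed

section \<open>The change of variables for spectral data\<close>

text \<open>The region is the intersection of a closed and an open set. Images of compact sets are compact, which makes the image of the region Borel.\<close>

lemma region_vec_sigma_compact:
  assumes m: "idx_half = m"
  shows "\<exists>K :: nat \<Rightarrow> (real ^ idx) set. (\<forall>n. compact (K n)) \<and> region_vec m S = (\<Union>n. K n)"
proof -
  define C where "C = {y. 0 \<le> thv m S (vec_decode y) 0}"
  define U where "U = (\<Inter>k<m. {y. thv m S (vec_decode y) k < thv m S (vec_decode y) (Suc k)})
     \<inter> {y. thv m S (vec_decode y) m < 2 * pi} \<inter> (\<Inter>k\<le>m. {y. 0 < nuv m (vec_decode y) k})"
  have ct: "continuous_on UNIV (\<lambda>y. thv m S (vec_decode y) j)" and cn: "continuous_on UNIV (\<lambda>y. nuv m (vec_decode y) j)" for j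
    using has_derivative_coordinates[OF m] by (auto intro!: has_derivative_continuous_on)
  have "closed C" unfolding C_def by (intro closed_Collect_le ct continuous_intros)
  have "open U" unfolding U_def by (intro open_Int open_INT open_Collect_less ct cn continuous_intros ballI finite_lessThan finite_atMost)
  have "\<exists>B :: nat \<Rightarrow> (real ^ idx) set. (\<forall>n. compact (B n)) \<and> (\<Union>n. B n) = U"
  proof (rule open_Union_compact_subsets[OF \<open>open U\<close>])
    fix B :: "nat \<Rightarrow> (real ^ idx) set" assume "\<And>n. compact (B n)" "(\<Union>n. B n) = U"
    then show ?thesis by blast
  qed
  then obtain B :: "nat \<Rightarrow> (real ^ idx) set" where B: "\<And>n. compact (B n)" "(\<Union>n. B n) = U" by blast
  show ?thesis
  proof (intro exI[of _ "\<lambda>n. C \<inter> B n"] conjI allI)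
    show "compact (C \<inter> B n)" for n by (rule closed_Int_compact[OF \<open>closed C\<close> B(1)])
    have "region_vec m S = C \<inter> U"
    proof (rule Set.set_eqI)
      fix y
      have "vec_decode y \<in> {..<m} \<rightarrow>\<^sub>E UNIV" using vec_decode_PiE[of y] unfolding m .
      then show "y \<in> region_vec m S \<longleftrightarrow> y \<in> C \<inter> U"
        unfolding region_vec_def Reg_def increasing_angles_def C_def U_def by blast
    qed
    then show "region_vec m S = (\<Union>n. C \<inter> B n)" unfolding B(2)[symmetric] by simp
  qed
qed

lemma cov_holds_idx_half: "cov_holds idx_half"
proof -
  define m where "m = idx_half"
  have m: "idx_half = m" by (simp add: m_def)
  let ?L = "PiM {..<m} (\<lambda>_. lborel :: complex measure)"
  have "sv m S ` Reg m S \<in> sets ?L \<and>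
     (\<forall>h\<in>borel_measurable ?L.
        (\<integral>\<^sup>+ s. h s * indicator (sv m S ` Reg m S) s \<partial>?L)
      = (\<integral>\<^sup>+ x. h (sv m S x) * ennreal ((1 / 2) ^ m * (cmod (vandermonde (Suc m) (\<lambda>k. cis (thv m S x k))))\<^sup>2)
             * indicator (Reg m S) x \<partial>?L))" for S
  proof -
    define G where "G y = vec_encode (coef_map m S y)" for y
    define G' where "G' y h = vec_encode (\<lambda>a. frechet_derivative (\<lambda>y. coef_map m S y a) (at y) h)" for y h
    define dec where "dec y = reversed m (vec_decode y)" for y
    define D where "D y = (1 / 2) ^ m * (cmod (vandermonde (Suc m) (\<lambda>k. cis (thv m S (vec_decode y) k))))\<^sup>2" for y
    let ?R = "region_vec m S"
    have dec_G: "dec (G y) = sv m S (vec_decode y)" for y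
    proof (rule ext)
      fix j
      show "dec (G y) j = sv m S (vec_decode y) j"
      proof (cases "j < m")
        case True
        then have "m - 1 - j < m" by linarith
        then show ?thesis using True
          by (simp add: dec_def G_def reversed_def vec_decode_def vec_encode_def m sv_def coef_map_def complex_eq_iff)
      qed (simp add: dec_def reversed_def sv_def)
    qed
    have dec_PiE: "dec y \<in> {..<m} \<rightarrow>\<^sub>E UNIV" for y unfolding dec_def by (rule reversed_PiE)
    have enc_dec: "vec_encode (reversed m (dec y)) = y" for y
      unfolding dec_def using reversed_reversed[OF vec_decode_PiE[of y, unfolded m]] by simp
    have dec_enc: "dec (vec_encode (reversed m s)) = s" if "s \<in> {..<m} \<rightarrow>\<^sub>E UNIV" for s
      unfolding dec_def using vec_decode_encode[of "reversed m s"] reversed_PiE[of m s] reversed_reversed[OF that] by (simp add: m)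
    have der: "(G has_derivative G' y) (at y)" for y
      unfolding G_def[abs_def] G'_def[abs_def] by (rule has_derivative_vec_encode) (rule coef_map_has_derivative[OF m])
    have G [measurable]: "G \<in> borel_measurable borel"
      by (rule borel_measurable_continuous_onI) (rule has_derivative_continuous_on[OF has_derivative_at_withinI[OF der]])
    have ct: "continuous_on UNIV (\<lambda>y. thv m S (vec_decode y) j)" for j
      using has_derivative_coordinates[OF m] by (auto intro!: has_derivative_continuous_on)
    have D [measurable]: "D \<in> borel_measurable borel"
      unfolding D_def vandermonde_def by (intro borel_measurable_continuous_onI continuous_intros ct)
    have det: "\<bar>Determinants.det (matrix (G' y))\<bar> = D y" if "y \<in> ?R" for y
      using abs_det_coef_map[OF m that] unfolding G'_def D_def .
    obtain K :: "nat \<Rightarrow> (real ^ idx) set" where K': "(\<forall>n. compact (K n)) \<and> ?R = (\<Union>n. K n)" by (rule exE[OF region_vec_sigma_compact[OF m, of S]]) (rule that)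
    note K = conjunct1[OF K', rule_format] conjunct2[OF K']
    have R [measurable]: "?R \<in> sets borel" unfolding K(2) by (intro sets.countable_nat_UN image_subsetI borel_compact K(1))
    have contG: "continuous_on A G" for A by (rule has_derivative_continuous_on[OF has_derivative_at_withinI[OF der]])
    have GR [measurable]: "G ` ?R \<in> sets borel"
    proof -
      have "compact (G ` K n)" for n by (rule compact_continuous_image[OF contG K(1)])
      then show ?thesis unfolding K(2) image_UN by (intro sets.countable_nat_UN image_subsetI borel_compact)
    qed
    have inj: "inj_on G ?R"
    proof (rule inj_onI)
      fix x y assume xy: "x \<in> ?R" "y \<in> ?R" "G x = G y"
      have "sv m S (vec_decode x) = sv m S (vec_decode y)" unfolding dec_G[symmetric] xy(3) ..
      moreover have "vec_decode x \<in> Reg m S" "vec_decode y \<in> Reg m S" using xy(1,2) unfolding region_vec_def by simp_all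
      ultimately have "vec_decode x = vec_decode y" by (rule inj_onD[OF sv_inj_on])
      then have "vec_encode (vec_decode x) = vec_encode (vec_decode y)" by (rule arg_cong)
      then show "x = y" unfolding vec_encode_decode .
    qed
    have meas_enc: "(\<lambda>s. vec_encode (reversed m s)) \<in> borel_measurable ?L"
      by (rule measurable_compose[OF measurable_reversed]) (rule measurable_vec_encode[unfolded m])
    have image_iff: "s \<in> sv m S ` Reg m S \<longleftrightarrow> vec_encode (reversed m s) \<in> G ` ?R" if s: "s \<in> {..<m} \<rightarrow>\<^sub>E UNIV" for s
    proof
      assume "s \<in> sv m S ` Reg m S"
      then obtain x where x: "x \<in> Reg m S" "s = sv m S x" by (rule imageE) (rule that)
      have xE: "x \<in> {..<m} \<rightarrow>\<^sub>E UNIV" using x(1) by (simp add: Reg_def)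
      have dx: "vec_decode (vec_encode x) = x" using vec_decode_encode[of x] xE by (simp add: m)
      have "s = dec (G (vec_encode x))" unfolding dec_G dx x(2) ..
      then have "vec_encode (reversed m s) = G (vec_encode x)" by (simp add: enc_dec)
      moreover have "vec_encode x \<in> ?R" using x(1) by (simp add: region_vec_def dx)
      ultimately show "vec_encode (reversed m s) \<in> G ` ?R" by (rule image_eqI)
    next
      assume "vec_encode (reversed m s) \<in> G ` ?R"
      then obtain y where y: "y \<in> ?R" "vec_encode (reversed m s) = G y" by (rule imageE) (rule that)
      have "s = sv m S (vec_decode y)" using dec_enc[OF s] unfolding y(2) dec_G by (rule sym)
      moreover have "vec_decode y \<in> Reg m S" using y(1) by (simp add: region_vec_def)
      ultimately show "s \<in> sv m S ` Reg m S" by (rule image_eqI)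
    qed
    have sub: "sv m S ` Reg m S \<subseteq> {..<m} \<rightarrow>\<^sub>E UNIV" by (rule image_subsetI) (simp add: sv_def)
    have space: "space ?L = {..<m} \<rightarrow>\<^sub>E UNIV" by (simp add: space_PiM)
    have "sv m S ` Reg m S = (\<lambda>s. vec_encode (reversed m s)) -` (G ` ?R) \<inter> space ?L"
    proof (rule Set.set_eqI)
      fix s
      show "s \<in> sv m S ` Reg m S \<longleftrightarrow> s \<in> (\<lambda>s. vec_encode (reversed m s)) -` (G ` ?R) \<inter> space ?L"
        unfolding space vimage_eq Int_iff using subsetD[OF sub, of s] image_iff[of s] by blast
    qed
    then have sets: "sv m S ` Reg m S \<in> sets ?L" using measurable_sets[OF meas_enc GR] by (simp only:)
    moreover have "(\<integral>\<^sup>+ s. h s * indicator (sv m S ` Reg m S) s \<partial>?L)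
      = (\<integral>\<^sup>+ x. h (sv m S x) * ennreal ((1 / 2) ^ m * (cmod (vandermonde (Suc m) (\<lambda>k. cis (thv m S x k))))\<^sup>2)
             * indicator (Reg m S) x \<partial>?L)" if h: "h \<in> borel_measurable ?L" for h
    proof -
      note dec_int = nn_integral_vec_decode[unfolded m]
      have meas_dec: "dec \<in> measurable borel ?L"
        unfolding dec_def by (rule measurable_compose[OF dec_int(3)[OF h] measurable_reversed])
      have hdec [measurable]: "(\<lambda>y. h (dec y)) \<in> borel_measurable borel" by (rule measurable_compose[OF meas_dec h])
      have H1: "(\<lambda>s. h s * indicator (sv m S ` Reg m S) s) \<in> borel_measurable ?L"
        using h sets by (intro borel_measurable_times_ennreal borel_measurable_indicator)
      have "(\<integral>\<^sup>+ s. h s * indicator (sv m S ` Reg m S) s \<partial>?L) = (\<integral>\<^sup>+ y. h (dec y) * indicator (sv m S ` Reg m S) (dec y) \<partial>lborel)"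
        unfolding dec_def by (rule dec_int(2)[OF H1])
      also have "\<dots> = (\<integral>\<^sup>+ y. h (dec y) * indicator (G ` ?R) y \<partial>lborel)"
        by (intro nn_integral_cong arg_cong2[where f = "(*)"] refl) (simp add: indicator_def image_iff[OF dec_PiE] enc_dec)
      also have "\<dots> = (\<integral>\<^sup>+ y. h (dec (G y)) * ennreal (D y) * indicator ?R y \<partial>lborel)"
        by (rule nn_integral_change_of_variables[OF R GR has_derivative_at_withinI[OF der] inj G D det hdec])
      also have "\<dots> = (\<integral>\<^sup>+ x. h (dec (G (vec_encode x))) * ennreal (D (vec_encode x)) * indicator ?R (vec_encode x) \<partial>?L)"
      proof -
        have hG: "(\<lambda>y. h (dec (G y))) \<in> borel_measurable borel" by (rule measurable_compose[OF G hdec])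
        have F: "(\<lambda>y. h (dec (G y)) * ennreal (D y) * indicator ?R y) \<in> borel_measurable borel"
          using hG by measurable
        show ?thesis using dec_int(1)[OF measurable_compose[OF measurable_vec_encode[unfolded m] F]] by simp
      qed
      also have "\<dots> = (\<integral>\<^sup>+ x. h (sv m S x) * ennreal ((1 / 2) ^ m * (cmod (vandermonde (Suc m) (\<lambda>k. cis (thv m S x k))))\<^sup>2)
             * indicator (Reg m S) x \<partial>?L)"
      proof (rule nn_integral_cong)
        fix x assume "x \<in> space ?L"
        then have dx: "vec_decode (vec_encode x) = x" using vec_decode_encode[of x] unfolding space by (simp add: m)
        show "h (dec (G (vec_encode x))) * ennreal (D (vec_encode x)) * indicator ?R (vec_encode x)
          = h (sv m S x) * ennreal ((1 / 2) ^ m * (cmod (vandermonde (Suc m) (\<lambda>k. cis (thv m S x k))))\<^sup>2) * indicator (Reg m S) x"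
          unfolding dec_G D_def dx by (simp add: indicator_def region_vec_def dx)
      qed
      finally show ?thesis .
    qed
    ultimately show ?thesis by blast
  qed
  then show ?thesis unfolding m cov_holds_def by blast
qed

text \<open>A failing dimension would make \<open>idx_half\<close> a failing dimension, contrary to the previous lemma.\<close>

lemma sv_change_of_variables: "m \<ge> 1 \<Longrightarrow> cov_holds m"
proof (rule ccontr)
  assume "m \<ge> 1" "\<not> cov_holds m"
  then have "1 \<le> m \<and> \<not> cov_holds m" by simp
  then have bad: "1 \<le> bad_dim \<and> \<not> cov_holds bad_dim" unfolding bad_dim_def by (rule someI)
  then have "idx_half = bad_dim" unfolding idx_half_def by (simp add: max_def)
  then show False using cov_holds_idx_half bad by simp
qed

section \<open>Every stable polynomial comes from spectral data\<close>

lemma lag_cong: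
  assumes "\<And>j. j \<le> m \<Longrightarrow> z j = z' j" "\<And>j. j \<le> m \<Longrightarrow> \<nu> j = \<nu>' j"
  shows "lag m z \<nu> w = lag m z' \<nu>' w"
  unfolding lag_def using assms by (intro sum.cong prod.cong arg_cong2[where f = "(*)"]) auto

lemma mev_eq_imp_coeff_eq:
  assumes "\<And>w. mev m s w = mev m t w" "j < m"
  shows "s j = t j"
proof -
  have "monic_of m s = monic_of m t" by (simp add: poly_eq_poly_eq_iff[symmetric] fun_eq_iff assms(1))
  then have "Polynomial.coeff (monic_of m s) (m - 1 - j) = Polynomial.coeff (monic_of m t) (m - 1 - j)" by simp
  moreover have "m - 1 - j < m" "m - 1 - (m - 1 - j) = j" "m - 1 - j \<noteq> m" using assms(2) by linarith+
  ultimately show ?thesis by (simp only: coeff_monic_of if_True if_False)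
qed

text \<open>List the arguments in \<open>[0, 2 * pi)\<close> in increasing order.\<close>

lemma sorted_angles_exist:
  assumes z: "\<And>j. j \<le> m \<Longrightarrow> cmod (z j) = 1" and inj: "inj_on z {..m}"
  shows "\<exists>\<theta>. increasing_angles m \<theta> \<and> (\<forall>w. (\<Prod>j\<le>m. w - z j) = (\<Prod>j\<le>m. w - cis (\<theta> j)))"
proof -
  have "\<exists>t. 0 \<le> t \<and> t < 2 * pi \<and> x = cis t" if "cmod x = 1" for x
  proof (rule complex_unimodular_polar[OF that])
    fix t assume "0 \<le> t" "t < 2 * pi" "x = Complex (cos t) (sin t)"
    then show ?thesis by (intro exI[of _ t]) (simp add: complex_eq_iff)
  qed
  then have "\<exists>t. j \<le> m \<longrightarrow> 0 \<le> t \<and> t < 2 * pi \<and> z j = cis t" for j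
    using z[of j] by (cases "j \<le> m") simp_all
  then have "\<exists>a. \<forall>j. j \<le> m \<longrightarrow> 0 \<le> a j \<and> a j < 2 * pi \<and> z j = cis (a j)" by (intro choice allI)
  then obtain a where a': "\<forall>j. j \<le> m \<longrightarrow> 0 \<le> a j \<and> a j < 2 * pi \<and> z j = cis (a j)" ..
  then have a: "0 \<le> a j \<and> a j < 2 * pi \<and> z j = cis (a j)" if "j \<le> m" for j using that by simp
  have inj_a: "inj_on a {..m}"
  proof (rule inj_onI)
    fix i j assume ij: "i \<in> {..m}" "j \<in> {..m}" "a i = a j"
    then have "z i = z j" using a[of i] a[of j] by simp
    then show "i = j" using inj_onD[OF inj _ ij(1,2)] by simp
  qed
  define xs where "xs = sorted_list_of_set (a ` {..m})"
  have set: "set xs = a ` {..m}" and dist: "distinct xs" and srt: "sorted_wrt (<) xs"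
    by (simp_all add: xs_def)
  have len: "length xs = Suc m" using distinct_card[OF dist] unfolding set by (simp add: card_image[OF inj_a])
  define \<theta> where "\<theta> k = xs ! k" for k
  have \<theta>: "0 \<le> \<theta> k \<and> \<theta> k < 2 * pi" if "k \<le> m" for k
  proof -
    have "\<theta> k \<in> set xs" unfolding \<theta>_def by (rule nth_mem) (simp add: len that less_Suc_eq_le)
    then obtain j where j: "\<theta> k = a j" "j \<in> {..m}" unfolding set by (rule imageE) (rule that)
    then show ?thesis using a[of j] by simp
  qed
  have inc: "increasing_angles m \<theta>"
    unfolding increasing_angles_def
  proof (intro conjI allI impI)
    fix k assume "k < m"
    then show "\<theta> k < \<theta> (Suc k)" unfolding \<theta>_def by (intro sorted_wrt_nth_less[OF srt]) (simp_all add: len)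
  qed (use \<theta>[OF le0] \<theta>[OF order_refl] in simp_all)
  have "(\<Prod>j\<le>m. w - z j) = (\<Prod>j\<le>m. w - cis (\<theta> j))" for w
  proof -
    have "(\<Prod>j\<le>m. w - z j) = (\<Prod>j\<le>m. w - cis (a j))" by (rule prod.cong[OF refl]) (use a' in simp)
    also have "\<dots> = (\<Prod>x\<in>set xs. w - cis x)" unfolding set by (subst prod.reindex[OF inj_a]) simp
    also have "\<dots> = (\<Prod>j<Suc m. w - cis (\<theta> j))"
    proof -
      have "bij_betw \<theta> {..<Suc m} (set xs)" unfolding \<theta>_def by (rule bij_betw_nth[OF dist _ refl]) (simp add: len)
      then show ?thesis by (rule prod.reindex_bij_betw[symmetric])
    qed
    finally show ?thesis by (simp only: lessThan_Suc_atMost)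
  qed
  then show ?thesis using inc by blast
qed

lemma cis_period: "cis (S + 2 * pi * real k) = cis S"
proof -
  have "cis (2 * pi * real k) = 1" by (rule cis_multiple_2pi) simp
  then show ?thesis by (simp add: cis_mult[symmetric])
qed

text \<open>The completion determines the increasing angles and thereby their sum.\<close>

lemma sv_window_unique:
  assumes x: "x \<in> Reg m (S + 2 * pi * real k)" and y: "y \<in> Reg m (S + 2 * pi * real l)"
    and eq: "sv m (S + 2 * pi * real k) x = sv m (S + 2 * pi * real l) y"
  shows "k = l"
proof -
  let ?Sk = "S + 2 * pi * real k" and ?Sl = "S + 2 * pi * real l"
  have prod_eq: "(\<Prod>j\<le>m. w - cis (thv m ?Sk x j)) = (\<Prod>j\<le>m. w - cis (thv m ?Sl y j))" for w
    unfolding sv_completion[symmetric] eq cis_period ..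
  have roots: "w \<in> (\<lambda>k. cis (\<theta> k)) ` {..m} \<longleftrightarrow> (\<Prod>j\<le>m. w - cis (\<theta> j)) = 0" for w and \<theta> :: "nat \<Rightarrow> real"
    by auto
  have im: "(\<lambda>k. cis (thv m ?Sk x k)) ` {..m} = (\<lambda>k. cis (thv m ?Sl y k)) ` {..m}"
    by (rule Set.set_eqI) (simp only: roots prod_eq)
  have "increasing_angles m (thv m ?Sk x)" "increasing_angles m (thv m ?Sl y)" using x y by (simp_all add: Reg_def)
  from increasing_angles_unique[OF this im] have "(\<Sum>j\<le>m. thv m ?Sk x j) = (\<Sum>j\<le>m. thv m ?Sl y j)"
    by (intro sum.cong) simp_all
  then show ?thesis unfolding sum_thv by simp
qed

text \<open>Complete with \<open>u\<close>, sort the angles of the roots, and read the weights off \<open>completion_lag\<close>. The sum of the angles is known modulo \<open>2 * pi\<close> and lies in \<open>[0, 2 * pi * (m + 1))\<close>, which leaves \<open>m + 1\<close> windows.\<close>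

lemma sv_surjective:
  assumes s: "s \<in> {..<m} \<rightarrow>\<^sub>E UNIV" and st: "schur_stable m s" and S: "0 \<le> S" "S < 2 * pi"
  shows "\<exists>k\<le>m. s \<in> sv m (S + 2 * pi * real k) ` Reg m (S + 2 * pi * real k)"
proof -
  define u where "u = (- 1) ^ Suc m * cis S"
  have u: "cmod u = 1" by (simp add: u_def norm_mult norm_power)
  obtain z where "\<And>w. mev (Suc m) ((lin m u s)(m := u)) w = (\<Prod>i<Suc m. w - z i)" using mev_factorization by blast
  then have z: "w * mev m s w + u * rmev m s w = (\<Prod>j\<le>m. w - z j)" for w by (simp only: mev_step lessThan_Suc_atMost)
  have "\<And>j. j \<le> m \<Longrightarrow> cmod (z j) = 1" "inj_on z {..m}"
    using completion_roots_unit[OF st u z] completion_lag[OF st u z] by blast+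
  from sorted_angles_exist[OF this] obtain \<theta> where
    inc: "increasing_angles m \<theta>" and \<theta>: "\<And>w. (\<Prod>j\<le>m. w - z j) = (\<Prod>j\<le>m. w - cis (\<theta> j))" by blast
  have c: "w * mev m s w + u * rmev m s w = (\<Prod>j\<le>m. w - cis (\<theta> j))" for w unfolding z \<theta> ..
  obtain \<nu> where \<nu>: "\<And>j. j \<le> m \<Longrightarrow> \<nu> j > 0" "(\<Sum>j\<le>m. \<nu> j) = (1::real)" "\<And>w. mev m s w = lag m (\<lambda>j. cis (\<theta> j)) \<nu> w"
    using completion_lag[OF st u c] by blast
  define T where "T = (\<Sum>j\<le>m. \<theta> j)"
  have "(- 1) ^ Suc m * cis T = (- 1) ^ Suc m * cis S"
    using completion_prod[OF c] unfolding prod_neg_cis T_def u_def .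
  then have cT: "cis T = cis S" by simp
  then have "cos T = cos S" "sin T = sin S" by (metis cis.sel(1), metis cis.sel(2))
  then obtain n :: int where n: "T = S + 2 * pi * n" using sin_cos_eq_iff[of T S] by auto
  have "0 \<le> T" unfolding T_def by (rule sum_nonneg) (simp_all add: increasing_angles_range[OF inc])
  moreover have "T < (\<Sum>j\<le>m. 2 * pi)" unfolding T_def by (rule sum_strict_mono) (simp_all add: increasing_angles_range[OF inc])
  ultimately have "0 \<le> S + 2 * pi * n" "S + 2 * pi * n < 2 * pi * (real m + 1)" unfolding n by (simp_all add: algebra_simps)
  then have "2 * pi * (-1) < 2 * pi * n" "2 * pi * n < 2 * pi * (real m + 1)" using S by linarith+
  then have "-1 < real_of_int n" "real_of_int n < real m + 1" by (simp_all only: mult_less_cancel_left_pos[of "2 * pi"] pi_gt_zero mult_pos_pos zero_less_numeral)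
  then have nn: "0 \<le> n" "nat n \<le> m" by linarith+
  define k where "k = nat n"
  have Tk: "T = S + 2 * pi * real k" using n nn by (simp add: k_def)
  define x where "x = (\<lambda>j\<in>{..<m}. Complex (\<nu> j) (\<theta> j))"
  have "\<theta> m = T - (\<Sum>j<m. \<theta> j)" "\<nu> m = 1 - (\<Sum>j<m. \<nu> j)"
    using \<nu>(2) unfolding T_def lessThan_Suc_atMost[symmetric] by simp_all
  then have th: "thv m T x j = \<theta> j" and nu: "nuv m x j = \<nu> j" if "j \<le> m" for j
    using that by (cases "j = m", simp_all add: thv_def nuv_def x_def)
  have "increasing_angles m (thv m T x)" using inc th unfolding increasing_angles_def by simp
  then have xR: "x \<in> Reg m T" unfolding Reg_def using \<nu>(1) nu by (simp add: x_def)
  have "mev m s w = mev m (sv m T x) w" for w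
    unfolding mev_sv \<nu>(3) by (rule lag_cong) (simp_all add: th nu)
  then have coeffs: "s j = sv m T x j" if "j < m" for j using that by (rule mev_eq_imp_coeff_eq)
  have "s = sv m T x"
  proof (rule ext)
    fix j
    show "s j = sv m T x j"
      using coeffs[of j] PiE_arb[OF s, of j] by (cases "j < m") (simp_all add: sv_def)
  qed
  then have "s \<in> sv m T ` Reg m T" using xR by (rule image_eqI)
  then show ?thesis unfolding Tk using nn by (intro exI[of _ k]) (simp add: k_def)
qed

section \<open>The coefficient density in spectral coordinates\<close>

lemma completion_of_sv:
  assumes u: "u = (- 1) ^ Suc m * cis S"
  shows "monic_of (Suc m) ((lin m u (sv m S x))(m := u)) = (\<Prod>i<Suc m. [:- circle_point (Suc m) (thv m S x) i, 1:])"
proof (rule poly_eq_poly_eq_iff[THEN iffD1], rule ext)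
  fix w
  have "poly (monic_of (Suc m) ((lin m u (sv m S x))(m := u))) w = (\<Prod>j\<le>m. w - cis (thv m S x j))"
    unfolding poly_monic_of mev_step u by (rule sv_completion)
  also have "\<dots> = poly (\<Prod>i<Suc m. [:- circle_point (Suc m) (thv m S x) i, 1:]) w"
    unfolding poly_prod lessThan_Suc_atMost[symmetric] by (rule prod.cong[OF refl]) (simp add: circle_point_def)
  finally show "poly (monic_of (Suc m) ((lin m u (sv m S x))(m := u))) w = poly (\<Prod>i<Suc m. [:- circle_point (Suc m) (thv m S x) i, 1:]) w" .
qed

lemma vandermonde_cong: "(\<And>i. i < n \<Longrightarrow> z i = z' i) \<Longrightarrow> vandermonde n z = vandermonde n z'"
  unfolding vandermonde_def by (intro prod.cong refl arg_cong2[where f = minus]) auto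

lemma vandermonde_circle: "vandermonde n (circle_point n \<theta>) = vandermonde n (\<lambda>k. cis (\<theta> k))"
  by (rule vandermonde_cong) (simp add: circle_point_def)

text \<open>The density is the power \<open>\<beta> / 2 - 1\<close> of the resultant \<open>\<Prod>\<nu> * \<bar>\<Delta>\<bar>\<^sup>2\<close>, and the Jacobian adds \<open>\<bar>\<Delta>\<bar>\<^sup>2\<close>. The total power of \<open>\<bar>\<Delta>\<bar>\<close> is \<open>\<beta>\<close>, and the weights separate from the angles.\<close>

lemma Wt_sv:
  assumes x: "x \<in> Reg m S"
  shows "schur_stable m (sv m S x)"
    and "Wt (\<beta> / 2 - 1) m (sv m S x) * ((1 / 2) ^ m * (cmod (vandermonde (Suc m) (\<lambda>k. cis (thv m S x k))))\<^sup>2)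
      = cmod (vandermonde (Suc m) (circle_point (Suc m) (thv m S x))) powr \<beta> * ((1 / 2) ^ m * (\<Prod>j\<le>m. nuv m x j) powr (\<beta> / 2 - 1))"
proof -
  define z where "z k = cis (thv m S x k)" for k
  define D where "D = cmod (vandermonde (Suc m) z)"
  define V where "V = (\<Prod>j\<le>m. nuv m x j)"
  have inj: "inj_on z {..m}" unfolding z_def using x by (intro increasing_angles_inj) (simp add: Reg_def)
  have nu: "nuv m x j > 0" if "j \<le> m" for j using x that by (simp add: Reg_def)
  have unit: "cmod (z j) = 1" for j by (simp add: z_def)
  have ev: "mev m (sv m S x) w = lag m z (nuv m x) w" for w unfolding z_def by (rule mev_sv)
  show st: "schur_stable m (sv m S x)" by (rule lag_schur_stable[OF unit inj nu ev])
  obtain v where v: "\<And>w. mev m (sv m S x) w = (\<Prod>i<m. w - v i)" using mev_factorization by blast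
  have r: "(\<Prod>i<m. cmod (rmev m (sv m S x) (v i))) = V * D\<^sup>2"
    unfolding V_def D_def by (rule lag_resultant[OF unit sum_nuv nu ev v])
  have W: "Wt (\<beta> / 2 - 1) m (sv m S x) = (V * D\<^sup>2) powr (\<beta> / 2 - 1)" and pos: "V * D\<^sup>2 > 0"
    using Wt_stable_aux[OF st v, of "\<beta> / 2 - 1"] unfolding r by (rule conjunct1, rule conjunct2)
  have V: "V > 0" unfolding V_def by (rule prod_pos) (rule nu, simp)
  have D: "D > 0" using pos V by (simp add: D_def zero_less_mult_iff)
  have "D powr 2 = D\<^sup>2" using D by (simp add: powr_numeral)
  then have "(D\<^sup>2) powr (\<beta> / 2 - 1) = D powr (2 * (\<beta> / 2 - 1))" by (metis powr_powr)
  then have "(V * D\<^sup>2) powr (\<beta> / 2 - 1) * D\<^sup>2 = V powr (\<beta> / 2 - 1) * (D powr (2 * (\<beta> / 2 - 1)) * D powr 2)"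
    using V D \<open>D powr 2 = D\<^sup>2\<close> by (simp add: powr_mult)
  also have "D powr (2 * (\<beta> / 2 - 1)) * D powr 2 = D powr \<beta>" by (simp add: powr_add[symmetric])
  finally show "Wt (\<beta> / 2 - 1) m (sv m S x) * ((1 / 2) ^ m * (cmod (vandermonde (Suc m) (\<lambda>k. cis (thv m S x k))))\<^sup>2)
      = cmod (vandermonde (Suc m) (circle_point (Suc m) (thv m S x))) powr \<beta> * ((1 / 2) ^ m * (\<Prod>j\<le>m. nuv m x j) powr (\<beta> / 2 - 1))"
  proof -
    assume X: "(V * D\<^sup>2) powr (\<beta> / 2 - 1) * D\<^sup>2 = V powr (\<beta> / 2 - 1) * D powr \<beta>"
    have "(V * D\<^sup>2) powr (\<beta> / 2 - 1) * ((1 / 2) ^ m * D\<^sup>2) = (1 / 2) ^ m * ((V * D\<^sup>2) powr (\<beta> / 2 - 1) * D\<^sup>2)"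
      by (rule mult.left_commute)
    also have "\<dots> = D powr \<beta> * ((1 / 2) ^ m * V powr (\<beta> / 2 - 1))" unfolding X by (simp only: mult_ac)
    finally show ?thesis
      unfolding W vandermonde_circle z_def[symmetric] D_def[symmetric] V_def[symmetric] .
  qed
qed

lemma cov_holds_0: "cov_holds 0"
  unfolding cov_holds_def
proof (intro allI conjI ballI)
  fix S
  let ?M = "PiM {..<0::nat} (\<lambda>_. lborel :: complex measure)"
  let ?p = "\<lambda>_::nat. undefined :: complex"
  have sv: "sv 0 S x = ?p" for x by (simp add: sv_def fun_eq_iff)
  show "sv 0 S ` Reg 0 S \<in> sets ?M"
  proof -
    have "sv 0 S ` Reg 0 S = {} \<or> sv 0 S ` Reg 0 S = {?p}" unfolding sv by blast
    then show ?thesis by (elim disjE) (simp_all add: sets_PiM_empty)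
  qed
  fix h :: "(nat \<Rightarrow> complex) \<Rightarrow> ennreal" assume "h \<in> borel_measurable ?M"
  have "?p \<in> sv 0 S ` Reg 0 S \<longleftrightarrow> ?p \<in> Reg 0 S"
  proof -
    have "x = ?p" if "x \<in> Reg 0 S" for x using that by (simp add: Reg_def)
    then show ?thesis unfolding sv by (metis imageE image_eqI)
  qed
  then show "(\<integral>\<^sup>+ s. h s * indicator (sv 0 S ` Reg 0 S) s \<partial>?M)
      = (\<integral>\<^sup>+ x. h (sv 0 S x) * ennreal ((1 / 2) ^ 0 * (cmod (vandermonde (Suc 0) (\<lambda>k. cis (thv 0 S x k))))\<^sup>2) * indicator (Reg 0 S) x \<partial>?M)"
    unfolding lessThan_0
    by (subst (1 2) lborel_prod.nn_integral_empty) (simp_all add: sv vandermonde_def indicator_def)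
qed

text \<open>The windows partition the stable coefficient vectors.\<close>

lemma nn_integral_stable_coefficients:
  fixes h :: "(nat \<Rightarrow> complex) \<Rightarrow> ennreal"
  assumes h: "h \<in> borel_measurable (PiM {..<m} (\<lambda>_. lborel))" and S: "0 \<le> S" "S < 2 * pi"
    and unst: "\<And>s. \<not> schur_stable m s \<Longrightarrow> h s = 0"
  shows "(\<integral>\<^sup>+ s. h s \<partial>PiM {..<m} (\<lambda>_. lborel)) = (\<Sum>k\<le>m. \<integral>\<^sup>+ x. h (sv m (S + 2 * pi * real k) x)
     * ennreal ((1 / 2) ^ m * (cmod (vandermonde (Suc m) (\<lambda>j. cis (thv m (S + 2 * pi * real k) x j))))\<^sup>2)
     * indicator (Reg m (S + 2 * pi * real k)) x \<partial>PiM {..<m} (\<lambda>_. lborel))"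
proof -
  let ?M = "PiM {..<m} (\<lambda>_. lborel :: complex measure)"
  define E where "E k = sv m (S + 2 * pi * real k) ` Reg m (S + 2 * pi * real k)" for k
  have cov: "cov_holds m" using cov_holds_0 sv_change_of_variables[of m] by (cases "m = 0") simp_all
  have E: "E k \<in> sets ?M" for k unfolding E_def by (rule conjunct1[OF spec[OF cov[unfolded cov_holds_def]]])
  have split: "h s = (\<Sum>k\<le>m. h s * indicator (E k) s)" if s: "s \<in> space ?M" for s
  proof (cases "schur_stable m s")
    case True
    have "s \<in> {..<m} \<rightarrow>\<^sub>E UNIV" using s by (simp add: space_PiM)
    from sv_surjective[OF this True S] obtain k where k': "k \<le> m \<and> s \<in> E k" unfolding E_def ..
    note k = conjunct1[OF k'] conjunct2[OF k']
    have uniq: "l = k" if l: "s \<in> E l" for l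
    proof -
      obtain x where x: "x \<in> Reg m (S + 2 * pi * real l)" "s = sv m (S + 2 * pi * real l) x"
        using l unfolding E_def by (rule imageE) (rule that)
      obtain y where y: "y \<in> Reg m (S + 2 * pi * real k)" "s = sv m (S + 2 * pi * real k) y"
        using k(2) unfolding E_def by (rule imageE) (rule that)
      show ?thesis by (rule sv_window_unique[OF x(1) y(1)]) (simp only: x(2)[symmetric] y(2)[symmetric])
    qed
    have "h s * indicator (E l) s = (if l = k then h s else 0)" for l
    proof (cases "l = k")
      case True
      then show ?thesis using k(2) by simp
    next
      case False
      then have "s \<notin> E l" using uniq[of l] by (rule contrapos_nn)
      then show ?thesis using False by simp
    qed
    then have "(\<Sum>l\<le>m. h s * indicator (E l) s) = (\<Sum>l\<le>m. if l = k then h s else 0)" by (simp only:)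
    also have "\<dots> = h s" using k(1) by simp
    finally show ?thesis by (rule sym)
  qed (simp add: unst)
  have "(\<integral>\<^sup>+ s. h s \<partial>?M) = (\<integral>\<^sup>+ s. (\<Sum>k\<le>m. h s * indicator (E k) s) \<partial>?M)"
    by (rule nn_integral_cong) (rule split)
  also have "\<dots> = (\<Sum>k\<le>m. \<integral>\<^sup>+ s. h s * indicator (E k) s \<partial>?M)"
    using h E by (intro nn_integral_sum borel_measurable_times_ennreal borel_measurable_indicator)
  also have "\<dots> = (\<Sum>k\<le>m. \<integral>\<^sup>+ x. h (sv m (S + 2 * pi * real k) x)
     * ennreal ((1 / 2) ^ m * (cmod (vandermonde (Suc m) (\<lambda>j. cis (thv m (S + 2 * pi * real k) x j))))\<^sup>2)
     * indicator (Reg m (S + 2 * pi * real k)) x \<partial>?M)"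
    unfolding E_def
    by (rule sum.cong[OF refl]) (rule bspec[OF conjunct2[OF spec[OF cov[unfolded cov_holds_def]]] h])
  finally show ?thesis .
qed

section \<open>Reindexing products and rotating the circle\<close>

text \<open>Both measures agree on boxes.\<close>

lemma distr_PiM_bij:
  fixes \<pi> :: "'i \<Rightarrow> 'i"
  assumes I: "finite I" and bij: "bij_betw \<pi> I I"
    and M: "product_sigma_finite M" and N: "product_sigma_finite N"
    and g: "\<And>i. i \<in> I \<Longrightarrow> g \<in> measurable (M (\<pi> i)) (N i)"
    and d: "\<And>i. i \<in> I \<Longrightarrow> distr (M (\<pi> i)) (N i) g = N i"
  shows "(\<lambda>x. \<lambda>i\<in>I. g (x (\<pi> i))) \<in> measurable (PiM I M) (PiM I N)"
    and "distr (PiM I M) (PiM I N) (\<lambda>x. \<lambda>i\<in>I. g (x (\<pi> i))) = PiM I N"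
proof -
  interpret M: product_sigma_finite M by (rule M)
  interpret N: product_sigma_finite N by (rule N)
  have \<pi>: "\<pi> i \<in> I" if "i \<in> I" for i using bij_betwE[OF bij] that by blast
  let ?T = "\<lambda>x. \<lambda>i\<in>I. g (x (\<pi> i))"
  show T: "?T \<in> measurable (PiM I M) (PiM I N)"
  proof (rule measurable_restrict)
    fix i assume i: "i \<in> I"
    show "(\<lambda>x. g (x (\<pi> i))) \<in> measurable (PiM I M) (N i)"
      by (rule measurable_compose[where f = "\<lambda>x. x (\<pi> i)" and g = g and N = "M (\<pi> i)"])
        (rule measurable_component_singleton[OF \<pi>[OF i]], rule g[OF i])
  qed
  show "distr (PiM I M) (PiM I N) ?T = PiM I N"
  proof (rule N.PiM_eqI[OF I])
    fix A assume A: "\<And>i. i \<in> I \<Longrightarrow> A i \<in> sets (N i)"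
    have pre: thesis if "k \<in> I" "\<And>i. i \<in> I \<Longrightarrow> k = \<pi> i \<Longrightarrow> thesis" for k thesis
    proof -
      have "k \<in> \<pi> ` I" using that(1) bij_betw_imp_surj_on[OF bij] by (simp only:)
      then show thesis by (rule imageE) (rule that(2))
    qed
    define B where "B k = g -` A (inv_into I \<pi> k) \<inter> space (M k)" for k
    have B\<pi>: "B (\<pi> i) = g -` A i \<inter> space (M (\<pi> i))" if "i \<in> I" for i
      using bij_betw_inv_into_left[OF bij that] by (simp add: B_def)
    have Bm: "B k \<in> sets (M k)" if "k \<in> I" for k
    proof -
      obtain i where i: "i \<in> I" "k = \<pi> i" by (rule pre[OF \<open>k \<in> I\<close>])
      show ?thesis unfolding i(2) B\<pi>[OF i(1)] by (rule measurable_sets[OF g[OF i(1)] A[OF i(1)]])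
    qed
    have vim: "?T -` PiE I A \<inter> space (PiM I M) = PiE I B"
    proof (rule Set.set_eqI)
      fix x
      show "x \<in> ?T -` PiE I A \<inter> space (PiM I M) \<longleftrightarrow> x \<in> PiE I B"
      proof
        assume x: "x \<in> ?T -` PiE I A \<inter> space (PiM I M)"
        then have xs: "x \<in> PiE I (\<lambda>i. space (M i))" and T: "?T x \<in> PiE I A"
          unfolding Int_iff vimage_eq space_PiM by (rule conjunct2, rule conjunct1)
        show "x \<in> PiE I B"
        proof (rule PiE_I)
          fix k assume "k \<in> I"
          then obtain i where i: "i \<in> I" "k = \<pi> i" by (rule pre)
          show "x k \<in> B k" unfolding i(2) B\<pi>[OF i(1)]
            using PiE_mem[OF T i(1)] PiE_mem[OF xs \<pi>[OF i(1)]] i(1) by simp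
        qed (rule PiE_arb[OF xs])
      next
        assume x: "x \<in> PiE I B"
        have "x \<in> PiE I (\<lambda>i. space (M i))"
        proof (rule PiE_I)
          fix k assume "k \<in> I"
          from PiE_mem[OF x this] show "x k \<in> space (M k)" by (simp add: B_def)
        qed (rule PiE_arb[OF x])
        moreover have "?T x \<in> PiE I A"
        proof (rule PiE_I)
          fix i assume i: "i \<in> I"
          from PiE_mem[OF x \<pi>[OF i]] show "?T x i \<in> A i" using i by (simp add: B\<pi>)
        qed simp
        ultimately show "x \<in> ?T -` PiE I A \<inter> space (PiM I M)"
          unfolding Int_iff vimage_eq space_PiM by (rule conjI[rotated])
      qed
    qed
    have "emeasure (distr (PiM I M) (PiM I N) ?T) (PiE I A) = emeasure (PiM I M) (PiE I B)"
      by (subst emeasure_distr[OF T sets_PiM_I_finite[OF I A]]) (simp_all only: vim)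
    also have "\<dots> = (\<Prod>k\<in>I. emeasure (M k) (B k))" by (rule M.emeasure_PiM[OF I Bm])
    also have "\<dots> = (\<Prod>i\<in>I. emeasure (M (\<pi> i)) (B (\<pi> i)))" by (rule prod.reindex_bij_betw[OF bij, symmetric])
    also have "\<dots> = (\<Prod>i\<in>I. emeasure (N i) (A i))"
    proof (rule prod.cong[OF refl])
      fix i assume i: "i \<in> I"
      have "emeasure (M (\<pi> i)) (B (\<pi> i)) = emeasure (distr (M (\<pi> i)) (N i) g) (A i)"
        unfolding B\<pi>[OF i] by (rule emeasure_distr[OF g[OF i] A[OF i], symmetric])
      then show "emeasure (M (\<pi> i)) (B (\<pi> i)) = emeasure (N i) (A i)" unfolding d[OF i] .
    qed
    finally show "emeasure (distr (PiM I M) (PiM I N) ?T) (PiE I A) = (\<Prod>i\<in>I. emeasure (N i) (A i))" .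
  qed simp
qed

lemma nn_integral_lborel_permute:
  fixes n :: nat
  assumes \<sigma>: "\<sigma> permutes {..<n}" and H: "H \<in> borel_measurable (PiM {..<n} (\<lambda>_. lborel :: real measure))"
  shows "(\<integral>\<^sup>+ x. H (\<lambda>i\<in>{..<n}. x (\<sigma> i)) \<partial>PiM {..<n} (\<lambda>_. lborel)) = (\<integral>\<^sup>+ x. H x \<partial>PiM {..<n} (\<lambda>_. lborel :: real measure))"
proof -
  have P: "product_sigma_finite (\<lambda>_::nat. lborel :: real measure)" ..
  have d: "distr lborel lborel (\<lambda>x. x) = (lborel :: real measure)" by (rule distr_id2) simp
  have I: "(\<lambda>x. x) \<in> measurable (lborel :: real measure) lborel" by simp
  have E1: "(\<lambda>x. \<lambda>i\<in>{..<n}. x (\<sigma> i)) \<in> measurable (PiM {..<n} (\<lambda>_. lborel :: real measure)) (PiM {..<n} (\<lambda>_. lborel :: real measure))"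
    by (rule distr_PiM_bij(1)[where I = "{..<n}" and \<pi> = \<sigma> and M = "\<lambda>_. lborel" and N = "\<lambda>_. lborel" and g = "\<lambda>x. x", OF finite_lessThan permutes_imp_bij[OF \<sigma>] P P]) (rule I d)+
  have E2: "distr (PiM {..<n} (\<lambda>_. lborel :: real measure)) (PiM {..<n} (\<lambda>_. lborel :: real measure)) (\<lambda>x. \<lambda>i\<in>{..<n}. x (\<sigma> i)) = (PiM {..<n} (\<lambda>_. lborel :: real measure))"
    by (rule distr_PiM_bij(2)[where I = "{..<n}" and \<pi> = \<sigma> and M = "\<lambda>_. lborel" and N = "\<lambda>_. lborel" and g = "\<lambda>x. x", OF finite_lessThan permutes_imp_bij[OF \<sigma>] P P]) (rule I d)+
  have "(\<integral>\<^sup>+ x. H x \<partial>PiM {..<n} (\<lambda>_. lborel)) = (\<integral>\<^sup>+ x. H x \<partial>distr (PiM {..<n} (\<lambda>_. lborel)) (PiM {..<n} (\<lambda>_. lborel)) (\<lambda>x. \<lambda>i\<in>{..<n}. x (\<sigma> i)))"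
    unfolding E2 ..
  also have "\<dots> = (\<integral>\<^sup>+ x. H (\<lambda>i\<in>{..<n}. x (\<sigma> i)) \<partial>PiM {..<n} (\<lambda>_. lborel))"
    by (rule nn_integral_distr[OF E1]) (simp add: H)
  finally show ?thesis by (rule sym)
qed

lemma nn_integral_period:
  fixes h :: "real \<Rightarrow> ennreal"
  assumes [measurable]: "h \<in> borel_measurable borel" and per: "\<And>t. h (t + 2 * pi) = h t"
  shows "(\<integral>\<^sup>+ t. h (t + pi) * indicator {0..<2 * pi} t \<partial>lborel) = (\<integral>\<^sup>+ t. h t * indicator {0..<2 * pi} t \<partial>lborel)"
proof -
  have tr: "(\<integral>\<^sup>+ t. g t \<partial>lborel) = (\<integral>\<^sup>+ t. g (c + t) \<partial>lborel)" if "g \<in> borel_measurable borel" for g :: "real \<Rightarrow> ennreal" and c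
    using nn_integral_real_affine[OF that, of 1 c] by simp
  have "(\<integral>\<^sup>+ t. h (t + pi) * indicator {0..<2 * pi} t \<partial>lborel) = (\<integral>\<^sup>+ t. h (t + pi) * indicator {0..<pi} t + h (t + pi) * indicator {pi..<2 * pi} t \<partial>lborel)"
    by (intro nn_integral_cong) (auto simp: indicator_def)
  also have "\<dots> = (\<integral>\<^sup>+ t. h (t + pi) * indicator {0..<pi} t \<partial>lborel) + (\<integral>\<^sup>+ t. h (t + pi) * indicator {pi..<2 * pi} t \<partial>lborel)"
    by (rule nn_integral_add) measurable
  also have "(\<integral>\<^sup>+ t. h (t + pi) * indicator {0..<pi} t \<partial>lborel) = (\<integral>\<^sup>+ t. h t * indicator {pi..<2 * pi} t \<partial>lborel)"
  proof -
    have "(\<lambda>t. h (t + pi) * indicator {0..<pi} t) \<in> borel_measurable borel" by measurable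
    moreover have "h (- pi + t + pi) * indicator {0..<pi} (- pi + t) = h t * indicator {pi..<2 * pi} t" for t
      by (simp add: indicator_def)
    ultimately show ?thesis using tr[of "\<lambda>t. h (t + pi) * indicator {0..<pi} t" "- pi"] by (simp only:)
  qed
  also have "(\<integral>\<^sup>+ t. h (t + pi) * indicator {pi..<2 * pi} t \<partial>lborel) = (\<integral>\<^sup>+ t. h t * indicator {0..<pi} t \<partial>lborel)"
  proof -
    have "h (pi + t + pi) = h t" for t using per[of t] by (simp add: algebra_simps)
    then have "h (pi + t + pi) * indicator {pi..<2 * pi} (pi + t) = h t * indicator {0..<pi} t" for t
      by (simp add: indicator_def)
    moreover have m: "(\<lambda>t. h (t + pi) * indicator {pi..<2 * pi} t) \<in> borel_measurable borel" by measurable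
    ultimately show ?thesis using tr[OF m, of pi] by (simp only:)
  qed
  also have "(\<integral>\<^sup>+ t. h t * indicator {pi..<2 * pi} t \<partial>lborel) + (\<integral>\<^sup>+ t. h t * indicator {0..<pi} t \<partial>lborel)
      = (\<integral>\<^sup>+ t. h t * indicator {pi..<2 * pi} t + h t * indicator {0..<pi} t \<partial>lborel)"
    by (rule nn_integral_add[symmetric]) measurable
  also have "\<dots> = (\<integral>\<^sup>+ t. h t * indicator {0..<2 * pi} t \<partial>lborel)"
    by (intro nn_integral_cong) (auto simp: indicator_def)
  finally show ?thesis .
qed

text \<open>The uniform law on the circle is invariant under conjugation and rotation. The sign \<open>(-1) ^ Suc m\<close> is the one relating the product of \<open>- z j\<close> to the sum of the angles.\<close>

lemma nn_integral_circle_reflect: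
  fixes \<Psi> :: "complex \<Rightarrow> ennreal"
  assumes [measurable]: "\<Psi> \<in> borel_measurable borel"
  shows "(\<integral>\<^sup>+ t. \<Psi> (- cnj (cis t)) * indicator {0..2 * pi} t \<partial>lborel)
       = (\<integral>\<^sup>+ t. \<Psi> ((- 1) ^ Suc m * cis t) * indicator {0..<2 * pi} t \<partial>lborel)"
proof -
  have [measurable]: "cis \<in> borel_measurable borel" by (intro borel_measurable_continuous_onI continuous_intros)
  have "(\<integral>\<^sup>+ t. \<Psi> (- cnj (cis t)) * indicator {0..2 * pi} t \<partial>lborel)
     = (\<integral>\<^sup>+ t. \<Psi> (- cnj (cis (2 * pi - t))) * indicator {0..2 * pi} (2 * pi - t) \<partial>lborel)"
  proof -
    have "(\<lambda>t. \<Psi> (- cnj (cis t)) * indicator {0..2 * pi} t) \<in> borel_measurable borel"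
      unfolding cis_cnj by measurable
    from nn_integral_real_affine[OF this, of "-1" "2 * pi"] show ?thesis by simp
  qed
  also have "\<dots> = (\<integral>\<^sup>+ t. \<Psi> (- cis t) * indicator {0..<2 * pi} t \<partial>lborel)"
  proof (rule nn_integral_cong_AE)
    have "AE t in lborel. t \<noteq> 2 * pi" by (rule AE_lborel_singleton)
    then show "AE t in lborel. \<Psi> (- cnj (cis (2 * pi - t))) * indicator {0..2 * pi} (2 * pi - t) = \<Psi> (- cis t) * indicator {0..<2 * pi} t"
    proof eventually_elim
      case (elim t)
      have "cnj (cis (2 * pi - t)) = cis t" unfolding cis_cnj by (simp add: complex_eq_iff cos_diff sin_diff)
      then show ?case using elim by (auto simp: indicator_def)
    qed
  qed
  also have "\<dots> = (\<integral>\<^sup>+ t. \<Psi> ((- 1) ^ Suc m * cis t) * indicator {0..<2 * pi} t \<partial>lborel)"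
  proof (cases "even m")
    case False
    have s: "- cis t = cis (t + pi)" for t by (simp add: complex_eq_iff)
    have p: "cis (t + 2 * pi) = cis t" for t by (simp add: complex_eq_iff)
    have m: "(\<lambda>t. \<Psi> (cis t)) \<in> borel_measurable borel" by measurable
    have "(- 1) ^ Suc m * cis t = cis t" for t using False by simp
    then show ?thesis unfolding s using nn_integral_period[OF m] unfolding p by (simp only:)
  qed simp
  finally show ?thesis .
qed

section \<open>Integrating out the weights\<close>

lemma measurable_any_component [measurable]:
  "(\<lambda>x. x k) \<in> borel_measurable (PiM I (\<lambda>_. lborel :: 'a::euclidean_space measure))"
proof (cases "k \<in> I")
  case True
  then show ?thesis using measurable_component_singleton[of k I "\<lambda>_. lborel :: 'a measure"] by simp
next
  case False
  have "(\<lambda>x. x k) \<in> borel_measurable (PiM I (\<lambda>_. lborel :: 'a measure)) \<longleftrightarrow> (\<lambda>x. undefined :: 'a) \<in> borel_measurable (PiM I (\<lambda>_. lborel :: 'a measure))"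
  proof (rule measurable_cong)
    fix x assume "x \<in> space (PiM I (\<lambda>_. lborel :: 'a measure))"
    then have "x \<in> PiE I (\<lambda>_. UNIV)" by (simp add: space_PiM)
    then show "x k = undefined" using False by (rule PiE_arb)
  qed
  then show ?thesis by simp
qed

lemma measurable_increasing_angles [measurable]:
  "Measurable.pred (PiM I (\<lambda>_. lborel :: real measure)) (\<lambda>\<theta>. increasing_angles m \<theta>)"
  unfolding increasing_angles_def by measurable

lemma measurable_circle_point [measurable]:
  "circle_point n \<in> measurable (PiM I (\<lambda>_. lborel :: real measure)) (PiM {..<n} (\<lambda>_. borel))"
  unfolding circle_point_def
proof (rule measurable_restrict)
  fix i
  have "cis \<in> borel_measurable borel" by (intro borel_measurable_continuous_onI continuous_intros)
  then show "(\<lambda>\<theta>. cis (\<theta> i)) \<in> measurable (PiM I (\<lambda>_. lborel :: real measure)) borel"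
    by (rule measurable_compose[OF measurable_any_component])
qed

lemma measurable_vandermonde:
  assumes "\<And>i. i < n \<Longrightarrow> (\<lambda>w. z w i) \<in> borel_measurable M"
  shows "(\<lambda>w. vandermonde n (z w)) \<in> borel_measurable M"
  unfolding vandermonde_def
  by (intro borel_measurable_prod borel_measurable_diff assms) auto

text \<open>A test function weighted by the unnormalised Coulomb density.\<close>

definition gas :: "nat \<Rightarrow> real \<Rightarrow> ((nat \<Rightarrow> complex) \<Rightarrow> ennreal) \<Rightarrow> (nat \<Rightarrow> real) \<Rightarrow> ennreal" where
  "gas n \<beta> F \<theta> = F (circle_point n \<theta>) * ennreal (cmod (vandermonde n (circle_point n \<theta>)) powr \<beta>)"

lemma measurable_gas:
  assumes [measurable]: "F \<in> borel_measurable (PiM {..<n} (\<lambda>_. borel))"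
  shows "gas n \<beta> F \<in> borel_measurable (PiM I (\<lambda>_. lborel))"
proof -
  have [measurable]: "(\<lambda>\<theta>. vandermonde n (circle_point n \<theta>)) \<in> borel_measurable (PiM I (\<lambda>_. lborel))"
    by (rule measurable_vandermonde) (rule measurable_compose[OF measurable_circle_point measurable_component_singleton], simp)
  show ?thesis unfolding gas_def[abs_def] by measurable
qed

definition sorted_gas :: "nat \<Rightarrow> real \<Rightarrow> ((nat \<Rightarrow> complex) \<Rightarrow> ennreal) \<Rightarrow> (nat \<Rightarrow> real) \<Rightarrow> ennreal" where
  "sorted_gas m \<beta> F \<theta> = gas (Suc m) \<beta> F \<theta> * of_bool (increasing_angles m \<theta>)"

lemma measurable_sorted_gas:
  assumes "F \<in> borel_measurable (PiM {..<Suc m} (\<lambda>_. borel))"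
  shows "sorted_gas m \<beta> F \<in> borel_measurable (PiM I (\<lambda>_. lborel))"
proof -
  note [measurable] = measurable_gas[OF assms]
  show ?thesis unfolding sorted_gas_def[abs_def] by measurable
qed

lemma sorted_gas_cong:
  assumes "\<And>i. i \<le> m \<Longrightarrow> \<theta> i = \<theta>' i"
  shows "sorted_gas m \<beta> F \<theta> = sorted_gas m \<beta> F \<theta>'"
proof -
  have "circle_point (Suc m) \<theta> = circle_point (Suc m) \<theta>'" unfolding circle_point_def using assms by (intro restrict_ext) simp
  moreover have "increasing_angles m \<theta> = increasing_angles m \<theta>'" unfolding increasing_angles_def using assms by simp
  ultimately show ?thesis unfolding sorted_gas_def gas_def by (simp only:)
qed

text \<open>The part of the transformed density that depends on the spectral weights alone.\<close>

definition weight_factor :: "nat \<Rightarrow> real \<Rightarrow> (nat \<Rightarrow> complex) \<Rightarrow> ennreal" where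
  "weight_factor m \<beta> x = ennreal ((1 / 2) ^ m * (\<Prod>j\<le>m. nuv m x j) powr (\<beta> / 2 - 1)) * of_bool (\<forall>k\<le>m. nuv m x k > 0)"

lemma nn_integral_split_weights:
  assumes F: "F \<in> borel_measurable (PiM {..<Suc m} (\<lambda>_. borel))"
  shows "(\<integral>\<^sup>+ x. sorted_gas m \<beta> F (thv m S x) * weight_factor m \<beta> x \<partial>PiM {..<m} (\<lambda>_. lborel))
    = (\<integral>\<^sup>+ w. weight_factor m \<beta> (\<lambda>k. of_real (w (m + k))) \<partial>PiM {m..<2 * m} (\<lambda>_. lborel))
      * (\<integral>\<^sup>+ y. sorted_gas m \<beta> F (y(m := S - (\<Sum>j<m. y j))) \<partial>PiM {..<m} (\<lambda>_. lborel))"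
proof -
  interpret R: product_sigma_finite "\<lambda>_::nat. lborel :: real measure" by standard
  have nuv_meas [measurable]: "(\<lambda>w. nuv m (f w) k) \<in> borel_measurable N" if "\<And>k. (\<lambda>w. Re (f w k)) \<in> borel_measurable N" for f :: "'b \<Rightarrow> nat \<Rightarrow> complex" and N k
    using that unfolding nuv_def by simp
  have W: "(\<lambda>w. weight_factor m \<beta> (f w)) \<in> borel_measurable N" if "\<And>k. (\<lambda>w. Re (f w k)) \<in> borel_measurable N" for f :: "'b \<Rightarrow> nat \<Rightarrow> complex" and N
  proof -
    have [measurable]: "(\<lambda>w. nuv m (f w) k) \<in> borel_measurable N" for k using that unfolding nuv_def by simp
    show ?thesis unfolding weight_factor_def by measurable
  qed
  have th: "(\<lambda>w. sorted_gas m \<beta> F (g w)) \<in> borel_measurable N" if "\<And>k. (\<lambda>w. g w k) \<in> borel_measurable N" for g :: "'b \<Rightarrow> nat \<Rightarrow> real" and N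
  proof -
    have "(\<lambda>w. \<lambda>k\<in>{..<Suc m}. g w k) \<in> measurable N (PiM {..<Suc m} (\<lambda>_. lborel))"
      by (rule measurable_restrict) (use that in simp)
    from measurable_compose[OF this measurable_sorted_gas[OF F]]
    have "(\<lambda>w. sorted_gas m \<beta> F (\<lambda>k\<in>{..<Suc m}. g w k)) \<in> borel_measurable N" .
    moreover have "sorted_gas m \<beta> F (\<lambda>k\<in>{..<Suc m}. g w k) = sorted_gas m \<beta> F (g w)" for w
      by (rule sorted_gas_cong) simp
    ultimately show ?thesis by (simp only:)
  qed
  let ?X = "\<lambda>w. \<lambda>k\<in>{..<m}. Complex (w (m + k)) (w k)"
  let ?U = "{m..<2 * m}" and ?V = "{..<m}"
  have H: "(\<lambda>x. sorted_gas m \<beta> F (thv m S x) * weight_factor m \<beta> x) \<in> borel_measurable (PiM {..<m} (\<lambda>_. lborel))"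
    by (intro borel_measurable_times_ennreal th W) (auto simp: thv_def)
  have im: "(\<lambda>k. m + k) ` {..<m} = ?U" "(\<lambda>k. k) ` {..<m} = ?V"
  proof -
    have "x \<in> (\<lambda>k. m + k) ` {..<m}" if "m \<le> x" "x < 2 * m" for x
      by (rule image_eqI[of _ _ "x - m"]) (use that in auto)
    then show "(\<lambda>k. m + k) ` {..<m} = ?U" by (intro subset_antisym subsetI) auto
  qed simp
  have "(\<integral>\<^sup>+ x. sorted_gas m \<beta> F (thv m S x) * weight_factor m \<beta> x \<partial>PiM {..<m} (\<lambda>_. lborel))
    = (\<integral>\<^sup>+ w. sorted_gas m \<beta> F (thv m S (?X w)) * weight_factor m \<beta> (?X w) \<partial>PiM (?U \<union> ?V) (\<lambda>_. lborel))"
    using nn_integral_PiM_complex_real[of "{..<m}" "\<lambda>k. m + k" "\<lambda>k. k", OF _ _ _ _ H] unfolding im by (simp add: inj_on_def disjoint_iff)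
  also have "\<dots> = (\<integral>\<^sup>+ w. sorted_gas m \<beta> F (w(m := S - (\<Sum>j<m. w j))) * weight_factor m \<beta> (\<lambda>k. of_real (w (m + k))) \<partial>PiM (?U \<union> ?V) (\<lambda>_. lborel))"
  proof (rule nn_integral_cong)
    fix w :: "nat \<Rightarrow> real"
    have "sorted_gas m \<beta> F (thv m S (?X w)) = sorted_gas m \<beta> F (w(m := S - (\<Sum>j<m. w j)))"
      by (rule sorted_gas_cong) (simp add: thv_def)
    moreover have "nuv m (?X w) = nuv m (\<lambda>k. of_real (w (m + k)))" by (simp add: nuv_def fun_eq_iff)
    ultimately show "sorted_gas m \<beta> F (thv m S (?X w)) * weight_factor m \<beta> (?X w) = sorted_gas m \<beta> F (w(m := S - (\<Sum>j<m. w j))) * weight_factor m \<beta> (\<lambda>k. of_real (w (m + k)))"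
      unfolding weight_factor_def by (simp only:)
  qed
  also have "\<dots> = (\<integral>\<^sup>+ x. \<integral>\<^sup>+ y. sorted_gas m \<beta> F ((merge ?U ?V (x, y))(m := S - (\<Sum>j<m. merge ?U ?V (x, y) j)))
      * weight_factor m \<beta> (\<lambda>k. of_real (merge ?U ?V (x, y) (m + k))) \<partial>PiM ?V (\<lambda>_. lborel) \<partial>PiM ?U (\<lambda>_. lborel))"
  proof (rule R.product_nn_integral_fold)
    show "(\<lambda>w. sorted_gas m \<beta> F (w(m := S - (\<Sum>j<m. w j))) * weight_factor m \<beta> (\<lambda>k. of_real (w (m + k)))) \<in> borel_measurable (PiM (?U \<union> ?V) (\<lambda>_. lborel))"
      by (intro borel_measurable_times_ennreal th W) (auto simp: fun_upd_def)
  qed auto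
  also have "\<dots> = (\<integral>\<^sup>+ x. \<integral>\<^sup>+ y. weight_factor m \<beta> (\<lambda>k. of_real (x (m + k))) * sorted_gas m \<beta> F (y(m := S - (\<Sum>j<m. y j))) \<partial>PiM ?V (\<lambda>_. lborel) \<partial>PiM ?U (\<lambda>_. lborel))"
  proof (intro nn_integral_cong)
    fix x y :: "nat \<Rightarrow> real"
    have "sorted_gas m \<beta> F ((merge ?U ?V (x, y))(m := S - (\<Sum>j<m. merge ?U ?V (x, y) j))) = sorted_gas m \<beta> F (y(m := S - (\<Sum>j<m. y j)))"
      by (rule sorted_gas_cong) (simp add: merge_def)
    moreover have "nuv m (\<lambda>k. of_real (merge ?U ?V (x, y) (m + k))) = nuv m (\<lambda>k. of_real (x (m + k)))"
      by (simp add: nuv_def merge_def fun_eq_iff)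
    ultimately show "sorted_gas m \<beta> F ((merge ?U ?V (x, y))(m := S - (\<Sum>j<m. merge ?U ?V (x, y) j))) * weight_factor m \<beta> (\<lambda>k. of_real (merge ?U ?V (x, y) (m + k)))
       = weight_factor m \<beta> (\<lambda>k. of_real (x (m + k))) * sorted_gas m \<beta> F (y(m := S - (\<Sum>j<m. y j)))"
      unfolding weight_factor_def by (simp only: mult.commute)
  qed
  also have "\<dots> = (\<integral>\<^sup>+ x. weight_factor m \<beta> (\<lambda>k. of_real (x (m + k))) \<partial>PiM ?U (\<lambda>_. lborel)) * (\<integral>\<^sup>+ y. sorted_gas m \<beta> F (y(m := S - (\<Sum>j<m. y j))) \<partial>PiM ?V (\<lambda>_. lborel))"
  proof -
    have m1: "(\<lambda>y. sorted_gas m \<beta> F (y(m := S - (\<Sum>j<m. y j)))) \<in> borel_measurable (PiM ?V (\<lambda>_. lborel))"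
      by (rule th) (auto simp: fun_upd_def)
    have m2: "(\<lambda>x. weight_factor m \<beta> (\<lambda>k. of_real (x (m + k)))) \<in> borel_measurable (PiM ?U (\<lambda>_. lborel))"
      by (rule W) simp
    show ?thesis unfolding nn_integral_cmult[OF m1] by (rule nn_integral_multc[OF m2])
  qed
  finally show ?thesis .
qed

section \<open>Integrating over the phase\<close>

declare measurable_any_component [measurable del]

lemma sum_indicator_windows:
  "(\<Sum>k\<le>m. indicator {2 * pi * real k..<2 * pi * (real k + 1)} S) = (indicator {0..<2 * pi * (real m + 1)} S :: ennreal)"
proof (induction m)
  case (Suc m)
  have add: "indicator {0..<a} S + indicator {a..<b} S = (indicator {0..<b} S :: ennreal)" if "0 \<le> a" "a \<le> b" for a b :: real
    using that by (auto simp: indicator_def)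
  have w: "real (Suc m) = real m + 1" by simp
  show ?case unfolding sum.atMost_Suc Suc unfolding w by (rule add) simp_all
qed simp

text \<open>Unfolds integration over one period into integration over the line.\<close>

lemma nn_integral_windows:
  fixes J :: "real \<Rightarrow> ennreal"
  assumes J: "J \<in> borel_measurable borel" and supp: "\<And>S. \<not> (0 \<le> S \<and> S < 2 * pi * (real m + 1)) \<Longrightarrow> J S = 0"
  shows "(\<integral>\<^sup>+ S. (\<Sum>k\<le>m. J (S + 2 * pi * real k)) * indicator {0..<2 * pi} S \<partial>lborel) = (\<integral>\<^sup>+ S. J S \<partial>lborel)"
proof -
  note [measurable] = J
  have shift: "(\<integral>\<^sup>+ S. J (S + 2 * pi * real k) * indicator {0..<2 * pi} S \<partial>lborel)
      = (\<integral>\<^sup>+ S. J S * indicator {2 * pi * real k..<2 * pi * (real k + 1)} S \<partial>lborel)" for k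
  proof -
    have "(\<lambda>S. J S * indicator {2 * pi * real k..<2 * pi * (real k + 1)} S) \<in> borel_measurable borel" by measurable
    from nn_integral_real_affine[OF this, of 1 "2 * pi * real k"]
    have "(\<integral>\<^sup>+ S. J S * indicator {2 * pi * real k..<2 * pi * (real k + 1)} S \<partial>lborel)
      = (\<integral>\<^sup>+ S. J (2 * pi * real k + S) * indicator {2 * pi * real k..<2 * pi * (real k + 1)} (2 * pi * real k + S) \<partial>lborel)" by simp
    also have "\<dots> = (\<integral>\<^sup>+ S. J (S + 2 * pi * real k) * indicator {0..<2 * pi} S \<partial>lborel)"
      by (rule nn_integral_cong) (simp add: indicator_def ring_distribs add.commute)
    finally show ?thesis by (rule sym)
  qed
  have "(\<integral>\<^sup>+ S. (\<Sum>k\<le>m. J (S + 2 * pi * real k)) * indicator {0..<2 * pi} S \<partial>lborel)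
     = (\<integral>\<^sup>+ S. (\<Sum>k\<le>m. J (S + 2 * pi * real k) * indicator {0..<2 * pi} S) \<partial>lborel)"
    by (simp only: sum_distrib_right)
  also have "\<dots> = (\<Sum>k\<le>m. \<integral>\<^sup>+ S. J (S + 2 * pi * real k) * indicator {0..<2 * pi} S \<partial>lborel)"
    by (rule nn_integral_sum) measurable
  also have "\<dots> = (\<Sum>k\<le>m. \<integral>\<^sup>+ S. J S * indicator {2 * pi * real k..<2 * pi * (real k + 1)} S \<partial>lborel)"
    unfolding shift ..
  also have "\<dots> = (\<integral>\<^sup>+ S. (\<Sum>k\<le>m. J S * indicator {2 * pi * real k..<2 * pi * (real k + 1)} S) \<partial>lborel)"
    by (rule nn_integral_sum[symmetric]) measurable
  also have "\<dots> = (\<integral>\<^sup>+ S. J S * indicator {0..<2 * pi * (real m + 1)} S \<partial>lborel)"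
    unfolding sum_distrib_left[symmetric] sum_indicator_windows ..
  also have "\<dots> = (\<integral>\<^sup>+ S. J S \<partial>lborel)"
  proof (rule nn_integral_cong)
    fix S
    show "J S * indicator {0..<2 * pi * (real m + 1)} S = J S"
      using supp[of S] by (cases "0 \<le> S \<and> S < 2 * pi * (real m + 1)") (simp_all add: indicator_def)
  qed
  finally show ?thesis .
qed

text \<open>For fixed first \<open>m\<close> angles, integrating over the sum of all angles is, by translation, integrating over the last one.\<close>

lemma nn_integral_trace_out:
  assumes F: "F \<in> borel_measurable (PiM {..<Suc m} (\<lambda>_. borel))"
  shows "(\<lambda>S. \<integral>\<^sup>+ y. sorted_gas m \<beta> F (y(m := S - (\<Sum>j<m. y j))) \<partial>PiM {..<m} (\<lambda>_. lborel)) \<in> borel_measurable borel"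
    and "(\<integral>\<^sup>+ S. \<integral>\<^sup>+ y. sorted_gas m \<beta> F (y(m := S - (\<Sum>j<m. y j))) \<partial>PiM {..<m} (\<lambda>_. lborel) \<partial>lborel)
       = (\<integral>\<^sup>+ \<theta>. sorted_gas m \<beta> F \<theta> \<partial>PiM {..<Suc m} (\<lambda>_. lborel))"
proof -
  interpret R: product_sigma_finite "\<lambda>_::nat. lborel :: real measure" by standard
  let ?P = "PiM {..<m} (\<lambda>_. lborel :: real measure)"
  interpret V: finite_product_sigma_finite "\<lambda>_::nat. lborel :: real measure" "{..<m}" by standard simp
  interpret pr: pair_sigma_finite "lborel :: real measure" ?P ..
  define g where "g p = sorted_gas m \<beta> F ((snd p)(m := fst p - (\<Sum>j<m. snd p j)))" for p :: "real \<times> (nat \<Rightarrow> real)"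
  have upd: "(\<lambda>p. (snd p)(m := fst p - (\<Sum>j<m. snd p j))) \<in> measurable (lborel \<Otimes>\<^sub>M ?P) (PiM {..<Suc m} (\<lambda>_. lborel))"
  proof (rule measurable_fun_upd[where J = "{..<m}"])
    show "{..<Suc m} = {..<m} \<union> {m}" by auto
    have [measurable]: "(\<lambda>p. snd p j) \<in> borel_measurable ((lborel :: real measure) \<Otimes>\<^sub>M ?P)" for j
      by (rule measurable_compose[OF measurable_snd measurable_any_component])
    show "(\<lambda>p. fst p - (\<Sum>j<m. snd p j)) \<in> measurable ((lborel :: real measure) \<Otimes>\<^sub>M ?P) lborel"
      unfolding measurable_lborel1 by measurable
  qed simp
  have g: "g \<in> borel_measurable (lborel \<Otimes>\<^sub>M ?P)"
    unfolding g_def[abs_def] by (rule measurable_compose[OF upd measurable_sorted_gas[OF F]])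
  show "(\<lambda>S. \<integral>\<^sup>+ y. sorted_gas m \<beta> F (y(m := S - (\<Sum>j<m. y j))) \<partial>?P) \<in> borel_measurable borel"
    using V.borel_measurable_nn_integral_fst[OF g] by (simp add: g_def)
  have G: "sorted_gas m \<beta> F \<in> borel_measurable (PiM (insert m {..<m}) (\<lambda>_. lborel))" by (rule measurable_sorted_gas[OF F])
  have "(\<integral>\<^sup>+ S. \<integral>\<^sup>+ y. sorted_gas m \<beta> F (y(m := S - (\<Sum>j<m. y j))) \<partial>?P \<partial>lborel) = (\<integral>\<^sup>+ S. \<integral>\<^sup>+ y. g (S, y) \<partial>?P \<partial>lborel)"
    by (simp add: g_def)
  also have "\<dots> = (\<integral>\<^sup>+ y. \<integral>\<^sup>+ S. g (S, y) \<partial>lborel \<partial>?P)"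
    using pr.Fubini[OF g] by simp
  also have "\<dots> = (\<integral>\<^sup>+ y. \<integral>\<^sup>+ t. sorted_gas m \<beta> F (y(m := t)) \<partial>lborel \<partial>?P)"
  proof (rule nn_integral_cong)
    fix y assume y: "y \<in> space ?P"
    have "(\<lambda>t. y(m := t)) \<in> measurable lborel (PiM {..<Suc m} (\<lambda>_. lborel))"
      by (rule measurable_fun_upd[where J = "{..<m}"]) (use y in auto)
    from measurable_compose[OF this measurable_sorted_gas[OF F]]
    have "(\<lambda>t. sorted_gas m \<beta> F (y(m := t))) \<in> borel_measurable borel" by simp
    from nn_integral_real_affine[OF this, of 1 "- (\<Sum>j<m. y j)"]
    show "(\<integral>\<^sup>+ S. g (S, y) \<partial>lborel) = (\<integral>\<^sup>+ t. sorted_gas m \<beta> F (y(m := t)) \<partial>lborel)" by (simp add: g_def)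
  qed
  also have "\<dots> = (\<integral>\<^sup>+ \<theta>. sorted_gas m \<beta> F \<theta> \<partial>PiM (insert m {..<m}) (\<lambda>_. lborel))"
    by (rule R.product_nn_integral_insert[symmetric, OF _ _ G]) simp_all
  finally show "(\<integral>\<^sup>+ S. \<integral>\<^sup>+ y. sorted_gas m \<beta> F (y(m := S - (\<Sum>j<m. y j))) \<partial>?P \<partial>lborel)
       = (\<integral>\<^sup>+ \<theta>. sorted_gas m \<beta> F \<theta> \<partial>PiM {..<Suc m} (\<lambda>_. lborel))" by (simp only: lessThan_Suc)
qed

lemma sorted_gas_support:
  assumes "sorted_gas m \<beta> F (y(m := S - (\<Sum>j<m. y j))) \<noteq> 0"
  shows "0 \<le> S \<and> S < 2 * pi * (real m + 1)"
proof -
  let ?\<theta> = "y(m := S - (\<Sum>j<m. y j))"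
  have inc: "increasing_angles m ?\<theta>" using assms by (cases "increasing_angles m ?\<theta>") (simp_all add: sorted_gas_def)
  have S: "S = (\<Sum>j\<le>m. ?\<theta> j)" by (simp add: lessThan_Suc_atMost[symmetric])
  have "0 \<le> (\<Sum>j\<le>m. ?\<theta> j)" by (rule sum_nonneg) (rule increasing_angles_range(1)[OF inc], simp)
  moreover have "(\<Sum>j\<le>m. ?\<theta> j) < (\<Sum>j\<le>m. 2 * pi)" by (rule sum_strict_mono) (simp, simp, rule increasing_angles_range(2)[OF inc], simp)
  moreover have "(\<Sum>j\<le>m. 2 * pi) = 2 * pi * (real m + 1)" by (simp add: algebra_simps)
  ultimately show ?thesis unfolding S[symmetric] by (simp only: simp_thms)
qed

text \<open>All ingredients meet here: for each phase the coefficients are replaced by angles and weights, the weights contribute a constant, and the phase becomes the last angle.\<close>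

lemma nn_integral_coefficients_to_angles:
  fixes \<Phi> F :: "(nat \<Rightarrow> complex) \<Rightarrow> ennreal"
  assumes F: "F \<in> borel_measurable (PiM {..<Suc m} (\<lambda>_. borel))" and \<Phi>: "\<Phi> \<in> borel_measurable (PiM {..<Suc m} (\<lambda>_. borel))"
    and \<Phi>F: "\<And>t v. t \<in> {..<Suc m} \<rightarrow>\<^sub>E UNIV \<Longrightarrow> v \<in> {..<Suc m} \<rightarrow>\<^sub>E UNIV \<Longrightarrow> monic_of (Suc m) t = (\<Prod>i<Suc m. [:- v i, 1:]) \<Longrightarrow> \<Phi> t = F v"
  defines "u S \<equiv> (- 1) ^ Suc m * cis S"
  shows "(\<integral>\<^sup>+ S. (\<integral>\<^sup>+ s. \<Phi> ((lin m (u S) s)(m := u S)) * ennreal (Wt (\<beta> / 2 - 1) m s) \<partial>PiM {..<m} (\<lambda>_. lborel)) * indicator {0..<2 * pi} S \<partial>lborel)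
    = (\<integral>\<^sup>+ w. weight_factor m \<beta> (\<lambda>k. of_real (w (m + k))) \<partial>PiM {m..<2 * m} (\<lambda>_. lborel))
      * (\<integral>\<^sup>+ \<theta>. sorted_gas m \<beta> F \<theta> \<partial>PiM {..<Suc m} (\<lambda>_. lborel))"
proof -
  define K where "K = (\<integral>\<^sup>+ w. weight_factor m \<beta> (\<lambda>k. of_real (w (m + k))) \<partial>PiM {m..<2 * m} (\<lambda>_. lborel))"
  define J where "J S = (\<integral>\<^sup>+ x. sorted_gas m \<beta> F (thv m S x) * weight_factor m \<beta> x \<partial>PiM {..<m} (\<lambda>_. lborel))" for S
  define I where "I S = (\<integral>\<^sup>+ y. sorted_gas m \<beta> F (y(m := S - (\<Sum>j<m. y j))) \<partial>PiM {..<m} (\<lambda>_. lborel))" for S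
  have JI: "J S = K * I S" for S unfolding J_def K_def I_def by (rule nn_integral_split_weights[OF F])
  have Im: "I \<in> borel_measurable borel" unfolding I_def[abs_def] by (rule nn_integral_trace_out(1)[OF F])
  have Jm: "J \<in> borel_measurable borel" unfolding JI[abs_def] using Im by measurable
  have upd_PiE: "(lin m g s)(m := g) \<in> {..<Suc m} \<rightarrow>\<^sub>E UNIV" for g s by (auto simp: PiE_def extensional_def lin_def)
  have point: "\<Phi> ((lin m (u S) (sv m T x))(m := u S)) * ennreal (Wt (\<beta> / 2 - 1) m (sv m T x))
     * ennreal ((1 / 2) ^ m * (cmod (vandermonde (Suc m) (\<lambda>j. cis (thv m T x j))))\<^sup>2) * indicator (Reg m T) x
     = sorted_gas m \<beta> F (thv m T x) * weight_factor m \<beta> x"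
    if T: "cis T = cis S" and x: "x \<in> {..<m} \<rightarrow>\<^sub>E UNIV" for T S x
  proof (cases "x \<in> Reg m T")
    case True
    have "u S = (- 1) ^ Suc m * cis T" unfolding u_def T ..
    from completion_of_sv[OF this] have m: "monic_of (Suc m) ((lin m (u S) (sv m T x))(m := u S)) = (\<Prod>i<Suc m. [:- circle_point (Suc m) (thv m T x) i, 1:])" .
    have \<Phi>': "\<Phi> ((lin m (u S) (sv m T x))(m := u S)) = F (circle_point (Suc m) (thv m T x))"
      by (rule \<Phi>F[OF upd_PiE _ m], rule PiE_I) (simp_all add: circle_point_def)
    have W: "ennreal (Wt (\<beta> / 2 - 1) m (sv m T x)) * ennreal ((1 / 2) ^ m * (cmod (vandermonde (Suc m) (\<lambda>j. cis (thv m T x j))))\<^sup>2)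
      = ennreal (cmod (vandermonde (Suc m) (circle_point (Suc m) (thv m T x))) powr \<beta>) * ennreal ((1 / 2) ^ m * (\<Prod>j\<le>m. nuv m x j) powr (\<beta> / 2 - 1))"
      using Wt_sv(2)[OF True, of \<beta>] by (simp only: ennreal_mult'[symmetric] Wt_nonneg zero_le_power zero_le_divide_1_iff zero_le_numeral powr_ge_zero)
    have "increasing_angles m (thv m T x)" "\<forall>k\<le>m. nuv m x k > 0" using True unfolding Reg_def by simp_all
    then show ?thesis using True unfolding \<Phi>' mult.assoc[of "F _"] W sorted_gas_def gas_def weight_factor_def by (simp add: mult.assoc)
  next
    case False
    then have "\<not> (increasing_angles m (thv m T x) \<and> (\<forall>k\<le>m. nuv m x k > 0))" using x unfolding Reg_def by blast
    then have "sorted_gas m \<beta> F (thv m T x) * weight_factor m \<beta> x = 0"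
      unfolding sorted_gas_def weight_factor_def by (cases "increasing_angles m (thv m T x)") simp_all
    then show ?thesis using False by simp
  qed
  have inner: "(\<integral>\<^sup>+ s. \<Phi> ((lin m (u S) s)(m := u S)) * ennreal (Wt (\<beta> / 2 - 1) m s) \<partial>PiM {..<m} (\<lambda>_. lborel)) = (\<Sum>k\<le>m. J (S + 2 * pi * real k))"
    if S: "0 \<le> S" "S < 2 * pi" for S
  proof -
    have h: "(\<lambda>s. \<Phi> ((lin m (u S) s)(m := u S)) * ennreal (Wt (\<beta> / 2 - 1) m s)) \<in> borel_measurable (PiM {..<m} (\<lambda>_. lborel))"
    proof (intro borel_measurable_times_ennreal)
      have id: "(\<lambda>s. s) \<in> measurable (PiM {..<m} (\<lambda>_. lborel :: complex measure)) (PiM {..<m} (\<lambda>_. borel))"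
        by (rule measurable_ident_sets) (rule sets_PiM_cong, simp_all)
      show "(\<lambda>s. \<Phi> ((lin m (u S) s)(m := u S))) \<in> borel_measurable (PiM {..<m} (\<lambda>_. lborel))"
        by (rule measurable_compose[OF measurable_upd[OF measurable_lin[OF _ id]] \<Phi>]) simp_all
      have "(\<lambda>s. Wt (\<beta> / 2 - 1) m s) \<in> borel_measurable (PiM {..<m} (\<lambda>_. lborel))"
        by (rule measurable_Wt) (rule measurable_any_component)
      then show "(\<lambda>s. ennreal (Wt (\<beta> / 2 - 1) m s)) \<in> borel_measurable (PiM {..<m} (\<lambda>_. lborel))" by measurable
    qed
    show ?thesis
      unfolding J_def
    proof (subst nn_integral_stable_coefficients[OF h S])
      show "\<Phi> ((lin m (u S) s)(m := u S)) * ennreal (Wt (\<beta> / 2 - 1) m s) = 0" if "\<not> schur_stable m s" for s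
        using Wt_unstable[OF that] by simp
    next
      show "(\<Sum>k\<le>m. \<integral>\<^sup>+ x. \<Phi> ((lin m (u S) (sv m (S + 2 * pi * real k) x))(m := u S)) * ennreal (Wt (\<beta> / 2 - 1) m (sv m (S + 2 * pi * real k) x))
         * ennreal ((1 / 2) ^ m * (cmod (vandermonde (Suc m) (\<lambda>j. cis (thv m (S + 2 * pi * real k) x j))))\<^sup>2)
         * indicator (Reg m (S + 2 * pi * real k)) x \<partial>PiM {..<m} (\<lambda>_. lborel))
        = (\<Sum>k\<le>m. \<integral>\<^sup>+ x. sorted_gas m \<beta> F (thv m (S + 2 * pi * real k) x) * weight_factor m \<beta> x \<partial>PiM {..<m} (\<lambda>_. lborel))"
        by (intro sum.cong refl nn_integral_cong point cis_period) (simp add: space_PiM)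
    qed
  qed
  have supp: "J S = 0" if "\<not> (0 \<le> S \<and> S < 2 * pi * (real m + 1))" for S
  proof -
    have "sorted_gas m \<beta> F (y(m := S - (\<Sum>j<m. y j))) = 0" for y
      using sorted_gas_support[of m \<beta> F y S] that by (cases "sorted_gas m \<beta> F (y(m := S - (\<Sum>j<m. y j))) = 0") simp_all
    then have "I S = 0" unfolding I_def by simp
    then show ?thesis unfolding JI by simp
  qed
  have "(\<integral>\<^sup>+ S. (\<integral>\<^sup>+ s. \<Phi> ((lin m (u S) s)(m := u S)) * ennreal (Wt (\<beta> / 2 - 1) m s) \<partial>PiM {..<m} (\<lambda>_. lborel)) * indicator {0..<2 * pi} S \<partial>lborel)
    = (\<integral>\<^sup>+ S. (\<Sum>k\<le>m. J (S + 2 * pi * real k)) * indicator {0..<2 * pi} S \<partial>lborel)"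
  proof (rule nn_integral_cong)
    fix S
    show "(\<integral>\<^sup>+ s. \<Phi> ((lin m (u S) s)(m := u S)) * ennreal (Wt (\<beta> / 2 - 1) m s) \<partial>PiM {..<m} (\<lambda>_. lborel)) * indicator {0..<2 * pi} S
      = (\<Sum>k\<le>m. J (S + 2 * pi * real k)) * indicator {0..<2 * pi} S"
      using inner[of S] by (cases "0 \<le> S \<and> S < 2 * pi") simp_all
  qed
  also have "\<dots> = (\<integral>\<^sup>+ S. J S \<partial>lborel)" by (rule nn_integral_windows[OF Jm supp])
  also have "\<dots> = K * (\<integral>\<^sup>+ S. I S \<partial>lborel)" unfolding JI by (rule nn_integral_cmult) (simp add: Im)
  also have "(\<integral>\<^sup>+ S. I S \<partial>lborel) = (\<integral>\<^sup>+ \<theta>. sorted_gas m \<beta> F \<theta> \<partial>PiM {..<Suc m} (\<lambda>_. lborel))"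
    unfolding I_def by (rule nn_integral_trace_out(2)[OF F])
  finally show ?thesis unfolding K_def .
qed

section \<open>Symmetrisation over the cube\<close>

lemma cmod_vandermonde_permute:
  assumes \<sigma>: "\<sigma> permutes {..<n}"
  shows "cmod (vandermonde n (z \<circ> \<sigma>)) = cmod (vandermonde n z)"
proof -
  have bij: "bij_betw \<sigma> {..<n} {..<n}" by (rule permutes_imp_bij[OF \<sigma>])
  have inner: "(\<Prod>i\<in>{..<n}-{j}. cmod (z (\<sigma> j) - z (\<sigma> i))) = (\<Prod>i\<in>{..<n}-{\<sigma> j}. cmod (z (\<sigma> j) - z i))" if "j < n" for j
  proof -
    have "bij_betw \<sigma> ({..<n}-{j}) (\<sigma> ` ({..<n}-{j}))"
      by (rule inj_on_imp_bij_betw) (rule permutes_inj_on[OF \<sigma>])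
    moreover have "\<sigma> ` ({..<n}-{j}) = {..<n}-{\<sigma> j}"
      unfolding image_set_diff[OF permutes_inj[OF \<sigma>]] permutes_image[OF \<sigma>] by simp
    ultimately have "bij_betw \<sigma> ({..<n}-{j}) ({..<n}-{\<sigma> j})" by (simp only:)
    then show ?thesis by (rule prod.reindex_bij_betw)
  qed
  have "(cmod (vandermonde n (z \<circ> \<sigma>)))\<^sup>2 = (\<Prod>j<n. \<Prod>i\<in>{..<n}-{j}. cmod (z (\<sigma> j) - z (\<sigma> i)))"
    unfolding vandermonde_sq[symmetric] comp_def ..
  also have "\<dots> = (\<Prod>j<n. \<Prod>i\<in>{..<n}-{\<sigma> j}. cmod (z (\<sigma> j) - z i))" by (rule prod.cong[OF refl]) (rule inner, simp)
  also have "\<dots> = (\<Prod>j<n. \<Prod>i\<in>{..<n}-{j}. cmod (z j - z i))"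
    by (rule prod.reindex_bij_betw[OF bij, of "\<lambda>j. \<Prod>i\<in>{..<n}-{j}. cmod (z j - z i)"])
  also have "\<dots> = (cmod (vandermonde n z))\<^sup>2" by (rule vandermonde_sq)
  finally show ?thesis by (simp only: power2_eq_iff_nonneg norm_ge_zero)
qed

lemma circle_point_permute:
  assumes \<sigma>: "\<sigma> permutes {..<n}"
  shows "circle_point n (\<lambda>i\<in>{..<n}. \<theta> (\<sigma> i)) = circle_point n \<theta> \<circ> \<sigma>"
proof (rule ext)
  fix i
  show "circle_point n (\<lambda>i\<in>{..<n}. \<theta> (\<sigma> i)) i = (circle_point n \<theta> \<circ> \<sigma>) i"
  proof (cases "i < n")
    case True
    have "\<sigma> i < n" using permutes_in_image[OF \<sigma>, of i] True by simp
    then show ?thesis using True by (simp add: circle_point_def)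
  next
    case False
    then have "\<sigma> i = i" using \<sigma> unfolding permutes_def by simp
    then show ?thesis using False by (simp add: circle_point_def)
  qed
qed

lemma gas_permute:
  assumes \<sigma>: "\<sigma> permutes {..<n}" and sym: "\<And>\<sigma> z. \<sigma> permutes {..<n} \<Longrightarrow> z \<in> {..<n} \<rightarrow>\<^sub>E UNIV \<Longrightarrow> F (z \<circ> \<sigma>) = F z"
  shows "gas n \<beta> F (\<lambda>i\<in>{..<n}. \<theta> (\<sigma> i)) = gas n \<beta> F \<theta>"
proof -
  have "circle_point n \<theta> \<in> {..<n} \<rightarrow>\<^sub>E UNIV" by (rule PiE_I) (simp_all add: circle_point_def)
  from sym[OF \<sigma> this] show ?thesis
    unfolding gas_def circle_point_permute[OF \<sigma>] cmod_vandermonde_permute[OF \<sigma>] by (simp only:)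
qed

lemma increasing_angles_cong: "(\<And>i. i \<le> m \<Longrightarrow> \<theta> i = \<theta>' i) \<Longrightarrow> increasing_angles m \<theta> = increasing_angles m \<theta>'"
  unfolding increasing_angles_def by simp

text \<open>Existence is taken from \<open>sorted_angles_exist\<close>, whose angles have the same node polynomial and so are a permutation of the given ones.\<close>

lemma unique_sorting_permutation:
  assumes \<theta>: "\<And>i. i \<le> m \<Longrightarrow> 0 \<le> \<theta> i \<and> \<theta> i < 2 * pi" and inj: "inj_on \<theta> {..m}"
  shows "\<exists>!\<sigma>. \<sigma> permutes {..<Suc m} \<and> increasing_angles m (\<lambda>i. \<theta> (\<sigma> i))"
proof -
  have le: "\<sigma> i \<le> m" if "\<sigma> permutes {..<Suc m}" "i \<le> m" for \<sigma> i
    using permutes_in_image[OF that(1), of i] that(2) by simp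
  have cinj: "inj_on (\<lambda>i. cis (\<theta> i)) {..m}"
  proof (rule inj_onI)
    fix i j assume ij: "i \<in> {..m}" "j \<in> {..m}" "cis (\<theta> i) = cis (\<theta> j)"
    have "\<theta> i = \<theta> j" by (rule cis_inj_range[OF ij(3)]) (use \<theta>[of i] \<theta>[of j] ij(1,2) in simp_all)
    then show "i = j" using ij(1,2) by (rule inj_onD[OF inj])
  qed
  have unit: "cmod (cis (\<theta> j)) = 1" for j by simp
  obtain \<phi> where \<phi>: "increasing_angles m \<phi>" "\<And>w. (\<Prod>j\<le>m. w - cis (\<theta> j)) = (\<Prod>j\<le>m. w - cis (\<phi> j))"
    using sorted_angles_exist[OF unit cinj] by blast
  have "(\<Prod>i<Suc m. [:- cis (\<phi> i), 1:]) = (\<Prod>i<Suc m. [:- cis (\<theta> i), 1:])"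
  proof (rule poly_eq_poly_eq_iff[THEN iffD1], rule ext)
    fix w
    show "poly (\<Prod>i<Suc m. [:- cis (\<phi> i), 1:]) w = poly (\<Prod>i<Suc m. [:- cis (\<theta> i), 1:]) w"
      using \<phi>(2)[of w] by (simp add: poly_prod lessThan_Suc_atMost)
  qed
  from root_vectors_permuted[OF this] obtain \<tau> where \<tau>: "\<tau> permutes {..<Suc m}" "\<And>i. i < Suc m \<Longrightarrow> cis (\<phi> i) = cis (\<theta> (\<tau> i))" by metis
  have \<phi>\<theta>: "\<phi> i = \<theta> (\<tau> i)" if "i \<le> m" for i
  proof (rule cis_inj_range)
    show "cis (\<phi> i) = cis (\<theta> (\<tau> i))" using \<tau>(2)[of i] that by simp
  qed (use increasing_angles_range[OF \<phi>(1) that] \<theta>[OF le[OF \<tau>(1) that]] in simp_all)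
  have ex: "increasing_angles m (\<lambda>i. \<theta> (\<tau> i))"
    using \<phi>(1) increasing_angles_cong[of m \<phi> "\<lambda>i. \<theta> (\<tau> i)", OF \<phi>\<theta>] by simp
  show ?thesis
  proof (rule ex1I[of _ \<tau>], rule conjI[OF \<tau>(1) ex])
    fix \<sigma> assume \<sigma>: "\<sigma> permutes {..<Suc m} \<and> increasing_angles m (\<lambda>i. \<theta> (\<sigma> i))"
    note \<sigma>1 = conjunct1[OF \<sigma>] and \<sigma>2 = conjunct2[OF \<sigma>]
    have im: "(\<lambda>k. cis (\<theta> (\<rho> k))) ` {..m} = (\<lambda>k. cis (\<theta> k)) ` {..m}" if \<rho>: "\<rho> permutes {..<Suc m}" for \<rho>
      using permutes_image[OF \<rho>] image_image[of "\<lambda>k. cis (\<theta> k)" \<rho> "{..m}"] unfolding lessThan_Suc_atMost by simp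
    have "\<theta> (\<sigma> i) = \<theta> (\<tau> i)" if "i \<le> m" for i
      by (rule increasing_angles_unique[OF \<sigma>2 ex _ that]) (simp only: im[OF \<sigma>1] im[OF \<tau>(1)])
    then have on: "\<sigma> i = \<tau> i" if "i \<le> m" for i
      using inj_onD[OF inj, of "\<sigma> i" "\<tau> i"] le[OF \<sigma>1 that] le[OF \<tau>(1) that] that by simp
    show "\<sigma> = \<tau>"
    proof (rule ext)
      fix i
      show "\<sigma> i = \<tau> i"
      proof (cases "i \<le> m")
        case False
        then show ?thesis using \<sigma>1 \<tau>(1) unfolding permutes_def by simp
      qed (rule on)
    qed
  qed
qed

text \<open>The Vandermonde factor vanishes, and \<open>0 powr \<beta> = 0\<close> for every \<open>\<beta>\<close>.\<close>

lemma gas_eq_0_of_tie: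
  assumes "i < n" "j < n" "i \<noteq> j" "\<theta> i = \<theta> j"
  shows "gas n \<beta> F \<theta> = 0"
proof -
  have c: "cmod (circle_point n \<theta> i - circle_point n \<theta> j) = 0" using assms by (simp add: circle_point_def)
  have inner: "(\<Prod>k\<in>{..<n}-{i}. cmod (circle_point n \<theta> i - circle_point n \<theta> k)) = 0"
    by (rule prod_zero, simp, rule bexI[of _ j], rule c) (use assms in simp)
  have "(\<Prod>j<n. \<Prod>k\<in>{..<n}-{j}. cmod (circle_point n \<theta> j - circle_point n \<theta> k)) = 0"
    by (rule prod_zero, simp, rule bexI[of _ i], rule inner) (use assms in simp)
  then have "vandermonde n (circle_point n \<theta>) = 0" unfolding vandermonde_sq by simp
  then show ?thesis by (simp add: gas_def)
qed

text \<open>A point of the cube with distinct angles has exactly one sorting permutation; a point with a tie has density zero. The endpoint \<open>2 * pi\<close> is excluded because it is identified with \<open>0\<close>.\<close>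

lemma gas_symmetrisation:
  assumes sym: "\<And>\<sigma> z. \<sigma> permutes {..<Suc m} \<Longrightarrow> z \<in> {..<Suc m} \<rightarrow>\<^sub>E UNIV \<Longrightarrow> F (z \<circ> \<sigma>) = F z"
    and ext: "\<theta> \<in> {..<Suc m} \<rightarrow>\<^sub>E UNIV" and ne: "\<And>i. i \<le> m \<Longrightarrow> \<theta> i \<noteq> 2 * pi"
  shows "gas (Suc m) \<beta> F \<theta> * indicator ({..<Suc m} \<rightarrow>\<^sub>E {0..2 * pi}) \<theta>
    = (\<Sum>\<sigma>\<in>{\<sigma>. \<sigma> permutes {..<Suc m}}. sorted_gas m \<beta> F (\<lambda>i\<in>{..<Suc m}. \<theta> (\<sigma> i)))"
proof -
  let ?S = "{\<sigma>. \<sigma> permutes {..<Suc m}}"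
  have fin: "finite ?S" by (rule finite_permutations) simp
  have one: "sorted_gas m \<beta> F (\<lambda>i\<in>{..<Suc m}. \<theta> (\<sigma> i)) = gas (Suc m) \<beta> F \<theta> * of_bool (increasing_angles m (\<lambda>i. \<theta> (\<sigma> i)))"
    if "\<sigma> permutes {..<Suc m}" for \<sigma>
  proof -
    have g: "gas (Suc m) \<beta> F (\<lambda>i\<in>{..<Suc m}. \<theta> (\<sigma> i)) = gas (Suc m) \<beta> F \<theta>" by (rule gas_permute[OF that sym])
    have i: "increasing_angles m (\<lambda>i\<in>{..<Suc m}. \<theta> (\<sigma> i)) = increasing_angles m (\<lambda>i. \<theta> (\<sigma> i))"
      by (rule increasing_angles_cong) simp
    show ?thesis unfolding sorted_gas_def g i ..
  qed
  have surj: "\<exists>k\<le>m. i = \<sigma> k" if "\<sigma> permutes {..<Suc m}" "i \<le> m" for \<sigma> i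
  proof -
    have "i \<in> \<sigma> ` {..<Suc m}" unfolding permutes_image[OF that(1)] using that(2) by simp
    then show ?thesis by (rule imageE) (simp add: less_Suc_eq_le exI)
  qed
  show ?thesis
  proof (cases "(\<forall>i\<le>m. 0 \<le> \<theta> i \<and> \<theta> i < 2 * pi) \<and> inj_on \<theta> {..m}")
    case True
    then obtain \<tau> where \<tau>: "\<tau> permutes {..<Suc m}" "increasing_angles m (\<lambda>i. \<theta> (\<tau> i))"
      and uniq: "\<And>\<sigma>. \<sigma> permutes {..<Suc m} \<Longrightarrow> increasing_angles m (\<lambda>i. \<theta> (\<sigma> i)) \<Longrightarrow> \<sigma> = \<tau>"
      using unique_sorting_permutation[of m \<theta>] by blast
    have cube: "\<theta> \<in> {..<Suc m} \<rightarrow>\<^sub>E {0..2 * pi}"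
    proof (rule PiE_I)
      fix i assume "i \<in> {..<Suc m}"
      then show "\<theta> i \<in> {0..2 * pi}" using conjunct1[OF True] by (simp add: less_imp_le)
    qed (rule PiE_arb[OF ext])
    have "(\<Sum>\<sigma>\<in>?S. sorted_gas m \<beta> F (\<lambda>i\<in>{..<Suc m}. \<theta> (\<sigma> i))) = (\<Sum>\<sigma>\<in>?S. if \<sigma> = \<tau> then gas (Suc m) \<beta> F \<theta> else 0)"
    proof (rule sum.cong[OF refl])
      fix \<sigma> assume "\<sigma> \<in> ?S"
      then have \<sigma>: "\<sigma> permutes {..<Suc m}" by (rule CollectD)
      show "sorted_gas m \<beta> F (\<lambda>i\<in>{..<Suc m}. \<theta> (\<sigma> i)) = (if \<sigma> = \<tau> then gas (Suc m) \<beta> F \<theta> else 0)"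
      proof (cases "\<sigma> = \<tau>")
        case True
        then show ?thesis unfolding one[OF \<sigma>] using \<tau>(2) by simp
      next
        case False
        then have "\<not> increasing_angles m (\<lambda>i. \<theta> (\<sigma> i))" using uniq[OF \<sigma>] by (rule contrapos_nn)
        then show ?thesis unfolding one[OF \<sigma>] using False by simp
      qed
    qed
    also have "\<dots> = gas (Suc m) \<beta> F \<theta>" using fin \<tau>(1) by simp
    finally show ?thesis using cube by simp
  next
    case False
    have "\<not> increasing_angles m (\<lambda>i. \<theta> (\<sigma> i))" if \<sigma>: "\<sigma> permutes {..<Suc m}" for \<sigma>
    proof
      assume inc: "increasing_angles m (\<lambda>i. \<theta> (\<sigma> i))"
      have "0 \<le> \<theta> i \<and> \<theta> i < 2 * pi" if i: "i \<le> m" for i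
      proof -
        obtain k where k: "k \<le> m" "i = \<sigma> k" using surj[OF \<sigma> i] by blast
        show ?thesis unfolding k(2) using increasing_angles_range[OF inc k(1)] by simp
      qed
      moreover have "inj_on \<theta> {..m}"
      proof (rule inj_onI)
        fix i j assume ij: "i \<in> {..m}" "j \<in> {..m}" "\<theta> i = \<theta> j"
        obtain k where k: "k \<le> m" "i = \<sigma> k" using surj[OF \<sigma>, of i] ij(1) by auto
        obtain l where l: "l \<le> m" "j = \<sigma> l" using surj[OF \<sigma>, of j] ij(2) by auto
        have "cis (\<theta> (\<sigma> k)) = cis (\<theta> (\<sigma> l))" using ij(3) unfolding k(2) l(2) by simp
        then have "k = l" by (rule inj_onD[OF increasing_angles_inj[OF inc]]) (use k l in simp_all)
        then show "i = j" unfolding k(2) l(2) by simp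
      qed
      ultimately show False using False by simp
    qed
    then have "(\<Sum>\<sigma>\<in>?S. sorted_gas m \<beta> F (\<lambda>i\<in>{..<Suc m}. \<theta> (\<sigma> i))) = 0"
      by (intro sum.neutral ballI) (simp add: one)
    moreover have "gas (Suc m) \<beta> F \<theta> * indicator ({..<Suc m} \<rightarrow>\<^sub>E {0..2 * pi}) \<theta> = 0"
    proof (cases "\<theta> \<in> {..<Suc m} \<rightarrow>\<^sub>E {0..2 * pi}")
      case True
      have "0 \<le> \<theta> i \<and> \<theta> i < 2 * pi" if "i \<le> m" for i
        using PiE_mem[OF True, of i] ne[OF that] that by simp
      then have "\<not> inj_on \<theta> {..m}" using False by blast
      then obtain i j where "i \<le> m" "j \<le> m" "i \<noteq> j" "\<theta> i = \<theta> j" unfolding inj_on_def by auto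
      then have "gas (Suc m) \<beta> F \<theta> = 0" by (intro gas_eq_0_of_tie[of i "Suc m" j]) simp_all
      then show ?thesis by simp
    qed simp
    ultimately show ?thesis by simp
  qed
qed

lemma nn_integral_gas_sorted:
  assumes F: "F \<in> borel_measurable (PiM {..<Suc m} (\<lambda>_. borel))"
    and sym: "\<And>\<sigma> z. \<sigma> permutes {..<Suc m} \<Longrightarrow> z \<in> {..<Suc m} \<rightarrow>\<^sub>E UNIV \<Longrightarrow> F (z \<circ> \<sigma>) = F z"
  shows "(\<integral>\<^sup>+ \<theta>. gas (Suc m) \<beta> F \<theta> * indicator ({..<Suc m} \<rightarrow>\<^sub>E {0..2 * pi}) \<theta> \<partial>PiM {..<Suc m} (\<lambda>_. lborel))
     = fact (Suc m) * (\<integral>\<^sup>+ \<theta>. sorted_gas m \<beta> F \<theta> \<partial>PiM {..<Suc m} (\<lambda>_. lborel))"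
proof -
  interpret R: product_sigma_finite "\<lambda>_::nat. lborel :: real measure" by standard
  let ?S = "{\<sigma>. \<sigma> permutes {..<Suc m}}" and ?P = "PiM {..<Suc m} (\<lambda>_. lborel :: real measure)"
  have G: "sorted_gas m \<beta> F \<in> borel_measurable ?P" by (rule measurable_sorted_gas[OF F])
  have meas: "(\<lambda>\<theta>. sorted_gas m \<beta> F (\<lambda>i\<in>{..<Suc m}. \<theta> (\<sigma> i))) \<in> borel_measurable ?P" for \<sigma>
  proof (rule measurable_compose[OF _ G], rule measurable_restrict)
    show "(\<lambda>\<theta>. \<theta> (\<sigma> i)) \<in> measurable ?P lborel" for i using measurable_any_component[of "\<sigma> i" "{..<Suc m}"] by simp
  qed
  have ne: "AE \<theta> in ?P. \<theta> i \<noteq> 2 * pi" if "i \<in> {..<Suc m}" for i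
  proof -
    have "emeasure ?P ({\<theta> \<in> space ?P. \<theta> i = 2 * pi}) = 0"
    proof -
      define A where "A j = (if j = i then {2 * pi} else (UNIV :: real set))" for j
      have "{\<theta> \<in> space ?P. \<theta> i = 2 * pi} = PiE {..<Suc m} A"
      proof (rule Set.set_eqI)
        fix \<theta>
        show "\<theta> \<in> {\<theta> \<in> space ?P. \<theta> i = 2 * pi} \<longleftrightarrow> \<theta> \<in> PiE {..<Suc m} A"
        proof
          assume *: "\<theta> \<in> {\<theta> \<in> space ?P. \<theta> i = 2 * pi}"
          then have e: "\<theta> \<in> {..<Suc m} \<rightarrow>\<^sub>E UNIV" and "\<theta> i = 2 * pi" by (simp_all add: space_PiM)
          show "\<theta> \<in> PiE {..<Suc m} A" by (rule PiE_I) (use \<open>\<theta> i = 2 * pi\<close> PiE_arb[OF e] in \<open>simp_all add: A_def\<close>)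
        next
          assume *: "\<theta> \<in> PiE {..<Suc m} A"
          have "\<theta> \<in> {..<Suc m} \<rightarrow>\<^sub>E UNIV" by (rule PiE_I) (use PiE_arb[OF *] in simp_all)
          moreover have "\<theta> i = 2 * pi" using PiE_mem[OF * that] by (simp add: A_def)
          ultimately show "\<theta> \<in> {\<theta> \<in> space ?P. \<theta> i = 2 * pi}" by (simp add: space_PiM)
        qed
      qed
      also have "emeasure ?P (PiE {..<Suc m} A) = (\<Prod>j<Suc m. emeasure lborel (A j))"
        by (rule R.emeasure_PiM) (simp_all add: A_def)
      also have "\<dots> = 0" by (rule prod_zero) (use that in \<open>auto simp: A_def intro!: bexI[of _ i]\<close>)
      finally show ?thesis .
    qed
    moreover have "{\<theta> \<in> space ?P. \<theta> i = 2 * pi} \<in> sets ?P"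
    proof -
      have "(\<lambda>\<theta>. \<theta> i) \<in> borel_measurable ?P" by (rule measurable_any_component)
      from measurable_sets[OF this, of "{2 * pi}"] show ?thesis by (simp add: vimage_def Int_def conj_commute)
    qed
    ultimately show ?thesis by (intro AE_I[of _ _ "{\<theta> \<in> space ?P. \<theta> i = 2 * pi}"]) auto
  qed
  have "(\<integral>\<^sup>+ \<theta>. gas (Suc m) \<beta> F \<theta> * indicator ({..<Suc m} \<rightarrow>\<^sub>E {0..2 * pi}) \<theta> \<partial>?P)
     = (\<integral>\<^sup>+ \<theta>. (\<Sum>\<sigma>\<in>?S. sorted_gas m \<beta> F (\<lambda>i\<in>{..<Suc m}. \<theta> (\<sigma> i))) \<partial>?P)"
  proof (rule nn_integral_cong_AE)
    have "AE \<theta> in ?P. \<forall>i\<in>{..<Suc m}. \<theta> i \<noteq> 2 * pi" by (rule AE_finite_allI) (simp, rule ne)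
    then show "AE \<theta> in ?P. gas (Suc m) \<beta> F \<theta> * indicator ({..<Suc m} \<rightarrow>\<^sub>E {0..2 * pi}) \<theta>
       = (\<Sum>\<sigma>\<in>?S. sorted_gas m \<beta> F (\<lambda>i\<in>{..<Suc m}. \<theta> (\<sigma> i)))"
    proof (rule AE_mp, intro AE_I2 impI)
      fix \<theta> assume \<theta>: "\<theta> \<in> space ?P" "\<forall>i\<in>{..<Suc m}. \<theta> i \<noteq> 2 * pi"
      show "gas (Suc m) \<beta> F \<theta> * indicator ({..<Suc m} \<rightarrow>\<^sub>E {0..2 * pi}) \<theta>
       = (\<Sum>\<sigma>\<in>?S. sorted_gas m \<beta> F (\<lambda>i\<in>{..<Suc m}. \<theta> (\<sigma> i)))"
      proof (rule gas_symmetrisation[OF sym])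
        show "\<theta> \<in> {..<Suc m} \<rightarrow>\<^sub>E UNIV" using \<theta>(1) by (simp add: space_PiM)
        show "\<theta> i \<noteq> 2 * pi" if "i \<le> m" for i using bspec[OF \<theta>(2), of i] that by simp
      qed
    qed
  qed
  also have "\<dots> = (\<Sum>\<sigma>\<in>?S. \<integral>\<^sup>+ \<theta>. sorted_gas m \<beta> F (\<lambda>i\<in>{..<Suc m}. \<theta> (\<sigma> i)) \<partial>?P)"
    by (rule nn_integral_sum) (rule meas)
  also have "\<dots> = (\<Sum>\<sigma>\<in>?S. \<integral>\<^sup>+ \<theta>. sorted_gas m \<beta> F \<theta> \<partial>?P)"
  proof (rule sum.cong[OF refl])
    fix \<sigma> assume "\<sigma> \<in> ?S"
    then have "\<sigma> permutes {..<Suc m}" by (rule CollectD)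
    from nn_integral_lborel_permute[OF this G]
    show "(\<integral>\<^sup>+ \<theta>. sorted_gas m \<beta> F (\<lambda>i\<in>{..<Suc m}. \<theta> (\<sigma> i)) \<partial>?P) = (\<integral>\<^sup>+ \<theta>. sorted_gas m \<beta> F \<theta> \<partial>?P)" .
  qed
  also have "\<dots> = of_nat (card ?S) * (\<integral>\<^sup>+ \<theta>. sorted_gas m \<beta> F \<theta> \<partial>?P)" by (rule sum_constant)
  also have "card ?S = fact (Suc m)" by (rule card_permutations) simp_all
  finally show ?thesis by (simp only: of_nat_fact)
qed

section \<open>From Verblunsky parameters to angles\<close>

text \<open>The coefficients of the characteristic polynomial of the CMV product with parameters \<open>a\<close>. The double negation is the rotation \<open>- u\<close> with \<open>u = - cnj (a m)\<close>.\<close>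

definition cmv_coefs :: "nat \<Rightarrow> (nat \<Rightarrow> complex) \<Rightarrow> nat \<Rightarrow> complex" where
  "cmv_coefs m a = (lin m (- cnj (a m)) (scoef (\<lambda>j. - (- cnj (a m)) * a (m - 1 - j)) m))(m := - cnj (a m))"

lemma prob_space_Theta_1: "prob_space (Theta 1)"
proof -
  have c: "cis \<in> borel_measurable borel" by (intro borel_measurable_continuous_onI continuous_intros)
  have "prob_space (uniform_measure lborel {0..2 * pi} :: real measure)" by (rule prob_space_uniform_measure) simp_all
  moreover have "cis \<in> measurable (uniform_measure lborel {0..2 * pi}) borel" using c by simp
  ultimately show ?thesis unfolding Theta_def by (simp add: prob_space.prob_space_distr)
qed

lemma nn_integral_Theta_1:
  assumes H: "H \<in> borel_measurable borel"
  shows "(\<integral>\<^sup>+ z. H z \<partial>Theta 1) = inverse (ennreal (2 * pi)) * (\<integral>\<^sup>+ t. H (cis t) * indicator {0..2 * pi} t \<partial>lborel)"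
proof -
  have c: "cis \<in> borel_measurable borel" by (intro borel_measurable_continuous_onI continuous_intros)
  have Hc: "(\<lambda>t. H (cis t)) \<in> borel_measurable lborel" using measurable_compose[OF c H] by simp
  have "(\<integral>\<^sup>+ z. H z \<partial>Theta 1) = (\<integral>\<^sup>+ t. H (cis t) \<partial>uniform_measure lborel {0..2 * pi})"
    unfolding Theta_def if_P[OF refl] by (rule nn_integral_distr) (use c H in simp_all)
  also have "\<dots> = (\<integral>\<^sup>+ t. H (cis t) * indicator {0..2 * pi} t \<partial>lborel) / emeasure lborel {0..2 * pi}"
    by (rule nn_integral_uniform_measure[OF Hc]) simp
  finally show ?thesis by (simp add: divide_ennreal_def mult.commute)
qed

lemma product_sigma_finite_law:
  assumes \<beta>: "\<beta> > 0"
  shows "product_sigma_finite (\<lambda>k::nat. Theta (\<beta> * (real (Suc m) - real k - 1) + 1))"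
  unfolding product_sigma_finite_def
proof
  fix k :: nat
  show "sigma_finite_measure (Theta (\<beta> * (real (Suc m) - real k - 1) + 1))"
  proof (cases "k = m")
    case True
    then show ?thesis using prob_space_imp_sigma_finite[OF prob_space_Theta_1] by simp
  next
    case False
    then have "\<beta> * (real (Suc m) - real k - 1) \<noteq> 0" using \<beta> by simp
    then show ?thesis by (intro sigma_finite_Theta) simp
  qed
qed

text \<open>For a fixed phase, rotating and reversing independent rotation invariant parameters only relabels their laws.\<close>

lemma nn_integral_rotated_parameters:
  fixes \<beta> :: real
  assumes \<beta>: "\<beta> > 0" and u: "cmod u = 1" and H: "H \<in> borel_measurable (PiM {..<m} (\<lambda>_. borel))"
  shows "(\<integral>\<^sup>+ a. H (scoef (\<lambda>j. - u * a (m - 1 - j)) m) \<partial>PiM {..<m} (\<lambda>k. Theta (\<beta> * (real (Suc m) - real k - 1) + 1)))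
    = (\<integral>\<^sup>+ b. H (scoef b m) \<partial>PiM {..<m} (\<lambda>j. Theta (\<beta> * (real j + 1) + 1)))"
proof -
  let ?M = "\<lambda>k::nat. Theta (\<beta> * (real (Suc m) - real k - 1) + 1)" and ?N = "\<lambda>j::nat. Theta (\<beta> * (real j + 1) + 1)"
  have bij: "bij_betw (\<lambda>j. m - 1 - j) {..<m} {..<m}" by (rule bij_betwI[of _ _ _ "\<lambda>j. m - 1 - j"]) auto
  have g: "(\<lambda>z. - u * z) \<in> measurable (?M (m - 1 - i)) (?N i)" if "i \<in> {..<m}" for i
  proof -
    have "(\<lambda>z. - u * z) \<in> borel_measurable borel" by measurable
    then show ?thesis by (simp only: measurable_cong_sets[OF sets_Theta sets_Theta])
  qed
  have d: "distr (?M (m - 1 - i)) (?N i) (\<lambda>z. - u * z) = ?N i" if "i \<in> {..<m}" for i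
  proof -
    have "real (Suc m) - real (m - 1 - i) - 1 = real i + 1" using that by (simp add: of_nat_diff)
    then have MN: "?M (m - 1 - i) = ?N i" by (simp only:)
    have "\<beta> * (real i + 1) > 0" using \<beta> by (intro mult_pos_pos) simp_all
    then have ne: "\<beta> * (real i + 1) + 1 \<noteq> 1" by linarith
    have "distr (?N i) (?N i) (\<lambda>z. - u * z) = distr (?N i) borel (\<lambda>z. - u * z)" by (rule distr_cong) simp_all
    also have "\<dots> = ?N i" by (rule Theta_rotate[OF ne]) (simp add: u)
    finally show ?thesis unfolding MN .
  qed
  let ?T = "\<lambda>a. \<lambda>i\<in>{..<m}. - u * a (m - 1 - i)"
  note E = distr_PiM_bij[where I = "{..<m}" and \<pi> = "\<lambda>j. m - 1 - j" and M = ?M and N = ?N and g = "\<lambda>z. - u * z",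
      OF finite_lessThan bij product_sigma_finite_law[OF \<beta>] product_sigma_finite_Theta[OF \<beta>]]
  have E1: "?T \<in> measurable (PiM {..<m} ?M) (PiM {..<m} ?N)" by (rule E(1)) (erule g, erule d)
  have E2: "distr (PiM {..<m} ?M) (PiM {..<m} ?N) ?T = PiM {..<m} ?N" by (rule E(2)) (erule g, erule d)
  have G: "(\<lambda>b. H (scoef b m)) \<in> borel_measurable (PiM {..<m} ?N)"
  proof (rule measurable_compose[OF measurable_scoef H])
    fix j assume "j < m"
    then have "(\<lambda>b. b j) \<in> measurable (PiM {..<m} ?N) (?N j)" by (intro measurable_component_singleton) simp
    then show "(\<lambda>b. b j) \<in> borel_measurable (PiM {..<m} ?N)" by (simp only: measurable_cong_sets[OF refl sets_Theta])
  qed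
  have "(\<integral>\<^sup>+ b. H (scoef b m) \<partial>PiM {..<m} ?N) = (\<integral>\<^sup>+ b. H (scoef b m) \<partial>distr (PiM {..<m} ?M) (PiM {..<m} ?N) ?T)"
    unfolding E2 ..
  also have "\<dots> = (\<integral>\<^sup>+ a. H (scoef (?T a) m) \<partial>PiM {..<m} ?M)" by (rule nn_integral_distr[OF E1]) (use G in simp)
  also have "\<dots> = (\<integral>\<^sup>+ a. H (scoef (\<lambda>j. - u * a (m - 1 - j)) m) \<partial>PiM {..<m} ?M)"
    by (intro nn_integral_cong arg_cong[where f = H] scoef_cong) simp
  finally show ?thesis by (rule sym)
qed

lemma measurable_cmv_coefs:
  "cmv_coefs m \<in> measurable (PiM {..<Suc m} (\<lambda>_. borel)) (PiM {..<Suc m} (\<lambda>_. borel))"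
proof -
  have c: "(\<lambda>a. a k) \<in> borel_measurable (PiM {..<Suc m} (\<lambda>_. borel :: complex measure))" if "k \<le> m" for k
    by (rule measurable_component_singleton) (use that in simp)
  have u: "(\<lambda>a. - cnj (a m)) \<in> borel_measurable (PiM {..<Suc m} (\<lambda>_. borel :: complex measure))"
    using measurable_compose[OF c[OF order_refl] measurable_cnj] by (rule borel_measurable_uminus)
  show ?thesis
    unfolding cmv_coefs_def[abs_def]
  proof (intro measurable_upd measurable_lin measurable_scoef u)
    fix j assume "j < m"
    show "(\<lambda>a. - (- cnj (a m)) * a (m - 1 - j)) \<in> borel_measurable (PiM {..<Suc m} (\<lambda>_. borel))"
      by (intro borel_measurable_times borel_measurable_uminus[OF u] c) simp
  qed
qed

text \<open>The test function \<open>\<Phi>\<close> on coefficients stands for \<open>F\<close> evaluated at the roots. The constant depends on neither, so it can be determined later from \<open>F = 1\<close>.\<close>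

lemma nn_integral_verblunsky:
  fixes \<beta> :: real
  assumes \<beta>: "\<beta> > 0"
  shows "\<exists>C. \<forall>F \<Phi>. F \<in> borel_measurable (PiM {..<Suc m} (\<lambda>_. borel)) \<longrightarrow> \<Phi> \<in> borel_measurable (PiM {..<Suc m} (\<lambda>_. borel)) \<longrightarrow>
     (\<forall>t v. t \<in> {..<Suc m} \<rightarrow>\<^sub>E UNIV \<longrightarrow> v \<in> {..<Suc m} \<rightarrow>\<^sub>E UNIV \<longrightarrow> monic_of (Suc m) t = (\<Prod>i<Suc m. [:- v i, 1:]) \<longrightarrow> \<Phi> t = F v) \<longrightarrow>
     (\<integral>\<^sup>+ a. \<Phi> (cmv_coefs m a) \<partial>PiM {..<Suc m} (\<lambda>k. Theta (\<beta> * (real (Suc m) - real k - 1) + 1)))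
       = C * (\<integral>\<^sup>+ \<theta>. sorted_gas m \<beta> F \<theta> \<partial>PiM {..<Suc m} (\<lambda>_. lborel))"
proof -
  let ?M = "\<lambda>k::nat. Theta (\<beta> * (real (Suc m) - real k - 1) + 1)"
  interpret M: product_sigma_finite ?M by (rule product_sigma_finite_law[OF \<beta>])
  interpret V: finite_product_sigma_finite ?M "{..<m}" by standard simp
  interpret VL: finite_product_sigma_finite "\<lambda>_::nat. lborel :: complex measure" "{..<m}" by standard simp
  obtain K where K: "\<forall>H\<in>borel_measurable (PiM {..<m} (\<lambda>_. borel)).
     (\<integral>\<^sup>+ b. H (scoef b m) \<partial>PiM {..<m} (\<lambda>j. Theta (\<beta> * (real j + 1) + 1))) = K * (\<integral>\<^sup>+ s. H s * ennreal (Wt (\<beta> / 2 - 1) m s) \<partial>PiM {..<m} (\<lambda>_. lborel))"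
    using nn_integral_scoef[OF \<beta>, of m] by (rule exE) (rule that)
  define Kw where "Kw = (\<integral>\<^sup>+ w. weight_factor m \<beta> (\<lambda>k. of_real (w (m + k))) \<partial>PiM {m..<2 * m} (\<lambda>_. lborel))"
  show ?thesis
  proof (intro exI[of _ "inverse (ennreal (2 * pi)) * (K * Kw)"] allI impI)
    fix F \<Phi> :: "(nat \<Rightarrow> complex) \<Rightarrow> ennreal"
    assume F: "F \<in> borel_measurable (PiM {..<Suc m} (\<lambda>_. borel))" and \<Phi>: "\<Phi> \<in> borel_measurable (PiM {..<Suc m} (\<lambda>_. borel))"
      and \<Phi>F: "\<forall>t v. t \<in> {..<Suc m} \<rightarrow>\<^sub>E UNIV \<longrightarrow> v \<in> {..<Suc m} \<rightarrow>\<^sub>E UNIV \<longrightarrow> monic_of (Suc m) t = (\<Prod>i<Suc m. [:- v i, 1:]) \<longrightarrow> \<Phi> t = F v"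
    define \<Psi> where "\<Psi> u = (\<integral>\<^sup>+ s. \<Phi> ((lin m u s)(m := u)) * ennreal (Wt (\<beta> / 2 - 1) m s) \<partial>PiM {..<m} (\<lambda>_. lborel))" for u
    have \<Psi>m: "\<Psi> \<in> borel_measurable borel"
    proof -
      have idL: "(\<lambda>s. s) \<in> measurable (PiM {..<m} (\<lambda>_. lborel :: complex measure)) (PiM {..<m} (\<lambda>_. borel))"
        by (rule measurable_ident_sets) (rule sets_PiM_cong, simp_all)
      note s2 = measurable_compose[OF measurable_snd[of "borel :: complex measure"] idL]
      have W: "(\<lambda>p. Wt (\<beta> / 2 - 1) m (snd p)) \<in> borel_measurable ((borel :: complex measure) \<Otimes>\<^sub>M PiM {..<m} (\<lambda>_. lborel))"
        by (rule measurable_Wt) (rule measurable_compose[OF measurable_snd measurable_any_component])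
      have "(\<lambda>p. \<Phi> ((lin m (fst p) (snd p))(m := fst p)) * ennreal (Wt (\<beta> / 2 - 1) m (snd p))) \<in> borel_measurable ((borel :: complex measure) \<Otimes>\<^sub>M PiM {..<m} (\<lambda>_. lborel))"
        by (intro borel_measurable_times_ennreal measurable_compose[OF W measurable_ennreal]
            measurable_compose[OF measurable_upd[OF measurable_lin[OF measurable_fst s2] measurable_fst] \<Phi>])
      from VL.borel_measurable_nn_integral_fst[OF this] show ?thesis by (simp add: \<Psi>_def[abs_def])
    qed
    have id: "(\<lambda>a. a) \<in> measurable (PiM {..<Suc m} ?M) (PiM {..<Suc m} (\<lambda>_. borel))"
      by (rule measurable_ident_sets) (rule sets_PiM_cong, simp_all)
    have h: "(\<lambda>a. \<Phi> (cmv_coefs m a)) \<in> borel_measurable (PiM {..<Suc m} ?M)"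
      by (rule measurable_compose[OF measurable_compose[OF id measurable_cmv_coefs] \<Phi>])
    define \<Gamma> where "\<Gamma> z = (\<integral>\<^sup>+ a. \<Phi> (cmv_coefs m (a(m := z))) \<partial>PiM {..<m} ?M)" for z
    have \<Gamma>m: "\<Gamma> \<in> borel_measurable borel"
    proof -
      have "(\<lambda>p. (snd p)(m := fst p)) \<in> measurable (borel \<Otimes>\<^sub>M PiM {..<m} ?M) (PiM {..<Suc m} ?M)"
      proof (rule measurable_fun_upd[where J = "{..<m}"])
        show "fst \<in> measurable (borel \<Otimes>\<^sub>M PiM {..<m} ?M) (?M m)"
          using measurable_fst[of borel "PiM {..<m} ?M"] by (simp only: measurable_cong_sets[OF refl sets_Theta])
      qed auto
      from measurable_compose[OF this h]
      have "(\<lambda>p. \<Phi> (cmv_coefs m ((snd p)(m := fst p)))) \<in> borel_measurable (borel \<Otimes>\<^sub>M PiM {..<m} ?M)" .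
      from V.borel_measurable_nn_integral_fst[OF this] show ?thesis by (simp add: \<Gamma>_def[abs_def])
    qed
    have \<Gamma>: "\<Gamma> (cis t) = K * \<Psi> (- cnj (cis t))" for t
    proof -
      let ?u = "- cnj (cis t)"
      let ?H = "\<lambda>s. \<Phi> ((lin m ?u s)(m := ?u))"
      have u: "cmod ?u = 1" by simp
      have H: "?H \<in> borel_measurable (PiM {..<m} (\<lambda>_. borel))"
      proof (rule measurable_compose[OF measurable_upd[OF measurable_lin] \<Phi>])
        show "(\<lambda>s. s) \<in> measurable (PiM {..<m} (\<lambda>_. borel :: complex measure)) (PiM {..<m} (\<lambda>_. borel))" by (rule measurable_ident_sets) (rule refl)
      qed simp_all
      have "cmv_coefs m (a(m := cis t)) = (lin m ?u (scoef (\<lambda>j. - ?u * a (m - 1 - j)) m))(m := ?u)" for a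
      proof -
        have "scoef (\<lambda>j. - ?u * (a(m := cis t)) (m - 1 - j)) m = scoef (\<lambda>j. - ?u * a (m - 1 - j)) m"
          by (rule scoef_cong) auto
        then show ?thesis unfolding cmv_coefs_def fun_upd_same by (simp only:)
      qed
      then have "\<Gamma> (cis t) = (\<integral>\<^sup>+ a. ?H (scoef (\<lambda>j. - ?u * a (m - 1 - j)) m) \<partial>PiM {..<m} ?M)"
        unfolding \<Gamma>_def by (simp only:)
      also have "\<dots> = (\<integral>\<^sup>+ b. ?H (scoef b m) \<partial>PiM {..<m} (\<lambda>j. Theta (\<beta> * (real j + 1) + 1)))"
        by (rule nn_integral_rotated_parameters[OF \<beta> u H])
      also have "\<dots> = K * \<Psi> ?u" unfolding \<Psi>_def by (rule bspec[OF K H])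
      finally show ?thesis .
    qed
    have Mm: "?M m = Theta 1" by simp
    have "(\<integral>\<^sup>+ a. \<Phi> (cmv_coefs m a) \<partial>PiM {..<Suc m} ?M) = (\<integral>\<^sup>+ a. \<Phi> (cmv_coefs m a) \<partial>PiM (insert m {..<m}) ?M)"
      by (simp only: lessThan_Suc)
    also have "\<dots> = (\<integral>\<^sup>+ z. \<Gamma> z \<partial>?M m)"
      unfolding \<Gamma>_def by (rule M.product_nn_integral_insert_rev) (use h in \<open>simp_all only: lessThan_Suc finite_lessThan lessThan_iff less_irrefl not_False_eq_True\<close>)
    also have "\<dots> = inverse (ennreal (2 * pi)) * (\<integral>\<^sup>+ t. \<Gamma> (cis t) * indicator {0..2 * pi} t \<partial>lborel)"
      unfolding Mm by (rule nn_integral_Theta_1[OF \<Gamma>m])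
    also have "(\<integral>\<^sup>+ t. \<Gamma> (cis t) * indicator {0..2 * pi} t \<partial>lborel) = (\<integral>\<^sup>+ t. K * (\<Psi> (- cnj (cis t)) * indicator {0..2 * pi} t) \<partial>lborel)"
      unfolding \<Gamma> by (simp only: mult.assoc)
    also have "\<dots> = K * (\<integral>\<^sup>+ t. \<Psi> (- cnj (cis t)) * indicator {0..2 * pi} t \<partial>lborel)"
    proof (rule nn_integral_cmult)
      have "(\<lambda>t. - cnj (cis t)) \<in> borel_measurable borel" unfolding cis_cnj by (intro borel_measurable_continuous_onI continuous_intros)
      from measurable_compose[OF this \<Psi>m] show "(\<lambda>t. \<Psi> (- cnj (cis t)) * indicator {0..2 * pi} t) \<in> borel_measurable lborel"
        by (intro borel_measurable_times_ennreal borel_measurable_indicator) simp_all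
    qed
    also have "(\<integral>\<^sup>+ t. \<Psi> (- cnj (cis t)) * indicator {0..2 * pi} t \<partial>lborel) = (\<integral>\<^sup>+ S. \<Psi> ((- 1) ^ Suc m * cis S) * indicator {0..<2 * pi} S \<partial>lborel)"
      by (rule nn_integral_circle_reflect[OF \<Psi>m])
    also have "\<dots> = Kw * (\<integral>\<^sup>+ \<theta>. sorted_gas m \<beta> F \<theta> \<partial>PiM {..<Suc m} (\<lambda>_. lborel))"
      unfolding \<Psi>_def Kw_def
      by (rule nn_integral_coefficients_to_angles[OF F \<Phi>]) (use \<Phi>F in blast)
    finally show "(\<integral>\<^sup>+ a. \<Phi> (cmv_coefs m a) \<partial>PiM {..<Suc m} ?M)
       = inverse (ennreal (2 * pi)) * (K * Kw) * (\<integral>\<^sup>+ \<theta>. sorted_gas m \<beta> F \<theta> \<partial>PiM {..<Suc m} (\<lambda>_. lborel))"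
      by (simp only: mult.assoc)
  qed
qed

section \<open>Measurability of the characteristic polynomial\<close>

definition measurable_poly :: "'a measure \<Rightarrow> ('a \<Rightarrow> complex poly) \<Rightarrow> bool" where
  "measurable_poly M p \<longleftrightarrow> (\<forall>k. (\<lambda>\<omega>. Polynomial.coeff (p \<omega>) k) \<in> borel_measurable M)"

lemma measurable_poly_mult:
  assumes "measurable_poly M p" "measurable_poly M q"
  shows "measurable_poly M (\<lambda>\<omega>. p \<omega> * q \<omega>)"
  unfolding measurable_poly_def coeff_mult
  using assms by (intro allI borel_measurable_sum borel_measurable_times) (simp_all add: measurable_poly_def)

lemma measurable_poly_sum:
  assumes "\<And>i. i \<in> A \<Longrightarrow> measurable_poly M (p i)"
  shows "measurable_poly M (\<lambda>\<omega>. \<Sum>i\<in>A. p i \<omega>)"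
  unfolding measurable_poly_def coeff_sum
  using assms by (intro allI borel_measurable_sum) (simp add: measurable_poly_def)

lemma measurable_poly_const: "measurable_poly M (\<lambda>\<omega>. c)"
  by (simp add: measurable_poly_def)

lemma measurable_poly_prod:
  assumes "finite A" "\<And>i. i \<in> A \<Longrightarrow> measurable_poly M (p i)"
  shows "measurable_poly M (\<lambda>\<omega>. \<Prod>i\<in>A. p i \<omega>)"
  using assms
proof (induction A rule: finite_induct)
  case empty
  show ?case by (simp only: prod.empty measurable_poly_const)
next
  case (insert i A)
  have "measurable_poly M (\<lambda>\<omega>. p i \<omega> * (\<Prod>i\<in>A. p i \<omega>))"
    by (intro measurable_poly_mult insert.IH insert.prems) simp_all
  then show ?case using insert.hyps by (simp only: prod.insert[OF insert.hyps])
qed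

text \<open>The Leibniz formula makes every coefficient a polynomial in the entries.\<close>

lemma measurable_char_poly:
  assumes A: "\<And>\<omega>. A \<omega> \<in> carrier_mat n n"
    and meas: "\<And>i j. i < n \<Longrightarrow> j < n \<Longrightarrow> (\<lambda>\<omega>. A \<omega> $$ (i, j)) \<in> borel_measurable M"
  shows "measurable_poly M (\<lambda>\<omega>. char_poly (A \<omega>))"
proof -
  have entry: "char_poly_matrix (A \<omega>) $$ (i, j) = (if i = j then [:- (A \<omega> $$ (i, j)), 1:] else [:- (A \<omega> $$ (i, j)):])" if "i < n" "j < n" for i j \<omega>
    using A[of \<omega>] that by (simp add: char_poly_matrix_def)
  have "char_poly (A \<omega>) = (\<Sum>p\<in>{p. p permutes {0..<n}}. signof p * (\<Prod>i = 0..<n. if i = p i then [:- (A \<omega> $$ (i, p i)), 1:] else [:- (A \<omega> $$ (i, p i)):]))" for \<omega>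
  proof -
    have "char_poly (A \<omega>) = (\<Sum>p\<in>{p. p permutes {0..<n}}. signof p * (\<Prod>i = 0..<n. char_poly_matrix (A \<omega>) $$ (i, p i)))"
      unfolding char_poly_def by (rule det_def') (rule char_poly_matrix_closed[OF A])
    also have "\<dots> = (\<Sum>p\<in>{p. p permutes {0..<n}}. signof p * (\<Prod>i = 0..<n. if i = p i then [:- (A \<omega> $$ (i, p i)), 1:] else [:- (A \<omega> $$ (i, p i)):]))"
    proof (intro sum.cong refl arg_cong2[where f = "(*)"] prod.cong)
      fix p i assume p: "p \<in> {p. p permutes {0..<n}}" and i: "i \<in> {0..<n}"
      have "p i < n" using permutes_in_image[of p "{0..<n}" i] p i by simp
      then show "char_poly_matrix (A \<omega>) $$ (i, p i) = (if i = p i then [:- (A \<omega> $$ (i, p i)), 1:] else [:- (A \<omega> $$ (i, p i)):])"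
        using i by (intro entry) simp_all
    qed
    finally show ?thesis .
  qed
  moreover have "measurable_poly M (\<lambda>\<omega>. \<Sum>p\<in>{p. p permutes {0..<n}}. signof p * (\<Prod>i = 0..<n. if i = p i then [:- (A \<omega> $$ (i, p i)), 1:] else [:- (A \<omega> $$ (i, p i)):]))"
  proof (intro measurable_poly_sum measurable_poly_mult measurable_poly_const measurable_poly_prod)
    fix p i assume p: "p \<in> {p. p permutes {0..<n}}" and i: "i \<in> {0..<n}"
    have "p i < n" using permutes_in_image[of p "{0..<n}" i] p i by simp
    then have m: "(\<lambda>\<omega>. - (A \<omega> $$ (i, p i))) \<in> borel_measurable M" using i by (intro borel_measurable_uminus meas) simp_all
    show "measurable_poly M (\<lambda>\<omega>. if i = p i then [:- (A \<omega> $$ (i, p i)), 1:] else [:- (A \<omega> $$ (i, p i)):])"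
      unfolding measurable_poly_def
    proof
      fix k
      show "(\<lambda>\<omega>. Polynomial.coeff (if i = p i then [:- (A \<omega> $$ (i, p i)), 1:] else [:- (A \<omega> $$ (i, p i)):]) k) \<in> borel_measurable M"
        using m by (cases "i = p i"; cases k) simp_all
    qed
  qed simp
  ultimately show ?thesis by (simp only:)
qed

lemma measurable_cmv_rho: "cmv_rho \<in> borel_measurable borel"
  unfolding cmv_rho_def[abs_def] by (intro borel_measurable_continuous_onI continuous_intros)

lemma measurable_band:
  assumes a: "\<And>k. k < n \<Longrightarrow> (\<lambda>\<omega>. a \<omega> k) \<in> borel_measurable M" and ij: "i < n" "j < n"
  shows "(\<lambda>\<omega>. band (a \<omega>) q i j) \<in> borel_measurable M" "(\<lambda>\<omega>. mband (a \<omega>) i j) \<in> borel_measurable M"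
proof -
  have c: "(\<lambda>\<omega>. cnj (a \<omega> k)) \<in> borel_measurable M" if "k < n" for k by (rule measurable_compose[OF a[OF that] measurable_cnj])
  have r: "(\<lambda>\<omega>. cmv_rho (a \<omega> k)) \<in> borel_measurable M" if "k < n" for k by (rule measurable_compose[OF a[OF that] measurable_cmv_rho])
  have u: "(\<lambda>\<omega>. - a \<omega> k) \<in> borel_measurable M" if "k < n" for k by (rule borel_measurable_uminus[OF a[OF that]])
  have 1: "i - 1 < n" "j - 1 < n" using ij by simp_all
  show b: "(\<lambda>\<omega>. band (a \<omega>) q i j) \<in> borel_measurable M" for q
    unfolding band_def
    by (intro measurable_If c[OF ij(1)] c[OF ij(2)] r[OF ij(1)] r[OF ij(2)] u[OF 1(1)] u[OF 1(2)] u[OF ij(1)] borel_measurable_const) simp_all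
  show "(\<lambda>\<omega>. mband (a \<omega>) i j) \<in> borel_measurable M"
    unfolding mband_def by (intro measurable_If b borel_measurable_const) simp_all
qed

lemma measurable_cmv_char_poly:
  assumes a: "\<And>k. k < n \<Longrightarrow> (\<lambda>\<omega>. a \<omega> k) \<in> borel_measurable M" and n: "n \<ge> 1"
  shows "measurable_poly M (\<lambda>\<omega>. char_poly (cmv_L n (a \<omega>) * cmv_M n (a \<omega>)))" "measurable_poly M (\<lambda>\<omega>. char_poly (cmv_M n (a \<omega>) * cmv_L n (a \<omega>)))"
proof -
  note ba = measurable_band[of n a, OF a]
  show "measurable_poly M (\<lambda>\<omega>. char_poly (cmv_L n (a \<omega>) * cmv_M n (a \<omega>)))"
    unfolding cmv_L_eq[OF n] cmv_M_eq[OF n]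
  proof (rule measurable_char_poly[of _ n])
    fix i j assume ij: "i < n" "j < n"
    have "(\<lambda>\<omega>. \<Sum>k = 0..<n. band (a \<omega>) 0 i k * mband (a \<omega>) k j) \<in> borel_measurable M"
      by (intro borel_measurable_sum borel_measurable_times ba ij) simp_all
    then show "(\<lambda>\<omega>. (mat n n (\<lambda>(i, j). band (a \<omega>) 0 i j) * mat n n (\<lambda>(i, j). mband (a \<omega>) i j)) $$ (i, j)) \<in> borel_measurable M"
      using ij by (simp add: scalar_prod_def)
  qed (rule mult_carrier_mat[of _ n n], simp_all)
  show "measurable_poly M (\<lambda>\<omega>. char_poly (cmv_M n (a \<omega>) * cmv_L n (a \<omega>)))"
    unfolding cmv_L_eq[OF n] cmv_M_eq[OF n]
  proof (rule measurable_char_poly[of _ n])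
    fix i j assume ij: "i < n" "j < n"
    have "(\<lambda>\<omega>. \<Sum>k = 0..<n. mband (a \<omega>) i k * band (a \<omega>) 0 k j) \<in> borel_measurable M"
      by (intro borel_measurable_sum borel_measurable_times ba ij) simp_all
    then show "(\<lambda>\<omega>. (mat n n (\<lambda>(i, j). mband (a \<omega>) i j) * mat n n (\<lambda>(i, j). band (a \<omega>) 0 i j)) $$ (i, j)) \<in> borel_measurable M"
      using ij by (simp add: scalar_prod_def)
  qed (rule mult_carrier_mat[of _ n n], simp_all)
qed

lemma AE_Theta: "AE z in Theta \<nu>. cmod z \<le> 1"
  and AE_Theta_1: "AE z in Theta 1. cmod z = 1"
proof -
  have c: "cis \<in> borel_measurable borel" by (intro borel_measurable_continuous_onI continuous_intros)
  have s: "{z \<in> space borel. cmod z = 1} \<in> sets (borel :: complex measure)"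
  proof -
    have "closed {z :: complex. cmod z = 1}" by (intro closed_Collect_eq continuous_intros)
    then show ?thesis by simp
  qed
  show 1: "AE z in Theta 1. cmod z = 1"
    unfolding Theta_def if_P[OF refl] by (subst AE_distr_iff[OF _ s]) (use c in simp_all)
  show "AE z in Theta \<nu>. cmod z \<le> 1"
  proof (cases "\<nu> = 1")
    case True
    show ?thesis unfolding True using 1 by eventually_elim simp
  next
    case False
    have "Theta_density \<nu> z = 0" if "\<not> cmod z \<le> 1" for z using that by (simp add: Theta_density_def)
    then have "0 < Theta_density \<nu> z \<longrightarrow> cmod z \<le> 1" for z by (cases "cmod z \<le> 1") simp_all
    then show ?thesis unfolding Theta_eq_density[OF False] by (subst AE_density) simp_all
  qed
qed

text \<open>Some ordering of the roots; it enters only through symmetric functions.\<close>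

definition root_vec :: "nat \<Rightarrow> (nat \<Rightarrow> complex) \<Rightarrow> nat \<Rightarrow> complex" where
  "root_vec n t = (SOME v. v \<in> {..<n} \<rightarrow>\<^sub>E UNIV \<and> monic_of n t = (\<Prod>i<n. [:- v i, 1:]))"

lemma root_vec: "root_vec n t \<in> {..<n} \<rightarrow>\<^sub>E UNIV" "monic_of n t = (\<Prod>i<n. [:- root_vec n t i, 1:])"
proof -
  obtain w where w: "\<And>z. mev n t z = (\<Prod>i<n. z - w i)" using mev_factorization by blast
  have "monic_of n t = (\<Prod>i<n. [:- restrict w {..<n} i, 1:])"
    by (rule poly_eq_poly_eq_iff[THEN iffD1], rule ext) (simp add: w poly_prod)
  then have "\<exists>v. v \<in> {..<n} \<rightarrow>\<^sub>E UNIV \<and> monic_of n t = (\<Prod>i<n. [:- v i, 1:])"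
    by (intro exI[of _ "restrict w {..<n}"] conjI) simp_all
  then have "root_vec n t \<in> {..<n} \<rightarrow>\<^sub>E UNIV \<and> monic_of n t = (\<Prod>i<n. [:- root_vec n t i, 1:])"
    unfolding root_vec_def by (rule someI_ex)
  then show "root_vec n t \<in> {..<n} \<rightarrow>\<^sub>E UNIV" "monic_of n t = (\<Prod>i<n. [:- root_vec n t i, 1:])" by (rule conjunct1, rule conjunct2)
qed

lemma symmetric_fun_roots_unique:
  fixes n :: nat and x y :: "nat \<Rightarrow> complex"
  assumes sym: "\<And>\<sigma> z. \<sigma> permutes {..<n} \<Longrightarrow> z \<in> {..<n} \<rightarrow>\<^sub>E UNIV \<Longrightarrow> F (z \<circ> \<sigma>) = F z"
    and x: "x \<in> {..<n} \<rightarrow>\<^sub>E UNIV" and y: "y \<in> {..<n} \<rightarrow>\<^sub>E UNIV"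
    and eq: "(\<Prod>i<n. [:- x i, 1:]) = (\<Prod>i<n. [:- y i, 1 :: complex:])"
  shows "F x = F y"
proof (rule root_vectors_permuted[OF eq])
  fix \<tau> assume \<tau>: "\<tau> permutes {..<n}" "\<And>i. i < n \<Longrightarrow> x i = y (\<tau> i)"
  have "x = y \<circ> \<tau>"
  proof (rule ext)
    fix i
    show "x i = (y \<circ> \<tau>) i"
    proof (cases "i < n")
      case False
      then have "\<tau> i = i" using \<tau>(1) unfolding permutes_def by simp
      then show ?thesis using False PiE_arb[OF x, of i] PiE_arb[OF y, of i] by simp
    qed (simp add: \<tau>(2))
  qed
  then show ?thesis using sym[OF \<tau>(1) y] by (simp only:)
qed

lemma cmv_coefs_cong:
  assumes "\<And>k. k \<le> m \<Longrightarrow> a k = b k"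
  shows "cmv_coefs m a = cmv_coefs m b"
proof -
  have "scoef (\<lambda>j. - (- cnj (a m)) * a (m - 1 - j)) m = scoef (\<lambda>j. - (- cnj (b m)) * b (m - 1 - j)) m"
    by (rule scoef_cong) (use assms in auto)
  moreover have "a m = b m" by (rule assms) simp
  ultimately show ?thesis unfolding cmv_coefs_def by (simp only:)
qed

section \<open>The eigenvalue distribution\<close>

text \<open>Almost surely all parameters lie in the closed disk and the last one on the circle, so the characteristic polynomial is the one computed from the Szego recursion, whatever the chosen ordering of the eigenvalues.\<close>

lemma nn_integral_eigenvalues:
  fixes \<beta> :: real and p :: "'a \<Rightarrow> complex poly" and \<Lambda> :: "'a \<Rightarrow> nat \<Rightarrow> complex"
  assumes \<beta>: "\<beta> > 0" and P: "prob_space P"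
    and indep: "prob_space.indep_vars P (\<lambda>_. borel) \<alpha> {..<Suc m}"
    and law: "\<And>k. k < Suc m \<Longrightarrow> distr P borel (\<alpha> k) = Theta (\<beta> * (real (Suc m) - real k - 1) + 1)"
    and p: "\<And>a. (\<And>k. k \<le> m \<Longrightarrow> cmod (a k) \<le> 1) \<Longrightarrow> cmod (a m) = 1 \<Longrightarrow> q a = monic_of (Suc m) (cmv_coefs m a)"
    and \<Lambda>: "\<And>\<omega>. \<omega> \<in> space P \<Longrightarrow> \<Lambda> \<omega> \<in> {..<Suc m} \<rightarrow>\<^sub>E UNIV"
      "\<And>\<omega>. \<omega> \<in> space P \<Longrightarrow> q (\<lambda>k. \<alpha> k \<omega>) = (\<Prod>i<Suc m. [:- \<Lambda> \<omega> i, 1:])"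
  shows "\<exists>C. \<forall>F. F \<in> borel_measurable (PiM {..<Suc m} (\<lambda>_. borel)) \<longrightarrow>
      (\<forall>\<sigma> z. \<sigma> permutes {..<Suc m} \<longrightarrow> z \<in> {..<Suc m} \<rightarrow>\<^sub>E UNIV \<longrightarrow> F (z \<circ> \<sigma>) = F z) \<longrightarrow>
      (\<integral>\<^sup>+ \<omega>. F (\<Lambda> \<omega>) \<partial>P) = C * (\<integral>\<^sup>+ \<theta>. sorted_gas m \<beta> F \<theta> \<partial>PiM {..<Suc m} (\<lambda>_. lborel))"
proof -
  interpret P: prob_space P by (rule P)
  let ?M = "\<lambda>k::nat. Theta (\<beta> * (real (Suc m) - real k - 1) + 1)"
  obtain C where C: "\<forall>F \<Phi>. F \<in> borel_measurable (PiM {..<Suc m} (\<lambda>_. borel)) \<longrightarrow> \<Phi> \<in> borel_measurable (PiM {..<Suc m} (\<lambda>_. borel)) \<longrightarrow>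
     (\<forall>t v. t \<in> {..<Suc m} \<rightarrow>\<^sub>E UNIV \<longrightarrow> v \<in> {..<Suc m} \<rightarrow>\<^sub>E UNIV \<longrightarrow> monic_of (Suc m) t = (\<Prod>i<Suc m. [:- v i, 1:]) \<longrightarrow> \<Phi> t = F v) \<longrightarrow>
     (\<integral>\<^sup>+ a. \<Phi> (cmv_coefs m a) \<partial>PiM {..<Suc m} ?M) = C * (\<integral>\<^sup>+ \<theta>. sorted_gas m \<beta> F \<theta> \<partial>PiM {..<Suc m} (\<lambda>_. lborel))"
    using nn_integral_verblunsky[OF \<beta>, of m] by (rule exE) (rule that)
  have rv: "\<alpha> k \<in> borel_measurable P" if "k \<in> {..<Suc m}" for k
    using indep that unfolding P.indep_vars_def by simp
  have ne: "{..<Suc m} \<noteq> {}" using lessThan_iff[of m "Suc m"] by blast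
  let ?X = "\<lambda>\<omega>. \<lambda>i\<in>{..<Suc m}. \<alpha> i \<omega>"
  have X: "?X \<in> measurable P (PiM {..<Suc m} (\<lambda>_. borel))" by (rule measurable_restrict) (use rv in simp)
  have dX: "distr P (PiM {..<Suc m} (\<lambda>_. borel)) ?X = PiM {..<Suc m} ?M"
  proof -
    have "distr P (PiM {..<Suc m} (\<lambda>_. borel)) ?X = PiM {..<Suc m} (\<lambda>i. distr P borel (\<alpha> i))"
      by (rule P.indep_vars_iff_distr_eq_PiM'[where I = "{..<Suc m}" and M' = "\<lambda>_. borel" and X = \<alpha>, OF ne rv, THEN iffD1, OF _ indep])
    also have "\<dots> = PiM {..<Suc m} ?M" by (rule PiM_cong) (simp_all add: law)
    finally show ?thesis .
  qed
  have le1: "AE \<omega> in P. cmod (\<alpha> k \<omega>) \<le> 1" if "k \<in> {..<Suc m}" for k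
  proof (rule AE_distrD[where f = "\<alpha> k" and P = "\<lambda>z. cmod z \<le> 1" and M' = borel])
    show "\<alpha> k \<in> measurable P borel" using rv that by simp
    have "k < Suc m" using that by simp
    show "AE z in distr P borel (\<alpha> k). cmod z \<le> 1" unfolding law[OF \<open>k < Suc m\<close>] by (rule AE_Theta)
  qed
  have eq1: "AE \<omega> in P. cmod (\<alpha> m \<omega>) = 1"
  proof (rule AE_distrD[where f = "\<alpha> m" and P = "\<lambda>z. cmod z = 1" and M' = borel])
    show "\<alpha> m \<in> measurable P borel" using rv by simp
    have "\<beta> * (real (Suc m) - real m - 1) + 1 = 1" by simp
    then show "AE z in distr P borel (\<alpha> m). cmod z = 1" unfolding law[OF lessI] using AE_Theta_1 by (simp only:)
  qed
  have all: "AE \<omega> in P. \<forall>k\<in>{..<Suc m}. cmod (\<alpha> k \<omega>) \<le> 1" by (rule AE_finite_allI) (simp, rule le1)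
  show ?thesis
  proof (intro exI[of _ C] allI impI)
    fix F :: "(nat \<Rightarrow> complex) \<Rightarrow> ennreal"
    assume F: "F \<in> borel_measurable (PiM {..<Suc m} (\<lambda>_. borel))"
      and sym: "\<forall>\<sigma> z. \<sigma> permutes {..<Suc m} \<longrightarrow> z \<in> {..<Suc m} \<rightarrow>\<^sub>E UNIV \<longrightarrow> F (z \<circ> \<sigma>) = F z"
    have sym': "F (z \<circ> \<sigma>) = F z" if "\<sigma> permutes {..<Suc m}" "z \<in> {..<Suc m} \<rightarrow>\<^sub>E UNIV" for \<sigma> z using sym that by blast
    define \<Phi> where "\<Phi> t = F (root_vec (Suc m) t)" for t
    have \<Phi>: "\<Phi> \<in> borel_measurable (PiM {..<Suc m} (\<lambda>_. borel))"
      unfolding \<Phi>_def[abs_def]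
    proof (rule measurable_symmetric_of_roots[where p = "monic_of (Suc m)" and n = "Suc m", OF _ root_vec(2) root_vec(1) F sym'])
      fix k
      have "(\<lambda>t. t (m - k)) \<in> borel_measurable (PiM {..<Suc m} (\<lambda>_. borel :: complex measure))"
        by (rule measurable_component_singleton) simp
      then show "(\<lambda>t. Polynomial.coeff (monic_of (Suc m) t) k) \<in> borel_measurable (PiM {..<Suc m} (\<lambda>_. borel))"
        unfolding coeff_monic_of by (cases "k = Suc m"; cases "k < Suc m") simp_all
    qed
    have \<Phi>F: "\<Phi> t = F v" if "v \<in> {..<Suc m} \<rightarrow>\<^sub>E UNIV" "monic_of (Suc m) t = (\<Prod>i<Suc m. [:- v i, 1:])" for t v
      unfolding \<Phi>_def by (rule symmetric_fun_roots_unique[OF sym' root_vec(1) that(1) trans[OF root_vec(2)[symmetric] that(2)]]) (assumption+)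
    have "(\<integral>\<^sup>+ \<omega>. F (\<Lambda> \<omega>) \<partial>P) = (\<integral>\<^sup>+ \<omega>. \<Phi> (cmv_coefs m (?X \<omega>)) \<partial>P)"
    proof (rule nn_integral_cong_AE)
      show "AE \<omega> in P. F (\<Lambda> \<omega>) = \<Phi> (cmv_coefs m (?X \<omega>))"
        using all eq1 AE_space
      proof eventually_elim
        case (elim \<omega>)
        have c: "cmv_coefs m (?X \<omega>) = cmv_coefs m (\<lambda>k. \<alpha> k \<omega>)" by (rule cmv_coefs_cong) simp
        have "q (\<lambda>k. \<alpha> k \<omega>) = monic_of (Suc m) (cmv_coefs m (\<lambda>k. \<alpha> k \<omega>))"
          by (rule p) (use elim(1,2) in simp_all)
        then have "monic_of (Suc m) (cmv_coefs m (?X \<omega>)) = (\<Prod>i<Suc m. [:- \<Lambda> \<omega> i, 1:])" unfolding c \<Lambda>(2)[OF elim(3)] by (rule HOL.sym)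
        from \<Phi>F[OF \<Lambda>(1)[OF elim(3)] this] show ?case by (rule HOL.sym)
      qed
    qed
    also have "\<dots> = (\<integral>\<^sup>+ a. \<Phi> (cmv_coefs m a) \<partial>distr P (PiM {..<Suc m} (\<lambda>_. borel)) ?X)"
      by (rule nn_integral_distr[OF X, symmetric]) (use measurable_compose[OF measurable_cmv_coefs \<Phi>] in simp)
    also have "\<dots> = C * (\<integral>\<^sup>+ \<theta>. sorted_gas m \<beta> F \<theta> \<partial>PiM {..<Suc m} (\<lambda>_. lborel))"
      unfolding dX by (rule C[rule_format, OF F \<Phi>]) (rule \<Phi>F, assumption, assumption)
    finally show "(\<integral>\<^sup>+ \<omega>. F (\<Lambda> \<omega>) \<partial>P) = C * (\<integral>\<^sup>+ \<theta>. sorted_gas m \<beta> F \<theta> \<partial>PiM {..<Suc m} (\<lambda>_. lborel))" .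
  qed
qed

text \<open>Adding the bound makes \<open>g\<close> nonnegative. Taking the test function \<open>1\<close> shows that the normalisation is finite and nonzero and eliminates the constant \<open>C\<close>.\<close>

lemma bounded_real_expectation:
  fixes g :: "(nat \<Rightarrow> complex) \<Rightarrow> real"
  assumes P: "prob_space P"
    and C': "\<forall>F. F \<in> borel_measurable (PiM {..<Suc m} (\<lambda>_. borel)) \<longrightarrow>
      (\<forall>\<sigma> z. \<sigma> permutes {..<Suc m} \<longrightarrow> z \<in> {..<Suc m} \<rightarrow>\<^sub>E UNIV \<longrightarrow> F (z \<circ> \<sigma>) = F z) \<longrightarrow>
      (\<integral>\<^sup>+ \<omega>. F (\<Lambda> \<omega>) \<partial>P) = C * (\<integral>\<^sup>+ \<theta>. sorted_gas m \<beta> F \<theta> \<partial>PiM {..<Suc m} (\<lambda>_. lborel))"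
    and g: "g \<in> borel_measurable (PiM {..<Suc m} (\<lambda>_. borel))"
    and sym: "\<And>\<sigma> z. \<sigma> permutes {..<Suc m} \<Longrightarrow> z \<in> {..<Suc m} \<rightarrow>\<^sub>E UNIV \<Longrightarrow> g (z \<circ> \<sigma>) = g z"
    and bound: "\<And>z. z \<in> {..<Suc m} \<rightarrow>\<^sub>E UNIV \<Longrightarrow> \<bar>g z\<bar> \<le> B"
    and \<Lambda>: "\<And>\<omega>. \<omega> \<in> space P \<Longrightarrow> \<Lambda> \<omega> \<in> {..<Suc m} \<rightarrow>\<^sub>E UNIV" and g\<Lambda>: "(\<lambda>\<omega>. g (\<Lambda> \<omega>)) \<in> borel_measurable P"
  defines "w \<equiv> \<lambda>\<theta>. indicator ({..<Suc m} \<rightarrow>\<^sub>E {0..2 * pi}) \<theta> * cmod (vandermonde (Suc m) (circle_point (Suc m) \<theta>)) powr \<beta>"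
  defines "Q \<equiv> PiM {..<Suc m} (\<lambda>_. lborel :: real measure)"
  shows "integrable Q w" "(\<integral>\<theta>. w \<theta> \<partial>Q) > 0" "integrable Q (\<lambda>\<theta>. g (circle_point (Suc m) \<theta>) * w \<theta>)"
    "integrable P (\<lambda>\<omega>. g (\<Lambda> \<omega>))"
    "(\<integral>\<omega>. g (\<Lambda> \<omega>) \<partial>P) * (\<integral>\<theta>. w \<theta> \<partial>Q) = (\<integral>\<theta>. g (circle_point (Suc m) \<theta>) * w \<theta> \<partial>Q)"
proof -
  interpret P: prob_space P by (rule P)
  note C = C'[rule_format]
  let ?cube = "{..<Suc m} \<rightarrow>\<^sub>E {0..2 * pi}"
  have cube: "?cube \<in> sets Q" unfolding Q_def by (rule sets_PiM_I_finite) simp_all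
  have cp: "circle_point (Suc m) \<theta> \<in> {..<Suc m} \<rightarrow>\<^sub>E UNIV" for \<theta> by (rule PiE_I) (simp_all add: circle_point_def)
  have vm: "(\<lambda>\<theta>. vandermonde (Suc m) (circle_point (Suc m) \<theta>)) \<in> borel_measurable Q"
    unfolding Q_def by (rule measurable_vandermonde) (rule measurable_compose[OF measurable_circle_point measurable_component_singleton], simp)
  have cm: "(\<lambda>\<theta>. cmod (vandermonde (Suc m) (circle_point (Suc m) \<theta>))) \<in> borel_measurable Q"
    by (rule measurable_compose[OF vm]) measurable
  have wm: "w \<in> borel_measurable Q"
    unfolding w_def
    by (intro borel_measurable_times borel_measurable_indicator cube powr_real_measurable cm borel_measurable_const)
  have gm: "(\<lambda>\<theta>. g (circle_point (Suc m) \<theta>)) \<in> borel_measurable Q"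
    unfolding Q_def by (rule measurable_compose[OF measurable_circle_point g])
  have wpos: "0 \<le> w \<theta>" for \<theta> by (simp add: w_def)
  define S where "S F = (\<integral>\<^sup>+ \<theta>. sorted_gas m \<beta> F \<theta> \<partial>Q)" for F
  have S: "(\<integral>\<^sup>+ \<theta>. F (circle_point (Suc m) \<theta>) * ennreal (w \<theta>) \<partial>Q) = fact (Suc m) * S F"
    if "F \<in> borel_measurable (PiM {..<Suc m} (\<lambda>_. borel))" "\<And>\<sigma> z. \<sigma> permutes {..<Suc m} \<Longrightarrow> z \<in> {..<Suc m} \<rightarrow>\<^sub>E UNIV \<Longrightarrow> F (z \<circ> \<sigma>) = F z" for F
  proof -
    have "(\<integral>\<^sup>+ \<theta>. F (circle_point (Suc m) \<theta>) * ennreal (w \<theta>) \<partial>Q) = (\<integral>\<^sup>+ \<theta>. gas (Suc m) \<beta> F \<theta> * indicator ?cube \<theta> \<partial>Q)"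
      by (rule nn_integral_cong) (simp add: gas_def w_def indicator_def)
    also have "\<dots> = fact (Suc m) * S F" unfolding S_def Q_def by (rule nn_integral_gas_sorted[OF that])
    finally show ?thesis .
  qed
  have one: "C * S (\<lambda>_. 1) = 1"
  proof -
    have "C * S (\<lambda>_. 1) = (\<integral>\<^sup>+ \<omega>. 1 \<partial>P)"
      unfolding S_def Q_def by (rule C[of "\<lambda>_. 1", symmetric]) simp_all
    also have "\<dots> = 1" by (simp add: P.emeasure_space_1)
    finally show ?thesis .
  qed
  have W: "(\<integral>\<^sup>+ \<theta>. ennreal (w \<theta>) \<partial>Q) = fact (Suc m) * S (\<lambda>_. 1)"
  proof -
    have "(\<integral>\<^sup>+ \<theta>. 1 * ennreal (w \<theta>) \<partial>Q) = fact (Suc m) * S (\<lambda>_. 1)" by (rule S[of "\<lambda>_. 1"]) simp_all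
    then show ?thesis by (simp only: mult_1_left)
  qed
  have S1: "S (\<lambda>_. 1) \<noteq> 0" "S (\<lambda>_. 1) \<noteq> \<top>"
  proof -
    show "S (\<lambda>_. 1) \<noteq> 0"
    proof
      assume "S (\<lambda>_. 1) = 0"
      with one have "C * 0 = 1" by (simp only:)
      then show False by simp
    qed
    show "S (\<lambda>_. 1) \<noteq> \<top>"
    proof
      assume "S (\<lambda>_. 1) = \<top>"
      with one have "C * \<top> = 1" by (simp only:)
      then show False by (cases "C = 0") (simp_all add: ennreal_mult_top)
    qed
  qed
  define c where "c = enn2real (\<integral>\<^sup>+ \<theta>. ennreal (w \<theta>) \<partial>Q)"
  have f0: "(fact (Suc m) :: ennreal) \<noteq> 0" "(fact (Suc m) :: ennreal) \<noteq> \<top>"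
  proof -
    have "(of_nat (fact (Suc m)) :: ennreal) \<noteq> 0"
      by (simp only: of_nat_eq_0_iff fact_nonzero not_False_eq_True)
    then show "(fact (Suc m) :: ennreal) \<noteq> 0" unfolding of_nat_fact .
    have "(of_nat (fact (Suc m)) :: ennreal) < \<top>" by (rule of_nat_less_top)
    then have "(fact (Suc m) :: ennreal) < \<top>" unfolding of_nat_fact .
    then show "(fact (Suc m) :: ennreal) \<noteq> \<top>" by (rule less_imp_neq)
  qed
  have fin: "(\<integral>\<^sup>+ \<theta>. ennreal (w \<theta>) \<partial>Q) < \<top>"
    unfolding W less_top[symmetric] ennreal_mult_eq_top_iff using S1 f0 by blast
  have ne0: "(\<integral>\<^sup>+ \<theta>. ennreal (w \<theta>) \<partial>Q) \<noteq> 0"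
    unfolding W mult_eq_0_iff using S1 f0 by blast
  show wint: "integrable Q w"
    by (rule integrableI_nonneg[OF wm]) (use wpos fin in simp_all)
  have cint: "(\<integral>\<theta>. w \<theta> \<partial>Q) = c"
    unfolding c_def by (rule integral_eq_nn_integral[OF wm]) (simp add: wpos)
  show cpos: "(\<integral>\<theta>. w \<theta> \<partial>Q) > 0"
    unfolding cint c_def enn2real_positive_iff zero_less_iff_neq_zero using fin ne0 by blast
  have W': "(\<integral>\<^sup>+ \<theta>. ennreal (w \<theta>) \<partial>Q) = ennreal c" unfolding c_def using fin by simp
  have c0: "c > 0" using cpos unfolding cint .
  show gw: "integrable Q (\<lambda>\<theta>. g (circle_point (Suc m) \<theta>) * w \<theta>)"
  proof (rule Bochner_Integration.integrable_bound)
    show "integrable Q (\<lambda>\<theta>. B * w \<theta>)" by (rule integrable_mult_right) (rule wint)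
    show "(\<lambda>\<theta>. g (circle_point (Suc m) \<theta>) * w \<theta>) \<in> borel_measurable Q" by (intro borel_measurable_times gm wm)
    have "\<bar>g (circle_point (Suc m) \<theta>) * w \<theta>\<bar> \<le> B * w \<theta>" for \<theta>
      unfolding abs_mult using mult_right_mono[OF bound[OF cp] wpos, of \<theta> \<theta>] wpos[of \<theta>] by simp
    then show "AE \<theta> in Q. norm (g (circle_point (Suc m) \<theta>) * w \<theta>) \<le> norm (B * w \<theta>)"
      by (intro AE_I2) (metis abs_ge_self order_trans real_norm_def)
  qed
  show g\<Lambda>int: "integrable P (\<lambda>\<omega>. g (\<Lambda> \<omega>))"
    by (rule P.integrable_const_bound[where B = B, OF _ g\<Lambda>]) (simp add: AE_I2 bound \<Lambda>)
  define F where "F z = ennreal (g z + B)" for z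
  have F: "F \<in> borel_measurable (PiM {..<Suc m} (\<lambda>_. borel))" unfolding F_def[abs_def] using g by measurable
  have Fsym: "F (z \<circ> \<sigma>) = F z" if "\<sigma> permutes {..<Suc m}" "z \<in> {..<Suc m} \<rightarrow>\<^sub>E UNIV" for \<sigma> z
    unfolding F_def sym[OF that] ..
  have gB: "0 \<le> g z + B" if "z \<in> {..<Suc m} \<rightarrow>\<^sub>E UNIV" for z using bound[OF that] by linarith
  have key: "(\<integral>\<^sup>+ \<omega>. F (\<Lambda> \<omega>) \<partial>P) * ennreal c = (\<integral>\<^sup>+ \<theta>. F (circle_point (Suc m) \<theta>) * ennreal (w \<theta>) \<partial>Q)"
  proof -
    have 1: "(\<integral>\<^sup>+ \<omega>. F (\<Lambda> \<omega>) \<partial>P) = C * S F" unfolding S_def Q_def by (rule C[OF F Fsym])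
    have 2: "ennreal c = fact (Suc m) * S (\<lambda>_. 1)" unfolding W'[symmetric] by (rule W)
    have "(\<integral>\<^sup>+ \<omega>. F (\<Lambda> \<omega>) \<partial>P) * ennreal c = (C * S F) * (fact (Suc m) * S (\<lambda>_. 1))"
      by (simp only: 1 2)
    also have "\<dots> = (C * S (\<lambda>_. 1)) * (fact (Suc m) * S F)" by (simp only: mult_ac)
    also have "\<dots> = (\<integral>\<^sup>+ \<theta>. F (circle_point (Suc m) \<theta>) * ennreal (w \<theta>) \<partial>Q)"
      by (simp only: one S[OF F Fsym] mult_1_left)
    finally show ?thesis .
  qed
  have lhs: "(\<integral>\<^sup>+ \<omega>. F (\<Lambda> \<omega>) \<partial>P) = ennreal ((\<integral>\<omega>. g (\<Lambda> \<omega>) \<partial>P) + B)"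
  proof -
    have "(\<integral>\<^sup>+ \<omega>. F (\<Lambda> \<omega>) \<partial>P) = ennreal (\<integral>\<omega>. g (\<Lambda> \<omega>) + B \<partial>P)"
      unfolding F_def by (rule nn_integral_eq_integral) (use g\<Lambda>int gB \<Lambda> in \<open>simp_all add: AE_I2\<close>)
    then show ?thesis using g\<Lambda>int by (simp add: P.prob_space)
  qed
  have rhs: "(\<integral>\<^sup>+ \<theta>. F (circle_point (Suc m) \<theta>) * ennreal (w \<theta>) \<partial>Q) = ennreal ((\<integral>\<theta>. g (circle_point (Suc m) \<theta>) * w \<theta> \<partial>Q) + B * c)"
  proof -
    have "(\<integral>\<^sup>+ \<theta>. F (circle_point (Suc m) \<theta>) * ennreal (w \<theta>) \<partial>Q) = (\<integral>\<^sup>+ \<theta>. ennreal (g (circle_point (Suc m) \<theta>) * w \<theta> + B * w \<theta>) \<partial>Q)"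
      unfolding F_def by (rule nn_integral_cong) (simp add: ennreal_mult'[symmetric] wpos gB[OF cp] ring_distribs ennreal_mult[symmetric])
    also have "\<dots> = ennreal (\<integral>\<theta>. g (circle_point (Suc m) \<theta>) * w \<theta> + B * w \<theta> \<partial>Q)"
    proof (rule nn_integral_eq_integral)
      show "integrable Q (\<lambda>\<theta>. g (circle_point (Suc m) \<theta>) * w \<theta> + B * w \<theta>)" by (intro Bochner_Integration.integrable_add gw integrable_mult_right wint)
      have "0 \<le> (g (circle_point (Suc m) \<theta>) + B) * w \<theta>" for \<theta> by (intro mult_nonneg_nonneg gB cp wpos)
      then show "AE \<theta> in Q. 0 \<le> g (circle_point (Suc m) \<theta>) * w \<theta> + B * w \<theta>" by (intro AE_I2) (simp add: ring_distribs)
    qed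
    also have "(\<integral>\<theta>. g (circle_point (Suc m) \<theta>) * w \<theta> + B * w \<theta> \<partial>Q) = (\<integral>\<theta>. g (circle_point (Suc m) \<theta>) * w \<theta> \<partial>Q) + B * c"
      unfolding cint[symmetric] by (simp add: gw wint)
    finally show ?thesis .
  qed
  have "0 \<le> (\<integral>\<omega>. g (\<Lambda> \<omega>) + B \<partial>P)" by (rule integral_nonneg_AE) (simp add: AE_I2 gB \<Lambda>)
  then have n1: "0 \<le> (\<integral>\<omega>. g (\<Lambda> \<omega>) \<partial>P) + B" using g\<Lambda>int by (simp add: P.prob_space)
  have "0 \<le> (\<integral>\<theta>. (g (circle_point (Suc m) \<theta>) + B) * w \<theta> \<partial>Q)"
    by (rule integral_nonneg_AE) (intro AE_I2 mult_nonneg_nonneg gB cp wpos)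
  then have n2: "0 \<le> (\<integral>\<theta>. g (circle_point (Suc m) \<theta>) * w \<theta> \<partial>Q) + B * c"
    unfolding cint[symmetric] by (simp add: ring_distribs gw wint)
  have "ennreal (((\<integral>\<omega>. g (\<Lambda> \<omega>) \<partial>P) + B) * c) = ennreal ((\<integral>\<theta>. g (circle_point (Suc m) \<theta>) * w \<theta> \<partial>Q) + B * c)"
    using key unfolding lhs rhs using n1 c0 by (simp add: ennreal_mult)
  then have "((\<integral>\<omega>. g (\<Lambda> \<omega>) \<partial>P) + B) * c = (\<integral>\<theta>. g (circle_point (Suc m) \<theta>) * w \<theta> \<partial>Q) + B * c"
    using n1 n2 c0 by (subst (asm) ennreal_inj) simp_all
  then show "(\<integral>\<omega>. g (\<Lambda> \<omega>) \<partial>P) * (\<integral>\<theta>. w \<theta> \<partial>Q) = (\<integral>\<theta>. g (circle_point (Suc m) \<theta>) * w \<theta> \<partial>Q)"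
    unfolding cint by (simp add: ring_distribs)
qed

theorem theorem1:
  fixes n :: nat and \<beta> :: real
    and P :: "'a measure" and \<alpha> :: "nat \<Rightarrow> 'a \<Rightarrow> complex"
    and \<Lambda> :: "'a \<Rightarrow> nat \<Rightarrow> complex" and f :: "(nat \<Rightarrow> complex) \<Rightarrow> complex"
  assumes "n \<ge> 1" and "\<beta> > 0"
    and "prob_space P"
    and "prob_space.indep_vars P (\<lambda>_. borel) \<alpha> {..<n}"
    and "\<And>k. k < n \<Longrightarrow> distr P borel (\<alpha> k) = Theta (\<beta> * (real n - real k - 1) + 1)"
    and "(\<forall>\<omega>\<in>space P. eigenvalue_vector
            (cmv_L n (\<lambda>k. \<alpha> k \<omega>) * cmv_M n (\<lambda>k. \<alpha> k \<omega>)) (\<Lambda> \<omega>)) \<or>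
         (\<forall>\<omega>\<in>space P. eigenvalue_vector
            (cmv_M n (\<lambda>k. \<alpha> k \<omega>) * cmv_L n (\<lambda>k. \<alpha> k \<omega>)) (\<Lambda> \<omega>))"
    and "f \<in> borel_measurable (\<Pi>\<^sub>M i\<in>{..<n}. borel)"
    and "\<exists>B. \<forall>z\<in>{..<n} \<rightarrow>\<^sub>E UNIV. cmod (f z) \<le> B"
    and "symmetric_fun n f"
  shows "integrable P (\<lambda>\<omega>. f (\<Lambda> \<omega>)) \<and>
    (LINT \<omega>|P. f (\<Lambda> \<omega>)) =
      1 / complex_of_real ((2 * pi) ^ n * coulomb_Z n \<beta>) *
      (LINT \<theta>:({..<n} \<rightarrow>\<^sub>E {0..2 * pi})|(\<Pi>\<^sub>M i\<in>{..<n}. lborel).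
         f (circle_point n \<theta>) *
         complex_of_real (cmod (vandermonde n (circle_point n \<theta>)) powr \<beta>))"
proof -
  obtain m where n: "n = Suc m" using assms(1) by (cases n) auto
  interpret P: prob_space P by (rule assms(3))
  have rv: "\<alpha> k \<in> borel_measurable P" if "k < n" for k
    using assms(4) that unfolding P.indep_vars_def by simp
  define LM where "LM a = cmv_L n a * cmv_M n a" for a
  define prodML where "prodML a = cmv_M n a * cmv_L n a" for a
  have dims: "dim_row (LM a) = n" "dim_row (prodML a) = n" for a
    unfolding LM_def prodML_def cmv_L_eq[OF assms(1)] cmv_M_eq[OF assms(1)] by simp_all
  have "\<exists>q. (\<forall>a. (\<forall>k\<le>m. cmod (a k) \<le> 1) \<longrightarrow> cmod (a m) = 1 \<longrightarrow> q a = monic_of n (cmv_coefs m a)) \<and>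
      measurable_poly P (\<lambda>\<omega>. q (\<lambda>k. \<alpha> k \<omega>)) \<and>
      (\<forall>\<omega>\<in>space P. \<Lambda> \<omega> \<in> {..<n} \<rightarrow>\<^sub>E UNIV \<and> q (\<lambda>k. \<alpha> k \<omega>) = (\<Prod>i<n. [:- \<Lambda> \<omega> i, 1:]))"
    using assms(6)
  proof
    assume ev: "\<forall>\<omega>\<in>space P. eigenvalue_vector (cmv_L n (\<lambda>k. \<alpha> k \<omega>) * cmv_M n (\<lambda>k. \<alpha> k \<omega>)) (\<Lambda> \<omega>)"
    show ?thesis
    proof (intro exI[of _ "\<lambda>a. char_poly (LM a)"] conjI allI impI)
      show "measurable_poly P (\<lambda>\<omega>. char_poly (LM (\<lambda>k. \<alpha> k \<omega>)))"
        unfolding LM_def by (rule measurable_cmv_char_poly[OF rv assms(1)])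
      show "char_poly (LM a) = monic_of n (cmv_coefs m a)" if "\<forall>k\<le>m. cmod (a k) \<le> 1" "cmod (a m) = 1" for a
        unfolding LM_def n cmv_coefs_def by (rule char_poly_cmv(1)) (use that in simp_all)
      show "\<forall>\<omega>\<in>space P. \<Lambda> \<omega> \<in> {..<n} \<rightarrow>\<^sub>E UNIV \<and> char_poly (LM (\<lambda>k. \<alpha> k \<omega>)) = (\<Prod>i<n. [:- \<Lambda> \<omega> i, 1:])"
        using ev unfolding eigenvalue_vector_def LM_def[symmetric] dims .
    qed
  next
    assume ev: "\<forall>\<omega>\<in>space P. eigenvalue_vector (cmv_M n (\<lambda>k. \<alpha> k \<omega>) * cmv_L n (\<lambda>k. \<alpha> k \<omega>)) (\<Lambda> \<omega>)"
    show ?thesis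
    proof (intro exI[of _ "\<lambda>a. char_poly (prodML a)"] conjI allI impI)
      show "measurable_poly P (\<lambda>\<omega>. char_poly (prodML (\<lambda>k. \<alpha> k \<omega>)))"
        unfolding prodML_def by (rule measurable_cmv_char_poly[OF rv assms(1)])
      show "char_poly (prodML a) = monic_of n (cmv_coefs m a)" if "\<forall>k\<le>m. cmod (a k) \<le> 1" "cmod (a m) = 1" for a
        unfolding prodML_def n cmv_coefs_def by (rule char_poly_cmv(2)) (use that in simp_all)
      show "\<forall>\<omega>\<in>space P. \<Lambda> \<omega> \<in> {..<n} \<rightarrow>\<^sub>E UNIV \<and> char_poly (prodML (\<lambda>k. \<alpha> k \<omega>)) = (\<Prod>i<n. [:- \<Lambda> \<omega> i, 1:])"
        using ev unfolding eigenvalue_vector_def prodML_def[symmetric] dims .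
    qed
  qed
  then obtain q where
    q: "\<And>a. (\<And>k. k \<le> m \<Longrightarrow> cmod (a k) \<le> 1) \<Longrightarrow> cmod (a m) = 1 \<Longrightarrow> q a = monic_of (Suc m) (cmv_coefs m a)"
    and qm: "measurable_poly P (\<lambda>\<omega>. q (\<lambda>k. \<alpha> k \<omega>))"
    and \<Lambda>: "\<And>\<omega>. \<omega> \<in> space P \<Longrightarrow> \<Lambda> \<omega> \<in> {..<Suc m} \<rightarrow>\<^sub>E UNIV"
      "\<And>\<omega>. \<omega> \<in> space P \<Longrightarrow> q (\<lambda>k. \<alpha> k \<omega>) = (\<Prod>i<Suc m. [:- \<Lambda> \<omega> i, 1:])"
    unfolding n by blast
  obtain B where B: "\<And>z. z \<in> {..<Suc m} \<rightarrow>\<^sub>E UNIV \<Longrightarrow> cmod (f z) \<le> B" using assms(8) unfolding n by blast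
  have f: "f \<in> borel_measurable (PiM {..<Suc m} (\<lambda>_. borel))" using assms(7) unfolding n .
  have sym: "f (z \<circ> \<sigma>) = f z" if "\<sigma> permutes {..<Suc m}" "z \<in> {..<Suc m} \<rightarrow>\<^sub>E UNIV" for \<sigma> z
    using assms(9) that unfolding n symmetric_fun_def by blast
  have f\<Lambda>: "(\<lambda>\<omega>. f (\<Lambda> \<omega>)) \<in> borel_measurable P"
    by (rule measurable_symmetric_of_roots[where p = "\<lambda>\<omega>. q (\<lambda>k. \<alpha> k \<omega>)", OF _ \<Lambda>(2,1) f sym])
       (use qm in \<open>simp_all add: measurable_poly_def\<close>)
  have "\<exists>C. \<forall>F. F \<in> borel_measurable (PiM {..<Suc m} (\<lambda>_. borel)) \<longrightarrow>
      (\<forall>\<sigma> z. \<sigma> permutes {..<Suc m} \<longrightarrow> z \<in> {..<Suc m} \<rightarrow>\<^sub>E UNIV \<longrightarrow> F (z \<circ> \<sigma>) = F z) \<longrightarrow>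
      (\<integral>\<^sup>+ \<omega>. F (\<Lambda> \<omega>) \<partial>P) = C * (\<integral>\<^sup>+ \<theta>. sorted_gas m \<beta> F \<theta> \<partial>PiM {..<Suc m} (\<lambda>_. lborel))"
    by (rule nn_integral_eigenvalues[OF assms(2,3) assms(4)[unfolded n] assms(5)[unfolded n] q \<Lambda>])
  then obtain C where C: "\<forall>F. F \<in> borel_measurable (PiM {..<Suc m} (\<lambda>_. borel)) \<longrightarrow>
      (\<forall>\<sigma> z. \<sigma> permutes {..<Suc m} \<longrightarrow> z \<in> {..<Suc m} \<rightarrow>\<^sub>E UNIV \<longrightarrow> F (z \<circ> \<sigma>) = F z) \<longrightarrow>
      (\<integral>\<^sup>+ \<omega>. F (\<Lambda> \<omega>) \<partial>P) = C * (\<integral>\<^sup>+ \<theta>. sorted_gas m \<beta> F \<theta> \<partial>PiM {..<Suc m} (\<lambda>_. lborel))"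
    ..
  let ?Q = "PiM {..<Suc m} (\<lambda>_. lborel :: real measure)"
  define w where "w \<theta> = indicator ({..<Suc m} \<rightarrow>\<^sub>E {0..2 * pi}) \<theta> * cmod (vandermonde (Suc m) (circle_point (Suc m) \<theta>)) powr \<beta>" for \<theta>
  have Re: "(\<lambda>z. Re (f z)) \<in> borel_measurable (PiM {..<Suc m} (\<lambda>_. borel))" "(\<lambda>\<omega>. Re (f (\<Lambda> \<omega>))) \<in> borel_measurable P"
    by (rule measurable_compose[OF f borel_measurable_Re], rule measurable_compose[OF f\<Lambda> borel_measurable_Re])
  have Im: "(\<lambda>z. Im (f z)) \<in> borel_measurable (PiM {..<Suc m} (\<lambda>_. borel))" "(\<lambda>\<omega>. Im (f (\<Lambda> \<omega>))) \<in> borel_measurable P"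
    by (rule measurable_compose[OF f borel_measurable_Im], rule measurable_compose[OF f\<Lambda> borel_measurable_Im])
  have bd: "\<bar>Re (f z)\<bar> \<le> B" "\<bar>Im (f z)\<bar> \<le> B" if "z \<in> {..<Suc m} \<rightarrow>\<^sub>E UNIV" for z
    using B[OF that] abs_Re_le_cmod[of "f z"] abs_Im_le_cmod[of "f z"] by linarith+
  have symRe: "Re (f (z \<circ> \<sigma>)) = Re (f z)" and symIm: "Im (f (z \<circ> \<sigma>)) = Im (f z)"
    if "\<sigma> permutes {..<Suc m}" "z \<in> {..<Suc m} \<rightarrow>\<^sub>E UNIV" for \<sigma> z using sym[OF that] by simp_all
  note R = bounded_real_expectation[OF assms(3) C Re(1) symRe bd(1) \<Lambda>(1) Re(2), folded w_def]
  note I = bounded_real_expectation[OF assms(3) C Im(1) symIm bd(2) \<Lambda>(1) Im(2), folded w_def]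
  define c where "c = (\<integral>\<theta>. w \<theta> \<partial>?Q)"
  have Z: "(2 * pi) ^ n * coulomb_Z n \<beta> = c"
    unfolding coulomb_Z_def c_def w_def set_lebesgue_integral_def n by simp
  have c: "c > 0" unfolding c_def by (rule R(2))
  have int: "integrable P (\<lambda>\<omega>. f (\<Lambda> \<omega>))"
    by (rule P.integrable_const_bound[where B = B, OF _ f\<Lambda>]) (simp add: AE_I2 B \<Lambda>(1))
  let ?g = "\<lambda>\<theta>. f (circle_point (Suc m) \<theta>) * complex_of_real (w \<theta>)"
  have gint: "integrable ?Q ?g"
  proof -
    have "integrable ?Q (\<lambda>\<theta>. complex_of_real (Re (f (circle_point (Suc m) \<theta>)) * w \<theta>) + \<i> * complex_of_real (Im (f (circle_point (Suc m) \<theta>)) * w \<theta>))"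
      by (intro Bochner_Integration.integrable_add integrable_mult_right integrable_of_real R(3) I(3))
    moreover have "complex_of_real (Re (f (circle_point (Suc m) \<theta>)) * w \<theta>) + \<i> * complex_of_real (Im (f (circle_point (Suc m) \<theta>)) * w \<theta>) = ?g \<theta>" for \<theta>
      by (simp add: complex_eq_iff)
    ultimately show ?thesis by (simp only:)
  qed
  have ReP: "(\<integral>\<omega>. Re (f (\<Lambda> \<omega>)) \<partial>P) = Re (\<integral>\<omega>. f (\<Lambda> \<omega>) \<partial>P)" and ImP: "(\<integral>\<omega>. Im (f (\<Lambda> \<omega>)) \<partial>P) = Im (\<integral>\<omega>. f (\<Lambda> \<omega>) \<partial>P)"
    by (rule integral_bounded_linear[OF bounded_linear_Re int], rule integral_bounded_linear[OF bounded_linear_Im int])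
  have ReQ: "(\<integral>\<theta>. Re (f (circle_point (Suc m) \<theta>)) * w \<theta> \<partial>?Q) = Re (\<integral>\<theta>. ?g \<theta> \<partial>?Q)"
    using integral_bounded_linear[OF bounded_linear_Re gint] by simp
  have ImQ: "(\<integral>\<theta>. Im (f (circle_point (Suc m) \<theta>)) * w \<theta> \<partial>?Q) = Im (\<integral>\<theta>. ?g \<theta> \<partial>?Q)"
    using integral_bounded_linear[OF bounded_linear_Im gint] by simp
  have "(\<integral>\<omega>. f (\<Lambda> \<omega>) \<partial>P) * complex_of_real c = (\<integral>\<theta>. ?g \<theta> \<partial>?Q)"
    using R(5) I(5) unfolding ReP ImP ReQ ImQ c_def[symmetric] by (simp add: complex_eq_iff)
  then have "(\<integral>\<omega>. f (\<Lambda> \<omega>) \<partial>P) = 1 / complex_of_real c * (\<integral>\<theta>. ?g \<theta> \<partial>?Q)"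
    using c by (simp add: field_simps)
  moreover have "(\<integral>\<theta>. ?g \<theta> \<partial>?Q) = (LINT \<theta>:({..<n} \<rightarrow>\<^sub>E {0..2 * pi})|(\<Pi>\<^sub>M i\<in>{..<n}. lborel).
         f (circle_point n \<theta>) * complex_of_real (cmod (vandermonde n (circle_point n \<theta>)) powr \<beta>))"
    unfolding set_lebesgue_integral_def n w_def
    by (rule Bochner_Integration.integral_cong[OF refl]) (simp add: indicator_def)
  ultimately show ?thesis using int unfolding Z by simp
qed


end
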